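(* For $\delta\in(0,1/2)$ let $S^\delta(0)$ be the $\delta$-neighborhood of the unit sphere $\mathbb{S}^{n-1}\subset\mathbb{R}^n$ and define \[ N^\delta f(x)=\sup_{u\in\mathbb{S}^{n-1}}\frac{1}{|S^\delta(0)|}\Big|\int_{S^\delta(0)} f(x+u+y)\,dy\Big|. \] Define the exponent $\gamma(n,p)$ by: for $n=2$: $\gamma=1-\frac{2}{p}$ if $1\le p\le 2$ and $\gamma=0$ if $2\le p\le\infty$; for $n=3$: $\gamma=\frac32-\frac{5}{2p}$ if $1\le p\le 3/2$, $\gamma=\frac12-\frac1p$ if $3/2\le p\le 2$, and $\gamma=0$ if $2\le p\le\infty$; for $n\ge 4$: $\gamma=2-\frac{3}{p}$ if $1\le p\le 4/3$, $\gamma=\frac12-\frac1p$ if $4/3\le p\le 2$, and $\gamma=0$ if $2\le p\le\infty$. Then: (i) for every $n\ge2$, $1\le p\le\infty$ and every $\epsilon>0$ there is a constant $C_\epsilon$ (depending also on $n,p$) such that $\|N^\delta\|_{L^p(\mathbb{R}^n)\to L^p(\mathbb{R}^n)}\le C_\epsilon\,\delta^{-\epsilon}\,\delta^{\gamma(n,p)}$ for all $\delta\in(0,1/2)$; (ii) these powers of $\delta$ are sharp: for every $n\ge 2$ and $1\le p\le\infty$ there is a constant $c>0$ such that $\|N^\delta\|_{L^p(\mathbb{R}^n)\to L^p(\mathbb{R}^n)}\ge c\,\delta^{\gamma(n,p)}$ for all $\delta\in(0,1/2)$.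
   Context: $|E|$ denotes Lebesgue measure. Note $\delta^{\gamma}$ with $\gamma\le 0$ is a growing factor as $\delta\to0$. *)

theory Defs
  imports "HOL-Analysis.Analysis" "HOL-Probability.Essential_Supremum"
begin

definition sphere_nbhd :: "real \<Rightarrow> ('a::euclidean_space) set" where
  "sphere_nbhd \<delta> = {y. \<exists>z\<in>sphere 0 1. dist y z < \<delta>}"

definition N_op :: "real \<Rightarrow> (('a::euclidean_space) \<Rightarrow> real) \<Rightarrow> 'a \<Rightarrow> ennreal" where
  "N_op \<delta> f x = (SUP u\<in>sphere 0 1.
      ennreal (\<bar>set_lebesgue_integral lebesgue (sphere_nbhd \<delta> :: 'a set) (\<lambda>y. f (x + u + y))\<bar>
               / measure lebesgue (sphere_nbhd \<delta> :: 'a set)))"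

text \<open>real powers of extended nonnegative reals (exponent r > 0)\<close>
definition ennpow :: "ennreal \<Rightarrow> real \<Rightarrow> ennreal" where
  "ennpow a r = (if a = \<infinity> then \<infinity> else ennreal (enn2real a powr r))"

definition Lpnorm :: "ereal \<Rightarrow> (('a::euclidean_space) \<Rightarrow> ennreal) \<Rightarrow> ennreal" where
  "Lpnorm p g = (if p = \<infinity> then esssup lebesgue g
     else ennpow (\<integral>\<^sup>+ x. ennpow (g x) (real_of_ereal p) \<partial>lebesgue) (1 / real_of_ereal p))"

definition N_opnorm :: "ereal \<Rightarrow> real \<Rightarrow> ('a::euclidean_space) itself \<Rightarrow> ennreal" where
  "N_opnorm p \<delta> (t::'a itself) = (SUP f\<in>{f :: 'a \<Rightarrow> real. f \<in> borel_measurable lebesgue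
        \<and> Lpnorm p (\<lambda>x. ennreal \<bar>f x\<bar>) \<le> 1}. Lpnorm p (N_op \<delta> f))"

definition gamma_exp :: "nat \<Rightarrow> ereal \<Rightarrow> real" where
  "gamma_exp n p = (let q = real_of_ereal p in
     if n = 2 then (if p \<le> 2 then 1 - 2 / q else 0)
     else if n = 3 then (if p \<le> 3/2 then 3/2 - 5 / (2 * q) else if p \<le> 2 then 1/2 - 1/q else 0)
     else (if p \<le> 4/3 then 2 - 3 / q else if p \<le> 2 then 1/2 - 1/q else 0))"

end

theory Submission
  imports Defs
begin

text \<open>
  Upper bounds. \<open>N\<^sup>\<delta> f(x)\<close> is at most the supremum of the averages of \<open>|f|\<close> over the shells centred at \<open>c\<close> with
  \<open>|c - x| = 1\<close>. Choose \<open>c(x)\<close> measurably, nearly attaining the supremum, and let \<open>\<Phi>(z)\<close> be the measure of the set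
  of those \<open>x \<in> F\<close> for which the shell around \<open>c(x)\<close> passes through \<open>z\<close>. By duality an \<open>L\<^sup>k\<close> bound for \<open>\<Phi>\<close> is a weak type
  bound at \<open>p = k/(k - 1)\<close>, and \<open>\<integral> \<Phi>\<^sup>k\<close> integrates the volumes of \<open>k\<close>-fold intersections of shells. These are
  summed over dyadic distances of the centres; as \<open>|c(x) - x| = 1\<close>, a ball of radius \<open>T\<close> contains the centres \<open>c(x)\<close>
  of a set of measure \<open>O(T)\<close> only. The values \<open>k = 2\<close> (all dimensions), \<open>k = 3\<close> (dimension 3) and \<open>k = 4\<close> (dimension at
  least 4) give the bounds at \<open>p = 2, 3/2, 4/3\<close> up to powers of \<open>log (1/\<delta>)\<close>, and Marcinkiewicz interpolation with
  the trivial bounds at \<open>p = 1, \<infinity>\<close> gives the rest.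

  Lower bounds. For small \<open>p\<close> test on the \<open>\<delta>\<close>-neighbourhood of an \<open>(n - 3)\<close>-sphere that is common to a circle of
  unit spheres (for \<open>n = 2\<close> a ball of radius \<open>\<delta>\<close>, for \<open>n = 3\<close> a \<open>\<delta> \<times> \<delta> \<times> \<delta>\<^sup>1\<^sup>/\<^sup>2\<close> box), whose measure
  is \<open>\<delta>\<^sup>2\<close>, \<open>\<delta>\<^sup>5\<^sup>/\<^sup>2\<close>, \<open>\<delta>\<^sup>3\<close> for \<open>n = 2\<close>, \<open>n = 3\<close>, \<open>n \<ge> 4\<close>; for larger \<open>p \<le> 2\<close> on the
  \<open>\<delta>\<close>-neighbourhood of a unit cylinder, to which every unit sphere centred on its axis is tangent along an
  equator; for \<open>p > 2\<close> on a ball.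
\<close>

section \<open>Volumes in slabs\<close>

text \<open>Unit spheres are tangent when their centres are at distance 0 or 2. Cutting the shells
  into finitely many caps of diameter at most 1/8 keeps the centres of caps through a common point
  within 1/8 of each other: distance 2 cannot occur, and the degeneration at distance 0 is what the
  dyadic sums measure. The third sphere can still touch the intersection of the first two; this
  costs a square root in dimension 3 and nothing from dimension 4 on, which separates the cases of
  the theorem. The number k of shells is chosen so that the powers of the distance T cancel and all
  scales contribute alike. The resulting exponents 2, 5/2, 3 in dimensions 2, 3 and at least 4 are
  those of the volumes of the test sets for small p, and therefore both bounds meet. The supremum
  over directions is uncountable. Since the shells are open, averages are lower semicontinuous in
  the centre, so superlevel sets of the maximal function are open; this yields both its
  measurability and the measurable choice of c. All logarithms are absorbed into a loss of
  \<epsilon> in the exponent, which is built into the notion of weak type used below.\<close>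

lemma emeasure_lborel_orthogonal_vimage:
  fixes T :: "'a::euclidean_space \<Rightarrow> 'a"
  assumes T: "orthogonal_transformation T" and A: "A \<in> sets borel"
  shows "emeasure lborel (T -` A) = emeasure lborel A"
proof -
  have lin: "linear T" using T by (rule orthogonal_transformation_linear)
  have Tm [measurable]: "T \<in> borel \<rightarrow>\<^sub>M borel"
    using lin by (intro borel_measurable_continuous_onI linear_continuous_on) (simp add: linear_conv_bounded_linear)
  note A [measurable]
  let ?B = "ball 0 1 :: 'a set"
  have [measurable]: "?B \<in> sets borel" by simp
  have cB: "emeasure lborel ?B \<noteq> 0" "emeasure lborel ?B \<noteq> \<infinity>"
    using emeasure_lborel_ball_finite[of "0::'a" 1] content_ball_pos[of 1 "0::'a"]
    by (auto simp: measure_def)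
  have shift: "(\<integral>\<^sup>+x. f (x + a) \<partial>lborel) = (\<integral>\<^sup>+x. f x \<partial>lborel)"
    if [measurable]: "f \<in> borel_measurable borel" for f :: "'a \<Rightarrow> ennreal" and a
  proof -
    have "(\<integral>\<^sup>+x. f x \<partial>lborel) = (\<integral>\<^sup>+x. f x \<partial>distr lborel borel ((+) a))"
      by (simp only: lborel_distr_plus)
    also have "\<dots> = (\<integral>\<^sup>+x. f (x + a) \<partial>lborel)" by (subst nn_integral_distr) (auto simp: add.commute)
    finally show ?thesis by simp
  qed
  have refl: "(\<integral>\<^sup>+x. f (a - x) \<partial>lborel) = (\<integral>\<^sup>+x. f x \<partial>lborel)"
    if [measurable]: "f \<in> borel_measurable borel" for f :: "'a \<Rightarrow> ennreal" and a
    by (subst (2) lborel_affine[of "-1" a]) (auto simp: nn_integral_distr nn_integral_density)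
  have Tball: "indicator ?B (T x) = (indicator ?B x :: ennreal)" for x
    using orthogonal_transformation_norm[OF T, of x] by (auto simp: indicator_def)
  \<comment> \<open>A double integral of 1_A(T x) 1_B(y + T x), with B the unit ball, is evaluated
    in two ways. Fubini, translation and reflection turn the measure of the preimage of A times |B|
    into |A| times the measure of the preimage of B, and T preserves B.\<close>
  have "emeasure lborel (T -` A) * emeasure lborel ?B
      = (\<integral>\<^sup>+x. indicator A (T x) * (\<integral>\<^sup>+y. indicator ?B (y + T x) \<partial>lborel) \<partial>lborel)"
  proof -
    have "(\<integral>\<^sup>+y. indicator ?B (y + a) \<partial>lborel) = emeasure lborel ?B" for a
      by (subst shift) (auto intro!: borel_measurable_indicator)
    moreover have "emeasure lborel (T -` A) = (\<integral>\<^sup>+x. indicator A (T x) \<partial>lborel)"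
      using measurable_sets[OF Tm A] by (simp flip: nn_integral_indicator add: indicator_vimage[symmetric] comp_def)
    ultimately show ?thesis by (simp add: nn_integral_multc)
  qed
  also have "\<dots> = (\<integral>\<^sup>+x. \<integral>\<^sup>+y. indicator A (T x) * indicator ?B (y + T x) \<partial>lborel \<partial>lborel)"
    by (intro nn_integral_cong nn_integral_cmult[symmetric]) measurable
  also have "\<dots> = (\<integral>\<^sup>+y. \<integral>\<^sup>+x. indicator A (T x) * indicator ?B (y + T x) \<partial>lborel \<partial>lborel)"
    by (rule lborel_pair.Fubini') measurable
  also have "\<dots> = (\<integral>\<^sup>+y. \<integral>\<^sup>+x. indicator A (T x - y) * indicator ?B (T x) \<partial>lborel \<partial>lborel)"
  proof (rule nn_integral_cong)
    fix y :: 'a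
    obtain z where z: "T z = y" using orthogonal_transformation_surj[OF T] by (metis surjD)
    have "(\<integral>\<^sup>+x. indicator A (T x - y) * indicator ?B (T x) \<partial>lborel) =
       (\<integral>\<^sup>+x. indicator A (T (x + z) - y) * indicator ?B (T (x + z)) \<partial>lborel)"
      by (subst shift[where a=z]) auto
    then show "(\<integral>\<^sup>+x. indicator A (T x) * indicator ?B (y + T x) \<partial>lborel) =
        (\<integral>\<^sup>+x. indicator A (T x - y) * indicator ?B (T x) \<partial>lborel)"
      using lin z by (simp add: linear_add add.commute)
  qed
  also have "\<dots> = (\<integral>\<^sup>+x. \<integral>\<^sup>+y. indicator A (T x - y) * indicator ?B (T x) \<partial>lborel \<partial>lborel)"
    by (rule lborel_pair.Fubini'[symmetric]) measurable
  also have "\<dots> = (\<integral>\<^sup>+x. (\<integral>\<^sup>+y. indicator A y \<partial>lborel) * indicator ?B (T x) \<partial>lborel)"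
  proof (rule nn_integral_cong)
    fix x :: 'a
    have "(\<integral>\<^sup>+y. indicator A (T x - y) * indicator ?B (T x) \<partial>lborel)
      = (\<integral>\<^sup>+y. indicator A (T x - y) \<partial>lborel) * indicator ?B (T x)"
      by (rule nn_integral_multc) measurable
    also have "(\<integral>\<^sup>+y. indicator A (T x - y) \<partial>lborel) = (\<integral>\<^sup>+y. indicator A y \<partial>lborel)"
      by (rule refl) measurable
    finally show "(\<integral>\<^sup>+y. indicator A (T x - y) * indicator ?B (T x) \<partial>lborel)
      = (\<integral>\<^sup>+y. indicator A y \<partial>lborel) * indicator ?B (T x)" .
  qed
  also have "\<dots> = emeasure lborel A * emeasure lborel ?B"
    by (simp add: Tball nn_integral_cmult del: indicator_simps)
  finally show ?thesis using cB by (simp add: ennreal_mult_cancel_left mult.commute[of _ "emeasure lborel ?B"])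
qed

lemma orthogonal_reflection:
  fixes w :: "'a::euclidean_space"
  shows "orthogonal_transformation (\<lambda>x. x - (2 * (x \<bullet> w) / (w \<bullet> w)) *\<^sub>R w)"
proof (cases "w = 0")
  case False
  then show ?thesis
    unfolding orthogonal_transformation_def
    by (auto intro!: linearI simp: algebra_simps inner_add_left inner_add_right inner_diff_left
        inner_diff_right add_divide_distrib inner_commute)
qed (simp add: orthogonal_transformation_id)

text \<open>The reflection in the hyperplane bisecting \<open>a\<close> and \<open>b\<close>. It
  fixes everything orthogonal to both, so a second such map can follow without disturbing a vector
  already in place.\<close>

lemma orthogonal_transformation_swap:
  fixes a b :: "'a::euclidean_space"
  assumes "norm a = norm b"
  obtains T where "orthogonal_transformation T" "T a = b" "\<And>x. x \<bullet> a = 0 \<Longrightarrow> x \<bullet> b = 0 \<Longrightarrow> T x = x"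
proof (cases "a = b")
  case True
  then show ?thesis by (intro that[of "\<lambda>x. x"]) (auto simp: orthogonal_transformation_id)
next
  case False
  define w where "w = a - b"
  have "w \<bullet> w = 2 * (a \<bullet> w)"
    using assms by (simp add: w_def inner_diff_left inner_diff_right inner_commute norm_eq)
  moreover have "w \<bullet> w \<noteq> 0" using False by (simp add: w_def)
  ultimately have "a - (2 * (a \<bullet> w) / (w \<bullet> w)) *\<^sub>R w = b"
    by (auto simp: w_def)
  then show ?thesis
    by (intro that[OF orthogonal_reflection[of w]]) (auto simp: w_def inner_diff_right)
qed

text \<open>\<open>T1\<close> puts \<open>e\<close> in place; the map taking \<open>T1 f\<close> to
  \<open>j\<close> then fixes \<open>i\<close>, because \<open>i\<close> is orthogonal to
  both.\<close>

lemma orthogonal_transformation_two: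
  fixes e f i j :: "'a::euclidean_space"
  assumes "norm e = 1" "norm f = 1" "e \<bullet> f = 0" "norm i = 1" "norm j = 1" "i \<bullet> j = 0"
  obtains T where "orthogonal_transformation T" "T e = i" "T f = j"
proof -
  obtain T1 where T1: "orthogonal_transformation T1" "T1 e = i"
    using assms orthogonal_transformation_swap[of e i] by metis
  have "norm (T1 f) = norm j" using T1(1) assms orthogonal_transformation_norm by metis
  then obtain T2 where T2: "orthogonal_transformation T2" "T2 (T1 f) = j"
     "\<And>x. x \<bullet> T1 f = 0 \<Longrightarrow> x \<bullet> j = 0 \<Longrightarrow> T2 x = x"
    using orthogonal_transformation_swap by metis
  have "i \<bullet> T1 f = 0" using T1 assms by (metis orthogonal_transformation_def)
  then have "T2 i = i" using T2 assms by simp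
  then show ?thesis
    using that[of "T2 \<circ> T1"] T1 T2 by (simp add: orthogonal_transformation_compose)
qed

text \<open>It moves a centre to the origin and the directions between centres onto basis vectors,
  where volumes are computed coordinatewise.\<close>

lemma emeasure_rotate:
  fixes T :: "'a::euclidean_space \<Rightarrow> 'a"
  assumes T: "orthogonal_transformation T" and Z: "Z \<in> sets borel"
  shows "emeasure lborel {z. T (z - c) \<in> Z} = emeasure lborel Z"
proof -
  have Tm [measurable]: "T \<in> borel \<rightarrow>\<^sub>M borel"
    using orthogonal_transformation_linear[OF T]
    by (intro borel_measurable_continuous_onI linear_continuous_on) (simp add: linear_conv_bounded_linear)
  have [measurable]: "T -` Z \<in> sets borel" using measurable_sets[OF Tm Z] by simp
  have "emeasure lborel (T -` Z) = emeasure (distr lborel borel ((+) (-c))) (T -` Z)"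
    by (simp only: lborel_distr_plus)
  also have "\<dots> = emeasure lborel ((\<lambda>z. -c + z) -` (T -` Z))"
    by (subst emeasure_distr) auto
  also have "(\<lambda>z. -c + z) -` (T -` Z) = {z. T (z - c) \<in> Z}" by auto
  finally show ?thesis using emeasure_lborel_orthogonal_vimage[OF T Z] by simp
qed

section \<open>Fubini along coordinate subspaces\<close>

lemma emeasure_lborel_fold:
  fixes Z :: "'a::euclidean_space set"
  assumes Z [measurable]: "Z \<in> sets borel" and K: "K \<subseteq> Basis"
  shows "emeasure lborel Z = (\<integral>\<^sup>+x. emeasure (Pi\<^sub>M K (\<lambda>_. lborel))
      {y \<in> space (Pi\<^sub>M K (\<lambda>_. lborel)). (\<Sum>b\<in>Basis - K. x b *\<^sub>R b) + (\<Sum>b\<in>K. y b *\<^sub>R b) \<in> Z}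
      \<partial>Pi\<^sub>M (Basis - K) (\<lambda>_. lborel))"
proof -
  interpret product_sigma_finite "\<lambda>_::'a. lborel :: real measure" by standard
  have fin: "finite K" using K finite_Basis by (rule finite_subset)
  have un: "(Basis - K) \<union> K = Basis" using K by auto
  have eq: "(\<Sum>b\<in>Basis. merge (Basis - K) K (x, y) b *\<^sub>R b) = (\<Sum>b\<in>Basis - K. x b *\<^sub>R b) + (\<Sum>b\<in>K. y b *\<^sub>R b)"
    for x y :: "'a \<Rightarrow> real"
    using K fin by (subst sum.subset_diff[of K]) (auto intro!: sum.cong arg_cong2[where f="(+)"] simp: merge_def)
  have "emeasure lborel Z = (\<integral>\<^sup>+x. indicator Z (\<Sum>b\<in>Basis. x b *\<^sub>R b) \<partial>Pi\<^sub>M Basis (\<lambda>_::'a. lborel))"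
    by (subst lborel_eq) (simp add: nn_integral_distr flip: nn_integral_indicator)
  also have "\<dots> = (\<integral>\<^sup>+x. \<integral>\<^sup>+y. indicator Z (\<Sum>b\<in>Basis. merge (Basis - K) K (x, y) b *\<^sub>R b)
      \<partial>Pi\<^sub>M K (\<lambda>_. lborel) \<partial>Pi\<^sub>M (Basis - K) (\<lambda>_. lborel))"
    using fin by (subst product_nn_integral_fold[of "Basis - K" K, unfolded un]) auto
  also have "\<dots> = (\<integral>\<^sup>+x. emeasure (Pi\<^sub>M K (\<lambda>_. lborel))
      {y \<in> space (Pi\<^sub>M K (\<lambda>_. lborel)). (\<Sum>b\<in>Basis - K. x b *\<^sub>R b) + (\<Sum>b\<in>K. y b *\<^sub>R b) \<in> Z}
      \<partial>Pi\<^sub>M (Basis - K) (\<lambda>_. lborel))"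
    unfolding eq
  proof (rule nn_integral_cong)
    fix x :: "'a \<Rightarrow> real"
    let ?S = "{y \<in> space (Pi\<^sub>M K (\<lambda>_. lborel)). (\<Sum>b\<in>Basis - K. x b *\<^sub>R b) + (\<Sum>b\<in>K. y b *\<^sub>R b) \<in> Z}"
    have "?S \<in> sets (Pi\<^sub>M K (\<lambda>_. lborel))" by measurable
    then have "emeasure (Pi\<^sub>M K (\<lambda>_. lborel)) ?S = (\<integral>\<^sup>+y. indicator ?S y \<partial>Pi\<^sub>M K (\<lambda>_. lborel))" by simp
    also have "\<dots> = (\<integral>\<^sup>+y. indicator Z ((\<Sum>b\<in>Basis - K. x b *\<^sub>R b) + (\<Sum>b\<in>K. y b *\<^sub>R b)) \<partial>Pi\<^sub>M K (\<lambda>_. lborel))"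
      by (intro nn_integral_cong) (auto split: split_indicator)
    finally show "(\<integral>\<^sup>+y. indicator Z ((\<Sum>b\<in>Basis - K. x b *\<^sub>R b) + (\<Sum>b\<in>K. y b *\<^sub>R b)) \<partial>Pi\<^sub>M K (\<lambda>_. lborel))
       = emeasure (Pi\<^sub>M K (\<lambda>_. lborel)) ?S" by simp
  qed
  finally show ?thesis .
qed

lemma nn_integral_PiM_box:
  fixes l h :: "'a \<Rightarrow> real"
  assumes "finite J" and "\<And>j. j \<in> J \<Longrightarrow> l j \<le> h j"
  shows "(\<integral>\<^sup>+x. (\<Prod>j\<in>J. indicator {l j..h j} (x j)) * B \<partial>Pi\<^sub>M J (\<lambda>_. lborel)) = ennreal (\<Prod>j\<in>J. h j - l j) * B"
proof -
  interpret product_sigma_finite "\<lambda>_::'a. lborel :: real measure" by standard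
  have "(\<integral>\<^sup>+x. (\<Prod>j\<in>J. indicator {l j..h j} (x j)) \<partial>Pi\<^sub>M J (\<lambda>_. lborel)) = (\<Prod>j\<in>J. \<integral>\<^sup>+x. indicator {l j..h j} x \<partial>lborel)"
    using assms by (subst product_nn_integral_prod) auto
  also have "\<dots> = (\<Prod>j\<in>J. ennreal (h j - l j))"
    using assms by (intro prod.cong) auto
  also have "\<dots> = ennreal (\<Prod>j\<in>J. h j - l j)"
    using assms by (intro prod_ennreal) auto
  finally show ?thesis using assms by (subst nn_integral_multc) auto
qed

text \<open>The box bounds the coordinates outside \<open>K\<close>, and the slices along
  \<open>K\<close> are replaced by the worst one. \<open>K\<close> will be a single direction
  transversal to the sphere, or a coordinate plane when the dimension is at least 4.\<close>

lemma emeasure_slab_le: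
  fixes Z :: "'a::euclidean_space set"
  assumes Z: "Z \<in> sets borel" and K: "K \<subseteq> Basis"
    and lh: "\<And>j. j \<in> Basis - K \<Longrightarrow> l j \<le> h j"
    and box: "\<And>z j. z \<in> Z \<Longrightarrow> j \<in> Basis - K \<Longrightarrow> l j \<le> z \<bullet> j \<and> z \<bullet> j \<le> h j"
    and fib: "\<And>w. (\<And>b. b \<in> K \<Longrightarrow> w \<bullet> b = 0) \<Longrightarrow>
       emeasure (Pi\<^sub>M K (\<lambda>_. lborel)) {y \<in> space (Pi\<^sub>M K (\<lambda>_. lborel)). w + (\<Sum>b\<in>K. y b *\<^sub>R b) \<in> Z} \<le> B"
  shows "emeasure lborel Z \<le> ennreal (\<Prod>j\<in>Basis - K. h j - l j) * B"
proof -
  let ?J = "Basis - K"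
  have fin: "finite K" using K finite_Basis by (rule finite_subset)
  have inner: "((\<Sum>b\<in>?J. x b *\<^sub>R b) + (\<Sum>b\<in>K. y b *\<^sub>R b)) \<bullet> j = x j" if "j \<in> ?J" for x y and j :: 'a
  proof -
    have "(\<Sum>b\<in>?J. x b *\<^sub>R b) \<bullet> j = (\<Sum>b\<in>?J. if b = j then x b else 0)"
      unfolding inner_sum_left using that by (intro sum.cong) (auto simp: inner_Basis)
    moreover have "(\<Sum>b\<in>K. y b *\<^sub>R b) \<bullet> j = 0"
      unfolding inner_sum_left using that K by (intro sum.neutral ballI) (metis DiffE inner_not_same_Basis inner_scaleR_left mult_zero_right subsetD)
    ultimately show ?thesis using that by (simp add: inner_add_left)
  qed
  have zero: "(\<Sum>b\<in>?J. x b *\<^sub>R b) \<bullet> b = 0" if "b \<in> K" for x and b :: 'a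
    unfolding inner_sum_left using that K
    by (intro sum.neutral ballI) (metis DiffE inner_not_same_Basis inner_scaleR_left mult_zero_right subsetD)
  have "emeasure lborel Z \<le> (\<integral>\<^sup>+x. (\<Prod>j\<in>?J. indicator {l j..h j} (x j)) * B \<partial>Pi\<^sub>M ?J (\<lambda>_. lborel))"
    unfolding emeasure_lborel_fold[OF Z K]
  proof (rule nn_integral_mono)
    fix x :: "'a \<Rightarrow> real"
    let ?S = "{y \<in> space (Pi\<^sub>M K (\<lambda>_. lborel)). (\<Sum>b\<in>?J. x b *\<^sub>R b) + (\<Sum>b\<in>K. y b *\<^sub>R b) \<in> Z}"
    show "emeasure (Pi\<^sub>M K (\<lambda>_. lborel)) ?S \<le> (\<Prod>j\<in>?J. indicator {l j..h j} (x j)) * B"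
    proof (cases "\<forall>j\<in>?J. x j \<in> {l j..h j}")
      case True
      then have "(\<Prod>j\<in>?J. indicator {l j..h j} (x j)) = (1::ennreal)" by (intro prod.neutral) auto
      then show ?thesis using fib[OF zero] by simp
    next
      case False
      then have "?S = {}" using box inner by fastforce
      then show ?thesis by (simp only: emeasure_empty zero_le)
    qed
  qed
  also have "\<dots> = ennreal (\<Prod>j\<in>?J. h j - l j) * B"
    using lh by (intro nn_integral_PiM_box) auto
  finally show ?thesis .
qed

lemma emeasure_PiM_lborel_singleton:
  fixes i :: 'a and P :: "real \<Rightarrow> bool"
  assumes [measurable]: "Measurable.pred borel P"
  shows "emeasure (Pi\<^sub>M {i} (\<lambda>_. lborel)) {y \<in> space (Pi\<^sub>M {i} (\<lambda>_. lborel)). P (y i)} = emeasure lborel {y. P y}"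
proof -
  interpret product_sigma_finite "\<lambda>_::'a. lborel :: real measure" by standard
  have "emeasure (Pi\<^sub>M {i} (\<lambda>_. lborel)) {y \<in> space (Pi\<^sub>M {i} (\<lambda>_. lborel)). P (y i)}
      = (\<integral>\<^sup>+y. indicator {y \<in> space (Pi\<^sub>M {i} (\<lambda>_. lborel)). P (y i)} y \<partial>Pi\<^sub>M {i} (\<lambda>_. lborel))"
    by (rule nn_integral_indicator[symmetric]) measurable
  also have "\<dots> = (\<integral>\<^sup>+y. indicator {y. P y} (y i) \<partial>Pi\<^sub>M {i} (\<lambda>_. lborel))"
    by (intro nn_integral_cong) (auto split: split_indicator)
  also have "\<dots> = emeasure lborel {y. P y}"
    by (subst product_nn_integral_singleton) auto
  finally show ?thesis .
qed

text \<open>Lower counterpart along one direction: slices are estimated over the box only, and the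
  rest of \<open>Z\<close> is discarded.\<close>

lemma emeasure_slab_ge:
  fixes Z :: "'a::euclidean_space set"
  assumes Z [measurable]: "Z \<in> sets borel" and i: "i \<in> Basis"
    and lh: "\<And>j. j \<in> Basis - {i} \<Longrightarrow> l j \<le> h j"
    and fib: "\<And>w. w \<bullet> i = 0 \<Longrightarrow> (\<And>j. j \<in> Basis - {i} \<Longrightarrow> l j \<le> w \<bullet> j \<and> w \<bullet> j \<le> h j) \<Longrightarrow>
       B \<le> emeasure lborel {y::real. w + y *\<^sub>R i \<in> Z}"
  shows "ennreal (\<Prod>j\<in>Basis - {i}. h j - l j) * B \<le> emeasure lborel Z"
proof -
  interpret product_sigma_finite "\<lambda>_::'a. lborel :: real measure" by standard
  let ?J = "Basis - {i}"
  have inner: "(\<Sum>b\<in>?J. x b *\<^sub>R b) \<bullet> j = x j" if "j \<in> ?J" for x and j :: 'a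
  proof -
    have "(\<Sum>b\<in>?J. x b *\<^sub>R b) \<bullet> j = (\<Sum>b\<in>?J. if b = j then x b else 0)"
      unfolding inner_sum_left using that by (intro sum.cong) (auto simp: inner_Basis)
    then show ?thesis using that by simp
  qed
  have zero: "(\<Sum>b\<in>?J. x b *\<^sub>R b) \<bullet> i = 0" for x
    unfolding inner_sum_left using i by (intro sum.neutral) (auto simp: inner_Basis)
  have "ennreal (\<Prod>j\<in>?J. h j - l j) * B = (\<integral>\<^sup>+x. (\<Prod>j\<in>?J. indicator {l j..h j} (x j)) * B \<partial>Pi\<^sub>M ?J (\<lambda>_. lborel))"
    using lh by (intro nn_integral_PiM_box[symmetric]) auto
  also have "\<dots> \<le> emeasure lborel Z"
    unfolding emeasure_lborel_fold[OF Z, of "{i}", simplified, OF i]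
  proof (rule nn_integral_mono)
    fix x :: "'a \<Rightarrow> real"
    let ?S = "{y \<in> space (Pi\<^sub>M {i} (\<lambda>_. lborel)). (\<Sum>b\<in>?J. x b *\<^sub>R b) + y i *\<^sub>R i \<in> Z}"
    have eq: "emeasure (Pi\<^sub>M {i} (\<lambda>_. lborel)) ?S = emeasure lborel {y. (\<Sum>b\<in>?J. x b *\<^sub>R b) + y *\<^sub>R i \<in> Z}"
      by (rule emeasure_PiM_lborel_singleton) measurable
    show "(\<Prod>j\<in>?J. indicator {l j..h j} (x j)) * B \<le> emeasure (Pi\<^sub>M {i} (\<lambda>_. lborel)) ?S"
    proof (cases "\<forall>j\<in>?J. x j \<in> {l j..h j}")
      case True
      then have "(\<Prod>j\<in>?J. indicator {l j..h j} (x j)) = (1::ennreal)" by (intro prod.neutral) auto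
      then show ?thesis using fib[OF zero] True inner unfolding eq by auto
    next
      case False
      then have "(\<Prod>j\<in>?J. indicator {l j..h j} (x j)) = (0::ennreal)" by (auto simp: prod_zero_iff indicator_def)
      then show ?thesis by (simp only: mult_zero_left zero_le)
    qed
  qed
  finally show ?thesis .
qed

lemma emeasure_slab1_le:
  fixes Z :: "'a::euclidean_space set"
  assumes Z [measurable]: "Z \<in> sets borel" and i: "i \<in> Basis"
    and lh: "\<And>j. j \<in> Basis - {i} \<Longrightarrow> l j \<le> h j"
    and box: "\<And>z j. z \<in> Z \<Longrightarrow> j \<in> Basis - {i} \<Longrightarrow> l j \<le> z \<bullet> j \<and> z \<bullet> j \<le> h j"
    and fib: "\<And>w. w \<bullet> i = 0 \<Longrightarrow> emeasure lborel {y::real. w + y *\<^sub>R i \<in> Z} \<le> B"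
  shows "emeasure lborel Z \<le> ennreal (\<Prod>j\<in>Basis - {i}. h j - l j) * B"
proof (rule emeasure_slab_le[OF Z _ lh box])
  fix w assume w: "\<And>b. b \<in> {i} \<Longrightarrow> w \<bullet> b = 0"
  have "emeasure (Pi\<^sub>M {i} (\<lambda>_. lborel)) {y \<in> space (Pi\<^sub>M {i} (\<lambda>_. lborel)). w + y i *\<^sub>R i \<in> Z}
      = emeasure lborel {y. w + y *\<^sub>R i \<in> Z}"
    by (rule emeasure_PiM_lborel_singleton) measurable
  also have "\<dots> \<le> B" using fib w by simp
  finally show "emeasure (Pi\<^sub>M {i} (\<lambda>_. lborel)) {y \<in> space (Pi\<^sub>M {i} (\<lambda>_. lborel)). w + (\<Sum>b\<in>{i}. y b *\<^sub>R b) \<in> Z} \<le> B"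
    by simp
qed (use i in auto)

text \<open>Above height \<sigma>^2 the square root has slope at most 1/(2 \<sigma>), and the two
  signs of y give two intervals of length at most \<eta>/(2 \<sigma>) each.\<close>

lemma emeasure_square_interval:
  fixes X \<eta> \<sigma> :: real
  assumes "\<sigma> > 0" "\<eta> \<ge> 0"
  shows "emeasure lborel {y::real. X \<le> y\<^sup>2 \<and> y\<^sup>2 \<le> X + \<eta> \<and> \<sigma> \<le> \<bar>y\<bar>} \<le> ennreal (\<eta> / \<sigma>)"
proof -
  define p where "p = sqrt (max X (\<sigma>\<^sup>2))"
  define q where "q = sqrt (X + \<eta>)"
  let ?S = "{y::real. X \<le> y\<^sup>2 \<and> y\<^sup>2 \<le> X + \<eta> \<and> \<sigma> \<le> \<bar>y\<bar>}"
  have sub: "?S \<subseteq> {p..q} \<union> {-q..-p}"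
  proof
    fix y assume y: "y \<in> ?S"
    have "\<sigma>\<^sup>2 \<le> \<bar>y\<bar>\<^sup>2" using y assms by (intro power_mono) auto
    then have "p \<le> \<bar>y\<bar>" "\<bar>y\<bar> \<le> q"
      using y unfolding p_def q_def by (auto intro!: real_le_rsqrt real_le_lsqrt)
    then show "y \<in> {p..q} \<union> {-q..-p}" by (auto simp: abs_if split: if_splits)
  qed
  have ps: "\<sigma> \<le> p" using assms unfolding p_def by (intro real_le_rsqrt) auto
  show ?thesis
  proof (cases "p \<le> q")
    case True
    have "0 \<le> X + \<eta>" using True ps assms unfolding q_def by (smt (verit) real_sqrt_lt_0_iff)
    then have q2: "q\<^sup>2 = X + \<eta>" by (simp add: q_def)
    have "0 \<le> max X (\<sigma>\<^sup>2)" by (simp add: le_max_iff_disj)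
    then have p2: "p\<^sup>2 \<ge> X" by (simp add: p_def)
    have "(q - p) * (2 * \<sigma>) \<le> (q - p) * (q + p)" using True ps by (intro mult_left_mono) auto
    also have "\<dots> \<le> \<eta>" using q2 p2 by (simp add: algebra_simps power2_eq_square)
    finally have "(q - p) + (q - p) \<le> \<eta> / \<sigma>" using assms by (simp add: field_simps)
    moreover have "emeasure lborel ?S \<le> emeasure lborel {p..q} + emeasure lborel {-q..-p}"
      by (rule order_trans[OF emeasure_mono[OF sub]]) (auto intro: emeasure_subadditive)
    ultimately show ?thesis using True by (simp add: order_trans flip: ennreal_plus)
  next
    case False
    then have "?S = {}" using sub by (auto simp del: atLeastAtMost_iff)
    then show ?thesis by (metis emeasure_empty zero_le)
  qed
qed

section \<open>Unit sphere shells\<close>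

text \<open>The strict inequality keeps the set open, which later makes averages over it lower
  semicontinuous in the centre.\<close>

definition shell :: "real \<Rightarrow> 'a::euclidean_space \<Rightarrow> 'a set" where
  "shell \<delta> c = {z. \<bar>norm (z - c) - 1\<bar> < \<delta>}"

lemma mem_shell: "z \<in> shell \<delta> c \<longleftrightarrow> \<bar>norm (z - c) - 1\<bar> < \<delta>"
  by (simp add: shell_def)

lemma open_shell: "open (shell \<delta> c)"
  unfolding shell_def by (intro open_Collect_less continuous_intros)

lemma shell_borel [measurable]: "shell \<delta> c \<in> sets borel"
  by (rule borel_open[OF open_shell])

text \<open>The nearest point of the sphere is y / |y|; the bound \<delta> < 1 keeps the origin out
  of the shell.\<close>

lemma sphere_nbhd_eq_shell:
  assumes "0 < \<delta>" "\<delta> < 1"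
  shows "sphere_nbhd \<delta> = (shell \<delta> 0 :: 'a::euclidean_space set)"
proof (intro set_eqI iffI)
  fix y :: 'a assume "y \<in> sphere_nbhd \<delta>"
  then obtain z where "norm z = 1" "dist y z < \<delta>" by (auto simp: sphere_nbhd_def)
  then show "y \<in> shell \<delta> 0"
    using norm_triangle_ineq3[of y z] by (simp add: mem_shell dist_norm)
next
  fix y :: 'a assume y: "y \<in> shell \<delta> 0"
  then have "norm y > 0" using assms by (auto simp: mem_shell)
  then have "dist y (y /\<^sub>R norm y) = norm ((1 - 1 / norm y) *\<^sub>R y)"
    by (simp add: dist_norm algebra_simps divide_inverse)
  also have "\<dots> = \<bar>(1 - 1 / norm y) * norm y\<bar>" by (simp add: abs_mult)
  also have "(1 - 1 / norm y) * norm y = norm y - 1" using \<open>norm y > 0\<close> by (simp add: field_simps)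
  finally show "y \<in> sphere_nbhd \<delta>"
    using y \<open>norm y > 0\<close> by (auto simp: sphere_nbhd_def mem_shell intro!: bexI[of _ "y /\<^sub>R norm y"])
qed

text \<open>Lipschitz bound on [0, 3], where 3 is the outer radius 1 + t of the thickest annulus t =
  2 measured next.\<close>

lemma power_diff_le:
  fixes x y :: real
  assumes "0 \<le> y" "y \<le> x" "x \<le> 3"
  shows "x ^ n - y ^ n \<le> n * 3 ^ n * (x - y)"
proof (induction n)
  case (Suc n)
  have "x ^ Suc n - y ^ Suc n = x * (x ^ n - y ^ n) + (x - y) * y ^ n" by (simp add: algebra_simps)
  also have "\<dots> \<le> 3 * (n * 3 ^ n * (x - y)) + (x - y) * 3 ^ Suc n"
  proof (intro add_mono mult_mono)
    show "0 \<le> x ^ n - y ^ n" using assms by (simp add: power_mono)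
    have "y ^ n \<le> 3 ^ n" using assms by (intro power_mono) auto
    moreover have "(3::real) ^ n \<le> 3 ^ Suc n" by simp
    ultimately show "y ^ n \<le> 3 ^ Suc n" by linarith
  qed (use assms Suc in auto)
  also have "\<dots> = real (Suc n) * 3 ^ Suc n * (x - y)" by (simp add: algebra_simps)
  finally show ?case .
qed auto

text \<open>Difference of two balls, the inner radius being cut off at 0 for t > 1. Besides the
  shells it measures the set of points whose selected centre lies in a small ball.\<close>

lemma emeasure_annulus_le:
  "\<exists>C>0. \<forall>t c. 0 \<le> t \<longrightarrow> t \<le> 2 \<longrightarrow>
     emeasure lborel {z::'a::euclidean_space. \<bar>norm (z - c) - 1\<bar> \<le> t} \<le> ennreal (C * t)"
proof -
  let ?n = "DIM('a)"
  define \<omega> where "\<omega> = unit_ball_vol (real ?n)"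
  have \<omega>: "\<omega> > 0" unfolding \<omega>_def by simp
  define C where "C = \<omega> * (2 * ?n * 3 ^ ?n)"
  have "C > 0" using \<omega> by (simp add: C_def)
  moreover have "emeasure lborel {z::'a. \<bar>norm (z - c) - 1\<bar> \<le> t} \<le> ennreal (C * t)"
    if t: "0 \<le> t" "t \<le> 2" for t c
  proof -
    let ?r = "max 0 (1 - t)"
    have "emeasure lborel {z::'a. \<bar>norm (z - c) - 1\<bar> \<le> t} \<le> emeasure lborel (cball c (1 + t) - ball c ?r)"
      by (intro emeasure_mono) (auto simp: dist_norm norm_minus_commute max_def split: if_splits)
    also have "\<dots> = emeasure lborel (cball c (1 + t)) - emeasure lborel (ball c ?r)"
      using t by (intro emeasure_Diff) (auto simp: emeasure_ball)
    also have "\<dots> = ennreal (\<omega> * (1 + t) ^ ?n) - ennreal (\<omega> * ?r ^ ?n)"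
      using t by (simp add: emeasure_cball emeasure_ball \<omega>_def)
    also have "\<dots> = ennreal (\<omega> * ((1 + t) ^ ?n - ?r ^ ?n))"
      using \<omega> by (subst ennreal_minus) (auto simp: algebra_simps)
    also have "\<dots> \<le> ennreal (C * t)"
    proof (rule ennreal_leI)
      have "(1 + t) ^ ?n - ?r ^ ?n \<le> real ?n * 3 ^ ?n * (1 + t - ?r)"
        using t by (intro power_diff_le) auto
      also have "\<dots> \<le> real ?n * 3 ^ ?n * (2 * t)"
        using t by (intro mult_left_mono) auto
      finally show "\<omega> * ((1 + t) ^ ?n - ?r ^ ?n) \<le> C * t"
        using \<omega> by (simp add: C_def mult.assoc mult_left_mono)
    qed
    finally show ?thesis .
  qed
  ultimately show ?thesis by blast
qed

lemma measure_sphere_nbhd_ge: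
  "\<exists>c>0. \<forall>\<delta>\<in>{0<..<1/2}. c * \<delta> \<le> measure lebesgue (sphere_nbhd \<delta> :: 'a::euclidean_space set)"
proof -
  let ?n = "DIM('a)"
  define \<omega> where "\<omega> = unit_ball_vol (real ?n)"
  have \<omega>: "\<omega> > 0" unfolding \<omega>_def by simp
  have "\<omega> * \<delta> \<le> measure lebesgue (sphere_nbhd \<delta> :: 'a set)" if d: "\<delta> \<in> {0<..<1/2}" for \<delta>
  proof -
    have eq: "(sphere_nbhd \<delta> :: 'a set) = ball 0 (1 + \<delta>) - cball 0 (1 - \<delta>)"
      using d by (auto simp: sphere_nbhd_eq_shell mem_shell)
    have "measure lebesgue (sphere_nbhd \<delta> :: 'a set) = measure lborel (sphere_nbhd \<delta> :: 'a set)"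
      using d by (simp add: sphere_nbhd_eq_shell)
    also have "\<dots> = measure lborel (ball (0::'a) (1 + \<delta>)) - measure lborel (cball (0::'a) (1 - \<delta>))"
      unfolding eq using d by (intro measure_Diff) (auto simp: emeasure_ball)
    also have "\<dots> = \<omega> * ((1 + \<delta>) ^ ?n - (1 - \<delta>) ^ ?n)"
      using d by (simp add: content_ball content_cball \<omega>_def algebra_simps)
    finally have m: "measure lebesgue (sphere_nbhd \<delta> :: 'a set) = \<omega> * ((1 + \<delta>) ^ ?n - (1 - \<delta>) ^ ?n)" .
    have "(1 - \<delta>) ^ ?n \<le> 1" using d by (intro power_le_one) auto
    moreover have "1 + \<delta> \<le> (1 + \<delta>) ^ ?n" using d by (intro self_le_power) auto
    ultimately show ?thesis unfolding m using \<omega> by (intro mult_left_mono) auto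
  qed
  then show ?thesis using \<omega> by blast
qed

text \<open>The slicing direction \<open>i\<close> is transversal to the sphere on \<open>Z\<close>.
  On a line in this direction the square of the coordinate ranges over an interval of length (1 +
  \<delta>)^2 - (1 - \<delta>)^2 = 4 \<delta>, and staying \<sigma> away from 0 turns this into
  length 4 \<delta>/\<sigma>.\<close>

lemma emeasure_shell_slab:
  fixes Z :: "'a::euclidean_space set"
  assumes Z: "Z \<in> sets borel" and i: "i \<in> Basis" and d: "0 < \<delta>" "\<delta> < 1/2" and \<sigma>: "0 < \<sigma>"
    and lh: "\<And>j. j \<in> Basis - {i} \<Longrightarrow> l j \<le> h j"
    and box: "\<And>z j. z \<in> Z \<Longrightarrow> j \<in> Basis - {i} \<Longrightarrow> l j \<le> z \<bullet> j \<and> z \<bullet> j \<le> h j"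
    and sh: "\<And>z. z \<in> Z \<Longrightarrow> z \<in> shell \<delta> 0 \<and> \<sigma> \<le> \<bar>z \<bullet> i\<bar>"
  shows "emeasure lborel Z \<le> ennreal ((\<Prod>j\<in>Basis - {i}. h j - l j) * (4 * \<delta> / \<sigma>))"
proof -
  have "emeasure lborel Z \<le> ennreal (\<Prod>j\<in>Basis - {i}. h j - l j) * ennreal (4 * \<delta> / \<sigma>)"
  proof (rule emeasure_slab1_le[OF Z i lh box])
    fix w :: 'a assume w: "w \<bullet> i = 0"
    have "y \<in> {y. (1 - \<delta>)\<^sup>2 - w \<bullet> w \<le> y\<^sup>2 \<and> y\<^sup>2 \<le> ((1 - \<delta>)\<^sup>2 - w \<bullet> w) + 4 * \<delta> \<and> \<sigma> \<le> \<bar>y\<bar>}"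
      if "w + y *\<^sub>R i \<in> Z" for y
    proof -
      let ?z = "w + y *\<^sub>R i"
      have n: "(norm ?z)\<^sup>2 = w \<bullet> w + y\<^sup>2"
        using w i unfolding power2_norm_eq_inner by (simp add: inner_add_left inner_add_right inner_commute power2_eq_square)
      have s: "1 - \<delta> \<le> norm ?z" "norm ?z \<le> 1 + \<delta>" "\<sigma> \<le> \<bar>y\<bar>"
        using sh[OF that] w i by (auto simp: mem_shell inner_add_left)
      have "(1 - \<delta>)\<^sup>2 \<le> (norm ?z)\<^sup>2" "(norm ?z)\<^sup>2 \<le> (1 + \<delta>)\<^sup>2"
        using s d by (auto intro!: power_mono)
      then show ?thesis using s n by (auto simp: power2_eq_square algebra_simps)
    qed
    then have "{y. w + y *\<^sub>R i \<in> Z} \<subseteq>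
        {y. (1 - \<delta>)\<^sup>2 - w \<bullet> w \<le> y\<^sup>2 \<and> y\<^sup>2 \<le> ((1 - \<delta>)\<^sup>2 - w \<bullet> w) + 4 * \<delta> \<and> \<sigma> \<le> \<bar>y\<bar>}" by blast
    then have "emeasure lborel {y. w + y *\<^sub>R i \<in> Z} \<le> emeasure lborel
        {y. (1 - \<delta>)\<^sup>2 - w \<bullet> w \<le> y\<^sup>2 \<and> y\<^sup>2 \<le> ((1 - \<delta>)\<^sup>2 - w \<bullet> w) + 4 * \<delta> \<and> \<sigma> \<le> \<bar>y\<bar>}"
      by (intro emeasure_mono) auto
    also have "\<dots> \<le> ennreal (4 * \<delta> / \<sigma>)" using d \<sigma> by (intro emeasure_square_interval) auto
    finally show "emeasure lborel {y. w + y *\<^sub>R i \<in> Z} \<le> ennreal (4 * \<delta> / \<sigma>)" .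
  qed auto
  also have "\<dots> = ennreal ((\<Prod>j\<in>Basis - {i}. h j - l j) * (4 * \<delta> / \<sigma>))"
    by (rule ennreal_mult''[symmetric]) (use d \<sigma> in auto)
  finally show ?thesis .
qed

text \<open>Subtracting the two sphere equations leaves a linear condition, the radical hyperplane.
  Each squared radius is off by at most \<delta> (2 + \<delta>) \<le> 3 \<delta>; the difference is
  off by 6 \<delta>, and the linear term carries a factor 2.\<close>

lemma shell_inner_bound:
  fixes z c d :: "'a::euclidean_space"
  assumes "0 < \<delta>" "\<delta> < 1/2" "z \<in> shell \<delta> c" "z \<in> shell \<delta> (c + d)"
  shows "\<bar>(z - c) \<bullet> d - (d \<bullet> d) / 2\<bar> \<le> 3 * \<delta>"
proof -
  have sq: "\<bar>(norm x)\<^sup>2 - 1\<bar> \<le> 3 * \<delta>" if "\<bar>norm x - 1\<bar> < \<delta>" for x :: 'a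
  proof -
    have "(norm x)\<^sup>2 - 1 = (norm x - 1) * (norm x + 1)" by (simp add: algebra_simps power2_eq_square)
    then have "\<bar>(norm x)\<^sup>2 - 1\<bar> = \<bar>norm x - 1\<bar> * (norm x + 1)" by (simp add: abs_mult)
    also have "\<dots> \<le> \<delta> * 3" using that assms by (intro mult_mono) auto
    finally show ?thesis by simp
  qed
  have "\<bar>(norm (z - c))\<^sup>2 - 1\<bar> \<le> 3 * \<delta>" "\<bar>(norm ((z - c) - d))\<^sup>2 - 1\<bar> \<le> 3 * \<delta>"
    using assms by (auto intro!: sq simp: mem_shell diff_diff_eq)
  moreover have "(norm ((z - c) - d))\<^sup>2 = (norm (z - c))\<^sup>2 - 2 * ((z - c) \<bullet> d) + d \<bullet> d"
    unfolding power2_norm_eq_inner by (simp add: inner_diff_left inner_diff_right inner_commute)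
  ultimately show ?thesis by (simp add: abs_if split: if_splits)
qed

lemma emeasure_shell_le:
  "\<exists>C>0. \<forall>\<delta> c. 0 < \<delta> \<longrightarrow> \<delta> < 1/2 \<longrightarrow> emeasure lborel (shell \<delta> c :: 'a::euclidean_space set) \<le> ennreal (C * \<delta>)"
proof -
  obtain C where C: "C > 0" "\<And>t c. 0 \<le> t \<Longrightarrow> t \<le> 2 \<Longrightarrow>
     emeasure lborel {z::'a. \<bar>norm (z - c) - 1\<bar> \<le> t} \<le> ennreal (C * t)"
    using emeasure_annulus_le by blast
  have "emeasure lborel (shell \<delta> c :: 'a set) \<le> ennreal (C * \<delta>)" if "0 < \<delta>" "\<delta> < 1/2" for \<delta> c
  proof -
    have "emeasure lborel (shell \<delta> c :: 'a set) \<le> emeasure lborel {z::'a. \<bar>norm (z - c) - 1\<bar> \<le> \<delta>}"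
      by (intro emeasure_mono) (auto simp: mem_shell)
    also have "\<dots> \<le> ennreal (C * \<delta>)" using that by (intro C) auto
    finally show ?thesis .
  qed
  then show ?thesis using C(1) by blast
qed

section \<open>Intersections of shells\<close>

lemma norm_sq_Basis: "(norm (y::'a::euclidean_space))\<^sup>2 = (\<Sum>j\<in>Basis. (y \<bullet> j)\<^sup>2)"
  unfolding power2_norm_eq_inner by (subst euclidean_inner) (simp add: power2_eq_square)

text \<open>Both shells confine z - c to a slab of thickness O(\<delta>/T) orthogonal to
  \<open>d\<close>. As |d| is at most 1/4, the slab is near the equator, where the sphere is
  transversal to it, and slicing in another direction gains a further \<delta>. The alternatives for
  \<open>T\<close> say that it is the dyadic size of \<open>d\<close>, with everything below
  \<delta> lumped together.\<close>

lemma emeasure_two_shells_le: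
  assumes dim: "2 \<le> DIM('a::euclidean_space)"
  shows "\<exists>C>0. \<forall>\<delta> T c d. 0 < \<delta> \<longrightarrow> \<delta> < 1/2 \<longrightarrow> \<delta> \<le> T \<longrightarrow> T \<le> max \<delta> (1/4) \<longrightarrow>
     norm d \<le> T \<longrightarrow> T \<le> \<delta> \<or> T / 2 \<le> norm d \<longrightarrow>
     emeasure lborel (shell \<delta> c \<inter> shell \<delta> (c + d) :: 'a set) \<le> ennreal (C * (\<delta>\<^sup>2 / T))"
proof -
  let ?n = "DIM('a)"
  obtain C0 where C0: "C0 > 0" "\<And>\<delta> c. 0 < \<delta> \<Longrightarrow> \<delta> < 1/2 \<Longrightarrow> emeasure lborel (shell \<delta> c :: 'a set) \<le> ennreal (C0 * \<delta>)"
    using emeasure_shell_le by blast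
  obtain i :: 'a where i: "i \<in> Basis" using nonempty_Basis by blast
  \<comment> \<open>At most n pieces, a slab of width 12 \<delta>/T, n - 2 coordinates in [-2, 2],
    and slicing at distance 1/(4 n) from tangency, which gives 16 n \<delta>.\<close>
  define C1 where "C1 = real ?n * (12 * 4 ^ (?n - 2) * (16 * ?n))"
  define C where "C = max (48 * C0) C1"
  have main: "emeasure lborel (shell \<delta> c \<inter> shell \<delta> (c + d) :: 'a set) \<le> ennreal (C * (\<delta>\<^sup>2 / T))"
    if d: "0 < \<delta>" "\<delta> < 1/2" "\<delta> \<le> T" "T \<le> max \<delta> (1/4)" "norm d \<le> T" "T \<le> \<delta> \<or> T / 2 \<le> norm d" for \<delta> T and c d :: 'a
  \<comment> \<open>Below 48 \<delta> one shell suffices, since \<delta> is then comparable to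
    \<delta>^2/T. Above it t \<ge> 24 \<delta>, so the slab has half-width 3 \<delta>/t \<le> 1/8
    around t/2 \<le> 1/8.\<close>
  proof (cases "T < 48 * \<delta>")
    case True
    have "emeasure lborel (shell \<delta> c \<inter> shell \<delta> (c + d)) \<le> emeasure lborel (shell \<delta> c)"
      by (intro emeasure_mono) auto
    also have "\<dots> \<le> ennreal (C0 * \<delta>)" using d by (intro C0)
    also have "\<dots> \<le> ennreal (C * (\<delta>\<^sup>2 / T))"
    proof (rule ennreal_leI)
      have "C0 * \<delta> * T \<le> C0 * \<delta> * (48 * \<delta>)" using True C0 d by (intro mult_left_mono) auto
      also have "\<dots> = 48 * C0 * \<delta>\<^sup>2" by (simp add: power2_eq_square)
      also have "\<dots> \<le> C * \<delta>\<^sup>2" by (intro mult_right_mono) (auto simp: C_def)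
      finally show "C0 * \<delta> \<le> C * (\<delta>\<^sup>2 / T)" using d by (simp add: field_simps)
    qed
    finally show ?thesis .
  next
    case False
    define t where "t = norm d"
    have t: "T / 2 \<le> t" "t \<le> T" "0 < t" "24 * \<delta> \<le> t" "t \<le> 1/4"
      using False d by (auto simp: t_def max_def split: if_splits)
    define e where "e = d /\<^sub>R t"
    have "norm e = norm i" using t i by (simp add: e_def t_def)
    then obtain U where U: "orthogonal_transformation U" "U e = i"
      using orthogonal_transformation_swap by metis
    define Z where "Z = {y::'a. y \<in> shell \<delta> 0 \<and> \<bar>y \<bullet> i - t / 2\<bar> \<le> 3 * \<delta> / t}"
    have Zm: "Z \<in> sets borel" unfolding Z_def by measurable
    have sub: "shell \<delta> c \<inter> shell \<delta> (c + d) \<subseteq> {z. U (z - c) \<in> Z}"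
    proof
      fix z assume z: "z \<in> shell \<delta> c \<inter> shell \<delta> (c + d)"
      have "\<bar>(z - c) \<bullet> d - (d \<bullet> d) / 2\<bar> \<le> 3 * \<delta>"
        using z d by (intro shell_inner_bound) auto
      moreover have "d \<bullet> d = t * t" by (simp add: t_def dot_square_norm power2_eq_square)
      moreover have "(z - c) \<bullet> d = t * (U (z - c) \<bullet> i)"
      proof -
        have "(z - c) \<bullet> d = t * ((z - c) \<bullet> e)" using t by (simp add: e_def)
        also have "(z - c) \<bullet> e = U (z - c) \<bullet> i"
          using U by (metis orthogonal_transformation_def)
        finally show ?thesis .
      qed
      ultimately have "\<bar>t * (U (z - c) \<bullet> i - t / 2)\<bar> \<le> 3 * \<delta>" by (simp add: right_diff_distrib)
      then have "\<bar>U (z - c) \<bullet> i - t / 2\<bar> \<le> 3 * \<delta> / t"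
        using t by (simp only: abs_mult abs_of_pos pos_le_divide_eq mult.commute)
      moreover have "norm (U (z - c)) = norm (z - c)" using U orthogonal_transformation_norm by blast
      ultimately show "z \<in> {z. U (z - c) \<in> Z}" using z by (simp add: Z_def mem_shell)
    qed
    \<comment> \<open>Pigeonhole: |y| \<ge> 1/2 while |y . i| \<le> 1/4, so some other coordinate is
      at least 1/(4 n) in modulus; if all were smaller, |y|^2 would be at most 1/16 + 1/16 < 1/4.
      Slicing is done in that direction.\<close>
    define Zj where "Zj = (\<lambda>j. Z \<inter> {y. 1 / (4 * ?n) \<le> \<bar>y \<bullet> j\<bar>})"
    have Zjm: "Zj j \<in> sets borel" for j unfolding Zj_def using Zm by measurable
    have bnd: "\<bar>z \<bullet> j\<bar> \<le> 2" if "z \<in> Z" "j \<in> Basis" for z j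
      using Basis_le_norm[OF that(2), of z] that d by (auto simp: Z_def mem_shell)
    have cover: "Z \<subseteq> (\<Union>j\<in>Basis - {i}. Zj j)"
    proof
      fix y assume y: "y \<in> Z"
      show "y \<in> (\<Union>j\<in>Basis - {i}. Zj j)"
      proof (rule ccontr)
        assume "y \<notin> (\<Union>j\<in>Basis - {i}. Zj j)"
        then have small: "\<bar>y \<bullet> j\<bar> \<le> 1 / (4 * ?n)" if "j \<in> Basis - {i}" for j
          using that y by (auto simp: Zj_def not_le intro: less_imp_le)
        have yi: "\<bar>y \<bullet> i\<bar> \<le> 1/4"
        proof -
          have "3 * \<delta> / t \<le> 1/8" using t d by (simp add: field_simps)
          moreover have "\<bar>y \<bullet> i - t / 2\<bar> \<le> 3 * \<delta> / t" using y by (simp add: Z_def)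
          ultimately show ?thesis using t unfolding abs_le_iff by linarith
        qed
        have "(1/2)\<^sup>2 \<le> (norm y)\<^sup>2" using y d by (intro power_mono) (auto simp: Z_def mem_shell)
        also have "(norm y)\<^sup>2 = (y \<bullet> i)\<^sup>2 + (\<Sum>j\<in>Basis - {i}. (y \<bullet> j)\<^sup>2)"
          unfolding norm_sq_Basis using i by (intro sum.remove) auto
        also have "(y \<bullet> i)\<^sup>2 \<le> (1/4)\<^sup>2" using yi by (metis abs_ge_zero power2_abs power_mono)
        also have "(\<Sum>j\<in>Basis - {i}. (y \<bullet> j)\<^sup>2) \<le> (\<Sum>j\<in>Basis - {i}. (1 / (4 * ?n))\<^sup>2)"
          using small by (intro sum_mono) (metis abs_ge_zero power2_abs power_mono)
        also have "\<dots> \<le> ?n * (1 / (4 * ?n))\<^sup>2"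
          by (simp add: mult_right_mono card_Diff_subset i)
        also have "\<dots> = 1 / (16 * ?n)" by (simp add: power2_eq_square field_simps)
        also have "\<dots> \<le> 1 / 16" using dim by (simp add: field_simps)
        finally show False by (simp add: power2_eq_square)
      qed
    qed
    have each: "emeasure lborel (Zj j) \<le> ennreal ((6 * \<delta> / t * 4 ^ (?n - 2)) * (4 * \<delta> / (1 / (4 * ?n))))" if j: "j \<in> Basis - {i}" for j
    proof -
      define l where "l = (\<lambda>k. if k = i then t / 2 - 3 * \<delta> / t else - 2)"
      define h where "h = (\<lambda>k. if k = i then t / 2 + 3 * \<delta> / t else 2)"
      have "emeasure lborel (Zj j) \<le> ennreal ((\<Prod>k\<in>Basis - {j}. h k - l k) * (4 * \<delta> / (1 / (4 * ?n))))"
      proof (rule emeasure_shell_slab)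
        fix z k assume "z \<in> Zj j" and k: "k \<in> Basis - {j}"
        then have z: "z \<in> Z" by (auto simp: Zj_def)
        then show "l k \<le> z \<bullet> k \<and> z \<bullet> k \<le> h k"
          using bnd[OF z, of k] k unfolding Z_def l_def h_def by (auto simp: abs_le_iff)
      qed (use j d t Zjm in \<open>auto simp: Zj_def Z_def l_def h_def\<close>)
      also have "(\<Prod>k\<in>Basis - {j}. h k - l k) = (h i - l i) * (\<Prod>k\<in>Basis - {j} - {i}. h k - l k)"
        using i j by (intro prod.remove) auto
      also have "(\<Prod>k\<in>Basis - {j} - {i}. h k - l k) = (\<Prod>k\<in>Basis - {j} - {i}. 4)"
        by (intro prod.cong) (auto simp: h_def l_def)
      also have "\<dots> = 4 ^ (?n - 2)" using i j by (auto simp: card_Diff_singleton_if numeral_2_eq_2)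
      also have "h i - l i = 6 * \<delta> / t" by (simp add: h_def l_def)
      finally show ?thesis .
    qed
    have "emeasure lborel (shell \<delta> c \<inter> shell \<delta> (c + d)) \<le> emeasure lborel {z. U (z - c) \<in> Z}"
    proof (rule emeasure_mono[OF sub])
      have "U \<in> borel \<rightarrow>\<^sub>M borel"
        using orthogonal_transformation_linear[OF U(1)]
        by (intro borel_measurable_continuous_onI linear_continuous_on) (simp add: linear_conv_bounded_linear)
      then show "{z. U (z - c) \<in> Z} \<in> sets lborel" using Zm by simp
    qed
    also have "\<dots> = emeasure lborel Z" by (rule emeasure_rotate[OF U(1) Zm])
    also have "\<dots> \<le> (\<Sum>j\<in>Basis - {i}. emeasure lborel (Zj j))"
      by (rule order_trans[OF emeasure_mono[OF cover] emeasure_subadditive_finite]) (use Zjm in auto)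
    also have "\<dots> \<le> (\<Sum>j\<in>Basis - {i}. ennreal ((6 * \<delta> / t * 4 ^ (?n - 2)) * (4 * \<delta> / (1 / (4 * ?n)))))"
      by (intro sum_mono each)
    also have "\<dots> = ennreal (real (card (Basis - {i})) * ((6 * \<delta> / t * 4 ^ (?n - 2)) * (4 * \<delta> / (1 / (4 * ?n)))))"
      unfolding sum_constant ennreal_of_nat_eq_real_of_nat using d t by (intro ennreal_mult[symmetric]) auto
    also have "\<dots> \<le> ennreal (C * (\<delta>\<^sup>2 / T))"
    proof (rule ennreal_leI)
      have "6 * \<delta> / t \<le> 12 * \<delta> / T"
      proof -
        have "6 * \<delta> * T \<le> 6 * \<delta> * (2 * t)" using t d by (intro mult_left_mono) auto
        then show ?thesis using t d by (simp add: field_simps)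
      qed
      then have "real (card (Basis - {i})) * ((6 * \<delta> / t * 4 ^ (?n - 2)) * (4 * \<delta> / (1 / (4 * ?n))))
         \<le> real ?n * ((12 * \<delta> / T * 4 ^ (?n - 2)) * (4 * \<delta> / (1 / (4 * ?n))))"
        using d t i by (intro mult_mono) (auto simp: card_Diff_subset)
      also have "\<dots> = C1 * (\<delta>\<^sup>2 / T)" by (simp add: C1_def power2_eq_square)
      also have "\<dots> \<le> C * (\<delta>\<^sup>2 / T)" using d by (intro mult_right_mono) (auto simp: C_def)
      finally show "real (card (Basis - {i})) * ((6 * \<delta> / t * 4 ^ (?n - 2)) * (4 * \<delta> / (1 / (4 * ?n)))) \<le> C * (\<delta>\<^sup>2 / T)" .
    qed
    finally show ?thesis .
  qed
  have "C > 0" using C0 by (simp add: C_def max_def)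
  then show ?thesis using main by blast
qed

text \<open>Writing the centres as \<open>c\<close>, \<open>c + t e\<close>, \<open>c + a e + b f\<close> with \<open>e\<close>, \<open>f\<close> orthonormal, a common point of the
  three shells has its \<open>e\<close>- and \<open>f\<close>-coordinates confined to intervals of length \<open>6\<delta>/t\<close> and \<open>18\<delta>/b\<close>.
  If the intersection is not empty, \<open>b\<close> cannot be small: a line meets a unit sphere in two points only.\<close>
lemma three_shells_coordinates:
  fixes c d d' i j :: "'a::euclidean_space"
  assumes \<delta>: "0 < \<delta>" "\<delta> < 1/2" and T: "T \<le> 1/4" and R: "0 < R" "R \<le> 4 * T"
    and d: "norm d \<le> T" "T / 2 \<le> norm d" and d': "norm d' \<le> T" "T / 2 \<le> norm d'"
    and dd: "R / 2 \<le> norm (d' - d)" and RT: "1152 * \<delta> \<le> R * T"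
    and ij: "i \<in> Basis" "j \<in> Basis" "i \<noteq> j"
  obtains b v where "R * T / 128 \<le> b"
    "emeasure lborel (shell \<delta> c \<inter> shell \<delta> (c + d) \<inter> shell \<delta> (c + d'))
      \<le> emeasure lborel {y. y \<in> shell \<delta> 0 \<and> \<bar>y \<bullet> i - norm d / 2\<bar> \<le> 3 * \<delta> / norm d \<and> \<bar>y \<bullet> j - v\<bar> \<le> 9 * \<delta> / b}"
proof (cases "shell \<delta> c \<inter> shell \<delta> (c + d) \<inter> shell \<delta> (c + d') = {}")
  case True
  \<comment> \<open>An empty intersection satisfies every estimate, so the smallest admissible
    \<open>b\<close> is taken.\<close>
  then show ?thesis using that[of "R * T / 128" 0] by simp
next
  case False
  define t where "t = norm d"
  have Tp: "0 < T" using R by simp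
  have t: "0 < t" "T / 2 \<le> t" "t \<le> T" using d Tp by (auto simp: t_def)
  define e where "e = d /\<^sub>R t"
  have e1: "norm e = 1" using t by (simp add: e_def t_def)
  have de: "d = t *\<^sub>R e" using t by (simp add: e_def)
  \<comment> \<open>The third centre is decomposed as d' = a e + b f with f a unit vector orthogonal
    to e; \<open>b\<close> is its distance from the line through the first two centres.\<close>
  define a where "a = d' \<bullet> e"
  define b where "b = norm (d' - a *\<^sub>R e)"
  have ee: "e \<bullet> e = 1" using e1 by (simp add: norm_eq_1)
  have perp: "(d' - a *\<^sub>R e) \<bullet> e = 0" using ee by (simp add: a_def inner_diff_left)
  have pyth: "(norm d')\<^sup>2 = a\<^sup>2 + b\<^sup>2"
  proof -
    have "(norm ((d' - a *\<^sub>R e) + a *\<^sub>R e))\<^sup>2 = (norm (d' - a *\<^sub>R e))\<^sup>2 + (norm (a *\<^sub>R e))\<^sup>2"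
      using perp by (intro norm_add_Pythagorean) (simp add: orthogonal_def)
    then show ?thesis using e1 by (simp add: b_def)
  qed
  have pyth': "(norm (d' - d))\<^sup>2 = (a - t)\<^sup>2 + b\<^sup>2"
  proof -
    have "(norm ((d' - a *\<^sub>R e) + (a - t) *\<^sub>R e))\<^sup>2 = (norm (d' - a *\<^sub>R e))\<^sup>2 + (norm ((a - t) *\<^sub>R e))\<^sup>2"
      using perp by (intro norm_add_Pythagorean) (simp add: orthogonal_def)
    moreover have "(d' - a *\<^sub>R e) + (a - t) *\<^sub>R e = d' - d" by (simp add: de algebra_simps)
    ultimately show ?thesis using e1 by (simp only: b_def norm_scaleR mult_1_right power2_abs)
  qed
  have b0: "0 \<le> b" by (simp add: b_def)
  have bT: "b \<le> T" "\<bar>a\<bar> \<le> T"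
  proof -
    have "b\<^sup>2 \<le> T\<^sup>2" "\<bar>a\<bar>\<^sup>2 \<le> T\<^sup>2"
      using pyth power_mono[OF d'(1) norm_ge_zero, of 2] zero_le_power2[of a] zero_le_power2[of b]
      unfolding power2_abs by linarith+
    then show "b \<le> T" "\<bar>a\<bar> \<le> T" using Tp by (auto intro: power2_le_imp_le)
  qed
  \<comment> \<open>A multiple \<open>a\<close> of the first linear condition is subtracted from the
    one for \<open>d'\<close> to isolate the f-direction. Since |a| \<le> T \<le> 2 t, the error is
    at most 3 \<delta> + 2 t (3 \<delta>/t) = 9 \<delta>.\<close>
  have key: "\<bar>(z - c) \<bullet> e - t / 2\<bar> \<le> 3 * \<delta> / t \<and> \<bar>(z - c) \<bullet> (d' - a *\<^sub>R e) - ((norm d')\<^sup>2 - a * t) / 2\<bar> \<le> 9 * \<delta>"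
    if z: "z \<in> shell \<delta> c \<inter> shell \<delta> (c + d) \<inter> shell \<delta> (c + d')" for z
  proof
    have "\<bar>(z - c) \<bullet> d - (d \<bullet> d) / 2\<bar> \<le> 3 * \<delta>" using z \<delta> by (intro shell_inner_bound) auto
    moreover have "d \<bullet> d = t * t" by (simp add: t_def dot_square_norm power2_eq_square)
    moreover have "(z - c) \<bullet> d = t * ((z - c) \<bullet> e)" by (simp add: de)
    ultimately have "\<bar>t * ((z - c) \<bullet> e - t / 2)\<bar> \<le> 3 * \<delta>" by (simp add: right_diff_distrib)
    then show *: "\<bar>(z - c) \<bullet> e - t / 2\<bar> \<le> 3 * \<delta> / t"
      using t by (simp only: abs_mult abs_of_pos pos_le_divide_eq mult.commute)
    have "\<bar>a * ((z - c) \<bullet> e - t / 2)\<bar> \<le> T * (3 * \<delta> / t)"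
      unfolding abs_mult using * bT by (intro mult_mono) auto
    also have "\<dots> \<le> (2 * t) * (3 * \<delta> / t)" using t \<delta> by (intro mult_right_mono) auto
    also have "\<dots> = 6 * \<delta>" using t by simp
    finally have "\<bar>a * ((z - c) \<bullet> e - t / 2)\<bar> \<le> 6 * \<delta>" .
    moreover have "\<bar>(z - c) \<bullet> d' - (norm d')\<^sup>2 / 2\<bar> \<le> 3 * \<delta>"
      using shell_inner_bound[OF \<delta>, of z c d'] z by (simp add: dot_square_norm)
    moreover have "(z - c) \<bullet> (d' - a *\<^sub>R e) - ((norm d')\<^sup>2 - a * t) / 2
       = ((z - c) \<bullet> d' - (norm d')\<^sup>2 / 2) - a * ((z - c) \<bullet> e - t / 2)"
      by (simp add: inner_diff_right algebra_simps diff_divide_distrib)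
    ultimately show "\<bar>(z - c) \<bullet> (d' - a *\<^sub>R e) - ((norm d')\<^sup>2 - a * t) / 2\<bar> \<le> 9 * \<delta>" by linarith
  qed
  have RT4: "R * T \<le> R / 4" "R * T \<le> T" using T R Tp mult_left_mono[of T "1/4" R] mult_right_mono[of R 1 T] by auto
  \<comment> \<open>If b were smaller, the third centre would be nearly on the line yet away from
    both others: |a| \<ge> T/4 and |a - t| \<ge> R/4, so |a (a - t)| \<ge> R T/16. A common point
    forces |a (a - t)| \<le> 4 b + 18 \<delta>, which is less than R T/32 + R T/64 by the constants
    128 and 1152.\<close>
  have bge: "R * T / 128 \<le> b"
  proof (rule ccontr)
    assume nb: "\<not> R * T / 128 \<le> b"
    have bs: "b < T / 4" "b < R / 4" using nb RT4 Tp R by linarith+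
    have "T / 4 \<le> \<bar>a\<bar>"
    proof (rule ccontr)
      assume "\<not> T / 4 \<le> \<bar>a\<bar>"
      then have "\<bar>a\<bar>\<^sup>2 \<le> (T/4)\<^sup>2" "b\<^sup>2 \<le> (T/4)\<^sup>2" using bs b0 Tp by (intro power_mono; simp)+
      moreover have "(T/2)\<^sup>2 \<le> (norm d')\<^sup>2" using d' Tp by (intro power_mono) auto
      moreover have "(T/4)\<^sup>2 = T\<^sup>2 / 16" "(T/2)\<^sup>2 = T\<^sup>2 / 4" "0 < T\<^sup>2" using Tp by (simp_all add: power_divide)
      ultimately show False using pyth unfolding power2_abs by linarith
    qed
    moreover have "R / 4 \<le> \<bar>a - t\<bar>"
    proof (rule ccontr)
      assume "\<not> R / 4 \<le> \<bar>a - t\<bar>"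
      then have "\<bar>a - t\<bar>\<^sup>2 \<le> (R/4)\<^sup>2" "b\<^sup>2 \<le> (R/4)\<^sup>2" using bs b0 R by (intro power_mono; simp)+
      moreover have "(R/2)\<^sup>2 \<le> (norm (d' - d))\<^sup>2" using dd R by (intro power_mono) auto
      moreover have "(R/4)\<^sup>2 = R\<^sup>2 / 16" "(R/2)\<^sup>2 = R\<^sup>2 / 4" "0 < R\<^sup>2" using R by (simp_all add: power_divide)
      ultimately show False using pyth' unfolding power2_abs by linarith
    qed
    ultimately have "T / 4 * (R / 4) \<le> \<bar>a\<bar> * \<bar>a - t\<bar>" using R Tp by (intro mult_mono) auto
    then have low: "R * T / 16 \<le> \<bar>a * (a - t)\<bar>" by (simp add: abs_mult mult_ac)
    obtain z where z: "z \<in> shell \<delta> c \<inter> shell \<delta> (c + d) \<inter> shell \<delta> (c + d')" using False by blast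
    have "norm (z - c) \<le> 3/2" using z \<delta> by (auto simp: mem_shell)
    then have "\<bar>(z - c) \<bullet> (d' - a *\<^sub>R e)\<bar> \<le> 3/2 * b"
      unfolding b_def by (intro order_trans[OF Cauchy_Schwarz_ineq2] mult_right_mono) auto
    with key[OF z] have "\<bar>((norm d')\<^sup>2 - a * t) / 2\<bar> \<le> 3/2 * b + 9 * \<delta>" by linarith
    moreover have "(norm d')\<^sup>2 - a * t = a * (a - t) + b\<^sup>2" using pyth by (simp add: algebra_simps power2_eq_square)
    ultimately have "\<bar>a * (a - t) + b\<^sup>2\<bar> \<le> 3 * b + 18 * \<delta>" by simp
    moreover have "b\<^sup>2 \<le> b" using bT T b0 mult_left_mono[of b 1 b] by (simp add: power2_eq_square)
    moreover have "\<bar>a * (a - t)\<bar> \<le> \<bar>a * (a - t) + b\<^sup>2\<bar> + b\<^sup>2"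
      using abs_triangle_ineq4[of "a * (a - t) + b\<^sup>2" "b\<^sup>2"] by simp
    ultimately have "\<bar>a * (a - t)\<bar> \<le> 4 * b + 18 * \<delta>" by linarith
    then show False using low nb RT by linarith
  qed
  have "0 < R * T" using R Tp by simp
  then have bp: "0 < b" using bge by linarith
  define f where "f = (d' - a *\<^sub>R e) /\<^sub>R b"
  define v where "v = ((norm d')\<^sup>2 - a * t) / 2 / b"
  have f1: "norm f = 1" using bp by (simp add: f_def b_def)
  have ef: "e \<bullet> f = 0" using perp by (simp add: f_def inner_commute)
  obtain U where U: "orthogonal_transformation U" "U e = i" "U f = j"
    using orthogonal_transformation_two[OF e1 f1 ef norm_Basis[OF ij(1)] norm_Basis[OF ij(2)] inner_not_same_Basis[OF ij]] .
  let ?Z = "{y. y \<in> shell \<delta> 0 \<and> \<bar>y \<bullet> i - norm d / 2\<bar> \<le> 3 * \<delta> / norm d \<and> \<bar>y \<bullet> j - v\<bar> \<le> 9 * \<delta> / b}"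
  have Zm: "?Z \<in> sets borel" by measurable
  have "shell \<delta> c \<inter> shell \<delta> (c + d) \<inter> shell \<delta> (c + d') \<subseteq> {z. U (z - c) \<in> ?Z}"
  proof
    fix z assume z: "z \<in> shell \<delta> c \<inter> shell \<delta> (c + d) \<inter> shell \<delta> (c + d')"
    have "U (z - c) \<bullet> i = (z - c) \<bullet> e" "U (z - c) \<bullet> j = (z - c) \<bullet> f"
      using U by (metis orthogonal_transformation_def)+
    moreover have "\<bar>(z - c) \<bullet> f - v\<bar> \<le> 9 * \<delta> / b"
    proof -
      have "\<bar>(z - c) \<bullet> f - v\<bar> = \<bar>(z - c) \<bullet> (d' - a *\<^sub>R e) - ((norm d')\<^sup>2 - a * t) / 2\<bar> / b"
      proof -
        have "(z - c) \<bullet> f = (z - c) \<bullet> (d' - a *\<^sub>R e) / b" by (simp add: f_def divide_inverse mult.commute)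
        then have "(z - c) \<bullet> f - v = ((z - c) \<bullet> (d' - a *\<^sub>R e) - ((norm d')\<^sup>2 - a * t) / 2) / b"
          by (simp only: v_def diff_divide_distrib)
        then show ?thesis using bp by (simp only: abs_divide abs_of_pos)
      qed
      also have "\<dots> \<le> 9 * \<delta> / b" using key[OF z] bp by (intro divide_right_mono) auto
      finally show ?thesis .
    qed
    moreover have "norm (U (z - c)) = norm (z - c)" using U orthogonal_transformation_norm by blast
    ultimately show "z \<in> {z. U (z - c) \<in> ?Z}"
      using key[OF z] z by (simp add: mem_shell t_def)
  qed
  then have "emeasure lborel (shell \<delta> c \<inter> shell \<delta> (c + d) \<inter> shell \<delta> (c + d')) \<le> emeasure lborel {z. U (z - c) \<in> ?Z}"
  proof (rule emeasure_mono)
    have [measurable]: "U \<in> borel \<rightarrow>\<^sub>M borel"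
      using orthogonal_transformation_linear[OF U(1)]
      by (intro borel_measurable_continuous_onI linear_continuous_on) (simp add: linear_conv_bounded_linear)
    have "(\<lambda>z. U (z - c)) -` ?Z \<inter> space borel \<in> sets borel"
      by (rule measurable_sets[OF _ Zm]) measurable
    then show "{z. U (z - c) \<in> ?Z} \<in> sets lborel" by (simp add: vimage_def)
  qed
  also have "\<dots> = emeasure lborel ?Z" by (rule emeasure_rotate[OF U(1) Zm])
  finally show ?thesis using that bge by blast
qed

text \<open>In dimension 3 tangential intersections are unavoidable, whence the exponent \<open>1/2\<close>.\<close>
lemma slab_dim3:
  fixes i j :: "'a::euclidean_space"
  assumes dim: "DIM('a) = 3" and \<delta>: "0 < \<delta>" "\<delta> < 1/2" and ij: "i \<in> Basis" "j \<in> Basis" "i \<noteq> j"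
    and t: "24 * \<delta> \<le> t" "t \<le> 1/4" and b: "8 * \<delta> \<le> b"
  shows "emeasure lborel {y::'a. y \<in> shell \<delta> 0 \<and> \<bar>y \<bullet> i - t / 2\<bar> \<le> 3 * \<delta> / t \<and> \<bar>y \<bullet> j - v\<bar> \<le> 9 * \<delta> / b}
     \<le> ennreal (624 * (\<delta>\<^sup>2 / t) * sqrt (\<delta> / b))"
proof -
  have tp: "0 < t" and bp: "0 < b" using t b \<delta> by linarith+
  have "card (Basis - {i, j} :: 'a set) = 1" using ij dim by (subst card_Diff_subset) auto
  then obtain k where k: "Basis - {i, j} = {k}" by (auto simp: card_1_singleton_iff)
  have kB: "k \<in> Basis" "k \<noteq> i" "k \<noteq> j" using k by blast+
  have Bk: "Basis - {k} = {i, j}" "Basis - {j} = {i, k}" using k kB ij by blast+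
  have B: "(Basis::'a set) = {i, j, k}" using k ij by blast
  \<comment> \<open>\<open>s\<close> balances two ways of slicing. Where |y . k| \<ge> s, slicing
    along \<open>k\<close> gives (\<delta>/t)(\<delta>/b)(\<delta>/s); near tangency, |y . k| \<le>
    s, slicing along \<open>j\<close> gives (\<delta>/t) s \<delta>. The two agree for s^2 =
    \<delta>/b, with constants 432 + 192 = 624.\<close>
  define s where "s = sqrt (\<delta> / b)"
  have s: "0 < s" "s\<^sup>2 = \<delta> / b" using \<delta> bp by (auto simp: s_def)
  have "\<delta> / b \<le> 1/8" using b bp by (simp add: field_simps)
  let ?Z = "{y::'a. y \<in> shell \<delta> 0 \<and> \<bar>y \<bullet> i - t / 2\<bar> \<le> 3 * \<delta> / t \<and> \<bar>y \<bullet> j - v\<bar> \<le> 9 * \<delta> / b}"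
  define Z1 where "Z1 = {y. y \<in> shell \<delta> 0 \<and> \<bar>y \<bullet> i - t / 2\<bar> \<le> 3 * \<delta> / t \<and> \<bar>y \<bullet> j - v\<bar> \<le> 9 * \<delta> / b \<and> s \<le> \<bar>y \<bullet> k\<bar>}"
  define Z2 where "Z2 = {y. y \<in> shell \<delta> 0 \<and> \<bar>y \<bullet> i - t / 2\<bar> \<le> 3 * \<delta> / t \<and> \<bar>y \<bullet> k\<bar> \<le> s \<and> 1/4 \<le> \<bar>y \<bullet> j\<bar>}"
  have Zm: "Z1 \<in> sets borel" "Z2 \<in> sets borel" unfolding Z1_def Z2_def by measurable
  have cover: "?Z \<subseteq> Z1 \<union> Z2"
  proof
    fix y assume y: "y \<in> ?Z"
    show "y \<in> Z1 \<union> Z2"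
    proof (rule ccontr)
      assume "y \<notin> Z1 \<union> Z2"
      then have sm: "\<bar>y \<bullet> k\<bar> \<le> s" "\<bar>y \<bullet> j\<bar> \<le> 1/4" using y by (auto simp: Z1_def Z2_def)
      have yi: "\<bar>y \<bullet> i\<bar> \<le> 1/4"
      proof -
        have "3 * \<delta> / t \<le> 1/8" using t tp \<delta> by (simp add: field_simps)
        moreover have "\<bar>y \<bullet> i - t / 2\<bar> \<le> 3 * \<delta> / t" using y by simp
        ultimately show ?thesis using t tp unfolding abs_le_iff by linarith
      qed
      have "(1/2)\<^sup>2 < (norm y)\<^sup>2" using y \<delta> by (intro power_strict_mono) (auto simp: mem_shell)
      also have "(norm y)\<^sup>2 = \<bar>y \<bullet> i\<bar>\<^sup>2 + \<bar>y \<bullet> j\<bar>\<^sup>2 + \<bar>y \<bullet> k\<bar>\<^sup>2"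
        unfolding norm_sq_Basis using kB ij by (simp add: B)
      also have "\<dots> \<le> (1/4)\<^sup>2 + (1/4)\<^sup>2 + s\<^sup>2"
        using sm yi by (intro add_mono power_mono) auto
      finally show False using s \<open>\<delta> / b \<le> 1/8\<close> by (simp add: power2_eq_square)
    qed
  qed
  have 1: "emeasure lborel Z1 \<le> ennreal (6 * \<delta> / t * (18 * \<delta> / b) * (4 * \<delta> / s))"
  proof -
    define l where "l = (\<lambda>x. if x = i then t / 2 - 3 * \<delta> / t else v - 9 * \<delta> / b)"
    define h where "h = (\<lambda>x. if x = i then t / 2 + 3 * \<delta> / t else v + 9 * \<delta> / b)"
    have "emeasure lborel Z1 \<le> ennreal ((\<Prod>x\<in>Basis - {k}. h x - l x) * (4 * \<delta> / s))"
    proof (rule emeasure_shell_slab)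
      show "l x \<le> h x" if "x \<in> Basis - {k}" for x
        using \<delta> s tp bp by (simp add: l_def h_def)
      show "l x \<le> z \<bullet> x \<and> z \<bullet> x \<le> h x" if z: "z \<in> Z1" and x: "x \<in> Basis - {k}" for z x
      proof -
        have "x = i \<or> x = j" using x unfolding Bk by blast
        then show ?thesis
        proof
          assume "x = i"
          then show ?thesis using z by (simp add: Z1_def l_def h_def abs_le_iff)
        next
          assume "x = j"
          then show ?thesis using z ij kB by (simp add: Z1_def l_def h_def abs_le_iff)
        qed
      qed
    qed (use Zm kB ij \<delta> s in \<open>simp_all add: Z1_def\<close>)
    also have "(\<Prod>x\<in>Basis - {k}. h x - l x) = 6 * \<delta> / t * (18 * \<delta> / b)"
      unfolding Bk using ij by (simp add: l_def h_def)
    finally show ?thesis .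
  qed
  have 2: "emeasure lborel Z2 \<le> ennreal (6 * \<delta> / t * (2 * s) * (4 * \<delta> / (1/4)))"
  proof -
    define l where "l = (\<lambda>x. if x = i then t / 2 - 3 * \<delta> / t else - s)"
    define h where "h = (\<lambda>x. if x = i then t / 2 + 3 * \<delta> / t else s)"
    have "emeasure lborel Z2 \<le> ennreal ((\<Prod>x\<in>Basis - {j}. h x - l x) * (4 * \<delta> / (1/4)))"
    proof (rule emeasure_shell_slab)
      show "l x \<le> h x" if "x \<in> Basis - {j}" for x
        using \<delta> s tp bp by (simp add: l_def h_def)
      show "l x \<le> z \<bullet> x \<and> z \<bullet> x \<le> h x" if z: "z \<in> Z2" and x: "x \<in> Basis - {j}" for z x
      proof -
        have "x = i \<or> x = k" using x unfolding Bk by blast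
        then show ?thesis
        proof
          assume "x = i"
          then show ?thesis using z by (simp add: Z2_def l_def h_def abs_le_iff)
        next
          assume "x = k"
          then show ?thesis using z ij kB by (simp add: Z2_def l_def h_def abs_le_iff)
        qed
      qed
    qed (use Zm kB ij \<delta> s in \<open>simp_all add: Z2_def\<close>)
    also have "(\<Prod>x\<in>Basis - {j}. h x - l x) = 6 * \<delta> / t * (2 * s)"
      unfolding Bk using kB by (simp add: l_def h_def)
    finally show ?thesis .
  qed
  have "emeasure lborel ?Z \<le> emeasure lborel Z1 + emeasure lborel Z2"
    by (rule order_trans[OF emeasure_mono[OF cover]]) (use Zm in \<open>auto intro: emeasure_subadditive\<close>)
  also have "\<dots> \<le> ennreal (6 * \<delta> / t * (18 * \<delta> / b) * (4 * \<delta> / s)) + ennreal (6 * \<delta> / t * (2 * s) * (4 * \<delta> / (1/4)))"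
    by (intro add_mono 1 2)
  also have "\<dots> = ennreal (6 * \<delta> / t * (18 * \<delta> / b) * (4 * \<delta> / s) + 6 * \<delta> / t * (2 * s) * (4 * \<delta> / (1/4)))"
    using \<delta> tp bp s by (intro ennreal_plus[symmetric]) auto
  also have "6 * \<delta> / t * (18 * \<delta> / b) * (4 * \<delta> / s) + 6 * \<delta> / t * (2 * s) * (4 * \<delta> / (1/4)) = 624 * (\<delta>\<^sup>2 / t) * s"
  proof -
    have "(\<delta> / b) / s = s" using s(1) unfolding s(2)[symmetric] by (simp add: power2_eq_square)
    then have "6 * \<delta> / t * (18 * \<delta> / b) * (4 * \<delta> / s) = 432 * (\<delta>\<^sup>2 / t) * s"
      using tp bp s by (simp add: field_simps power2_eq_square)
    then show ?thesis by (simp add: power2_eq_square)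
  qed
  finally show ?thesis by (simp add: s_def)
qed

text \<open>Two coordinates remain free besides the constrained ones. In their plane the shell cuts
  an annulus whose area is \<pi> times the difference of the squared radii, wherever it lies; unlike
  an interval in dimension 3 it does not grow at tangency. The factor 432 is 6 * 18 * 4.\<close>

lemma slab_dim4:
  fixes i j :: "'a::euclidean_space"
  assumes dim: "4 \<le> DIM('a)" and \<delta>: "0 < \<delta>" "\<delta> < 1/2" and ij: "i \<in> Basis" "j \<in> Basis" "i \<noteq> j"
    and t: "0 < t" and b: "0 < b"
  shows "emeasure lborel {y::'a. y \<in> shell \<delta> 0 \<and> \<bar>y \<bullet> i - t / 2\<bar> \<le> 3 * \<delta> / t \<and> \<bar>y \<bullet> j - v\<bar> \<le> 9 * \<delta> / b}
     \<le> ennreal ((432 * pi * 4 ^ (DIM('a) - 4)) * (\<delta>\<^sup>2 / t) * (\<delta> / b))" (is "emeasure lborel ?Z \<le> _")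
proof -
  have Zm: "?Z \<in> sets borel" by measurable
  have "2 \<le> card (Basis - {i, j} :: 'a set)" using dim ij by (subst card_Diff_subset) auto
  then obtain K where K: "K \<subseteq> Basis - {i, j}" "card K = 2" "finite K"
    by (metis obtain_subset_with_card_n)
  define l where "l = (\<lambda>x. if x = i then t / 2 - 3 * \<delta> / t else if x = j then v - 9 * \<delta> / b else - 2)"
  define h where "h = (\<lambda>x. if x = i then t / 2 + 3 * \<delta> / t else if x = j then v + 9 * \<delta> / b else 2)"
  \<comment> \<open>For A > 0 this is a difference of two disks; for A \<le> 0 the set lies in the
    disk of squared radius \<eta>.\<close>
  have disk: "emeasure (Pi\<^sub>M K (\<lambda>_. lborel)) {y \<in> space (Pi\<^sub>M K (\<lambda>_. lborel)). A < (\<Sum>b\<in>K. (y b)\<^sup>2) \<and> (\<Sum>b\<in>K. (y b)\<^sup>2) \<le> A + \<eta>}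
      \<le> ennreal (pi * \<eta>)" if \<eta>: "0 < \<eta>" for A \<eta>
  proof -
    let ?M = "Pi\<^sub>M K (\<lambda>_. lborel :: real measure)"
    let ?q = "\<lambda>y::'a \<Rightarrow> real. \<Sum>b\<in>K. (y b)\<^sup>2"
    have ball: "emeasure ?M {y \<in> space ?M. ?q y \<le> r} = ennreal (pi * r)" if "0 < r" for r
    proof -
      have "{y \<in> space ?M. ?q y \<le> r} = {y. sqrt (?q y) \<le> sqrt r} \<inter> space ?M" by auto
      then show ?thesis using that K emeasure_cball_aux[of K "sqrt r"] by (simp add: unit_ball_vol_2)
    qed
    have sets: "{y \<in> space ?M. ?q y \<le> r} \<in> sets ?M" for r by measurable
    show ?thesis
    proof (cases "0 < A")
      case True
      have eq: "{y \<in> space ?M. A < ?q y \<and> ?q y \<le> A + \<eta>} = {y \<in> space ?M. ?q y \<le> A + \<eta>} - {y \<in> space ?M. ?q y \<le> A}" by auto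
      have "emeasure ?M {y \<in> space ?M. A < ?q y \<and> ?q y \<le> A + \<eta>} = emeasure ?M {y \<in> space ?M. ?q y \<le> A + \<eta>} - emeasure ?M {y \<in> space ?M. ?q y \<le> A}"
        unfolding eq
      proof (rule emeasure_Diff)
        show "emeasure ?M {y \<in> space ?M. ?q y \<le> A} \<noteq> \<infinity>" unfolding ball[OF True] by simp
        show "{y \<in> space ?M. ?q y \<le> A} \<subseteq> {y \<in> space ?M. ?q y \<le> A + \<eta>}" using \<eta> by auto
      qed (rule sets)+
      also have "\<dots> = ennreal (pi * \<eta>)" using True \<eta> by (subst (1 2) ball) (simp_all add: ennreal_minus distrib_left)
      finally show ?thesis by simp
    next
      case False
      have "emeasure ?M {y \<in> space ?M. A < ?q y \<and> ?q y \<le> A + \<eta>} \<le> emeasure ?M {y \<in> space ?M. ?q y \<le> \<eta>}"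
        using False sets by (intro emeasure_mono) auto
      then show ?thesis unfolding ball[OF \<eta>] .
    qed
  qed
  have "emeasure lborel ?Z \<le> ennreal (\<Prod>x\<in>Basis - K. h x - l x) * ennreal (pi * (4 * \<delta>))"
  proof (rule emeasure_slab_le[OF Zm])
    show "K \<subseteq> Basis" using K by blast
    show "l x \<le> h x" if "x \<in> Basis - K" for x using \<delta> t b by (auto simp: l_def h_def)
    show "l x \<le> z \<bullet> x \<and> z \<bullet> x \<le> h x" if "z \<in> ?Z" "x \<in> Basis - K" for z x
    proof -
      have "\<bar>z \<bullet> x\<bar> \<le> 2" using that Basis_le_norm[of x z] \<delta> by (auto simp: mem_shell)
      moreover have "\<bar>z \<bullet> i - t / 2\<bar> \<le> 3 * \<delta> / t" "\<bar>z \<bullet> j - v\<bar> \<le> 9 * \<delta> / b" using that by blast+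
      ultimately show ?thesis unfolding l_def h_def abs_le_iff by (cases "x = i"; cases "x = j") simp_all
    qed
    fix w :: 'a assume w: "\<And>b. b \<in> K \<Longrightarrow> w \<bullet> b = 0"
    let ?M = "Pi\<^sub>M K (\<lambda>_. lborel :: real measure)"
    let ?A = "(1 - \<delta>)\<^sup>2 - (norm w)\<^sup>2"
    have "{y \<in> space ?M. w + (\<Sum>b\<in>K. y b *\<^sub>R b) \<in> ?Z} \<subseteq> {y \<in> space ?M. ?A < (\<Sum>b\<in>K. (y b)\<^sup>2) \<and> (\<Sum>b\<in>K. (y b)\<^sup>2) \<le> ?A + 4 * \<delta>}"
    proof safe
      fix y assume y: "w + (\<Sum>b\<in>K. y b *\<^sub>R b) \<in> shell \<delta> 0"
      let ?u = "\<Sum>b\<in>K. y b *\<^sub>R b"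
      have "(norm (w + ?u))\<^sup>2 = (norm w)\<^sup>2 + (norm ?u)\<^sup>2"
        using w by (intro norm_add_Pythagorean) (simp add: orthogonal_def inner_sum_right)
      also have "(norm ?u)\<^sup>2 = (\<Sum>b\<in>K. (norm (y b *\<^sub>R b))\<^sup>2)"
      proof (rule norm_sum_Pythagorean)
        show "pairwise (\<lambda>i j. orthogonal (y i *\<^sub>R i) (y j *\<^sub>R j)) K"
          using K by (auto simp: pairwise_def orthogonal_def inner_not_same_Basis subset_iff)
      qed (use K in auto)
      also have "\<dots> = (\<Sum>b\<in>K. (y b)\<^sup>2)" using K by (intro sum.cong) auto
      finally have n: "(norm (w + ?u))\<^sup>2 = (norm w)\<^sup>2 + (\<Sum>b\<in>K. (y b)\<^sup>2)" .
      have "(1 - \<delta>)\<^sup>2 < (norm (w + ?u))\<^sup>2" "(norm (w + ?u))\<^sup>2 \<le> (1 + \<delta>)\<^sup>2"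
        using y \<delta> by (auto intro!: power_strict_mono power_mono simp: mem_shell)
      moreover have "(1 + \<delta>)\<^sup>2 = (1 - \<delta>)\<^sup>2 + 4 * \<delta>" by (simp add: power2_eq_square algebra_simps)
      ultimately show "?A < (\<Sum>b\<in>K. (y b)\<^sup>2)" "(\<Sum>b\<in>K. (y b)\<^sup>2) \<le> ?A + 4 * \<delta>" using n by linarith+
    qed
    then have "emeasure ?M {y \<in> space ?M. w + (\<Sum>b\<in>K. y b *\<^sub>R b) \<in> ?Z}
       \<le> emeasure ?M {y \<in> space ?M. ?A < (\<Sum>b\<in>K. (y b)\<^sup>2) \<and> (\<Sum>b\<in>K. (y b)\<^sup>2) \<le> ?A + 4 * \<delta>}"
      by (rule emeasure_mono) measurable
    also have "\<dots> \<le> ennreal (pi * (4 * \<delta>))" using \<delta> by (intro disk) auto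
    finally show "emeasure ?M {y \<in> space ?M. w + (\<Sum>b\<in>K. y b *\<^sub>R b) \<in> ?Z} \<le> ennreal (pi * (4 * \<delta>))" .
  qed
  also have "\<dots> = ennreal ((\<Prod>x\<in>Basis - K. h x - l x) * (pi * (4 * \<delta>)))"
    by (rule ennreal_mult''[symmetric]) (use \<delta> in auto)
  also have "(\<Prod>x\<in>Basis - K. h x - l x) = (h i - l i) * ((h j - l j) * (\<Prod>x\<in>Basis - K - {i} - {j}. h x - l x))"
  proof -
    have "(\<Prod>x\<in>Basis - K. h x - l x) = (h i - l i) * (\<Prod>x\<in>Basis - K - {i}. h x - l x)"
      using ij K by (intro prod.remove) auto
    moreover have "(\<Prod>x\<in>Basis - K - {i}. h x - l x) = (h j - l j) * (\<Prod>x\<in>Basis - K - {i} - {j}. h x - l x)"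
      using ij K by (intro prod.remove) auto
    ultimately show ?thesis by simp
  qed
  also have "(\<Prod>x\<in>Basis - K - {i} - {j}. h x - l x) = (\<Prod>x\<in>Basis - K - {i} - {j}. 4)"
    by (intro prod.cong) (auto simp: h_def l_def)
  also have "\<dots> = 4 ^ (DIM('a) - 4)"
  proof -
    have "Basis - K - {i} - {j} = Basis - (K \<union> {i, j})" by blast
    moreover have "card (K \<union> {i, j}) = 4" using K ij by (subst card_Un_disjoint) auto
    ultimately have "card (Basis - K - {i} - {j}) = DIM('a) - 4" using K ij by (simp add: card_Diff_subset subset_iff)
    then show ?thesis by simp
  qed
  also have "(h i - l i) * ((h j - l j) * 4 ^ (DIM('a) - 4)) * (pi * (4 * \<delta>)) = (432 * pi * 4 ^ (DIM('a) - 4)) * (\<delta>\<^sup>2 / t) * (\<delta> / b)"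
  proof -
    have "h i - l i = 6 * \<delta> / t" "h j - l j = 18 * \<delta> / b" using ij by (simp_all add: h_def l_def)
    then show ?thesis by (simp only: power2_eq_square) simp
  qed
  finally show ?thesis .
qed

text \<open>The factor (\<delta>/(R T))^\<alpha> is the gain from the third shell, with \<delta>/b
  at most 128 \<delta>/(R T). For R T < 1152 \<delta> this factor is bounded below, and two shells
  already give the estimate.\<close>

lemma emeasure_three_shells_le:
  assumes "(DIM('a::euclidean_space) = 3 \<and> \<alpha> = 1/2) \<or> (4 \<le> DIM('a) \<and> \<alpha> = (1::real))"
  shows "\<exists>C>0. \<forall>\<delta> T R c d d'. 0 < \<delta> \<longrightarrow> \<delta> < 1/2 \<longrightarrow> \<delta> \<le> T \<longrightarrow> T \<le> max \<delta> (1/4) \<longrightarrow> \<delta> \<le> R \<longrightarrow> R \<le> 4 * T \<longrightarrow>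
     norm d \<le> T \<longrightarrow> norm d' \<le> T \<longrightarrow> T \<le> \<delta> \<or> T / 2 \<le> norm d \<and> T / 2 \<le> norm d' \<longrightarrow>
     R \<le> \<delta> \<or> R / 2 \<le> norm (d' - d) \<longrightarrow>
     emeasure lborel (shell \<delta> c \<inter> shell \<delta> (c + d) \<inter> shell \<delta> (c + d') :: 'a set)
       \<le> ennreal (C * (\<delta>\<^sup>2 / T) * (\<delta> / (R * T)) powr \<alpha>)"
proof -
  have dim2: "2 \<le> DIM('a)" and \<alpha>: "0 < \<alpha>" "\<alpha> \<le> 1" using assms by auto
  obtain C2 where C2: "C2 > 0" "\<And>\<delta> T c d. 0 < \<delta> \<Longrightarrow> \<delta> < 1/2 \<Longrightarrow> \<delta> \<le> T \<Longrightarrow> T \<le> max \<delta> (1/4) \<Longrightarrow>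
     norm d \<le> T \<Longrightarrow> T \<le> \<delta> \<or> T / 2 \<le> norm d \<Longrightarrow>
     emeasure lborel (shell \<delta> c \<inter> shell \<delta> (c + d) :: 'a set) \<le> ennreal (C2 * (\<delta>\<^sup>2 / T))"
    using emeasure_two_shells_le[OF dim2] by blast
  have "2 \<le> card (Basis :: 'a set)" using dim2 .
  then obtain B :: "'a set" where "B \<subseteq> Basis" "card B = 2" by (metis obtain_subset_with_card_n)
  then obtain i j :: 'a where ij: "i \<in> Basis" "j \<in> Basis" "i \<noteq> j" by (auto simp: card_2_iff)
  define C0 where "C0 = 624 + 432 * pi * 4 ^ (DIM('a) - 4)"
  have "0 < C0" unfolding C0_def by (intro add_pos_nonneg) auto
  have slab: "emeasure lborel {y::'a. y \<in> shell \<delta> 0 \<and> \<bar>y \<bullet> i - t / 2\<bar> \<le> 3 * \<delta> / t \<and> \<bar>y \<bullet> j - v\<bar> \<le> 9 * \<delta> / b}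
      \<le> ennreal (C0 * (\<delta>\<^sup>2 / t) * (\<delta> / b) powr \<alpha>)"
    if h: "0 < \<delta>" "\<delta> < 1/2" "24 * \<delta> \<le> t" "t \<le> 1/4" "8 * \<delta> \<le> b" for \<delta> t b v
  proof -
    have p: "0 < t" "0 < b" using h by linarith+
    from assms show ?thesis
    proof
      assume *: "DIM('a) = 3 \<and> \<alpha> = 1/2"
      have "624 * (\<delta>\<^sup>2 / t) * sqrt (\<delta> / b) \<le> C0 * (\<delta>\<^sup>2 / t) * (\<delta> / b) powr \<alpha>"
      proof -
        have "(\<delta> / b) powr \<alpha> = sqrt (\<delta> / b)"
          unfolding conjunct2[OF *] using p h by (simp add: powr_half_sqrt)
        moreover have "624 * (\<delta>\<^sup>2 / t) * sqrt (\<delta> / b) \<le> C0 * (\<delta>\<^sup>2 / t) * sqrt (\<delta> / b)"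
          unfolding C0_def using p h by (intro mult_right_mono) auto
        ultimately show ?thesis by (simp only:)
      qed
      then show ?thesis
        using order_trans[OF slab_dim3[OF _ h(1,2) ij h(3,4,5)] ennreal_leI] * by blast
    next
      assume *: "4 \<le> DIM('a) \<and> \<alpha> = 1"
      have "432 * pi * 4 ^ (DIM('a) - 4) * (\<delta>\<^sup>2 / t) * (\<delta> / b) \<le> C0 * (\<delta>\<^sup>2 / t) * (\<delta> / b) powr \<alpha>"
      proof -
        have "(\<delta> / b) powr \<alpha> = \<delta> / b" using conjunct2[OF *] p h by simp
        moreover have "432 * pi * 4 ^ (DIM('a) - 4) * (\<delta>\<^sup>2 / t) * (\<delta> / b) \<le> C0 * (\<delta>\<^sup>2 / t) * (\<delta> / b)"
          unfolding C0_def using p h by (intro mult_right_mono) auto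
        ultimately show ?thesis by (simp only:)
      qed
      then show ?thesis
        using order_trans[OF slab_dim4[OF _ h(1,2) ij p] ennreal_leI] * by blast
    qed
  qed
  define C where "C = max (C2 * 1152) (C0 * 2 * 128)"
  have "emeasure lborel (shell \<delta> c \<inter> shell \<delta> (c + d) \<inter> shell \<delta> (c + d') :: 'a set)
       \<le> ennreal (C * (\<delta>\<^sup>2 / T) * (\<delta> / (R * T)) powr \<alpha>)"
    if h: "0 < \<delta>" "\<delta> < 1/2" "\<delta> \<le> T" "T \<le> max \<delta> (1/4)" "\<delta> \<le> R" "R \<le> 4 * T" "norm d \<le> T" "norm d' \<le> T"
      "T \<le> \<delta> \<or> T / 2 \<le> norm d \<and> T / 2 \<le> norm d'" "R \<le> \<delta> \<or> R / 2 \<le> norm (d' - d)" for \<delta> T R and c d d' :: 'a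
  proof -
    have pos: "0 < T" "0 < R" using h by auto
    show ?thesis
    proof (cases "R * T < 1152 * \<delta>")
      case True
      have "emeasure lborel (shell \<delta> c \<inter> shell \<delta> (c + d) \<inter> shell \<delta> (c + d')) \<le> emeasure lborel (shell \<delta> c \<inter> shell \<delta> (c + d))"
        by (intro emeasure_mono) auto
      also have "\<dots> \<le> ennreal (C2 * (\<delta>\<^sup>2 / T))" using h by (intro C2) auto
      also have "\<dots> \<le> ennreal (C * (\<delta>\<^sup>2 / T) * (\<delta> / (R * T)) powr \<alpha>)"
      proof (rule ennreal_leI)
        have "1 / 1152 \<le> \<delta> / (R * T)" using True pos by (simp add: field_simps)
        then have "(1 / 1152) powr \<alpha> \<le> (\<delta> / (R * T)) powr \<alpha>" using \<alpha> by (intro powr_mono2) auto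
        moreover have "(1 / 1152) powr 1 \<le> (1 / 1152) powr \<alpha>" using \<alpha> by (intro powr_mono') auto
        ultimately have "C2 * (\<delta>\<^sup>2 / T) * 1 \<le> C2 * (\<delta>\<^sup>2 / T) * (1152 * (\<delta> / (R * T)) powr \<alpha>)"
          using C2 h pos by (intro mult_left_mono) auto
        also have "\<dots> = (C2 * 1152) * (\<delta>\<^sup>2 / T) * (\<delta> / (R * T)) powr \<alpha>" by simp
        also have "\<dots> \<le> C * (\<delta>\<^sup>2 / T) * (\<delta> / (R * T)) powr \<alpha>"
          using pos by (intro mult_right_mono) (auto simp: C_def)
        finally show "C2 * (\<delta>\<^sup>2 / T) \<le> C * (\<delta>\<^sup>2 / T) * (\<delta> / (R * T)) powr \<alpha>" by simp
      qed
      finally show ?thesis .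
    next
      case False
      \<comment> \<open>T > 1/4 is possible only for T \<le> \<delta>, and then R T \<le> 4 \<delta>
        is in the range already settled.\<close>
      have T4: "T \<le> 1/4"
      proof (rule ccontr)
        assume "\<not> T \<le> 1/4"
        then have "T \<le> \<delta>" using h by (auto simp: max_def split: if_splits)
        then have "R * T \<le> 4 * \<delta>" using h pos mult_mono[of R 4 T \<delta>] by simp
        then show False using False h by simp
      qed
      have RT4: "R * T \<le> R / 4" "R * T \<le> T"
        using h T4 pos mult_left_mono[of T "1/4" R] mult_right_mono[of R 1 T] by auto
      have nd: "T / 2 \<le> norm d" "T / 2 \<le> norm d'" "R / 2 \<le> norm (d' - d)"
        using False h RT4 by linarith+
      have RT: "1152 * \<delta> \<le> R * T" using False by simp
      obtain b v where bv: "R * T / 128 \<le> b"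
        "emeasure lborel (shell \<delta> c \<inter> shell \<delta> (c + d) \<inter> shell \<delta> (c + d'))
         \<le> emeasure lborel {y. y \<in> shell \<delta> 0 \<and> \<bar>y \<bullet> i - norm d / 2\<bar> \<le> 3 * \<delta> / norm d \<and> \<bar>y \<bullet> j - v\<bar> \<le> 9 * \<delta> / b}"
        using three_shells_coordinates[OF h(1,2) T4 pos(2) h(6,7) nd(1) h(8) nd(2,3) RT ij, of c] .
      have b: "8 * \<delta> \<le> b" "24 * \<delta> \<le> norm d" "norm d \<le> 1/4" using bv False h T4 RT4 nd by linarith+
      note bv(2)
      also have "emeasure lborel {y. y \<in> shell \<delta> 0 \<and> \<bar>y \<bullet> i - norm d / 2\<bar> \<le> 3 * \<delta> / norm d \<and> \<bar>y \<bullet> j - v\<bar> \<le> 9 * \<delta> / b}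
         \<le> ennreal (C0 * (\<delta>\<^sup>2 / norm d) * (\<delta> / b) powr \<alpha>)"
        using h b by (intro slab)
      also have "\<dots> \<le> ennreal (C * (\<delta>\<^sup>2 / T) * (\<delta> / (R * T)) powr \<alpha>)"
      proof (rule ennreal_leI)
        have "\<delta>\<^sup>2 / norm d \<le> 2 * (\<delta>\<^sup>2 / T)"
        proof -
          have "0 < norm d" using nd pos by linarith
          moreover have "\<delta>\<^sup>2 * T \<le> \<delta>\<^sup>2 * (2 * norm d)" using nd by (intro mult_left_mono) auto
          ultimately show ?thesis using pos by (simp add: field_simps)
        qed
        moreover have "(\<delta> / b) powr \<alpha> \<le> 128 * (\<delta> / (R * T)) powr \<alpha>"
        proof -
          have "0 < R * T" using pos by simp
          then have "\<delta> / b \<le> \<delta> / (R * T / 128)"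
            using bv(1) h(1) b(1) by (intro divide_left_mono) auto
          then have "\<delta> / b \<le> 128 * (\<delta> / (R * T))" by (simp add: mult.commute)
          then have "(\<delta> / b) powr \<alpha> \<le> (128 * (\<delta> / (R * T))) powr \<alpha>"
            using h b \<alpha> by (intro powr_mono2) auto
          also have "\<dots> = 128 powr \<alpha> * (\<delta> / (R * T)) powr \<alpha>" using h pos by (intro powr_mult)
          also have "128 powr \<alpha> \<le> 128 powr (1::real)" using \<alpha> by (intro powr_mono) auto
          finally show ?thesis by (simp add: mult_right_mono)
        qed
        ultimately have "C0 * (\<delta>\<^sup>2 / norm d) * (\<delta> / b) powr \<alpha> \<le> C0 * (2 * (\<delta>\<^sup>2 / T)) * (128 * (\<delta> / (R * T)) powr \<alpha>)"
          using \<open>0 < C0\<close> pos by (intro mult_mono) auto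
        also have "\<dots> = (C0 * 2 * 128) * (\<delta>\<^sup>2 / T) * (\<delta> / (R * T)) powr \<alpha>" by simp
        also have "\<dots> \<le> C * (\<delta>\<^sup>2 / T) * (\<delta> / (R * T)) powr \<alpha>"
          using pos by (intro mult_right_mono) (auto simp: C_def)
        finally show "C0 * (\<delta>\<^sup>2 / norm d) * (\<delta> / b) powr \<alpha> \<le> C * (\<delta>\<^sup>2 / T) * (\<delta> / (R * T)) powr \<alpha>" .
      qed
      finally show ?thesis .
    qed
  qed
  moreover have "C > 0" using C2 by (simp add: C_def max_def)
  ultimately show ?thesis by blast
qed

section \<open>Overlaps of spherical caps\<close>

text \<open>Sum at most cardinality times maximum, a crude form of Hoelder's inequality. The index
  set will be the set of scales, whose cardinality is logarithmic, so powers of it are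
  harmless.\<close>

lemma sum_power_le_ennreal:
  fixes a :: "'b \<Rightarrow> ennreal"
  assumes "finite I"
  shows "(\<Sum>i\<in>I. a i) ^ Suc m \<le> of_nat (card I ^ Suc m) * (\<Sum>i\<in>I. a i ^ Suc m)"
proof (cases "I = {}")
  case False
  define M where "M = Max (a ` I)"
  have "M \<in> a ` I" unfolding M_def using assms False by (intro Max_in) auto
  then obtain j where j: "j \<in> I" "M = a j" by blast
  have "(\<Sum>i\<in>I. a i) \<le> of_nat (card I) * M"
    by (rule sum_bounded_above) (use assms in \<open>auto simp: M_def\<close>)
  then have "(\<Sum>i\<in>I. a i) ^ Suc m \<le> (of_nat (card I) * M) ^ Suc m" by (intro power_mono) auto
  also have "\<dots> = of_nat (card I ^ Suc m) * a j ^ Suc m" by (simp add: power_mult_distrib j del: power_Suc)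
  also have "a j ^ Suc m \<le> (\<Sum>i\<in>I. a i ^ Suc m)" using assms j by (intro member_le_sum) auto
  finally show ?thesis by (simp add: mult_left_mono del: power_Suc)
qed simp

text \<open>Membership of a distance \<open>r\<close> in the dyadic scale 2^i \<delta>. For positive
  \<delta> the first alternative holds only at i = 0, which collects all distances up to
  \<delta>.\<close>

definition lev :: "real \<Rightarrow> nat \<Rightarrow> real \<Rightarrow> bool" where
  "lev \<delta> i r \<longleftrightarrow> r \<le> 2 ^ i * \<delta> \<and> (2 ^ i * \<delta> \<le> \<delta> \<or> 2 ^ i * \<delta> / 2 \<le> r)"

text \<open>The bound 1/4 is twice the largest distance 1/8 between relevant centres; the maximum
  with \<delta> keeps scale 0 present when \<delta> exceeds 1/4.\<close>

definition scales :: "real \<Rightarrow> nat set" where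
  "scales \<delta> = {i. 2 ^ i * \<delta> \<le> max \<delta> (1/4)}"

lemma finite_scales:
  assumes "0 < \<delta>" shows "finite (scales \<delta>)"
proof -
  obtain N where N: "max \<delta> (1/4) / \<delta> < 2 ^ N" using real_arch_pow[of 2] by auto
  have "scales \<delta> \<subseteq> {..N}"
  proof
    fix i assume "i \<in> scales \<delta>"
    then have "2 ^ i \<le> max \<delta> (1/4) / \<delta>" using assms by (simp add: scales_def field_simps)
    also have "\<dots> < 2 ^ N" by fact
    finally show "i \<in> {..N}" by (simp add: power_less_imp_less_exp less_imp_le)
  qed
  then show ?thesis using finite_subset by blast
qed

lemma lev_exists:
  assumes "0 < \<delta>" "r \<le> 1/8"
  shows "\<exists>i\<in>scales \<delta>. lev \<delta> i r"
proof (cases "r \<le> \<delta>")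
  case True
  then show ?thesis by (intro bexI[of _ 0]) (auto simp: lev_def scales_def)
next
  case False
  obtain N where N: "r / \<delta> < 2 ^ N" using real_arch_pow[of 2] by auto
  define i where "i = (LEAST i. r \<le> 2 ^ i * \<delta>)"
  have "r \<le> 2 ^ N * \<delta>" using N assms by (simp add: field_simps)
  then have i: "r \<le> 2 ^ i * \<delta>" unfolding i_def by (rule LeastI)
  have "i \<noteq> 0" using False i by (cases i) auto
  then obtain j where j: "i = Suc j" by (cases i) auto
  have "\<not> r \<le> 2 ^ j * \<delta>" using not_less_Least[of j "\<lambda>i. r \<le> 2 ^ i * \<delta>"] j by (simp add: i_def)
  then have "2 ^ i * \<delta> / 2 \<le> r" "2 ^ i * \<delta> \<le> 1/4" using j assms by auto
  then show ?thesis using i by (intro bexI[of _ i]) (auto simp: lev_def scales_def)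
qed

text \<open>\<open>c x\<close> is the centre selected for \<open>x\<close>, and only the cap of its
  shell in the directions \<open>V\<close> is kept. As \<open>V\<close> has diameter at most 1/8,
  caps with a common point have centres within 1/8 of each other; spheres touching from outside are
  thereby excluded.\<close>

locale sphere_family =
  fixes \<delta> :: real and c :: "'a::euclidean_space \<Rightarrow> 'a" and F V :: "'a set"
  assumes \<delta>: "0 < \<delta>" "\<delta> < 1/2"
    and c [measurable]: "c \<in> borel_measurable borel"
    and F [measurable]: "F \<in> sets borel" and V [measurable]: "V \<in> sets borel"
    and unit: "\<And>x. x \<in> F \<Longrightarrow> norm (c x - x) = 1"
    and small: "\<And>v w. v \<in> V \<Longrightarrow> w \<in> V \<Longrightarrow> norm (v - w) \<le> 1/8"
begin

definition cap :: "'a \<Rightarrow> 'a \<Rightarrow> bool" where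
  "cap x z \<longleftrightarrow> x \<in> F \<and> z \<in> shell \<delta> (c x) \<and> z - c x \<in> V"

definition chi :: "'a \<Rightarrow> 'a \<Rightarrow> ennreal" where
  "chi x z = (if cap x z then 1 else 0)"

definition near :: "nat \<Rightarrow> 'a \<Rightarrow> 'a \<Rightarrow> bool" where
  "near i x y \<longleftrightarrow> lev \<delta> i (norm (c y - c x))"

definition Phi :: "'a \<Rightarrow> ennreal" where
  "Phi z = (\<integral>\<^sup>+x. chi x z \<partial>lborel)"

definition Phi_at :: "nat \<Rightarrow> 'a \<Rightarrow> 'a \<Rightarrow> ennreal" where
  "Phi_at i x z = (\<integral>\<^sup>+y. chi y z * indicator {y. near i x y} y \<partial>lborel)"

lemma measurable_cap [measurable]:
  assumes [measurable]: "f \<in> M \<rightarrow>\<^sub>M borel" "g \<in> M \<rightarrow>\<^sub>M borel"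
  shows "Measurable.pred M (\<lambda>w. cap (f w) (g w))"
  unfolding cap_def shell_def by measurable

lemma measurable_chi [measurable]:
  assumes [measurable]: "f \<in> M \<rightarrow>\<^sub>M borel" "g \<in> M \<rightarrow>\<^sub>M borel"
  shows "(\<lambda>w. chi (f w) (g w)) \<in> borel_measurable M"
  unfolding chi_def by measurable

lemma measurable_near [measurable]:
  assumes [measurable]: "f \<in> M \<rightarrow>\<^sub>M borel" "g \<in> M \<rightarrow>\<^sub>M borel"
  shows "Measurable.pred M (\<lambda>w. near i (f w) (g w))"
  unfolding near_def lev_def by measurable

lemma measurable_Phi [measurable]: "Phi \<in> borel_measurable borel"
  unfolding Phi_def by measurable

lemma measurable_Phi_at [measurable]:
  assumes [measurable]: "f \<in> M \<rightarrow>\<^sub>M borel" "g \<in> M \<rightarrow>\<^sub>M borel"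
  shows "(\<lambda>w. Phi_at i (f w) (g w)) \<in> borel_measurable M"
  unfolding Phi_at_def by measurable

lemma centres_close:
  assumes "cap x z" "cap y z" shows "norm (c y - c x) \<le> 1/8"
  using small[of "z - c x" "z - c y"] assms by (simp add: cap_def)

text \<open>Every centre of a cap through \<open>z\<close> is within 1/8 of \<open>c x\<close> and
  hence belongs to some scale; a distance counted at two scales only enlarges the sum.\<close>

lemma Phi_le_sum:
  assumes "cap x z"
  shows "Phi z \<le> (\<Sum>i\<in>scales \<delta>. Phi_at i x z)"
proof -
  have "Phi z \<le> (\<integral>\<^sup>+y. (\<Sum>i\<in>scales \<delta>. chi y z * indicator {y. near i x y} y) \<partial>lborel)"
    unfolding Phi_def
  proof (rule nn_integral_mono)
    fix y
    show "chi y z \<le> (\<Sum>i\<in>scales \<delta>. chi y z * indicator {y. near i x y} y)"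
    proof (cases "cap y z")
      case True
      then obtain i where i: "i \<in> scales \<delta>" "near i x y"
        using lev_exists[OF \<delta>(1) centres_close[OF assms True]] by (auto simp: near_def)
      have "chi y z \<le> chi y z * indicator {y. near i x y} y" using i by simp
      also have "\<dots> \<le> (\<Sum>i\<in>scales \<delta>. chi y z * indicator {y. near i x y} y)"
        using i finite_scales[OF \<delta>(1)] by (intro member_le_sum) auto
      finally show ?thesis .
    qed (simp add: chi_def)
  qed
  also have "\<dots> = (\<Sum>i\<in>scales \<delta>. Phi_at i x z)"
    unfolding Phi_at_def by (intro nn_integral_sum) measurable
  finally show ?thesis .
qed

text \<open>The base point \<open>x\<close> is kept fixed and the remaining centres are sorted by their distance from \<open>c x\<close>.\<close>
lemma Phi_power_le:
  assumes B: "\<And>x i. x \<in> F \<Longrightarrow> i \<in> scales \<delta> \<Longrightarrow> (\<integral>\<^sup>+z. chi x z * Phi_at i x z ^ Suc m \<partial>lborel) \<le> B"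
  shows "(\<integral>\<^sup>+z. Phi z ^ Suc (Suc m) \<partial>lborel) \<le> of_nat (card (scales \<delta>) ^ Suc (Suc m)) * B * emeasure lborel F"
proof -
  let ?I = "scales \<delta>"
  have fin: "finite ?I" by (rule finite_scales[OF \<delta>(1)])
  have "(\<integral>\<^sup>+z. Phi z ^ Suc (Suc m) \<partial>lborel) = (\<integral>\<^sup>+z. \<integral>\<^sup>+x. chi x z * Phi z ^ Suc m \<partial>lborel \<partial>lborel)"
  proof (rule nn_integral_cong)
    fix z
    have "(\<integral>\<^sup>+x. chi x z * Phi z ^ Suc m \<partial>lborel) = (\<integral>\<^sup>+x. chi x z \<partial>lborel) * Phi z ^ Suc m"
      by (rule nn_integral_multc) measurable
    then show "Phi z ^ Suc (Suc m) = (\<integral>\<^sup>+x. chi x z * Phi z ^ Suc m \<partial>lborel)" by (simp add: Phi_def)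
  qed
  also have "\<dots> = (\<integral>\<^sup>+x. \<integral>\<^sup>+z. chi x z * Phi z ^ Suc m \<partial>lborel \<partial>lborel)"
    by (rule lborel_pair.Fubini') measurable
  also have "\<dots> \<le> (\<integral>\<^sup>+x. of_nat (card ?I ^ Suc (Suc m)) * B * indicator F x \<partial>lborel)"
  proof (rule nn_integral_mono)
    fix x
    show "(\<integral>\<^sup>+z. chi x z * Phi z ^ Suc m \<partial>lborel) \<le> of_nat (card ?I ^ Suc (Suc m)) * B * indicator F x"
    proof (cases "x \<in> F")
      case True
      have "(\<integral>\<^sup>+z. chi x z * Phi z ^ Suc m \<partial>lborel)
         \<le> (\<integral>\<^sup>+z. of_nat (card ?I ^ Suc m) * (\<Sum>i\<in>?I. chi x z * Phi_at i x z ^ Suc m) \<partial>lborel)"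
      proof (rule nn_integral_mono)
        fix z
        show "chi x z * Phi z ^ Suc m \<le> of_nat (card ?I ^ Suc m) * (\<Sum>i\<in>?I. chi x z * Phi_at i x z ^ Suc m)"
        proof (cases "cap x z")
          case True
          have "Phi z ^ Suc m \<le> (\<Sum>i\<in>?I. Phi_at i x z) ^ Suc m"
            using Phi_le_sum[OF True] by (intro power_mono) auto
          also have "\<dots> \<le> of_nat (card ?I ^ Suc m) * (\<Sum>i\<in>?I. Phi_at i x z ^ Suc m)"
            by (rule sum_power_le_ennreal[OF fin])
          finally show ?thesis using True by (simp add: chi_def del: power_Suc)
        qed (simp add: chi_def)
      qed
      also have "\<dots> = of_nat (card ?I ^ Suc m) * (\<Sum>i\<in>?I. \<integral>\<^sup>+z. chi x z * Phi_at i x z ^ Suc m \<partial>lborel)"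
        by (subst nn_integral_cmult, measurable, subst nn_integral_sum) measurable
      \<comment> \<open>The last of the m + 2 factors comes from bounding the sum over scales; the
        other m + 1 came from taking the power of that sum.\<close>
      also have "\<dots> \<le> of_nat (card ?I ^ Suc m) * (of_nat (card ?I) * B)"
        using B True by (intro mult_left_mono sum_bounded_above) auto
      finally show ?thesis using True by (simp add: mult_ac)
    qed (simp add: chi_def cap_def)
  qed
  also have "\<dots> = of_nat (card ?I ^ Suc (Suc m)) * B * emeasure lborel F"
    by (rule nn_integral_cmult_indicator) simp
  finally show ?thesis .
qed

text \<open>By the triangle inequality |y - c x| differs from |y - c y| = 1 by at most the scale, so
  all such y lie in an annulus about \<open>c x\<close>.\<close>

lemma emeasure_centres_le:
  assumes CA: "\<And>t c. 0 \<le> t \<Longrightarrow> t \<le> 2 \<Longrightarrow> emeasure lborel {z::'a. \<bar>norm (z - c) - 1\<bar> \<le> t} \<le> ennreal (CA * t)"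
    and i: "i \<in> scales \<delta>" and x: "x \<in> F"
  shows "emeasure lborel {y \<in> F. near i x y} \<le> ennreal (CA * (2 ^ i * \<delta>))"
proof -
  have "emeasure lborel {y \<in> F. near i x y} \<le> emeasure lborel {y. \<bar>norm (y - c x) - 1\<bar> \<le> 2 ^ i * \<delta>}"
  proof (rule emeasure_mono)
    show "{y \<in> F. near i x y} \<subseteq> {y. \<bar>norm (y - c x) - 1\<bar> \<le> 2 ^ i * \<delta>}"
    proof safe
      fix y assume y: "y \<in> F" "near i x y"
      have "norm (c x - y) \<le> norm (c y - y) + norm (c y - c x)"
        using norm_triangle_ineq4[of "c y - y" "c y - c x"] by simp
      moreover have "norm (c y - y) \<le> norm (c x - y) + norm (c y - c x)"
        using norm_triangle_ineq[of "c x - y" "c y - c x"] by simp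
      ultimately show "\<bar>norm (y - c x) - 1\<bar> \<le> 2 ^ i * \<delta>"
        using y(2) unit[OF y(1)] by (auto simp: near_def lev_def norm_minus_commute abs_le_iff)
    qed
  qed measurable
  also have "\<dots> \<le> ennreal (CA * (2 ^ i * \<delta>))"
    using i \<delta> by (intro CA) (auto simp: scales_def)
  finally show ?thesis .
qed

lemma Phi_at_le:
  assumes CA: "\<And>t c. 0 \<le> t \<Longrightarrow> t \<le> 2 \<Longrightarrow> emeasure lborel {z::'a. \<bar>norm (z - c) - 1\<bar> \<le> t} \<le> ennreal (CA * t)"
    and i: "i \<in> scales \<delta>" and x: "x \<in> F"
  shows "Phi_at i x z \<le> ennreal (CA * (2 ^ i * \<delta>))"
proof -
  have "Phi_at i x z \<le> (\<integral>\<^sup>+y. indicator {y \<in> F. near i x y} y \<partial>lborel)"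
    unfolding Phi_at_def by (intro nn_integral_mono) (auto simp: chi_def cap_def split: split_indicator)
  also have "\<dots> = emeasure lborel {y \<in> F. near i x y}" by (intro nn_integral_indicator) measurable
  also have "\<dots> \<le> ennreal (CA * (2 ^ i * \<delta>))" by (rule emeasure_centres_le[OF CA i x])
  finally show ?thesis .
qed

lemma scale_bounds:
  assumes "i \<in> scales \<delta>"
  shows "\<delta> \<le> 2 ^ i * \<delta>" "2 ^ i * \<delta> \<le> max \<delta> (1/4)" "2 ^ i * \<delta> \<le> 1" "0 < 2 ^ i * \<delta>"
  using assms \<delta> by (auto simp: scales_def)

text \<open>Intersections of size \<delta>^2/T are integrated over a set of y of measure O(T): the
  scale cancels, so two shells are the right number for the exponent 2.\<close>

lemma nn_integral_two_caps_le:
  assumes CA: "0 < CA" "\<And>t c. 0 \<le> t \<Longrightarrow> t \<le> 2 \<Longrightarrow> emeasure lborel {z::'a. \<bar>norm (z - c) - 1\<bar> \<le> t} \<le> ennreal (CA * t)"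
    and C2: "0 < C2" "\<And>T c d. \<delta> \<le> T \<Longrightarrow> T \<le> max \<delta> (1/4) \<Longrightarrow> norm d \<le> T \<Longrightarrow> T \<le> \<delta> \<or> T / 2 \<le> norm d \<Longrightarrow>
     emeasure lborel (shell \<delta> c \<inter> shell \<delta> (c + d) :: 'a set) \<le> ennreal (C2 * (\<delta>\<^sup>2 / T))"
    and i: "i \<in> scales \<delta>" and x: "x \<in> F"
  shows "(\<integral>\<^sup>+z. chi x z * Phi_at i x z \<partial>lborel) \<le> ennreal (CA * C2 * \<delta>\<^sup>2)"
proof -
  define T where "T = 2 ^ i * \<delta>"
  have T: "\<delta> \<le> T" "T \<le> max \<delta> (1/4)" "0 < T" using scale_bounds[OF i] by (auto simp: T_def)
  have "(\<integral>\<^sup>+z. chi x z * Phi_at i x z \<partial>lborel)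
      = (\<integral>\<^sup>+z. \<integral>\<^sup>+y. chi x z * (chi y z * indicator {y. near i x y} y) \<partial>lborel \<partial>lborel)"
    unfolding Phi_at_def by (intro nn_integral_cong nn_integral_cmult[symmetric]) measurable
  also have "\<dots> = (\<integral>\<^sup>+y. \<integral>\<^sup>+z. chi x z * (chi y z * indicator {y. near i x y} y) \<partial>lborel \<partial>lborel)"
    by (rule lborel_pair.Fubini') measurable
  also have "\<dots> \<le> (\<integral>\<^sup>+y. ennreal (C2 * (\<delta>\<^sup>2 / T)) * indicator {y \<in> F. near i x y} y \<partial>lborel)"
  proof (rule nn_integral_mono)
    fix y
    show "(\<integral>\<^sup>+z. chi x z * (chi y z * indicator {y. near i x y} y) \<partial>lborel)
       \<le> ennreal (C2 * (\<delta>\<^sup>2 / T)) * indicator {y \<in> F. near i x y} y"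
    proof (cases "y \<in> F \<and> near i x y")
      case True
      have "(\<integral>\<^sup>+z. chi x z * (chi y z * indicator {y. near i x y} y) \<partial>lborel)
         \<le> (\<integral>\<^sup>+z. indicator (shell \<delta> (c x) \<inter> shell \<delta> (c x + (c y - c x))) z \<partial>lborel)"
        by (intro nn_integral_mono) (auto simp: chi_def cap_def split: split_indicator)
      also have "\<dots> = emeasure lborel (shell \<delta> (c x) \<inter> shell \<delta> (c x + (c y - c x)))" by simp
      also have "\<dots> \<le> ennreal (C2 * (\<delta>\<^sup>2 / T))"
        using True T by (intro C2) (auto simp: near_def lev_def T_def)
      finally show ?thesis using True by simp
    next
      case False
      then have "chi x z * (chi y z * indicator {y. near i x y} y) = 0" for z
        by (auto simp: chi_def cap_def)
      then show ?thesis by (simp only: nn_integral_const mult_zero_left zero_le)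
    qed
  qed
  also have "\<dots> = ennreal (C2 * (\<delta>\<^sup>2 / T)) * emeasure lborel {y \<in> F. near i x y}"
    by (rule nn_integral_cmult_indicator) measurable
  also have "\<dots> \<le> ennreal (C2 * (\<delta>\<^sup>2 / T)) * ennreal (CA * T)"
    unfolding T_def by (intro mult_left_mono emeasure_centres_le[OF CA(2) i x]) auto
  also have "\<dots> = ennreal (CA * C2 * \<delta>\<^sup>2)"
    using T CA(1) C2(1) by (subst ennreal_mult[symmetric]) auto
  finally show ?thesis .
qed

text \<open>For y at scale T from x and y' at scale R from y, the sets have measure O(T) and O(R)
  and the intersection has size (\<delta>^2/T)(\<delta>/(R T))^\<alpha>. The product contains R^(1 -
  \<alpha>), largest at R about T, which leaves T^(1 - 2 \<alpha>); the sum over R costs the number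
  of scales.\<close>

lemma nn_integral_three_caps_le:
  assumes CA: "0 < CA" "\<And>t c. 0 \<le> t \<Longrightarrow> t \<le> 2 \<Longrightarrow> emeasure lborel {z::'a. \<bar>norm (z - c) - 1\<bar> \<le> t} \<le> ennreal (CA * t)"
    and \<alpha>: "0 < \<alpha>" "\<alpha> \<le> 1"
    and C3: "0 < C3" "\<And>T R c d d'. \<delta> \<le> T \<Longrightarrow> T \<le> max \<delta> (1/4) \<Longrightarrow> \<delta> \<le> R \<Longrightarrow> R \<le> 4 * T \<Longrightarrow>
     norm d \<le> T \<Longrightarrow> norm d' \<le> T \<Longrightarrow> T \<le> \<delta> \<or> T / 2 \<le> norm d \<and> T / 2 \<le> norm d' \<Longrightarrow>
     R \<le> \<delta> \<or> R / 2 \<le> norm (d' - d) \<Longrightarrow>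
     emeasure lborel (shell \<delta> c \<inter> shell \<delta> (c + d) \<inter> shell \<delta> (c + d') :: 'a set)
       \<le> ennreal (C3 * (\<delta>\<^sup>2 / T) * (\<delta> / (R * T)) powr \<alpha>)"
    and i: "i \<in> scales \<delta>" and x: "x \<in> F"
  shows "(\<integral>\<^sup>+z. chi x z * Phi_at i x z ^ 2 \<partial>lborel)
     \<le> ennreal (4 * CA\<^sup>2 * C3 * \<delta> powr (2 + \<alpha>) * (2 ^ i * \<delta>) powr (1 - 2 * \<alpha>)) * of_nat (card (scales \<delta>))"
proof -
  define T where "T = 2 ^ i * \<delta>"
  have T: "\<delta> \<le> T" "T \<le> max \<delta> (1/4)" "0 < T" "T \<le> 1" using scale_bounds[OF i] by (auto simp: T_def)
  define A where "A = {y \<in> F. near i x y}"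
  have [measurable]: "A \<in> sets borel" unfolding A_def by measurable
  define J where "J = {j \<in> scales \<delta>. 2 ^ j * \<delta> \<le> 4 * T}"
  have finJ: "finite J" unfolding J_def using finite_scales[OF \<delta>(1)] by simp
  define b where "b = (\<lambda>j::nat. C3 * (\<delta>\<^sup>2 / T) * (\<delta> / (2 ^ j * \<delta> * T)) powr \<alpha>)"
  define D where "D = 4 * CA * C3 * \<delta> powr (2 + \<alpha>) * T powr (- 2 * \<alpha>)"
  have D0: "0 \<le> D" using CA(1) C3(1) by (simp add: D_def)
  \<comment> \<open>The square is expanded into an integral over pairs of centres, with the volume
    of the triple intersection innermost.\<close>
  have sym: "(\<integral>\<^sup>+z. chi x z * Phi_at i x z ^ 2 \<partial>lborel) =
     (\<integral>\<^sup>+y. indicator A y * (\<integral>\<^sup>+y'. indicator A y' * (\<integral>\<^sup>+z. chi x z * chi y z * chi y' z \<partial>lborel) \<partial>lborel) \<partial>lborel)"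
  proof -
    have at: "Phi_at i x z = (\<integral>\<^sup>+y. indicator A y * chi y z \<partial>lborel)" for z
      unfolding Phi_at_def A_def by (intro nn_integral_cong) (auto simp: chi_def cap_def split: split_indicator)
    have "(\<integral>\<^sup>+z. chi x z * Phi_at i x z ^ 2 \<partial>lborel)
        = (\<integral>\<^sup>+z. \<integral>\<^sup>+y. indicator A y * chi y z * (chi x z * Phi_at i x z) \<partial>lborel \<partial>lborel)"
    proof (rule nn_integral_cong)
      fix z
      have "(\<integral>\<^sup>+y. indicator A y * chi y z * (chi x z * Phi_at i x z) \<partial>lborel)
          = (\<integral>\<^sup>+y. indicator A y * chi y z \<partial>lborel) * (chi x z * Phi_at i x z)"
        by (rule nn_integral_multc) measurable
      then show "chi x z * Phi_at i x z ^ 2 = (\<integral>\<^sup>+y. indicator A y * chi y z * (chi x z * Phi_at i x z) \<partial>lborel)"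
        by (simp add: at[symmetric] power2_eq_square mult_ac)
    qed
    also have "\<dots> = (\<integral>\<^sup>+y. \<integral>\<^sup>+z. indicator A y * chi y z * (chi x z * Phi_at i x z) \<partial>lborel \<partial>lborel)"
      by (rule lborel_pair.Fubini') measurable
    also have "\<dots> = (\<integral>\<^sup>+y. indicator A y * (\<integral>\<^sup>+y'. indicator A y' * (\<integral>\<^sup>+z. chi x z * chi y z * chi y' z \<partial>lborel) \<partial>lborel) \<partial>lborel)"
    proof (rule nn_integral_cong)
      fix y
      have "(\<integral>\<^sup>+z. indicator A y * chi y z * (chi x z * Phi_at i x z) \<partial>lborel)
          = indicator A y * (\<integral>\<^sup>+z. chi y z * chi x z * Phi_at i x z \<partial>lborel)"
        unfolding mult.assoc by (rule nn_integral_cmult) measurable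
      also have "(\<integral>\<^sup>+z. chi y z * chi x z * Phi_at i x z \<partial>lborel)
          = (\<integral>\<^sup>+z. \<integral>\<^sup>+y'. chi y z * chi x z * (indicator A y' * chi y' z) \<partial>lborel \<partial>lborel)"
        unfolding at by (intro nn_integral_cong nn_integral_cmult[symmetric]) measurable
      also have "\<dots> = (\<integral>\<^sup>+y'. \<integral>\<^sup>+z. chi y z * chi x z * (indicator A y' * chi y' z) \<partial>lborel \<partial>lborel)"
        by (rule lborel_pair.Fubini') measurable
      also have "\<dots> = (\<integral>\<^sup>+y'. indicator A y' * (\<integral>\<^sup>+z. chi x z * chi y z * chi y' z \<partial>lborel) \<partial>lborel)"
        by (intro nn_integral_cong, subst nn_integral_cmult[symmetric]) (measurable, auto intro!: nn_integral_cong simp: mult_ac)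
      finally show "(\<integral>\<^sup>+z. indicator A y * chi y z * (chi x z * Phi_at i x z) \<partial>lborel) =
          indicator A y * (\<integral>\<^sup>+y'. indicator A y' * (\<integral>\<^sup>+z. chi x z * chi y z * chi y' z \<partial>lborel) \<partial>lborel)" .
    qed
    finally show ?thesis .
  qed
  have inner: "(\<integral>\<^sup>+y'. indicator A y' * (\<integral>\<^sup>+z. chi x z * chi y z * chi y' z \<partial>lborel) \<partial>lborel)
      \<le> ennreal D * of_nat (card (scales \<delta>))" if y: "y \<in> A" for y
  proof -
    have yF: "y \<in> F" and yn: "near i x y" using y by (auto simp: A_def)
    have "(\<integral>\<^sup>+y'. indicator A y' * (\<integral>\<^sup>+z. chi x z * chi y z * chi y' z \<partial>lborel) \<partial>lborel)
       \<le> (\<integral>\<^sup>+y'. (\<Sum>j\<in>J. ennreal (b j) * indicator {y' \<in> F. near j y y'} y') \<partial>lborel)"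
    proof (rule nn_integral_mono)
      fix y'
      show "indicator A y' * (\<integral>\<^sup>+z. chi x z * chi y z * chi y' z \<partial>lborel)
         \<le> (\<Sum>j\<in>J. ennreal (b j) * indicator {y' \<in> F. near j y y'} y')"
      proof (cases "y' \<in> A \<and> (\<exists>z. cap x z \<and> cap y z \<and> cap y' z)")
        case True
        then have y': "y' \<in> F" "near i x y'" by (auto simp: A_def)
        from True obtain z where z: "cap x z" "cap y z" "cap y' z" by blast
        obtain j where j: "j \<in> scales \<delta>" "near j y y'"
          using lev_exists[OF \<delta>(1) centres_close[OF z(2,3)]] by (auto simp: near_def)
        have "norm (c y' - c y) \<le> norm (c y' - c x) + norm (c y - c x)"
          using norm_triangle_ineq4[of "c y' - c x" "c y - c x"] by simp
        then have "norm (c y' - c y) \<le> 2 * T" using yn y' by (simp add: near_def lev_def T_def)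
        \<comment> \<open>The distance 2 T is at most doubled by dyadic rounding; at the bottom
          scale \<delta> \<le> T is used instead.\<close>
        then have R: "2 ^ j * \<delta> \<le> 4 * T" using j T by (auto simp: near_def lev_def)
        have "(\<integral>\<^sup>+z. chi x z * chi y z * chi y' z \<partial>lborel)
           \<le> (\<integral>\<^sup>+z. indicator (shell \<delta> (c x) \<inter> shell \<delta> (c x + (c y - c x)) \<inter> shell \<delta> (c x + (c y' - c x))) z \<partial>lborel)"
          by (intro nn_integral_mono) (auto simp: chi_def cap_def split: split_indicator)
        also have "\<dots> = emeasure lborel (shell \<delta> (c x) \<inter> shell \<delta> (c x + (c y - c x)) \<inter> shell \<delta> (c x + (c y' - c x)))" by simp
        also have "\<dots> \<le> ennreal (b j)"
          unfolding b_def using scale_bounds[OF j(1)] T R yn y' j(2)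
          by (intro C3(2)) (auto simp: near_def lev_def T_def)
        also have "\<dots> = ennreal (b j) * indicator {y' \<in> F. near j y y'} y'" using j y' by simp
        also have "\<dots> \<le> (\<Sum>j\<in>J. ennreal (b j) * indicator {y' \<in> F. near j y y'} y')"
          using finJ j R by (intro member_le_sum) (auto simp: J_def)
        finally show ?thesis using True by simp
      next
        case False
        then have "indicator A y' * (chi x z * chi y z * chi y' z) = 0" for z
          by (auto simp: chi_def split: split_indicator)
        moreover have "indicator A y' * (\<integral>\<^sup>+z. chi x z * chi y z * chi y' z \<partial>lborel)
            = (\<integral>\<^sup>+z. indicator A y' * (chi x z * chi y z * chi y' z) \<partial>lborel)"
          by (rule nn_integral_cmult[symmetric]) measurable
        ultimately show ?thesis by (simp only: nn_integral_const mult_zero_left zero_le)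
      qed
    qed
    also have "\<dots> = (\<Sum>j\<in>J. ennreal (b j) * emeasure lborel {y' \<in> F. near j y y'})"
      by (subst nn_integral_sum, measurable, intro sum.cong refl nn_integral_cmult_indicator) measurable
    also have "\<dots> \<le> (\<Sum>j\<in>J. ennreal D)"
    proof (rule sum_mono)
      fix j assume j: "j \<in> J"
      define R where "R = 2 ^ j * \<delta>"
      have R: "0 < R" "R \<le> 4 * T" using j \<delta> by (auto simp: R_def J_def)
      have js: "j \<in> scales \<delta>" using j by (simp add: J_def)
      have "ennreal (b j) * emeasure lborel {y' \<in> F. near j y y'} \<le> ennreal (b j) * ennreal (CA * R)"
        unfolding R_def by (intro mult_left_mono emeasure_centres_le[OF CA(2) js yF]) auto
      also have "\<dots> = ennreal (b j * (CA * R))"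
        using CA(1) R by (subst ennreal_mult''[symmetric]) auto
      also have "\<dots> \<le> ennreal D"
      proof (rule ennreal_leI)
        \<comment> \<open>Here \<alpha> \<le> 1 enters: the exponent of R is nonnegative, so R may
          be replaced by its maximum 4 T.\<close>
        have "R powr (1 - \<alpha>) \<le> (4 * T) powr (1 - \<alpha>)" using R \<alpha> by (intro powr_mono2) auto
        also have "\<dots> = 4 powr (1 - \<alpha>) * T powr (1 - \<alpha>)" using T by (intro powr_mult)
        also have "\<dots> \<le> 4 powr (1::real) * T powr (1 - \<alpha>)" using \<alpha> by (intro mult_right_mono powr_mono) auto
        finally have *: "R powr (1 - \<alpha>) \<le> 4 * T powr (1 - \<alpha>)" by simp
        have "b j * (CA * R) = CA * C3 * (\<delta>\<^sup>2 * \<delta> powr \<alpha>) * (R * R powr (-\<alpha>)) * (T powr (-\<alpha>) / T)"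
        proof -
          have "(\<delta> / (R * T)) powr \<alpha> = \<delta> powr \<alpha> * (R powr (-\<alpha>) * T powr (-\<alpha>))"
            using \<delta> R T by (simp add: powr_divide powr_mult powr_minus_divide)
          then show ?thesis unfolding b_def R_def[symmetric] by simp
        qed
        also have "\<delta>\<^sup>2 * \<delta> powr \<alpha> = \<delta> powr (2 + \<alpha>)" using \<delta> by (simp add: powr_add)
        also have "R * R powr (-\<alpha>) = R powr (1 - \<alpha>)" using R by (simp add: powr_diff powr_minus_divide)
        also have "CA * C3 * \<delta> powr (2 + \<alpha>) * R powr (1 - \<alpha>) * (T powr (-\<alpha>) / T)
           \<le> CA * C3 * \<delta> powr (2 + \<alpha>) * (4 * T powr (1 - \<alpha>)) * (T powr (-\<alpha>) / T)"
          using * CA(1) C3(1) T by (intro mult_right_mono mult_left_mono) auto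
        also have "\<dots> = 4 * CA * C3 * \<delta> powr (2 + \<alpha>) * (T powr (1 - \<alpha>) * T powr (-\<alpha>) / T)" by simp
        also have "T powr (1 - \<alpha>) * T powr (-\<alpha>) / T = T powr (- 2 * \<alpha>)"
        proof -
          have "T powr (1 - \<alpha>) * T powr (-\<alpha>) = T powr (1 - 2 * \<alpha>)" by (simp add: powr_add[symmetric])
          also have "\<dots> = T * T powr (- 2 * \<alpha>)" using T by (simp add: powr_diff powr_minus_divide)
          finally show ?thesis using T by simp
        qed
        finally show "b j * (CA * R) \<le> D" by (simp add: D_def)
      qed
      finally show "ennreal (b j) * emeasure lborel {y' \<in> F. near j y y'} \<le> ennreal D" .
    qed
    also have "\<dots> = ennreal D * of_nat (card J)" by (simp add: mult.commute)
    also have "\<dots> \<le> ennreal D * of_nat (card (scales \<delta>))"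
    proof -
      have "card J \<le> card (scales \<delta>)" unfolding J_def using finite_scales[OF \<delta>(1)] by (intro card_mono) auto
      then show ?thesis by (intro mult_left_mono) auto
    qed
    finally show ?thesis .
  qed
  have "(\<integral>\<^sup>+z. chi x z * Phi_at i x z ^ 2 \<partial>lborel) \<le> (\<integral>\<^sup>+y. (ennreal D * of_nat (card (scales \<delta>))) * indicator A y \<partial>lborel)"
    unfolding sym
  proof (rule nn_integral_mono)
    fix y
    show "indicator A y * (\<integral>\<^sup>+y'. indicator A y' * (\<integral>\<^sup>+z. chi x z * chi y z * chi y' z \<partial>lborel) \<partial>lborel)
      \<le> (ennreal D * of_nat (card (scales \<delta>))) * indicator A y"
      using inner[of y] by (auto split: split_indicator)
  qed
  also have "\<dots> = (ennreal D * of_nat (card (scales \<delta>))) * emeasure lborel A"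
    by (rule nn_integral_cmult_indicator) measurable
  also have "\<dots> \<le> (ennreal D * of_nat (card (scales \<delta>))) * ennreal (CA * T)"
    unfolding T_def A_def by (intro mult_left_mono emeasure_centres_le[OF CA(2) i x]) auto
  also have "\<dots> = (ennreal D * ennreal (CA * T)) * of_nat (card (scales \<delta>))" by (simp only: mult_ac)
  also have "ennreal D * ennreal (CA * T) = ennreal (D * (CA * T))"
    using CA(1) T by (subst ennreal_mult''[symmetric]) auto
  also have "D * (CA * T) = 4 * CA\<^sup>2 * C3 * \<delta> powr (2 + \<alpha>) * T powr (1 - 2 * \<alpha>)"
  proof -
    have "T powr (1 - 2 * \<alpha>) = T * T powr (- 2 * \<alpha>)" using T by (simp add: powr_diff powr_minus_divide)
    then show ?thesis by (simp add: D_def power2_eq_square)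
  qed
  finally show ?thesis by (simp add: T_def)
qed

end

text \<open>\<open>k\<close> is chosen to cancel the scale. Two shells leave no power of T; three
  shells leave T^(1 - 2 \<alpha>), which is 1 in dimension 3 where \<alpha> = 1/2. From dimension 4
  on \<alpha> = 1 leaves 1/T, and a fourth shell, estimated only by the measure O(T) of its possible
  centres, compensates it. Thus \<kappa> = 2 or 2 + \<alpha>.\<close>

lemma nn_integral_Phi_power_le:
  fixes k :: nat and \<kappa> :: real
  assumes cases: "(2 \<le> DIM('a::euclidean_space) \<and> k = 2 \<and> \<kappa> = 2) \<or> (DIM('a) = 3 \<and> k = 3 \<and> \<kappa> = 5/2) \<or> (4 \<le> DIM('a) \<and> k = 4 \<and> \<kappa> = 3)"
  shows "\<exists>C>0. \<forall>\<delta> c (F::'a set) V. sphere_family \<delta> c F V \<longrightarrow>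
     (\<integral>\<^sup>+z. sphere_family.Phi \<delta> c F V z ^ k \<partial>lborel)
       \<le> ennreal (C * real (card (scales \<delta>)) ^ 5 * \<delta> powr \<kappa>) * emeasure lborel F"
proof -
  obtain CA where CA: "0 < CA" "\<And>t c. 0 \<le> t \<Longrightarrow> t \<le> 2 \<Longrightarrow> emeasure lborel {z::'a. \<bar>norm (z - c) - 1\<bar> \<le> t} \<le> ennreal (CA * t)"
    using emeasure_annulus_le[where 'a='a] by blast
  have step: "(\<integral>\<^sup>+z. sphere_family.Phi \<delta> c F V z ^ k \<partial>lborel)
       \<le> ennreal (C * real (card (scales \<delta>)) ^ 5 * \<delta> powr \<kappa>) * emeasure lborel F"
    if sf: "sphere_family \<delta> c F V" and C: "0 < C" and k: "k = Suc (Suc m)" "k \<le> 4" and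
    B: "\<And>x i. x \<in> F \<Longrightarrow> i \<in> scales \<delta> \<Longrightarrow> (\<integral>\<^sup>+z. sphere_family.chi \<delta> c F V x z * sphere_family.Phi_at \<delta> c F V i x z ^ Suc m \<partial>lborel)
       \<le> ennreal (C * \<delta> powr \<kappa>) * of_nat (card (scales \<delta>))" for C \<delta> c m and F V :: "'a set"
  proof -
    interpret sphere_family \<delta> c F V by fact
    let ?n = "card (scales \<delta>)"
    have "0 \<in> scales \<delta>" by (simp add: scales_def)
    then have n: "1 \<le> ?n" using finite_scales[OF \<delta>(1)] by (metis card_0_eq empty_iff not_one_le_zero leI less_one)
    have "(\<integral>\<^sup>+z. Phi z ^ k \<partial>lborel) \<le> of_nat (?n ^ k) * (ennreal (C * \<delta> powr \<kappa>) * of_nat ?n) * emeasure lborel F"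
      unfolding k(1) using B by (rule Phi_power_le)
    also have "of_nat (?n ^ k) * (ennreal (C * \<delta> powr \<kappa>) * of_nat ?n) = ennreal (C * \<delta> powr \<kappa>) * of_nat (?n ^ Suc k)"
      by (simp add: mult_ac)
    \<comment> \<open>At most five powers of the number of scales occur: k \<le> 4 from taking the
      power and one from the sum over the distance between the second and third centre.\<close>
    also have "\<dots> \<le> ennreal (C * \<delta> powr \<kappa>) * of_nat (?n ^ 5)"
    proof -
      have "?n ^ Suc k \<le> ?n ^ 5" using n k by (intro power_increasing) auto
      then show ?thesis by (intro mult_left_mono of_nat_mono) auto
    qed
    also have "\<dots> = ennreal (C * real ?n ^ 5 * \<delta> powr \<kappa>)"
      unfolding ennreal_of_nat_eq_real_of_nat by (subst ennreal_mult''[symmetric]) (simp_all add: mult_ac)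
    finally show ?thesis by (simp add: mult_right_mono)
  qed
  have card1: "1 \<le> (of_nat (card (scales \<delta>)) :: ennreal)" if "0 < \<delta>" for \<delta>
  proof -
    have "0 \<in> scales \<delta>" by (simp add: scales_def)
    then have "1 \<le> card (scales \<delta>)" using finite_scales[OF that] by (metis card_0_eq empty_iff not_one_le_zero leI less_one)
    then show ?thesis by (metis of_nat_1 of_nat_mono)
  qed
  from cases consider (two) "2 \<le> DIM('a)" "k = 2" "\<kappa> = 2" | (three) "DIM('a) = 3" "k = 3" "\<kappa> = 5/2" | (four) "4 \<le> DIM('a)" "k = 4" "\<kappa> = 3"
    by blast
  then show ?thesis
  proof cases
    case two
    obtain C2 where C2: "0 < C2" "\<And>\<delta> T c d. 0 < \<delta> \<Longrightarrow> \<delta> < 1/2 \<Longrightarrow> \<delta> \<le> T \<Longrightarrow> T \<le> max \<delta> (1/4) \<Longrightarrow>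
       norm d \<le> T \<Longrightarrow> T \<le> \<delta> \<or> T / 2 \<le> norm d \<Longrightarrow>
       emeasure lborel (shell \<delta> c \<inter> shell \<delta> (c + d) :: 'a set) \<le> ennreal (C2 * (\<delta>\<^sup>2 / T))"
      using emeasure_two_shells_le[OF two(1)] by blast
    have "(\<integral>\<^sup>+z. sphere_family.Phi \<delta> c F V z ^ k \<partial>lborel)
       \<le> ennreal (CA * C2 * real (card (scales \<delta>)) ^ 5 * \<delta> powr \<kappa>) * emeasure lborel F"
      if sf: "sphere_family \<delta> c F V" for \<delta> c and F V :: "'a set"
    proof (rule step[OF sf _ _ _, where m = 0])
      interpret sphere_family \<delta> c F V by fact
      fix x i assume x: "x \<in> F" and i: "i \<in> scales \<delta>"
      have "(\<integral>\<^sup>+z. chi x z * Phi_at i x z \<partial>lborel) \<le> ennreal (CA * C2 * \<delta>\<^sup>2)"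
        by (rule nn_integral_two_caps_le[OF CA C2(1) C2(2)[OF \<delta>] i x])
      also have "\<dots> \<le> ennreal (CA * C2 * \<delta>\<^sup>2) * of_nat (card (scales \<delta>))"
        using mult_left_mono[OF card1[OF \<delta>(1)], of "ennreal (CA * C2 * \<delta>\<^sup>2)"] by simp
      finally show "(\<integral>\<^sup>+z. chi x z * Phi_at i x z ^ Suc 0 \<partial>lborel) \<le> ennreal (CA * C2 * \<delta> powr \<kappa>) * of_nat (card (scales \<delta>))"
        using two \<delta> by simp
    qed (use CA C2 two in auto)
    then show ?thesis using CA(1) C2(1) by (intro exI[of _ "CA * C2"]) auto
  next
    case three
    obtain C3 where C3: "0 < C3" "\<And>\<delta> T R c d d'. 0 < \<delta> \<Longrightarrow> \<delta> < 1/2 \<Longrightarrow> \<delta> \<le> T \<Longrightarrow> T \<le> max \<delta> (1/4) \<Longrightarrow> \<delta> \<le> R \<Longrightarrow> R \<le> 4 * T \<Longrightarrow>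
     norm d \<le> T \<Longrightarrow> norm d' \<le> T \<Longrightarrow> T \<le> \<delta> \<or> T / 2 \<le> norm d \<and> T / 2 \<le> norm d' \<Longrightarrow>
     R \<le> \<delta> \<or> R / 2 \<le> norm (d' - d) \<Longrightarrow>
     emeasure lborel (shell \<delta> c \<inter> shell \<delta> (c + d) \<inter> shell \<delta> (c + d') :: 'a set)
       \<le> ennreal (C3 * (\<delta>\<^sup>2 / T) * (\<delta> / (R * T)) powr (1/2))"
      using emeasure_three_shells_le[where 'a='a and \<alpha>="1/2"] three(1) by blast
    have "(\<integral>\<^sup>+z. sphere_family.Phi \<delta> c F V z ^ k \<partial>lborel)
       \<le> ennreal ((4 * CA\<^sup>2 * C3) * real (card (scales \<delta>)) ^ 5 * \<delta> powr \<kappa>) * emeasure lborel F"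
      if sf: "sphere_family \<delta> c F V" for \<delta> c and F V :: "'a set"
    proof (rule step[OF sf _ _ _, where m = 1])
      interpret sphere_family \<delta> c F V by fact
      fix x i assume x: "x \<in> F" and i: "i \<in> scales \<delta>"
      have "(\<integral>\<^sup>+z. chi x z * Phi_at i x z ^ 2 \<partial>lborel) \<le> ennreal (4 * CA\<^sup>2 * C3 * \<delta> powr (2 + 1/2) * (2 ^ i * \<delta>) powr (1 - 2 * (1/2))) * of_nat (card (scales \<delta>))"
        by (rule nn_integral_three_caps_le[OF CA _ _ C3(1) C3(2)[OF \<delta>] i x]) auto
      then show "(\<integral>\<^sup>+z. chi x z * Phi_at i x z ^ Suc 1 \<partial>lborel) \<le> ennreal (4 * CA\<^sup>2 * C3 * \<delta> powr \<kappa>) * of_nat (card (scales \<delta>))"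
        unfolding three(3) using \<delta> by (simp add: numeral_2_eq_2)
    qed (use CA C3 three in auto)
    then show ?thesis using CA(1) C3(1) by (intro exI[of _ "4 * CA\<^sup>2 * C3"]) auto
  next
    case four
    obtain C3 where C3: "0 < C3" "\<And>\<delta> T R c d d'. 0 < \<delta> \<Longrightarrow> \<delta> < 1/2 \<Longrightarrow> \<delta> \<le> T \<Longrightarrow> T \<le> max \<delta> (1/4) \<Longrightarrow> \<delta> \<le> R \<Longrightarrow> R \<le> 4 * T \<Longrightarrow>
     norm d \<le> T \<Longrightarrow> norm d' \<le> T \<Longrightarrow> T \<le> \<delta> \<or> T / 2 \<le> norm d \<and> T / 2 \<le> norm d' \<Longrightarrow>
     R \<le> \<delta> \<or> R / 2 \<le> norm (d' - d) \<Longrightarrow>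
     emeasure lborel (shell \<delta> c \<inter> shell \<delta> (c + d) \<inter> shell \<delta> (c + d') :: 'a set)
       \<le> ennreal (C3 * (\<delta>\<^sup>2 / T) * (\<delta> / (R * T)) powr 1)"
      using emeasure_three_shells_le[where 'a='a and \<alpha>=1] four(1) by blast
    have "(\<integral>\<^sup>+z. sphere_family.Phi \<delta> c F V z ^ k \<partial>lborel)
       \<le> ennreal ((4 * CA ^ 3 * C3) * real (card (scales \<delta>)) ^ 5 * \<delta> powr \<kappa>) * emeasure lborel F"
      if sf: "sphere_family \<delta> c F V" for \<delta> c and F V :: "'a set"
    proof (rule step[OF sf _ _ _, where m = 2])
      interpret sphere_family \<delta> c F V by fact
      fix x i assume x: "x \<in> F" and i: "i \<in> scales \<delta>"
      define T where "T = 2 ^ i * \<delta>"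
      have T: "0 < T" using scale_bounds[OF i] by (simp add: T_def)
      \<comment> \<open>One of the three factors \<open>Phi_at\<close> is replaced by its supremum
        bound \<open>CA * T\<close>, and the rest is the three-shell integral.\<close>
      have "(\<integral>\<^sup>+z. chi x z * Phi_at i x z ^ Suc 2 \<partial>lborel) \<le> (\<integral>\<^sup>+z. ennreal (CA * T) * (chi x z * Phi_at i x z ^ 2) \<partial>lborel)"
      proof (rule nn_integral_mono)
        fix z
        have "Phi_at i x z * (chi x z * Phi_at i x z ^ 2) \<le> ennreal (CA * T) * (chi x z * Phi_at i x z ^ 2)"
          unfolding T_def by (intro mult_right_mono Phi_at_le[OF CA(2) i x]) auto
        then show "chi x z * Phi_at i x z ^ Suc 2 \<le> ennreal (CA * T) * (chi x z * Phi_at i x z ^ 2)" by (simp only: power_Suc mult_ac)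
      qed
      also have "\<dots> = ennreal (CA * T) * (\<integral>\<^sup>+z. chi x z * Phi_at i x z ^ 2 \<partial>lborel)"
        by (rule nn_integral_cmult) measurable
      also have "\<dots> \<le> ennreal (CA * T) * (ennreal (4 * CA\<^sup>2 * C3 * \<delta> powr (2 + 1) * (2 ^ i * \<delta>) powr (1 - 2 * 1)) * of_nat (card (scales \<delta>)))"
        by (intro mult_left_mono nn_integral_three_caps_le[OF CA _ _ C3(1) C3(2)[OF \<delta>] i x]) auto
      also have "\<dots> = ennreal (CA * T * (4 * CA\<^sup>2 * C3 * \<delta> powr (2 + 1) * (2 ^ i * \<delta>) powr (1 - 2 * 1))) * of_nat (card (scales \<delta>))"
        using CA(1) C3(1) T by (subst ennreal_mult) (auto simp: mult_ac)
      also have "CA * T * (4 * CA\<^sup>2 * C3 * \<delta> powr (2 + 1) * (2 ^ i * \<delta>) powr (1 - 2 * 1)) = 4 * CA ^ 3 * C3 * \<delta> powr \<kappa>"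
        unfolding T_def[symmetric] using T four by (simp add: powr_minus_divide power2_eq_square power3_eq_cube)
      finally show "(\<integral>\<^sup>+z. chi x z * Phi_at i x z ^ Suc 2 \<partial>lborel) \<le> ennreal (4 * CA ^ 3 * C3 * \<delta> powr \<kappa>) * of_nat (card (scales \<delta>))" .
    qed (use CA C3 four in auto)
    then show ?thesis using CA(1) C3(1) by (intro exI[of _ "4 * CA ^ 3 * C3"]) auto
  qed
qed

section \<open>Duality\<close>

text \<open>No division by the measure of \<open>W\<close>, so for a shell levels are later written
  as \<mu> \<delta>. Values in \<open>ennreal\<close> make the integral meaningful without
  integrability.\<close>

definition cap_avg :: "'a::euclidean_space set \<Rightarrow> ('a \<Rightarrow> real) \<Rightarrow> 'a \<Rightarrow> ennreal" where
  "cap_avg W g c = (\<integral>\<^sup>+z. indicator {z. z - c \<in> W} z * ennreal (g z) \<partial>lborel)"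

definition cap_max :: "'a::euclidean_space set \<Rightarrow> ('a \<Rightarrow> real) \<Rightarrow> 'a \<Rightarrow> ennreal" where
  "cap_max W g x = (SUP u\<in>sphere 0 1. cap_avg W g (x + u))"

text \<open>For open \<open>W\<close> the indicator of z - c in \<open>W\<close> is lower
  semicontinuous in c, and Fatou's lemma carries this over to the integral.\<close>

lemma open_cap_avg_greater:
  fixes W :: "'a::euclidean_space set"
  assumes W: "open W" and g [measurable]: "g \<in> borel_measurable borel"
  shows "open {c. a < cap_avg W g c}"
proof -
  have [measurable]: "W \<in> sets borel" using W by simp
  have "closed {c. cap_avg W g c \<le> a}"
    unfolding closed_sequential_limits
  proof (intro allI impI)
    fix s c assume s: "(\<forall>n. s n \<in> {c. cap_avg W g c \<le> a}) \<and> s \<longlonglongrightarrow> c"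
    have "cap_avg W g c \<le> (\<integral>\<^sup>+z. liminf (\<lambda>n. indicator {z. z - s n \<in> W} z * ennreal (g z)) \<partial>lborel)"
      unfolding cap_avg_def
    proof (rule nn_integral_mono)
      fix z
      show "indicator {z. z - c \<in> W} z * ennreal (g z) \<le> liminf (\<lambda>n. indicator {z. z - s n \<in> W} z * ennreal (g z))"
      proof (cases "z - c \<in> W")
        case True
        have "(\<lambda>n. z - s n) \<longlonglongrightarrow> z - c" using s by (intro tendsto_intros) auto
        then have "\<forall>\<^sub>F n in sequentially. z - s n \<in> W" using W True by (rule topological_tendstoD)
        then have "\<forall>\<^sub>F n in sequentially. ennreal (g z) \<le> indicator {z. z - s n \<in> W} z * ennreal (g z)"
          by eventually_elim simp
        then show ?thesis using True by (intro Liminf_bounded) simp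
      qed simp
    qed
    also have "\<dots> \<le> liminf (\<lambda>n. cap_avg W g (s n))"
      unfolding cap_avg_def by (rule nn_integral_liminf) measurable
    also have "\<dots> \<le> liminf (\<lambda>n. a)" using s by (intro Liminf_mono) auto
    also have "\<dots> = a" by (simp add: Liminf_const)
    finally show "c \<in> {c. cap_avg W g c \<le> a}" by simp
  qed
  moreover have "{c. a < cap_avg W g c} = - {c. cap_avg W g c \<le> a}" by auto
  ultimately show ?thesis by (simp only: open_Compl)
qed

lemma open_cap_avg_shift:
  fixes W :: "'a::euclidean_space set"
  assumes "open W" "g \<in> borel_measurable borel"
  shows "open {x. a < cap_avg W g (x + u)}" "open {u. a < cap_avg W g (x + u)}"
proof -
  have "open ((\<lambda>x. x + u) -` {c. a < cap_avg W g c})" "open ((\<lambda>u. x + u) -` {c. a < cap_avg W g c})"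
    by (intro open_vimage open_cap_avg_greater assms continuous_intros)+
  then show "open {x. a < cap_avg W g (x + u)}" "open {u. a < cap_avg W g (x + u)}" by (simp_all add: vimage_def)
qed

text \<open>A superlevel set of a supremum is the union of the superlevel sets, all open here; this
  makes the uncountable supremum measurable.\<close>

lemma open_cap_max_greater:
  fixes W :: "'a::euclidean_space set"
  assumes "open W" "g \<in> borel_measurable borel"
  shows "open {x. a < cap_max W g x}"
proof -
  have "{x. a < cap_max W g x} = (\<Union>u\<in>sphere 0 1. {x. a < cap_avg W g (x + u)})"
    by (auto simp: cap_max_def less_SUP_iff)
  then show ?thesis using open_cap_avg_shift[OF assms] by auto
qed

lemma cap_max_measurable [measurable]:
  fixes W :: "'a::euclidean_space set"
  assumes "open W" "g \<in> borel_measurable borel"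
  shows "cap_max W g \<in> borel_measurable borel"
  by (rule borel_measurableI_greater) (use open_cap_max_greater[OF assms] in auto)

text \<open>The admissible directions at \<open>x\<close> form the trace on the sphere of an open
  set and so meet a countable dense subset. Taking the first one in an enumeration is measurable in
  \<open>x\<close>. It suffices that the selected average exceeds the level
  \<open>a\<close>.\<close>

lemma cap_max_selection:
  fixes W :: "'a::euclidean_space set"
  assumes W: "open W" and g: "g \<in> borel_measurable borel"
  obtains c where "c \<in> borel_measurable borel"
    "\<And>x. a < cap_max W g x \<Longrightarrow> norm (c x - x) = 1 \<and> a < cap_avg W g (c x)"
proof -
  obtain D :: "'a set" where D: "countable D" "D \<subseteq> sphere 0 1" "sphere 0 1 \<subseteq> closure D"
    using separable by blast
  have "sphere (0::'a) 1 \<noteq> {}" by simp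
  then have "D \<noteq> {}" using D by auto
  define d where "d = from_nat_into D"
  have dD: "d n \<in> D" for n unfolding d_def using \<open>D \<noteq> {}\<close> by (rule from_nat_into)
  define P where "P = (\<lambda>n x. a < cap_avg W g (x + d n))"
  have [measurable]: "Measurable.pred borel (P n)" for n
    unfolding P_def using open_cap_avg_shift(1)[OF W g] by (simp add: pred_def)
  define c where "c = (\<lambda>x. x + d (LEAST n. P n x))"
  have "c \<in> borel_measurable borel"
  proof -
    have "(\<lambda>x. LEAST n. P n x) \<in> measurable borel (count_space UNIV)" by measurable
    moreover have "d \<in> measurable (count_space UNIV) borel" by simp
    ultimately have [measurable]: "(\<lambda>x. d (LEAST n. P n x)) \<in> borel_measurable borel" by (rule measurable_compose)
    show ?thesis unfolding c_def by measurable
  qed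
  moreover have "norm (c x - x) = 1 \<and> a < cap_avg W g (c x)" if x: "a < cap_max W g x" for x
  proof -
    obtain u where u: "u \<in> sphere 0 1" "a < cap_avg W g (x + u)"
      using x by (auto simp: cap_max_def less_SUP_iff)
    have "u \<in> closure D" using u D by blast
    then have "{u. a < cap_avg W g (x + u)} \<inter> D \<noteq> {}"
      using open_Int_closure_eq_empty[OF open_cap_avg_shift(2)[OF W g]] u by blast
    then obtain v where "v \<in> D" "a < cap_avg W g (x + v)" by blast
    then have "\<exists>n. P n x" unfolding P_def d_def using D(1) by (metis from_nat_into_surj)
    then have "P (LEAST n. P n x) x" by (rule LeastI_ex)
    moreover have "norm (d n) = 1" for n using dD D(2) by (auto simp: subset_iff)
    ultimately show ?thesis by (simp add: P_def c_def)
  qed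
  ultimately show ?thesis using that by blast
qed

text \<open>Young's inequality without sharp constants for A = \<tau> g and B = \<phi>/\<tau>:
  compare B with A^(q - 1); the product is at most A^q in one case and B^k in the other. The weight
  \<tau> stays free for the absorption in \<open>cap_weak_type\<close>.\<close>

lemma young_ennreal:
  fixes g \<tau> q :: real and k :: nat
  assumes k: "2 \<le> k" and q: "q = k / (k - 1)" and g: "0 \<le> g" and \<tau>: "0 < \<tau>"
  shows "ennreal g * \<phi> \<le> ennreal (\<tau> powr q) * ennreal (g powr q) + ennreal (1 / \<tau> ^ k) * \<phi> ^ k"
proof (cases \<phi>)
  case top
  have "\<tau> ^ k > 0" using \<tau> by simp
  then have "ennreal (1 / \<tau> ^ k) * \<phi> ^ k = \<infinity>"
    using top k \<tau> by (simp add: top_power_ennreal ennreal_mult_eq_top_iff)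
  then show ?thesis by simp
next
  case (real r)
  define A where "A = \<tau> * g"
  define B where "B = r / \<tau>"
  have AB: "0 \<le> A" "0 \<le> B" using g \<tau> real by (auto simp: A_def B_def)
  have q1: "1 < q" "q - 1 = 1 / (k - 1)" using k by (auto simp: q field_simps of_nat_diff)
  have "A * B \<le> A powr q + B ^ k"
  proof (cases "B \<le> A powr (q - 1)")
    case True
    then have "A * B \<le> A * A powr (q - 1)" using AB by (intro mult_left_mono)
    also have "\<dots> = A powr q"
    proof (cases "A = 0")
      case False
      then have "A powr 1 * A powr (q - 1) = A powr q" by (simp only: powr_add[symmetric]) simp
      then show ?thesis using AB by simp
    qed simp
    finally show ?thesis using AB by (simp add: add_increasing2)
  next
    case False
    have "A = (A powr (q - 1)) ^ (k - 1)"
    proof (cases "A = 0")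
      case True
      then show ?thesis using k by simp
    next
      case False
      then have "(A powr (q - 1)) ^ (k - 1) = A powr ((q - 1) * real (k - 1))"
        using AB by (simp add: powr_powr powr_realpow[symmetric])
      also have "(q - 1) * real (k - 1) = 1" using k by (simp add: q1)
      finally show ?thesis using AB by simp
    qed
    also have "\<dots> \<le> B ^ (k - 1)" using False by (intro power_mono) auto
    finally have "A * B \<le> B ^ (k - 1) * B" using AB by (intro mult_right_mono)
    also have "\<dots> = B ^ k" using k by (simp flip: power_Suc2)
    finally show ?thesis using AB by (simp add: add_increasing)
  qed
  then have "g * r \<le> \<tau> powr q * g powr q + 1 / \<tau> ^ k * r ^ k"
    using \<tau> g by (simp add: A_def B_def powr_mult power_divide)
  then have "ennreal (g * r) \<le> ennreal (\<tau> powr q * g powr q + 1 / \<tau> ^ k * r ^ k)" by (rule ennreal_leI)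
  also have "\<dots> = ennreal (\<tau> powr q * g powr q) + ennreal (1 / \<tau> ^ k * r ^ k)"
    using real \<tau> by (intro ennreal_plus) auto
  also have "ennreal (\<tau> powr q * g powr q) = ennreal (\<tau> powr q) * ennreal (g powr q)" by (intro ennreal_mult) auto
  also have "ennreal (1 / \<tau> ^ k * r ^ k) = ennreal (1 / \<tau> ^ k) * ennreal r ^ k"
    using real \<tau> by (subst ennreal_mult) (auto simp: ennreal_power)
  also have "ennreal (g * r) = ennreal g * \<phi>" using g real by (simp add: ennreal_mult)
  finally show ?thesis using real by simp
qed

text \<open>Duality: testing the average against the level set turns the weak type bound at the exponent dual to \<open>k\<close>
  into a bound for the \<open>k\<close>-fold overlaps of the selected caps.\<close>
lemma cap_weak_type:
  fixes V :: "'a::euclidean_space set" and k :: nat and q D a :: real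
  assumes \<delta>: "0 < \<delta>" "\<delta> < 1/2" and V: "open V" and small: "\<And>v w. v \<in> V \<Longrightarrow> w \<in> V \<Longrightarrow> norm (v - w) \<le> 1/8"
    and k: "2 \<le> k" and q: "q = k / (k - 1)" and D: "0 < D" and a: "0 < a"
    and Phi: "\<And>c F. sphere_family \<delta> c F V \<Longrightarrow>
      (\<integral>\<^sup>+z. sphere_family.Phi \<delta> c F V z ^ k \<partial>lborel) \<le> ennreal D * emeasure lborel F"
    and g [measurable]: "g \<in> borel_measurable borel" and g0: "\<And>z. 0 \<le> g z"
  shows "emeasure lborel {x. ennreal a < cap_max (shell \<delta> 0 \<inter> V) g x}
     \<le> ennreal ((2 / a) powr q * D powr (q - 1)) * (\<integral>\<^sup>+z. ennreal (g z powr q) \<partial>lborel)"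
proof -
  let ?W = "shell \<delta> 0 \<inter> V"
  have W: "open ?W" using V open_shell by blast
  obtain c where c [measurable]: "c \<in> borel_measurable borel"
    and cx: "\<And>x. ennreal a < cap_max ?W g x \<Longrightarrow> norm (c x - x) = 1 \<and> ennreal a < cap_avg ?W g (c x)"
    using cap_max_selection[OF W g] by blast
  define E where "E = {x. ennreal a < cap_max ?W g x}"
  have E [measurable]: "E \<in> sets borel" unfolding E_def using open_cap_max_greater[OF W g] by simp
  define G where "G = (\<integral>\<^sup>+z. ennreal (g z powr q) \<partial>lborel)"
  have bounded: "emeasure lborel (E \<inter> ball 0 (real n)) \<le> ennreal ((2 / a) powr q * D powr (q - 1)) * G" for n
  proof -
    \<comment> \<open>Cutting to a ball makes the measure finite, so that a multiple of it can be
      moved to the left side; the ball exhausts the space at the end.\<close>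
    define F where "F = E \<inter> ball 0 (real n)"
    have F [measurable]: "F \<in> sets borel" unfolding F_def by measurable
    have [measurable]: "V \<in> sets borel" using V by simp
    interpret sphere_family \<delta> c F V
    proof
      show "F \<in> sets borel" by (rule F)
      show "norm (c x - x) = 1" if "x \<in> F" for x using that cx by (auto simp: F_def E_def)
    qed (use \<delta> small in auto)
    have "emeasure lborel F \<le> emeasure lborel (ball (0::'a) (real n))" by (intro emeasure_mono) (auto simp: F_def)
    also have "\<dots> < \<infinity>" by (rule emeasure_lborel_ball_finite)
    finally have fin: "emeasure lborel F < \<infinity>" .
    \<comment> \<open>With this weight the term containing the overlap is exactly half of the left
      side, a/2 times |F|, and is absorbed.\<close>
    define \<tau> where "\<tau> = (2 * D / a) powr (1 / k)"
    have \<tau>: "0 < \<tau>" using D a by (simp add: \<tau>_def)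
    have \<tau>k: "\<tau> ^ k = 2 * D / a" using k D a by (simp add: \<tau>_def powr_powr powr_realpow[symmetric])
    have "ennreal a * emeasure lborel F = (\<integral>\<^sup>+x. ennreal a * indicator F x \<partial>lborel)" by (simp add: nn_integral_cmult_indicator)
    also have "\<dots> \<le> (\<integral>\<^sup>+x. \<integral>\<^sup>+z. chi x z * ennreal (g z) \<partial>lborel \<partial>lborel)"
    proof (rule nn_integral_mono)
      fix x
      show "ennreal a * indicator F x \<le> (\<integral>\<^sup>+z. chi x z * ennreal (g z) \<partial>lborel)"
      proof (cases "x \<in> F")
        case True
        then have "ennreal a < cap_avg ?W g (c x)" using cx by (auto simp: F_def E_def)
        also have "cap_avg ?W g (c x) = (\<integral>\<^sup>+z. chi x z * ennreal (g z) \<partial>lborel)"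
          unfolding cap_avg_def using True
          by (intro nn_integral_cong) (auto simp: chi_def cap_def mem_shell split: split_indicator)
        finally show ?thesis using True by simp
      qed simp
    qed
    also have "\<dots> = (\<integral>\<^sup>+z. \<integral>\<^sup>+x. chi x z * ennreal (g z) \<partial>lborel \<partial>lborel)"
      by (rule lborel_pair.Fubini') measurable
    also have "\<dots> = (\<integral>\<^sup>+z. ennreal (g z) * Phi z \<partial>lborel)"
      unfolding Phi_def by (intro nn_integral_cong, subst nn_integral_multc) (auto simp: mult.commute)
    also have "\<dots> \<le> (\<integral>\<^sup>+z. ennreal (\<tau> powr q) * ennreal (g z powr q) + ennreal (1 / \<tau> ^ k) * Phi z ^ k \<partial>lborel)"
      by (intro nn_integral_mono young_ennreal k q g0 \<tau>)
    also have "\<dots> = ennreal (\<tau> powr q) * G + ennreal (1 / \<tau> ^ k) * (\<integral>\<^sup>+z. Phi z ^ k \<partial>lborel)"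
      unfolding G_def by (subst nn_integral_add, measurable, subst (1 2) nn_integral_cmult) measurable
    also have "\<dots> \<le> ennreal (\<tau> powr q) * G + ennreal (1 / \<tau> ^ k) * (ennreal D * emeasure lborel F)"
      using Phi[OF sphere_family_axioms] by (intro add_left_mono mult_left_mono) auto
    also have "ennreal (1 / \<tau> ^ k) * (ennreal D * emeasure lborel F) = ennreal (a / 2) * emeasure lborel F"
      unfolding \<tau>k using D a by (simp add: mult.assoc[symmetric] ennreal_mult'[symmetric])
    finally have main: "ennreal a * emeasure lborel F \<le> ennreal (\<tau> powr q) * G + ennreal (a / 2) * emeasure lborel F" .
    have "emeasure lborel F \<le> ennreal (2 / a) * (ennreal (\<tau> powr q) * G)"
    proof (cases "ennreal (\<tau> powr q) * G")
      case (real y)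
      obtain m where m: "emeasure lborel F = ennreal m" "0 \<le> m" using fin by (cases "emeasure lborel F") auto
      have "ennreal (a * m) \<le> ennreal (y + a / 2 * m)"
      proof -
        have "ennreal (a * m) = ennreal a * ennreal m" "ennreal (a / 2 * m) = ennreal (a / 2) * ennreal m"
          using a m by (intro ennreal_mult; simp)+
        moreover have "ennreal (y + a / 2 * m) = ennreal y + ennreal (a / 2 * m)"
          using a m real by (intro ennreal_plus) auto
        ultimately show ?thesis using main m(1) real(2) by (simp only:)
      qed
      then have "a * m \<le> y + a / 2 * m" using real m a by (subst (asm) ennreal_le_iff) auto
      then have "m \<le> 2 / a * y" using a by (simp add: field_simps)
      then have "ennreal m \<le> ennreal (2 / a * y)" by (rule ennreal_leI)
      also have "\<dots> = ennreal (2 / a) * ennreal y" using real a by (intro ennreal_mult) auto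
      finally show ?thesis by (simp only: m real(2))
    next
      case top
      then show ?thesis using a by (simp add: ennreal_mult_eq_top_iff)
    qed
    also have "\<dots> = ennreal (2 / a * \<tau> powr q) * G"
    proof -
      have "ennreal (2 / a * \<tau> powr q) = ennreal (2 / a) * ennreal (\<tau> powr q)" using a by (intro ennreal_mult) auto
      then show ?thesis by (simp only: mult.assoc)
    qed
    also have "2 / a * \<tau> powr q = (2 / a) powr q * D powr (q - 1)"
    proof -
      have "1 / real k * q = q - 1" using k by (simp add: q field_simps of_nat_diff)
      then have "\<tau> powr q = (2 / a * D) powr (q - 1)" by (simp add: \<tau>_def powr_powr)
      also have "\<dots> = (2 / a) powr (q - 1) * D powr (q - 1)" using a D by (intro powr_mult)
      finally show ?thesis using a by (simp add: powr_diff)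
    qed
    finally show ?thesis by (simp add: F_def)
  qed
  have "E = (\<Union>n. E \<inter> ball 0 (real n))" using reals_Archimedean2 by auto
  then have "emeasure lborel E = emeasure lborel (\<Union>n. E \<inter> ball 0 (real n))" by simp
  also have "\<dots> = (SUP n. emeasure lborel (E \<inter> ball 0 (real n)))"
    by (rule SUP_emeasure_incseq[symmetric]) (auto simp: incseq_def)
  also have "\<dots> \<le> ennreal ((2 / a) powr q * D powr (q - 1)) * G" using bounded by (intro SUP_least)
  finally show ?thesis by (simp add: E_def G_def)
qed

section \<open>Weak type bounds and interpolation\<close>

text \<open>Weak (p, p) bound for nonnegative functions with constant \<delta>^e up to \<epsilon>,
  in p-th power form; \<open>e\<close> will be p times the exponent of the operator norm. The level
  is \<mu> \<delta> because \<open>cap_max\<close> is unnormalised and the shell has measure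
  comparable to \<delta>.\<close>

definition weak_type :: "real \<Rightarrow> real \<Rightarrow> 'a::euclidean_space itself \<Rightarrow> bool" where
  "weak_type p e (t::'a itself) \<longleftrightarrow> (\<forall>\<epsilon>>0. \<exists>C>0. \<forall>\<delta>\<in>{0<..<1/2}. \<forall>g\<in>borel_measurable borel. (\<forall>z::'a. 0 \<le> g z) \<longrightarrow> (\<forall>\<mu>>0.
     emeasure lborel {x. ennreal (\<mu> * \<delta>) < cap_max (shell \<delta> 0) g x}
       \<le> ennreal (C * \<delta> powr (e - \<epsilon>) * \<mu> powr (- p)) * (\<integral>\<^sup>+z. ennreal (g z powr p) \<partial>lborel)))"

lemma weak_typeD:
  assumes "weak_type p e TYPE('a::euclidean_space)" "0 < \<epsilon>"
  obtains C where "0 < C" "\<And>\<delta> (g::'a \<Rightarrow> real) \<mu>. 0 < \<delta> \<Longrightarrow> \<delta> < 1/2 \<Longrightarrow> g \<in> borel_measurable borel \<Longrightarrow> (\<And>z. 0 \<le> g z) \<Longrightarrow> 0 < \<mu> \<Longrightarrow>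
     emeasure lborel {x. ennreal (\<mu> * \<delta>) < cap_max (shell \<delta> 0) g x}
       \<le> ennreal (C * \<delta> powr (e - \<epsilon>) * \<mu> powr (- p)) * (\<integral>\<^sup>+z. ennreal (g z powr p) \<partial>lborel)"
proof -
  obtain C where C: "0 < C" "\<forall>\<delta>\<in>{0<..<1/2}. \<forall>g\<in>borel_measurable borel. (\<forall>z::'a. 0 \<le> g z) \<longrightarrow> (\<forall>\<mu>>0.
     emeasure lborel {x. ennreal (\<mu> * \<delta>) < cap_max (shell \<delta> 0) g x}
       \<le> ennreal (C * \<delta> powr (e - \<epsilon>) * \<mu> powr (- p)) * (\<integral>\<^sup>+z. ennreal (g z powr p) \<partial>lborel))"
    using assms unfolding weak_type_def by blast
  show ?thesis
    by (rule that[OF C(1)]) (use C(2) in \<open>simp add: Ball_def\<close>)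
qed

section \<open>Sublinearity and the trivial bounds\<close>

lemma cap_avg_mono:
  assumes "\<And>z. g z \<le> h z" shows "cap_avg W g c \<le> cap_avg W h c"
  unfolding cap_avg_def by (intro nn_integral_mono mult_left_mono ennreal_leI assms) auto

lemma cap_avg_add:
  assumes [measurable]: "W \<in> sets borel" "g \<in> borel_measurable borel" "h \<in> borel_measurable borel"
    and "\<And>z. 0 \<le> g z" "\<And>z. 0 \<le> h z"
  shows "cap_avg W (\<lambda>z. g z + h z) c = cap_avg W g c + cap_avg W h c"
  unfolding cap_avg_def using assms by (subst nn_integral_add[symmetric]) (auto simp: distrib_left)

lemma cap_max_split:
  assumes meas: "W \<in> sets borel" "g \<in> borel_measurable borel" "h \<in> borel_measurable borel"
    and nn: "\<And>z. 0 \<le> g z" "\<And>z. 0 \<le> h z" and f: "\<And>z. f z \<le> g z + h z"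
    and a: "0 \<le> a" "0 \<le> b" "ennreal (a + b) < cap_max W f x"
  shows "ennreal a < cap_max W g x \<or> ennreal b < cap_max W h x"
proof (rule ccontr)
  assume "\<not> ?thesis"
  then have le: "cap_max W g x \<le> ennreal a" "cap_max W h x \<le> ennreal b" by auto
  have "cap_max W f x \<le> cap_max W g x + cap_max W h x"
    unfolding cap_max_def[of W f]
  proof (rule SUP_least)
    fix u :: 'a assume u: "u \<in> sphere 0 1"
    have "cap_avg W f (x + u) \<le> cap_avg W g (x + u) + cap_avg W h (x + u)"
      unfolding cap_avg_add[OF meas nn, symmetric] by (intro cap_avg_mono f)
    also have "\<dots> \<le> cap_max W g x + cap_max W h x"
      unfolding cap_max_def using u by (intro add_mono SUP_upper)
    finally show "cap_avg W f (x + u) \<le> cap_max W g x + cap_max W h x" .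
  qed
  also have "\<dots> \<le> ennreal (a + b)" using le a by (simp add: add_mono)
  finally show False using a by simp
qed

lemma cap_max_le_bound:
  fixes g :: "'a::euclidean_space \<Rightarrow> real"
  assumes CS: "0 < CS" "\<And>c. emeasure lborel (shell \<delta> c :: 'a set) \<le> ennreal (CS * \<delta>)" and \<delta>: "0 < \<delta>"
    and g: "\<And>z. g z \<le> M" and M: "0 \<le> M"
  shows "cap_max (shell \<delta> 0) g x \<le> ennreal (CS * \<delta> * M)"
  unfolding cap_max_def
proof (rule SUP_least)
  fix u :: 'a
  have "cap_avg (shell \<delta> 0) g (x + u) \<le> (\<integral>\<^sup>+z. ennreal M * indicator (shell \<delta> (x + u)) z \<partial>lborel)"
    unfolding cap_avg_def using g
    by (intro nn_integral_mono) (auto simp: mem_shell ennreal_leI split: split_indicator)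
  also have "\<dots> = ennreal M * emeasure lborel (shell \<delta> (x + u))" by (simp add: nn_integral_cmult_indicator)
  also have "\<dots> \<le> ennreal M * ennreal (CS * \<delta>)" by (intro mult_left_mono CS) auto
  also have "\<dots> = ennreal (CS * \<delta> * M)" using M CS(1) \<delta> by (simp add: ennreal_mult'[symmetric] mult.commute)
  finally show "cap_avg (shell \<delta> 0) g (x + u) \<le> ennreal (CS * \<delta> * M)" .
qed

text \<open>A shell centred at distance 1 from \<open>x\<close> stays within 1 + 3/2 < 3 of
  \<open>x\<close>, and all directions are dominated at once.\<close>

lemma cap_max_le_ball:
  fixes g :: "'a::euclidean_space \<Rightarrow> real"
  assumes \<delta>: "\<delta> < 1/2"
  shows "cap_max (shell \<delta> 0) g x \<le> (\<integral>\<^sup>+z. indicator (ball x 3) z * ennreal (g z) \<partial>lborel)"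
  unfolding cap_max_def cap_avg_def
proof (intro SUP_least nn_integral_mono mult_right_mono)
  fix u z :: 'a assume u: "u \<in> sphere 0 1"
  have "z \<in> ball x 3" if "z - (x + u) \<in> shell \<delta> 0"
  proof -
    have "norm (z - (x + u)) < 3/2" using that \<delta> by (auto simp: mem_shell)
    moreover have "norm (z - x) \<le> norm (z - (x + u)) + norm u"
      using norm_triangle_ineq[of "z - (x + u)" u] by simp
    ultimately show ?thesis using u by (simp add: dist_norm norm_minus_commute)
  qed
  then show "indicator {z. z - (x + u) \<in> shell \<delta> 0} z \<le> (indicator (ball x 3) z :: ennreal)"
    by (auto split: split_indicator)
qed auto

text \<open>Integrating the integral of g over balls of radius 3 gives an L^1 bound uniform in
  \<delta>. After normalising by the shell volume it becomes the factor 1/\<delta>, in accordance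
  with \<gamma> = -1 at p = 1.\<close>

lemma nn_integral_cap_max_le:
  "\<exists>C>0. \<forall>\<delta> (g::'a::euclidean_space \<Rightarrow> real). \<delta> < 1/2 \<longrightarrow> g \<in> borel_measurable borel \<longrightarrow>
     (\<integral>\<^sup>+x. cap_max (shell \<delta> 0) g x \<partial>lborel) \<le> ennreal C * (\<integral>\<^sup>+z. ennreal (g z) \<partial>lborel)"
proof -
  define C where "C = measure lborel (ball (0::'a) 3)"
  have C: "emeasure lborel (ball z 3) = ennreal C" for z :: 'a
  proof -
    have "emeasure lborel (ball z 3) = emeasure lborel (ball (0::'a) 3)" by (simp add: emeasure_ball)
    also have "\<dots> = ennreal C" unfolding C_def using emeasure_lborel_ball_finite[of "0::'a" 3] by (simp add: emeasure_eq_ennreal_measure)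
    finally show ?thesis .
  qed
  have "0 < C" unfolding C_def using content_ball_pos[of 3 "0::'a"] by simp
  moreover have "(\<integral>\<^sup>+x. cap_max (shell \<delta> 0) g x \<partial>lborel) \<le> ennreal C * (\<integral>\<^sup>+z. ennreal (g z) \<partial>lborel)"
    if \<delta>: "\<delta> < 1/2" and [measurable]: "g \<in> borel_measurable borel" for \<delta> and g :: "'a \<Rightarrow> real"
  proof -
    have "(\<integral>\<^sup>+x. cap_max (shell \<delta> 0) g x \<partial>lborel) \<le> (\<integral>\<^sup>+x. \<integral>\<^sup>+z. indicator (ball x 3) z * ennreal (g z) \<partial>lborel \<partial>lborel)"
      by (intro nn_integral_mono cap_max_le_ball \<delta>)
    also have "\<dots> = (\<integral>\<^sup>+x. \<integral>\<^sup>+z. indicator {w. dist (fst w) (snd w) < 3} (x, z) * ennreal (g z) \<partial>lborel \<partial>lborel)"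
      by (intro nn_integral_cong) (auto split: split_indicator)
    also have "\<dots> = (\<integral>\<^sup>+z. \<integral>\<^sup>+x. indicator {w. dist (fst w) (snd w) < 3} (x, z) * ennreal (g z) \<partial>lborel \<partial>lborel)"
      by (rule lborel_pair.Fubini') measurable
    also have "\<dots> = (\<integral>\<^sup>+z. \<integral>\<^sup>+x. ennreal (g z) * indicator (ball z 3) x \<partial>lborel \<partial>lborel)"
      by (intro nn_integral_cong) (auto simp: dist_commute split: split_indicator)
    also have "\<dots> = (\<integral>\<^sup>+z. ennreal (g z) * ennreal C \<partial>lborel)"
      by (intro nn_integral_cong) (simp add: nn_integral_cmult_indicator C)
    also have "\<dots> = ennreal C * (\<integral>\<^sup>+z. ennreal (g z) \<partial>lborel)"
      by (subst nn_integral_multc) (auto simp: mult.commute)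
    finally show ?thesis .
  qed
  ultimately show ?thesis by blast
qed

lemma card_scales_le:
  assumes "0 < \<eta>"
  shows "\<exists>C>0. \<forall>\<delta>. 0 < \<delta> \<longrightarrow> \<delta> < 1/2 \<longrightarrow> real (card (scales \<delta>)) \<le> C * \<delta> powr (- \<eta>)"
proof -
  define C where "C = 1 + 1 / (\<eta> * ln 2)"
  have "C > 0" using assms by (simp add: C_def add_pos_nonneg)
  moreover have "real (card (scales \<delta>)) \<le> C * \<delta> powr (- \<eta>)" if \<delta>: "0 < \<delta>" "\<delta> < 1/2" for \<delta>
  proof -
    define X where "X = \<delta> powr (- \<eta>) / (\<eta> * ln 2)"
    have X0: "0 \<le> X" using assms by (simp add: X_def)
    have "scales \<delta> \<subseteq> {..nat \<lfloor>X\<rfloor>}"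
    proof
      fix i assume "i \<in> scales \<delta>"
      then have "2 ^ i * \<delta> \<le> 1" using \<delta> by (auto simp: scales_def)
      then have "ln (2 ^ i * \<delta>) \<le> 0" using \<delta> by simp
      then have "real i * ln 2 \<le> ln (1 / \<delta>)" using \<delta> by (simp add: ln_mult ln_realpow ln_div)
      also have "\<dots> \<le> (1 / \<delta>) powr \<eta> / \<eta>" using \<delta> assms by (intro ln_powr_bound) auto
      also have "(1 / \<delta>) powr \<eta> = \<delta> powr (- \<eta>)" using \<delta> by (simp add: powr_divide powr_minus_divide)
      finally have "real i \<le> X" using assms by (simp add: X_def field_simps)
      then have "int i \<le> \<lfloor>X\<rfloor>" by (simp add: le_floor_iff)
      then show "i \<in> {..nat \<lfloor>X\<rfloor>}" by simp
    qed
    then have "card (scales \<delta>) \<le> card {..nat \<lfloor>X\<rfloor>}" by (intro card_mono) auto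
    then have "real (card (scales \<delta>)) \<le> 1 + real (nat \<lfloor>X\<rfloor>)" by simp
    also have "\<dots> \<le> 1 + X" using X0 by simp
    also have "1 \<le> \<delta> powr (- \<eta>)"
    proof -
      have "1 powr \<eta> \<le> (1 / \<delta>) powr \<eta>" using \<delta> assms by (intro powr_mono2) auto
      then show ?thesis using \<delta> by (simp add: powr_divide powr_minus_divide)
    qed
    then have "1 + X \<le> \<delta> powr (- \<eta>) + X" by simp
    also have "\<dots> = C * \<delta> powr (- \<eta>)" by (simp add: C_def X_def algebra_simps)
    finally show ?thesis by simp
  qed
  ultimately show ?thesis by blast
qed

text \<open>The radius 1/16 gives pieces of diameter at most 1/8, the size demanded of the direction
  set in \<open>sphere_family\<close>.\<close>

lemma shell_cover:
  obtains X :: "'a::euclidean_space set" where "finite X" "X \<noteq> {}" "\<And>\<delta>. \<delta> < 1/2 \<Longrightarrow> shell \<delta> 0 \<subseteq> (\<Union>v\<in>X. ball v (1/16))"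
proof -
  obtain X :: "'a set" where X: "finite X" "cball 0 2 \<subseteq> (\<Union>v\<in>X. ball v (1/16))"
    using compact_cball[of "0::'a" 2] unfolding compact_eq_totally_bounded by (metis zero_less_divide_1_iff zero_less_numeral)
  have "(0::'a) \<in> cball 0 2" by simp
  then have "X \<noteq> {}" using X by blast
  moreover have "shell \<delta> 0 \<subseteq> (\<Union>v\<in>X. ball v (1/16))" if "\<delta> < 1/2" for \<delta>
  proof -
    have "shell \<delta> 0 \<subseteq> cball (0::'a) 2" using that by (auto simp: mem_shell)
    then show ?thesis using X by blast
  qed
  ultimately show ?thesis using that X by blast
qed

text \<open>With overlap constant D of order \<delta>^\<kappa>, duality gives D^(q - 1) at level
  \<mu> \<delta>, whence \<kappa> (q - 1) - q. The decomposition of the shell into finitely many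
  caps costs only constants.\<close>

lemma weak_type_endpoint:
  fixes k :: nat and \<kappa> q :: real
  assumes cases: "(2 \<le> DIM('a::euclidean_space) \<and> k = 2 \<and> \<kappa> = 2) \<or> (DIM('a) = 3 \<and> k = 3 \<and> \<kappa> = 5/2) \<or> (4 \<le> DIM('a) \<and> k = 4 \<and> \<kappa> = 3)"
    and q: "q = k / (k - 1)"
  shows "weak_type q (\<kappa> * (q - 1) - q) TYPE('a)"
  unfolding weak_type_def
proof (intro allI impI)
  fix \<epsilon> :: real assume \<epsilon>: "0 < \<epsilon>"
  have k: "2 \<le> k" using cases by auto
  have q1: "0 < q - 1" using k by (simp add: q field_simps of_nat_diff)
  \<comment> \<open>Five powers of the number of scales, each scale count being
    O(\<delta>^(-\<eta>)), are raised to the power q - 1; the total loss is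
    \<delta>^(-\<epsilon>).\<close>
  define \<eta> where "\<eta> = \<epsilon> / (5 * (q - 1))"
  have \<eta>: "0 < \<eta>" using \<epsilon> q1 by (simp add: \<eta>_def)
  obtain CK where CK: "0 < CK" "\<And>\<delta> c (F::'a set) V. sphere_family \<delta> c F V \<Longrightarrow>
     (\<integral>\<^sup>+z. sphere_family.Phi \<delta> c F V z ^ k \<partial>lborel) \<le> ennreal (CK * real (card (scales \<delta>)) ^ 5 * \<delta> powr \<kappa>) * emeasure lborel F"
    using nn_integral_Phi_power_le[OF cases] by blast
  obtain Cs where Cs: "0 < Cs" "\<And>\<delta>. 0 < \<delta> \<Longrightarrow> \<delta> < 1/2 \<Longrightarrow> real (card (scales \<delta>)) \<le> Cs * \<delta> powr (- \<eta>)"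
    using card_scales_le[OF \<eta>] by blast
  obtain X :: "'a set" where X: "finite X" "X \<noteq> {}" "\<And>\<delta>. \<delta> < 1/2 \<Longrightarrow> shell \<delta> 0 \<subseteq> (\<Union>v\<in>X. ball v (1/16))"
    using shell_cover by blast
  define N where "N = real (card X)"
  have N: "0 < N" using X by (simp add: N_def card_gt_0_iff)
  define C where "C = N * ((2 * N) powr q * (CK * Cs ^ 5) powr (q - 1))"
  have "C > 0" using N CK Cs by (simp add: C_def)
  moreover have "emeasure lborel {x. ennreal (\<mu> * \<delta>) < cap_max (shell \<delta> 0) g x}
       \<le> ennreal (C * \<delta> powr (\<kappa> * (q - 1) - q - \<epsilon>) * \<mu> powr (- q)) * (\<integral>\<^sup>+z. ennreal (g z powr q) \<partial>lborel)"
    if \<delta>: "0 < \<delta>" "\<delta> < 1/2" and g [measurable]: "g \<in> borel_measurable borel" and g0: "\<And>z. 0 \<le> g z" and \<mu>: "0 < \<mu>"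
    for \<delta> \<mu> and g :: "'a \<Rightarrow> real"
  proof -
    have [measurable]: "ball v (1/16) \<in> sets borel" for v :: 'a by simp
    define D where "D = CK * (Cs * \<delta> powr (- \<eta>)) ^ 5 * \<delta> powr \<kappa>"
    have D: "0 < D" using CK Cs \<delta> by (simp add: D_def)
    \<comment> \<open>If the average over the whole shell exceeds the level, the average over one of
      the N pieces exceeds an N-th of it.\<close>
    define a where "a = \<mu> * \<delta> / N"
    have a: "0 < a" using \<mu> \<delta> N by (simp add: a_def)
    let ?E = "\<lambda>v. {x. ennreal a < cap_max (shell \<delta> 0 \<inter> ball v (1/16)) g x}"
    have Eo: "open (?E v)" for v by (intro open_cap_max_greater g open_Int open_shell open_ball)
    have sub: "{x. ennreal (\<mu> * \<delta>) < cap_max (shell \<delta> 0) g x} \<subseteq> (\<Union>v\<in>X. ?E v)"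
    proof (rule subsetI, rule ccontr)
      fix x assume x: "x \<in> {x. ennreal (\<mu> * \<delta>) < cap_max (shell \<delta> 0) g x}" and nx: "x \<notin> (\<Union>v\<in>X. ?E v)"
      have "cap_max (shell \<delta> 0) g x \<le> ennreal (\<mu> * \<delta>)"
        unfolding cap_max_def
      proof (rule SUP_least)
        fix u :: 'a assume u: "u \<in> sphere 0 1"
        have "cap_avg (shell \<delta> 0) g (x + u) \<le> (\<integral>\<^sup>+z. (\<Sum>v\<in>X. indicator {z. z - (x + u) \<in> shell \<delta> 0 \<inter> ball v (1/16)} z * ennreal (g z)) \<partial>lborel)"
          unfolding cap_avg_def
        proof (rule nn_integral_mono)
          fix z
          show "indicator {z. z - (x + u) \<in> shell \<delta> 0} z * ennreal (g z) \<le> (\<Sum>v\<in>X. indicator {z. z - (x + u) \<in> shell \<delta> 0 \<inter> ball v (1/16)} z * ennreal (g z))"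
          proof (cases "z - (x + u) \<in> shell \<delta> 0")
            case True
            then obtain v where v: "v \<in> X" "z - (x + u) \<in> ball v (1/16)" using X(3)[OF \<delta>(2)] by blast
            have "indicator {z. z - (x + u) \<in> shell \<delta> 0} z * ennreal (g z) = indicator {z. z - (x + u) \<in> shell \<delta> 0 \<inter> ball v (1/16)} z * ennreal (g z)"
              using True v by simp
            also have "\<dots> \<le> (\<Sum>v\<in>X. indicator {z. z - (x + u) \<in> shell \<delta> 0 \<inter> ball v (1/16)} z * ennreal (g z))"
              using v X by (intro member_le_sum) auto
            finally show ?thesis .
          qed simp
        qed
        also have "\<dots> = (\<Sum>v\<in>X. cap_avg (shell \<delta> 0 \<inter> ball v (1/16)) g (x + u))"
          unfolding cap_avg_def by (rule nn_integral_sum) (use g in measurable)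
        also have "\<dots> \<le> of_nat (card X) * ennreal a"
        proof (rule sum_bounded_above)
          fix v assume "v \<in> X"
          then have "cap_max (shell \<delta> 0 \<inter> ball v (1/16)) g x \<le> ennreal a" using nx by auto
          then show "cap_avg (shell \<delta> 0 \<inter> ball v (1/16)) g (x + u) \<le> ennreal a"
            unfolding cap_max_def using u by (meson SUP_upper order_trans)
        qed
        also have "\<dots> = ennreal (\<mu> * \<delta>)"
          using N a by (simp add: ennreal_of_nat_eq_real_of_nat N_def[symmetric] ennreal_mult'[symmetric]) (simp add: a_def)
        finally show "cap_avg (shell \<delta> 0) g (x + u) \<le> ennreal (\<mu> * \<delta>)" .
      qed
      then show False using x by auto
    qed
    have each: "emeasure lborel (?E v) \<le> ennreal ((2 / a) powr q * D powr (q - 1)) * (\<integral>\<^sup>+z. ennreal (g z powr q) \<partial>lborel)" for v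
    proof (rule cap_weak_type[OF \<delta> _ _ k q D a _ g g0])
      show "open (ball v (1/16))" by simp
      show "norm (y - w) \<le> 1/8" if "y \<in> ball v (1/16)" "w \<in> ball v (1/16)" for y w
        using that norm_triangle_ineq[of "y - v" "v - w"] by (simp add: dist_norm norm_minus_commute)
      fix c and F :: "'a set" assume sf: "sphere_family \<delta> c F (ball v (1/16))"
      have "CK * real (card (scales \<delta>)) ^ 5 * \<delta> powr \<kappa> \<le> D"
        unfolding D_def using CK(1) Cs(2)[OF \<delta>] by (intro mult_right_mono mult_left_mono power_mono) auto
      then have "ennreal (CK * real (card (scales \<delta>)) ^ 5 * \<delta> powr \<kappa>) * emeasure lborel F \<le> ennreal D * emeasure lborel F"
        by (intro mult_right_mono ennreal_leI) auto
      then show "(\<integral>\<^sup>+z. sphere_family.Phi \<delta> c F (ball v (1/16)) z ^ k \<partial>lborel) \<le> ennreal D * emeasure lborel F"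
        using CK(2)[OF sf] by (rule order_trans[rotated])
    qed
    have "emeasure lborel {x. ennreal (\<mu> * \<delta>) < cap_max (shell \<delta> 0) g x} \<le> emeasure lborel (\<Union>v\<in>X. ?E v)"
      using Eo by (intro emeasure_mono[OF sub]) (auto intro!: borel_open)
    also have "\<dots> \<le> (\<Sum>v\<in>X. emeasure lborel (?E v))"
      using X Eo by (intro emeasure_subadditive_finite) auto
    also have "\<dots> \<le> of_nat (card X) * (ennreal ((2 / a) powr q * D powr (q - 1)) * (\<integral>\<^sup>+z. ennreal (g z powr q) \<partial>lborel))"
      by (intro sum_bounded_above each)
    also have "\<dots> = ennreal (N * ((2 / a) powr q * D powr (q - 1))) * (\<integral>\<^sup>+z. ennreal (g z powr q) \<partial>lborel)"
      using N by (simp only: ennreal_of_nat_eq_real_of_nat N_def[symmetric] mult.assoc[symmetric] ennreal_mult'[symmetric])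
    also have "N * ((2 / a) powr q * D powr (q - 1)) = C * \<delta> powr (\<kappa> * (q - 1) - q - \<epsilon>) * \<mu> powr (- q)"
    proof -
      have "2 / a = (2 * N) * (1 / \<delta> * (1 / \<mu>))" by (simp add: a_def)
      then have 1: "(2 / a) powr q = (2 * N) powr q * (\<delta> powr (- q) * \<mu> powr (- q))"
        using N \<delta> \<mu> by (simp add: powr_mult powr_divide powr_minus_divide)
      have "(\<delta> powr (- \<eta>)) ^ 5 = \<delta> powr (- \<eta> * 5)" using \<delta> by (simp add: powr_powr powr_realpow[symmetric])
      then have "D = (CK * Cs ^ 5) * (\<delta> powr \<kappa> * \<delta> powr (- \<eta> * 5))" by (simp only: D_def power_mult_distrib mult_ac)
      then have "D = (CK * Cs ^ 5) * \<delta> powr (\<kappa> - 5 * \<eta>)" by (simp add: powr_add[symmetric] mult.commute[of \<eta>])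
      then have 2: "D powr (q - 1) = (CK * Cs ^ 5) powr (q - 1) * \<delta> powr ((\<kappa> - 5 * \<eta>) * (q - 1))"
        using CK Cs \<delta> by (simp add: powr_mult powr_powr)
      have "\<delta> powr ((\<kappa> - 5 * \<eta>) * (q - 1)) * \<delta> powr (- q) = \<delta> powr (\<kappa> * (q - 1) - q - \<epsilon>)"
      proof -
        have "5 * \<eta> * (q - 1) = \<epsilon>" using q1 by (simp add: \<eta>_def field_simps)
        then have "(\<kappa> - 5 * \<eta>) * (q - 1) + - q = \<kappa> * (q - 1) - q - \<epsilon>" by (simp add: left_diff_distrib)
        then show ?thesis by (simp only: powr_add[symmetric])
      qed
      then show ?thesis unfolding C_def 1 2 by (simp add: mult_ac)
    qed
    finally show ?thesis .
  qed
  ultimately show "\<exists>C>0. \<forall>\<delta>\<in>{0<..<1/2}. \<forall>g\<in>borel_measurable borel. (\<forall>z::'a. 0 \<le> g z) \<longrightarrow> (\<forall>\<mu>>0.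
     emeasure lborel {x. ennreal (\<mu> * \<delta>) < cap_max (shell \<delta> 0) g x}
       \<le> ennreal (C * \<delta> powr (\<kappa> * (q - 1) - q - \<epsilon>) * \<mu> powr (- q)) * (\<integral>\<^sup>+z. ennreal (g z powr q) \<partial>lborel))"
    by (intro exI[of _ C] conjI ballI allI impI) simp_all
qed

lemma weak_typeI:
  assumes "\<And>\<epsilon>. 0 < \<epsilon> \<Longrightarrow> \<exists>C>0. \<forall>\<delta> (g::'a::euclidean_space \<Rightarrow> real) \<mu>. 0 < \<delta> \<longrightarrow> \<delta> < 1/2 \<longrightarrow> g \<in> borel_measurable borel \<longrightarrow> (\<forall>z. 0 \<le> g z) \<longrightarrow> 0 < \<mu> \<longrightarrow>
     emeasure lborel {x. ennreal (\<mu> * \<delta>) < cap_max (shell \<delta> 0) g x}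
       \<le> ennreal (C * \<delta> powr (e - \<epsilon>) * \<mu> powr (- p)) * (\<integral>\<^sup>+z. ennreal (g z powr p) \<partial>lborel)"
  shows "weak_type p e TYPE('a)"
  unfolding weak_type_def
proof (intro allI impI)
  fix \<epsilon> :: real assume "0 < \<epsilon>"
  then obtain C where C: "0 < C" "\<forall>\<delta> (g::'a::euclidean_space \<Rightarrow> real) \<mu>. 0 < \<delta> \<longrightarrow> \<delta> < 1/2 \<longrightarrow> g \<in> borel_measurable borel \<longrightarrow> (\<forall>z. 0 \<le> g z) \<longrightarrow> 0 < \<mu> \<longrightarrow>
     emeasure lborel {x. ennreal (\<mu> * \<delta>) < cap_max (shell \<delta> 0) g x}
       \<le> ennreal (C * \<delta> powr (e - \<epsilon>) * \<mu> powr (- p)) * (\<integral>\<^sup>+z. ennreal (g z powr p) \<partial>lborel)"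
    using assms[of \<epsilon>] by blast
  show "\<exists>C>0. \<forall>\<delta>\<in>{0<..<1/2}. \<forall>g\<in>borel_measurable borel. (\<forall>z::'a. 0 \<le> g z) \<longrightarrow> (\<forall>\<mu>>0.
     emeasure lborel {x. ennreal (\<mu> * \<delta>) < cap_max (shell \<delta> 0) g x}
       \<le> ennreal (C * \<delta> powr (e - \<epsilon>) * \<mu> powr (- p)) * (\<integral>\<^sup>+z. ennreal (g z powr p) \<partial>lborel))"
  proof (intro exI[of _ C] conjI C(1) ballI allI impI)
    fix \<delta> :: real and g :: "'a \<Rightarrow> real" and \<mu> :: real
    assume "\<delta> \<in> {0<..<1/2}" "g \<in> borel_measurable borel" "\<forall>z. 0 \<le> g z" "0 < \<mu>"
    then show "emeasure lborel {x. ennreal (\<mu> * \<delta>) < cap_max (shell \<delta> 0) g x}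
       \<le> ennreal (C * \<delta> powr (e - \<epsilon>) * \<mu> powr (- p)) * (\<integral>\<^sup>+z. ennreal (g z powr p) \<partial>lborel)"
      using C(2)[rule_format, of \<delta> g \<mu>] by auto
  qed
qed

lemma open_cap_max_shell:
  "g \<in> borel_measurable borel \<Longrightarrow> open {x::'a::euclidean_space. a < cap_max (shell \<delta> 0) g x}"
  by (rule open_cap_max_greater[OF open_shell])

lemma emeasure_cap_max_split:
  fixes g h f :: "'a::euclidean_space \<Rightarrow> real"
  assumes meas: "g \<in> borel_measurable borel" "h \<in> borel_measurable borel"
    and nn: "\<And>z. 0 \<le> g z" "\<And>z. 0 \<le> h z" and f: "\<And>z. f z \<le> g z + h z" and a: "0 \<le> a" "0 \<le> b"
  shows "emeasure lborel {x. ennreal (a + b) < cap_max (shell \<delta> 0) f x}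
     \<le> emeasure lborel {x. ennreal a < cap_max (shell \<delta> 0) g x} + emeasure lborel {x. ennreal b < cap_max (shell \<delta> 0) h x}"
proof -
  have m: "{x. ennreal a < cap_max (shell \<delta> 0) g x} \<in> sets lborel" "{x. ennreal b < cap_max (shell \<delta> 0) h x} \<in> sets lborel"
    using open_cap_max_shell[OF meas(1)] open_cap_max_shell[OF meas(2)] by (auto intro!: borel_open)
  have "{x. ennreal (a + b) < cap_max (shell \<delta> 0) f x}
     \<subseteq> {x. ennreal a < cap_max (shell \<delta> 0) g x} \<union> {x. ennreal b < cap_max (shell \<delta> 0) h x}"
    using cap_max_split[OF shell_borel meas nn f a] by blast
  then have "emeasure lborel {x. ennreal (a + b) < cap_max (shell \<delta> 0) f x}
     \<le> emeasure lborel ({x. ennreal a < cap_max (shell \<delta> 0) g x} \<union> {x. ennreal b < cap_max (shell \<delta> 0) h x})"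
    using m by (intro emeasure_mono) auto
  also have "\<dots> \<le> emeasure lborel {x. ennreal a < cap_max (shell \<delta> 0) g x} + emeasure lborel {x. ennreal b < cap_max (shell \<delta> 0) h x}"
    using m by (rule emeasure_subadditive)
  finally show ?thesis .
qed

lemma nn_integral_powr_le:
  assumes [measurable]: "g \<in> borel_measurable borel" and "0 \<le> s" "\<And>z. h z powr q \<le> s * g z powr p"
  shows "(\<integral>\<^sup>+z. ennreal (h z powr q) \<partial>lborel) \<le> ennreal s * (\<integral>\<^sup>+z. ennreal (g z powr p) \<partial>lborel)"
proof -
  have "(\<integral>\<^sup>+z. ennreal (h z powr q) \<partial>lborel) \<le> (\<integral>\<^sup>+z. ennreal s * ennreal (g z powr p) \<partial>lborel)"
    using assms(2,3) by (intro nn_integral_mono) (simp add: ennreal_leI flip: ennreal_mult)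
  also have "\<dots> = ennreal s * (\<integral>\<^sup>+z. ennreal (g z powr p) \<partial>lborel)" by (rule nn_integral_cmult) measurable
  finally show ?thesis .
qed

lemma ennreal_mult_le_chain:
  assumes "x \<le> ennreal A * Y" "Y \<le> ennreal s * G" "0 \<le> A" "0 \<le> s" "A * s \<le> B"
  shows "x \<le> ennreal B * G"
proof -
  have "x \<le> ennreal A * (ennreal s * G)"
    by (rule order_trans[OF assms(1) mult_left_mono[OF assms(2)]]) simp
  also have "\<dots> = ennreal (A * s) * G" using assms by (simp add: ennreal_mult mult.assoc)
  also have "\<dots> \<le> ennreal B * G" using assms by (intro mult_right_mono ennreal_leI) auto
  finally show ?thesis .
qed

text \<open>Markov's inequality for the uniform L^1 bound; the exponent -1 comes from writing the
  level as \<mu> \<delta>.\<close>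

lemma weak_type_one: "weak_type 1 (- 1) TYPE('a::euclidean_space)"
proof (rule weak_typeI)
  fix \<epsilon> :: real assume \<epsilon>: "0 < \<epsilon>"
  obtain C where C: "0 < C" "\<And>\<delta> (g::'a \<Rightarrow> real). \<delta> < 1/2 \<Longrightarrow> g \<in> borel_measurable borel \<Longrightarrow>
     (\<integral>\<^sup>+x. cap_max (shell \<delta> 0) g x \<partial>lborel) \<le> ennreal C * (\<integral>\<^sup>+z. ennreal (g z) \<partial>lborel)"
    using nn_integral_cap_max_le by blast
  have "emeasure lborel {x. ennreal (\<mu> * \<delta>) < cap_max (shell \<delta> 0) g x}
       \<le> ennreal (C * \<delta> powr (- 1 - \<epsilon>) * \<mu> powr (- 1)) * (\<integral>\<^sup>+z. ennreal (g z powr 1) \<partial>lborel)"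
    if h: "0 < \<delta>" "\<delta> < 1/2" "g \<in> borel_measurable borel" "\<forall>z. 0 \<le> g z" "0 < \<mu>" for \<delta> \<mu> and g :: "'a \<Rightarrow> real"
  proof -
    have [measurable]: "cap_max (shell \<delta> 0) g \<in> borel_measurable borel"
      by (rule cap_max_measurable[OF open_shell h(3)])
    have "emeasure lborel {x. ennreal (\<mu> * \<delta>) < cap_max (shell \<delta> 0) g x}
      \<le> emeasure lborel ({x \<in> UNIV. 1 \<le> ennreal (1 / (\<mu> * \<delta>)) * cap_max (shell \<delta> 0) g x})"
    proof (rule emeasure_mono)
      show "{x. ennreal (\<mu> * \<delta>) < cap_max (shell \<delta> 0) g x} \<subseteq> {x \<in> UNIV. 1 \<le> ennreal (1 / (\<mu> * \<delta>)) * cap_max (shell \<delta> 0) g x}"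
      proof (rule subsetI)
        fix x assume "x \<in> {x. ennreal (\<mu> * \<delta>) < cap_max (shell \<delta> 0) g x}"
        then have "ennreal (1 / (\<mu> * \<delta>)) * ennreal (\<mu> * \<delta>) \<le> ennreal (1 / (\<mu> * \<delta>)) * cap_max (shell \<delta> 0) g x"
          by (intro mult_left_mono) auto
        then show "x \<in> {x \<in> UNIV. 1 \<le> ennreal (1 / (\<mu> * \<delta>)) * cap_max (shell \<delta> 0) g x}"
          using h by (simp add: ennreal_mult''[symmetric])
      qed
    qed measurable
    also have "\<dots> \<le> ennreal (1 / (\<mu> * \<delta>)) * (\<integral>\<^sup>+x. cap_max (shell \<delta> 0) g x * indicator UNIV x \<partial>lborel)"
      by (rule nn_integral_Markov_inequality) auto
    finally have "emeasure lborel {x. ennreal (\<mu> * \<delta>) < cap_max (shell \<delta> 0) g x} \<le> ennreal (1 / (\<mu> * \<delta>)) * (\<integral>\<^sup>+x. cap_max (shell \<delta> 0) g x \<partial>lborel)"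
      by simp
    moreover have "(\<integral>\<^sup>+x. cap_max (shell \<delta> 0) g x \<partial>lborel) \<le> ennreal C * (\<integral>\<^sup>+z. ennreal (g z powr 1) \<partial>lborel)"
      using C(2)[OF h(2,3)] h by simp
    moreover have "0 \<le> 1 / (\<mu> * \<delta>)" "0 \<le> C" using h C by auto
    moreover have "1 / (\<mu> * \<delta>) * C \<le> C * \<delta> powr (- 1 - \<epsilon>) * \<mu> powr (- 1)"
    proof -
      have "\<delta> powr (- 1) \<le> \<delta> powr (- 1 - \<epsilon>)" using h \<epsilon> by (intro powr_mono') auto
      then have "C * \<delta> powr (- 1) * \<mu> powr (- 1) \<le> C * \<delta> powr (- 1 - \<epsilon>) * \<mu> powr (- 1)"
        using C by (intro mult_right_mono mult_left_mono) auto
      then show ?thesis using h by (simp add: powr_minus_divide mult.commute)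
    qed
    ultimately show ?thesis
      by (rule ennreal_mult_le_chain)
  qed
  then show "\<exists>C>0. \<forall>\<delta> (g::'a \<Rightarrow> real) \<mu>. 0 < \<delta> \<longrightarrow> \<delta> < 1/2 \<longrightarrow> g \<in> borel_measurable borel \<longrightarrow> (\<forall>z. 0 \<le> g z) \<longrightarrow> 0 < \<mu> \<longrightarrow>
     emeasure lborel {x. ennreal (\<mu> * \<delta>) < cap_max (shell \<delta> 0) g x}
       \<le> ennreal (C * \<delta> powr (- 1 - \<epsilon>) * \<mu> powr (- 1)) * (\<integral>\<^sup>+z. ennreal (g z powr 1) \<partial>lborel)"
    using C(1) by blast
qed

text \<open>Marcinkiewicz truncation at height \<open>\<mu> \<delta>\<^sup>-\<^sup>a\<close>.\<close>
lemma weak_type_interpolate: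
  assumes w0: "weak_type p0 (a * p0 - b) TYPE('a::euclidean_space)" and w1: "weak_type p1 (a * p1 - b) TYPE('a)"
    and p: "p0 \<le> p" "p \<le> p1" "0 < p0"
  shows "weak_type p (a * p - b) TYPE('a)"
proof (rule weak_typeI)
  fix \<epsilon> :: real assume \<epsilon>: "0 < \<epsilon>"
  obtain C0 where C0: "0 < C0" "\<And>\<delta> (g::'a \<Rightarrow> real) \<mu>. 0 < \<delta> \<Longrightarrow> \<delta> < 1/2 \<Longrightarrow> g \<in> borel_measurable borel \<Longrightarrow> (\<And>z. 0 \<le> g z) \<Longrightarrow> 0 < \<mu> \<Longrightarrow>
     emeasure lborel {x. ennreal (\<mu> * \<delta>) < cap_max (shell \<delta> 0) g x}
       \<le> ennreal (C0 * \<delta> powr (a * p0 - b - \<epsilon>) * \<mu> powr (- p0)) * (\<integral>\<^sup>+z. ennreal (g z powr p0) \<partial>lborel)"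
    using weak_typeD[OF w0 \<epsilon>] by blast
  obtain C1 where C1: "0 < C1" "\<And>\<delta> (g::'a \<Rightarrow> real) \<mu>. 0 < \<delta> \<Longrightarrow> \<delta> < 1/2 \<Longrightarrow> g \<in> borel_measurable borel \<Longrightarrow> (\<And>z. 0 \<le> g z) \<Longrightarrow> 0 < \<mu> \<Longrightarrow>
     emeasure lborel {x. ennreal (\<mu> * \<delta>) < cap_max (shell \<delta> 0) g x}
       \<le> ennreal (C1 * \<delta> powr (a * p1 - b - \<epsilon>) * \<mu> powr (- p1)) * (\<integral>\<^sup>+z. ennreal (g z powr p1) \<partial>lborel)"
    using weak_typeD[OF w1 \<epsilon>] by blast
  define C where "C = C0 * 2 powr p0 + C1 * 2 powr p1"
  have "0 < C" using C0 C1 by (simp add: C_def add_pos_pos)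
  moreover have "emeasure lborel {x. ennreal (\<mu> * \<delta>) < cap_max (shell \<delta> 0) g x}
       \<le> ennreal (C * \<delta> powr (a * p - b - \<epsilon>) * \<mu> powr (- p)) * (\<integral>\<^sup>+z. ennreal (g z powr p) \<partial>lborel)"
    if h: "0 < \<delta>" "\<delta> < 1/2" "g \<in> borel_measurable borel" "\<forall>z. 0 \<le> g z" "0 < \<mu>" for \<delta> \<mu> and g :: "'a \<Rightarrow> real"
  proof -
    note h(3) [measurable]
    define t where "t = \<delta> powr (- a) * \<mu>"
    have t: "0 < t" using h by (simp add: t_def)
    define G where "G = (\<integral>\<^sup>+z. ennreal (g z powr p) \<partial>lborel)"
    define g0 where "g0 = (\<lambda>z. if t < g z then g z else 0)"
    define g1 where "g1 = (\<lambda>z. if t < g z then 0 else g z)"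
    have [measurable]: "g0 \<in> borel_measurable borel" "g1 \<in> borel_measurable borel" unfolding g0_def g1_def by measurable
    have nn: "\<And>z. 0 \<le> g0 z" "\<And>z. 0 \<le> g1 z" using h by (auto simp: g0_def g1_def)
    have trunc: "g0 z powr p0 \<le> t powr (p0 - p) * g z powr p" "g1 z powr p1 \<le> t powr (p1 - p) * g z powr p" for z
    proof -
      show "g0 z powr p0 \<le> t powr (p0 - p) * g z powr p"
      proof (cases "t < g z")
        case True
        then have "g z powr p0 = g z powr (p0 - p) * g z powr p" using t by (simp add: powr_add[symmetric])
        also have "\<dots> \<le> t powr (p0 - p) * g z powr p"
          using True t p by (intro mult_right_mono powr_mono2') auto
        finally show ?thesis using True by (simp add: g0_def)
      qed (simp add: g0_def)
      show "g1 z powr p1 \<le> t powr (p1 - p) * g z powr p"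
      proof (cases "t < g z \<or> g z = 0")
        case False
        then have "0 < g z" "g z \<le> t" using h(4) by (auto simp: less_le)
        then have "g z powr p1 = g z powr (p1 - p) * g z powr p" by (simp add: powr_add[symmetric])
        also have "\<dots> \<le> t powr (p1 - p) * g z powr p"
          using \<open>0 < g z\<close> \<open>g z \<le> t\<close> p by (intro mult_right_mono powr_mono2) auto
        finally show ?thesis using False by (simp add: g1_def)
      qed (auto simp: g1_def)
    qed
    \<comment> \<open>With this truncation height the powers of \<delta> and \<mu> that depend on r
      cancel, so both endpoints r = p0 and r = p1 contribute the same expression. This is why the
      exponents have to lie on one line a p - b.\<close>
    have const: "c * \<delta> powr (a * r - b - \<epsilon>) * (\<mu> / 2) powr (- r) * t powr (r - p) = (c * 2 powr r) * \<delta> powr (a * p - b - \<epsilon>) * \<mu> powr (- p)" for c r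
    proof -
      have 1: "(\<mu> / 2) powr (- r) = 2 powr r * \<mu> powr (- r)" using h by (simp add: powr_divide powr_minus_divide)
      have 2: "t powr (r - p) = \<delta> powr (- a * (r - p)) * \<mu> powr (r - p)" using h by (simp add: t_def powr_mult powr_powr)
      have 3: "\<delta> powr (a * r - b - \<epsilon>) * \<delta> powr (- a * (r - p)) = \<delta> powr (a * p - b - \<epsilon>)"
        by (simp add: powr_add[symmetric] algebra_simps)
      have 4: "\<mu> powr (- r) * \<mu> powr (r - p) = \<mu> powr (- p)" by (simp add: powr_add[symmetric])
      show ?thesis unfolding 1 2 3[symmetric] 4[symmetric] by (simp only: mult_ac)
    qed
    have b0: "emeasure lborel {x. ennreal (\<mu> / 2 * \<delta>) < cap_max (shell \<delta> 0) g0 x}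
        \<le> ennreal ((C0 * 2 powr p0) * \<delta> powr (a * p - b - \<epsilon>) * \<mu> powr (- p)) * G"
      unfolding G_def
    proof (rule ennreal_mult_le_chain[OF C0(2) nn_integral_powr_le[OF h(3) _ trunc(1)]])
      show "C0 * \<delta> powr (a * p0 - b - \<epsilon>) * (\<mu> / 2) powr (- p0) * t powr (p0 - p) \<le> C0 * 2 powr p0 * \<delta> powr (a * p - b - \<epsilon>) * \<mu> powr (- p)"
        by (rule eq_refl[OF const])
    qed (use h nn C0(1) in auto)
    have b1: "emeasure lborel {x. ennreal (\<mu> / 2 * \<delta>) < cap_max (shell \<delta> 0) g1 x}
        \<le> ennreal ((C1 * 2 powr p1) * \<delta> powr (a * p - b - \<epsilon>) * \<mu> powr (- p)) * G"
      unfolding G_def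
    proof (rule ennreal_mult_le_chain[OF C1(2) nn_integral_powr_le[OF h(3) _ trunc(2)]])
      show "C1 * \<delta> powr (a * p1 - b - \<epsilon>) * (\<mu> / 2) powr (- p1) * t powr (p1 - p) \<le> C1 * 2 powr p1 * \<delta> powr (a * p - b - \<epsilon>) * \<mu> powr (- p)"
        by (rule eq_refl[OF const])
    qed (use h nn C1(1) in auto)
    have half: "\<mu> * \<delta> = \<mu> / 2 * \<delta> + \<mu> / 2 * \<delta>" by simp
    have "emeasure lborel {x. ennreal (\<mu> * \<delta>) < cap_max (shell \<delta> 0) g x}
      \<le> emeasure lborel {x. ennreal (\<mu> / 2 * \<delta>) < cap_max (shell \<delta> 0) g0 x} + emeasure lborel {x. ennreal (\<mu> / 2 * \<delta>) < cap_max (shell \<delta> 0) g1 x}"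
      unfolding half by (rule emeasure_cap_max_split) (use h nn in \<open>auto simp: g0_def g1_def\<close>)
    also have "\<dots> \<le> ennreal ((C0 * 2 powr p0) * \<delta> powr (a * p - b - \<epsilon>) * \<mu> powr (- p)) * G
       + ennreal ((C1 * 2 powr p1) * \<delta> powr (a * p - b - \<epsilon>) * \<mu> powr (- p)) * G"
      by (intro add_mono b0 b1)
    also have "\<dots> = ennreal (C * \<delta> powr (a * p - b - \<epsilon>) * \<mu> powr (- p)) * G"
    proof -
      have "ennreal (C * \<delta> powr (a * p - b - \<epsilon>) * \<mu> powr (- p))
        = ennreal ((C0 * 2 powr p0) * \<delta> powr (a * p - b - \<epsilon>) * \<mu> powr (- p) + (C1 * 2 powr p1) * \<delta> powr (a * p - b - \<epsilon>) * \<mu> powr (- p))"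
        unfolding C_def distrib_right ..
      also have "\<dots> = ennreal ((C0 * 2 powr p0) * \<delta> powr (a * p - b - \<epsilon>) * \<mu> powr (- p)) + ennreal ((C1 * 2 powr p1) * \<delta> powr (a * p - b - \<epsilon>) * \<mu> powr (- p))"
        using C0(1) C1(1) by (intro ennreal_plus) auto
      finally show ?thesis by (simp only: distrib_right)
    qed
    finally show ?thesis unfolding G_def .
  qed
  ultimately show "\<exists>C>0. \<forall>\<delta> (g::'a \<Rightarrow> real) \<mu>. 0 < \<delta> \<longrightarrow> \<delta> < 1/2 \<longrightarrow> g \<in> borel_measurable borel \<longrightarrow> (\<forall>z. 0 \<le> g z) \<longrightarrow> 0 < \<mu> \<longrightarrow>
     emeasure lborel {x. ennreal (\<mu> * \<delta>) < cap_max (shell \<delta> 0) g x}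
       \<le> ennreal (C * \<delta> powr (a * p - b - \<epsilon>) * \<mu> powr (- p)) * (\<integral>\<^sup>+z. ennreal (g z powr p) \<partial>lborel)"
    by blast
qed

text \<open>Interpolation with the trivial bound at infinity: the part of g below \<mu>/(2 CS) has
  averages at most \<mu> \<delta>/2 and drops out, and on the rest g^p0 is at most a multiple of
  \<mu>^(p0 - p) g^p.\<close>

lemma weak_type_mono:
  assumes w: "weak_type p0 e TYPE('a::euclidean_space)" and p: "0 < p0" "p0 \<le> p"
  shows "weak_type p e TYPE('a)"
proof (rule weak_typeI)
  fix \<epsilon> :: real assume \<epsilon>: "0 < \<epsilon>"
  obtain C0 where C0: "0 < C0" "\<And>\<delta> (g::'a \<Rightarrow> real) \<mu>. 0 < \<delta> \<Longrightarrow> \<delta> < 1/2 \<Longrightarrow> g \<in> borel_measurable borel \<Longrightarrow> (\<And>z. 0 \<le> g z) \<Longrightarrow> 0 < \<mu> \<Longrightarrow>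
     emeasure lborel {x. ennreal (\<mu> * \<delta>) < cap_max (shell \<delta> 0) g x}
       \<le> ennreal (C0 * \<delta> powr (e - \<epsilon>) * \<mu> powr (- p0)) * (\<integral>\<^sup>+z. ennreal (g z powr p0) \<partial>lborel)"
    using weak_typeD[OF w \<epsilon>] by blast
  obtain CS where CS: "0 < CS" "\<And>\<delta> c. 0 < \<delta> \<Longrightarrow> \<delta> < 1/2 \<Longrightarrow> emeasure lborel (shell \<delta> c :: 'a set) \<le> ennreal (CS * \<delta>)"
    using emeasure_shell_le by blast
  define C where "C = C0 * 2 powr p0 * (1 / (2 * CS)) powr (p0 - p)"
  have "0 < C" using C0 CS by (simp add: C_def)
  moreover have "emeasure lborel {x. ennreal (\<mu> * \<delta>) < cap_max (shell \<delta> 0) g x}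
       \<le> ennreal (C * \<delta> powr (e - \<epsilon>) * \<mu> powr (- p)) * (\<integral>\<^sup>+z. ennreal (g z powr p) \<partial>lborel)"
    if h: "0 < \<delta>" "\<delta> < 1/2" "g \<in> borel_measurable borel" "\<forall>z. 0 \<le> g z" "0 < \<mu>" for \<delta> \<mu> and g :: "'a \<Rightarrow> real"
  proof -
    note h(3) [measurable]
    define t where "t = 1 / (2 * CS) * \<mu>"
    have t: "0 < t" using h CS by (simp add: t_def)
    define g0 where "g0 = (\<lambda>z. if t < g z then g z else 0)"
    define g1 where "g1 = (\<lambda>z. if t < g z then 0 else g z)"
    have [measurable]: "g0 \<in> borel_measurable borel" "g1 \<in> borel_measurable borel" unfolding g0_def g1_def by measurable
    have nn: "\<And>z. 0 \<le> g0 z" "\<And>z. 0 \<le> g1 z" using h by (auto simp: g0_def g1_def)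
    have trunc: "g0 z powr p0 \<le> t powr (p0 - p) * g z powr p" for z
    proof (cases "t < g z")
      case True
      then have "g z powr p0 = g z powr (p0 - p) * g z powr p" using t by (simp add: powr_add[symmetric])
      also have "\<dots> \<le> t powr (p0 - p) * g z powr p"
        using True t p by (intro mult_right_mono powr_mono2') auto
      finally show ?thesis using True by (simp add: g0_def)
    qed (simp add: g0_def)
    have "cap_max (shell \<delta> 0) g1 x \<le> ennreal (CS * \<delta> * t)" for x
      by (rule cap_max_le_bound[OF CS(1) CS(2)]) (use h t in \<open>auto simp: g1_def\<close>)
    moreover have "CS * \<delta> * t = \<mu> / 2 * \<delta>" using CS by (simp add: t_def)
    ultimately have empty: "{x. ennreal (\<mu> / 2 * \<delta>) < cap_max (shell \<delta> 0) g1 x} = {}" by (auto simp: not_less)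
    have half: "\<mu> * \<delta> = \<mu> / 2 * \<delta> + \<mu> / 2 * \<delta>" by simp
    have "emeasure lborel {x. ennreal (\<mu> * \<delta>) < cap_max (shell \<delta> 0) g x}
      \<le> emeasure lborel {x. ennreal (\<mu> / 2 * \<delta>) < cap_max (shell \<delta> 0) g0 x} + emeasure lborel {x. ennreal (\<mu> / 2 * \<delta>) < cap_max (shell \<delta> 0) g1 x}"
      unfolding half by (rule emeasure_cap_max_split) (use h nn in \<open>auto simp: g0_def g1_def\<close>)
    then have "emeasure lborel {x. ennreal (\<mu> * \<delta>) < cap_max (shell \<delta> 0) g x} \<le> emeasure lborel {x. ennreal (\<mu> / 2 * \<delta>) < cap_max (shell \<delta> 0) g0 x}"
      unfolding empty by (simp only: emeasure_empty add_0_right)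
    also have "\<dots> \<le> ennreal (C * \<delta> powr (e - \<epsilon>) * \<mu> powr (- p)) * (\<integral>\<^sup>+z. ennreal (g z powr p) \<partial>lborel)"
    proof (rule ennreal_mult_le_chain[OF C0(2) nn_integral_powr_le[OF h(3) _ trunc]])
      have 1: "(\<mu> / 2) powr (- p0) = 2 powr p0 * \<mu> powr (- p0)" using h by (simp add: powr_divide powr_minus_divide)
      have 2: "t powr (p0 - p) = (1 / (2 * CS)) powr (p0 - p) * \<mu> powr (p0 - p)" using h CS unfolding t_def by (intro powr_mult)
      have 4: "\<mu> powr (- p0) * \<mu> powr (p0 - p) = \<mu> powr (- p)" by (simp add: powr_add[symmetric])
      have "C0 * \<delta> powr (e - \<epsilon>) * (\<mu> / 2) powr (- p0) * t powr (p0 - p) = C * \<delta> powr (e - \<epsilon>) * \<mu> powr (- p)"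
        unfolding 1 2 C_def 4[symmetric] by (simp only: mult_ac)
      then show "C0 * \<delta> powr (e - \<epsilon>) * (\<mu> / 2) powr (- p0) * t powr (p0 - p) \<le> C * \<delta> powr (e - \<epsilon>) * \<mu> powr (- p)" by (rule eq_refl)
    qed (use h nn C0(1) in auto)
    finally show ?thesis .
  qed
  ultimately show "\<exists>C>0. \<forall>\<delta> (g::'a \<Rightarrow> real) \<mu>. 0 < \<delta> \<longrightarrow> \<delta> < 1/2 \<longrightarrow> g \<in> borel_measurable borel \<longrightarrow> (\<forall>z. 0 \<le> g z) \<longrightarrow> 0 < \<mu> \<longrightarrow>
     emeasure lborel {x. ennreal (\<mu> * \<delta>) < cap_max (shell \<delta> 0) g x}
       \<le> ennreal (C * \<delta> powr (e - \<epsilon>) * \<mu> powr (- p)) * (\<integral>\<^sup>+z. ennreal (g z powr p) \<partial>lborel)"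
    by blast
qed

section \<open>From weak to strong type\<close>

lemma nn_integral_powr_0:
  fixes s Y :: real
  assumes "0 < s" "0 \<le> Y"
  shows "(\<integral>\<^sup>+\<mu>. ennreal (\<mu> powr (s - 1)) * indicator {0..Y} \<mu> \<partial>lborel) = ennreal (Y powr s / s)"
proof -
  have "((\<lambda>\<mu>. \<mu> powr (s - 1)) has_integral (Y powr (s - 1 + 1) / (s - 1 + 1))) {0..Y}"
    using assms by (intro has_integral_powr_from_0) auto
  then show ?thesis
    using nn_integral_has_integral_lebesgue'[of "{0..Y}" "\<lambda>\<mu>. \<mu> powr (s - 1)"] by simp
qed

lemma nn_integral_inverse_Icc:
  fixes u v :: real
  assumes "0 < u" "u \<le> v"
  shows "(\<integral>\<^sup>+\<mu>. ennreal (1 / \<mu>) * indicator {u..v} \<mu> \<partial>lborel) = ennreal (ln (v / u))"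
proof -
  have "(\<integral>\<^sup>+\<mu>. ennreal (1 / \<mu>) * indicator {u..v} \<mu> \<partial>lborel) = ennreal (ln v - ln u)"
    using assms by (intro nn_integral_FTC_Icc) (auto intro!: derivative_eq_intros)
  then show ?thesis using assms by (simp add: ln_div)
qed

text \<open>Levels are parametrised as \<mu> \<delta> to match \<open>weak_type\<close>, whence the
  factor \<delta>^p. Superlevel sets are strict, as in the weak type bounds.\<close>

lemma layer_cake:
  assumes p: "0 < p" and \<delta>: "0 < \<delta>" and y: "y < \<infinity>"
  shows "ennpow y p \<le> (\<integral>\<^sup>+\<mu>. ennreal (\<delta> powr p * p * \<mu> powr (p - 1)) * indicator {\<mu>. 0 < \<mu> \<and> ennreal (\<mu> * \<delta>) < y} \<mu> \<partial>lborel)"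
proof -
  obtain r where r: "y = ennreal r" "0 \<le> r" using y by (cases y) auto
  have "ennpow y p = ennreal (r powr p)" using r by (simp add: ennpow_def)
  also have "r powr p = (\<delta> powr p * p) * ((r / \<delta>) powr p / p)"
    using r \<delta> p by (simp add: powr_divide)
  also have "ennreal \<dots> = ennreal (\<delta> powr p * p) * ennreal ((r / \<delta>) powr p / p)"
    using p by (intro ennreal_mult) auto
  also have "\<dots> = ennreal (\<delta> powr p * p) * (\<integral>\<^sup>+\<mu>. ennreal (\<mu> powr (p - 1)) * indicator {0..r / \<delta>} \<mu> \<partial>lborel)"
    using p r \<delta> by (subst nn_integral_powr_0) auto
  also have "\<dots> = (\<integral>\<^sup>+\<mu>. ennreal (\<delta> powr p * p) * (ennreal (\<mu> powr (p - 1)) * indicator {0..r / \<delta>} \<mu>) \<partial>lborel)"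
    by (rule nn_integral_cmult[symmetric]) measurable
  also have "\<dots> \<le> (\<integral>\<^sup>+\<mu>. ennreal (\<delta> powr p * p * \<mu> powr (p - 1)) * indicator {\<mu>. 0 < \<mu> \<and> ennreal (\<mu> * \<delta>) < y} \<mu> \<partial>lborel)"
  proof (rule nn_integral_mono_AE)
    \<comment> \<open>The closed interval and the strict level condition differ only at the two
      endpoints, a null set.\<close>
    have "AE \<mu> in lborel. \<mu> \<notin> {0, r / \<delta>}"
      by (intro AE_not_in countable_imp_null_set_lborel) auto
    then show "AE \<mu> in lborel. ennreal (\<delta> powr p * p) * (ennreal (\<mu> powr (p - 1)) * indicator {0..r / \<delta>} \<mu>)
        \<le> ennreal (\<delta> powr p * p * \<mu> powr (p - 1)) * indicator {\<mu>. 0 < \<mu> \<and> ennreal (\<mu> * \<delta>) < y} \<mu>"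
    proof eventually_elim
      case (elim \<mu>)
      show ?case
      proof (cases "\<mu> \<in> {0..r / \<delta>}")
        case True
        then have m: "0 < \<mu>" "\<mu> < r / \<delta>" using elim by auto
        then have "\<mu> * \<delta> < r" using \<delta> by (simp add: field_simps)
        then have "ennreal (\<mu> * \<delta>) < y" using m \<delta> r by (simp add: ennreal_less_iff)
        moreover have "ennreal (\<delta> powr p * p * \<mu> powr (p - 1)) = ennreal (\<delta> powr p * p) * ennreal (\<mu> powr (p - 1))"
          using p by (intro ennreal_mult) auto
        ultimately show ?thesis using m True by simp
      qed simp
    qed
  qed
  finally show ?thesis .
qed

lemma ln_le_powr:
  fixes A B \<epsilon> :: real
  assumes "1 \<le> A" "0 \<le> B" "0 < \<epsilon>"
  shows "\<exists>C>0. \<forall>\<delta>. 0 < \<delta> \<longrightarrow> \<delta> < 1 \<longrightarrow> ln (A * \<delta> powr (- B)) \<le> C * \<delta> powr (- \<epsilon>)"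
proof -
  define C where "C = 1 + ln A + B / \<epsilon>"
  have "C > 0" using assms by (simp add: C_def add_pos_nonneg)
  moreover have "ln (A * \<delta> powr (- B)) \<le> C * \<delta> powr (- \<epsilon>)" if \<delta>: "0 < \<delta>" "\<delta> < 1" for \<delta>
  proof -
    have p: "(1 / \<delta>) powr \<epsilon> = \<delta> powr (- \<epsilon>)" using \<delta> by (simp add: powr_divide powr_minus_divide)
    have one: "1 \<le> \<delta> powr (- \<epsilon>)"
      unfolding p[symmetric] using \<delta> assms powr_mono2[of \<epsilon> 1 "1 / \<delta>"] by simp
    have "ln (1 / \<delta>) \<le> (1 / \<delta>) powr \<epsilon> / \<epsilon>" using \<delta> assms by (intro ln_powr_bound) auto
    then have l: "ln (1 / \<delta>) \<le> \<delta> powr (- \<epsilon>) / \<epsilon>" unfolding p .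
    have "ln (A * \<delta> powr (- B)) = ln A + B * ln (1 / \<delta>)" using \<delta> assms by (simp add: ln_mult ln_powr ln_div)
    also have "\<dots> \<le> (1 + ln A) * \<delta> powr (- \<epsilon>) + B * (\<delta> powr (- \<epsilon>) / \<epsilon>)"
    proof (rule add_mono)
      have "ln A * 1 \<le> (1 + ln A) * \<delta> powr (- \<epsilon>)" using assms one by (intro mult_mono) auto
      then show "ln A \<le> (1 + ln A) * \<delta> powr (- \<epsilon>)" by simp
    qed (rule mult_left_mono[OF l assms(2)])
    also have "\<dots> = C * \<delta> powr (- \<epsilon>)" by (simp add: C_def algebra_simps)
    finally show ?thesis .
  qed
  ultimately show ?thesis by blast
qed

text \<open>At level \<open>\<mu>\<close> the part of \<open>g\<close> below \<open>\<mu>/(2 C)\<close> does not contribute, the part above \<open>H \<mu>\<close> is treated by the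
  trivial weak \<open>(1,1)\<close> bound, and the remaining range of \<open>\<mu>\<close> has logarithmic length \<open>ln (2 C H)\<close>.\<close>
lemma strong_type:
  assumes w: "weak_type p e TYPE('a::euclidean_space)" and p: "1 < p" and e: "e \<le> 0" and \<epsilon>: "0 < \<epsilon>"
  shows "\<exists>C>0. \<forall>\<delta> (g::'a \<Rightarrow> real). 0 < \<delta> \<longrightarrow> \<delta> < 1/2 \<longrightarrow> g \<in> borel_measurable borel \<longrightarrow> (\<forall>z. 0 \<le> g z) \<longrightarrow>
     (\<integral>\<^sup>+x. ennpow (cap_max (shell \<delta> 0) g x) p \<partial>lborel) \<le> ennreal (C * \<delta> powr (p + e - \<epsilon>)) * (\<integral>\<^sup>+z. ennreal (g z powr p) \<partial>lborel)"
proof -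
  define \<eta> where "\<eta> = \<epsilon> / 2"
  have \<eta>: "0 < \<eta>" using \<epsilon> by (simp add: \<eta>_def)
  obtain C1 where C1: "0 < C1" "\<And>\<delta> (g::'a \<Rightarrow> real) \<mu>. 0 < \<delta> \<Longrightarrow> \<delta> < 1/2 \<Longrightarrow> g \<in> borel_measurable borel \<Longrightarrow> (\<And>z. 0 \<le> g z) \<Longrightarrow> 0 < \<mu> \<Longrightarrow>
     emeasure lborel {x. ennreal (\<mu> * \<delta>) < cap_max (shell \<delta> 0) g x}
       \<le> ennreal (C1 * \<delta> powr (e - \<eta>) * \<mu> powr (- p)) * (\<integral>\<^sup>+z. ennreal (g z powr p) \<partial>lborel)"
    using weak_typeD[OF w \<eta>] by blast
  obtain C2 where C2: "0 < C2" "\<And>\<delta> (g::'a \<Rightarrow> real) \<mu>. 0 < \<delta> \<Longrightarrow> \<delta> < 1/2 \<Longrightarrow> g \<in> borel_measurable borel \<Longrightarrow> (\<And>z. 0 \<le> g z) \<Longrightarrow> 0 < \<mu> \<Longrightarrow>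
     emeasure lborel {x. ennreal (\<mu> * \<delta>) < cap_max (shell \<delta> 0) g x}
       \<le> ennreal (C2 * \<delta> powr (- 1 - \<epsilon>) * \<mu> powr (- 1)) * (\<integral>\<^sup>+z. ennreal (g z powr 1) \<partial>lborel)"
    using weak_typeD[OF weak_type_one \<epsilon>] by blast
  obtain CS0 where CS0: "0 < CS0" "\<And>\<delta> c. 0 < \<delta> \<Longrightarrow> \<delta> < 1/2 \<Longrightarrow> emeasure lborel (shell \<delta> c :: 'a set) \<le> ennreal (CS0 * \<delta>)"
    using emeasure_shell_le by blast
  \<comment> \<open>The constant is raised to at least 1 so that the argument of the logarithm below
    is at least 1.\<close>
  define CS where "CS = max 1 CS0"
  have CS: "1 \<le> CS" "\<And>\<delta> c. 0 < \<delta> \<Longrightarrow> \<delta> < 1/2 \<Longrightarrow> emeasure lborel (shell \<delta> c :: 'a set) \<le> ennreal (CS * \<delta>)"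
  proof -
    fix \<delta> :: real and c :: 'a assume \<delta>: "0 < \<delta>" "\<delta> < 1/2"
    have "ennreal (CS0 * \<delta>) \<le> ennreal (CS * \<delta>)" using \<delta> by (intro ennreal_leI mult_right_mono) (auto simp: CS_def)
    then show "emeasure lborel (shell \<delta> c) \<le> ennreal (CS * \<delta>)" using CS0(2)[OF \<delta>] order_trans by blast
  qed (simp add: CS_def)
  \<comment> \<open>With H = \<delta>^(-B) one has H^(-(p - 1)) = \<delta>^2. This outweighs the
    loss \<delta>^(-1 - \<epsilon>) of the weak (1,1) bound, and the remaining \<delta>^(p + 1 -
    \<epsilon>) is within the claim because e \<le> 0.\<close>
  define B where "B = 2 / (p - 1)"
  have B: "0 < B" using p by (simp add: B_def)
  obtain CL where CL: "0 < CL" "\<And>\<delta>. 0 < \<delta> \<Longrightarrow> \<delta> < 1 \<Longrightarrow> ln ((2 * CS) * \<delta> powr (- B)) \<le> CL * \<delta> powr (- \<eta>)"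
    using ln_le_powr[of "2 * CS" B \<eta>] CS(1) B \<eta> by auto
  define C where "C = p * 4 powr p * C1 * CL + 4 * p * C2 / (p - 1)"
  have "0 < C" using p C1(1) C2(1) CL(1) by (simp add: C_def add_pos_pos)
  moreover have "(\<integral>\<^sup>+x. ennpow (cap_max (shell \<delta> 0) g x) p \<partial>lborel) \<le> ennreal (C * \<delta> powr (p + e - \<epsilon>)) * (\<integral>\<^sup>+z. ennreal (g z powr p) \<partial>lborel)"
    if \<delta>: "0 < \<delta>" "\<delta> < 1/2" and g [measurable]: "g \<in> borel_measurable borel" and g0: "\<forall>z. 0 \<le> g z" for \<delta> and g :: "'a \<Rightarrow> real"
  proof -
    define G where "G = (\<integral>\<^sup>+z. ennreal (g z powr p) \<partial>lborel)"
    have Cd: "0 < C * \<delta> powr (p + e - \<epsilon>)" using \<open>0 < C\<close> \<delta> by simp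
    show ?thesis
    proof (cases "G < \<infinity>")
      case False
      then have "G = top" by (metis infinity_ennreal_def less_top)
      moreover have "ennreal (C * \<delta> powr (p + e - \<epsilon>)) \<noteq> 0" using Cd by (simp only: ennreal_eq_0_iff not_le)
      ultimately have "ennreal (C * \<delta> powr (p + e - \<epsilon>)) * G = top" by (simp only: ennreal_mult_eq_top_iff simp_thms)
      then show ?thesis by (simp only: G_def[symmetric] top_greatest)
    next
      case True
      define y where "y = cap_max (shell \<delta> 0) g"
      have ym [measurable]: "y \<in> borel_measurable borel" unfolding y_def by (rule cap_max_measurable[OF open_shell g])
      \<comment> \<open>\<open>layer_cake\<close> asks for finite values; g is locally integrable
        because g \<le> 1 + g^p.\<close>
      have yfin: "y x < \<infinity>" for x
      proof -
        have "y x \<le> (\<integral>\<^sup>+z. indicator (ball x 3) z * ennreal (g z) \<partial>lborel)"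
          unfolding y_def by (rule cap_max_le_ball[OF \<delta>(2)])
        also have "\<dots> \<le> (\<integral>\<^sup>+z. indicator (ball x 3) z + ennreal (g z powr p) \<partial>lborel)"
        proof (rule nn_integral_mono)
          fix z
          have "g z \<le> 1 + g z powr p"
          proof (cases "g z \<le> 1")
            case False
            then have "g z powr 1 \<le> g z powr p" using p by (intro powr_mono) auto
            then show ?thesis using False by simp
          qed (simp add: add_increasing2)
          then have "ennreal (g z) \<le> 1 + ennreal (g z powr p)" by (metis ennreal_1 ennreal_leI ennreal_plus powr_ge_zero zero_le_one)
          then show "indicator (ball x 3) z * ennreal (g z) \<le> indicator (ball x 3) z + ennreal (g z powr p)"
            by (auto split: split_indicator)
        qed
        also have "\<dots> = emeasure lborel (ball x 3) + G"
          unfolding G_def by (subst nn_integral_add) (auto intro!: borel_measurable_indicator)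
        also have "\<dots> < \<infinity>" using True emeasure_lborel_ball_finite[of x 3] by simp
        finally show ?thesis .
      qed
      define H where "H = \<delta> powr (- B)"
      have H: "1 \<le> H"
      proof -
        have "\<delta> powr 0 \<le> \<delta> powr (- B)" using \<delta> B by (intro powr_mono') auto
        then show ?thesis using \<delta> by (simp add: H_def)
      qed
      define lo where "lo = (\<lambda>\<mu> z. if g z \<le> \<mu> / (2 * CS) then g z else 0)"
      define mid where "mid = (\<lambda>\<mu> z. if \<mu> / (2 * CS) < g z \<and> g z \<le> H * \<mu> then g z else 0)"
      define hi where "hi = (\<lambda>\<mu> z. if H * \<mu> < g z then g z else 0)"
      have [measurable]: "lo \<mu> \<in> borel_measurable borel" "mid \<mu> \<in> borel_measurable borel" "hi \<mu> \<in> borel_measurable borel" for \<mu>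
        unfolding lo_def mid_def hi_def by measurable
      have nn: "0 \<le> lo \<mu> z" "0 \<le> mid \<mu> z" "0 \<le> hi \<mu> z" for \<mu> z using g0 by (auto simp: lo_def mid_def hi_def)
      have level: "emeasure lborel {x. ennreal (\<mu> * \<delta>) < y x}
         \<le> ennreal (C1 * \<delta> powr (e - \<eta>) * (\<mu> / 4) powr (- p)) * (\<integral>\<^sup>+z. ennreal (mid \<mu> z powr p) \<partial>lborel)
         + ennreal (C2 * \<delta> powr (- 1 - \<epsilon>) * (\<mu> / 4) powr (- 1)) * (\<integral>\<^sup>+z. ennreal (hi \<mu> z powr 1) \<partial>lborel)" if \<mu>: "0 < \<mu>" for \<mu>
      proof -
        \<comment> \<open>Half of the level is reserved for \<open>lo\<close>, whose averages cannot
          exceed it; \<open>mid\<close> and \<open>hi\<close> share the other half.\<close>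
        have eq: "\<mu> * \<delta> = (\<mu> / 4 * \<delta> + \<mu> / 4 * \<delta>) + \<mu> / 2 * \<delta>" by simp
        have "cap_max (shell \<delta> 0) (lo \<mu>) x \<le> ennreal (CS * \<delta> * (\<mu> / (2 * CS)))" for x
          by (rule cap_max_le_bound[OF _ CS(2)]) (use \<delta> \<mu> CS(1) in \<open>auto simp: lo_def\<close>)
        moreover have "CS * \<delta> * (\<mu> / (2 * CS)) = \<mu> / 2 * \<delta>" using CS(1) by simp
        ultimately have "\<not> ennreal (\<mu> / 2 * \<delta>) < cap_max (shell \<delta> 0) (lo \<mu>) x" for x by (simp only: not_less)
        then have empty: "{x. ennreal (\<mu> / 2 * \<delta>) < cap_max (shell \<delta> 0) (lo \<mu>) x} = {}" by blast
        have "emeasure lborel {x. ennreal (\<mu> * \<delta>) < y x}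
          \<le> emeasure lborel {x. ennreal (\<mu> / 4 * \<delta> + \<mu> / 4 * \<delta>) < cap_max (shell \<delta> 0) (\<lambda>z. mid \<mu> z + hi \<mu> z) x}
          + emeasure lborel {x. ennreal (\<mu> / 2 * \<delta>) < cap_max (shell \<delta> 0) (lo \<mu>) x}"
          unfolding eq y_def
          by (rule emeasure_cap_max_split) (use \<delta> \<mu> g0 nn in \<open>auto simp: lo_def mid_def hi_def add_nonneg_nonneg\<close>)
        also have "\<dots> = emeasure lborel {x. ennreal (\<mu> / 4 * \<delta> + \<mu> / 4 * \<delta>) < cap_max (shell \<delta> 0) (\<lambda>z. mid \<mu> z + hi \<mu> z) x}"
          unfolding empty by (simp only: emeasure_empty add_0_right)
        also have "\<dots> \<le> emeasure lborel {x. ennreal (\<mu> / 4 * \<delta>) < cap_max (shell \<delta> 0) (mid \<mu>) x}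
          + emeasure lborel {x. ennreal (\<mu> / 4 * \<delta>) < cap_max (shell \<delta> 0) (hi \<mu>) x}"
          by (rule emeasure_cap_max_split) (use \<delta> \<mu> nn in auto)
        also have "\<dots> \<le> ennreal (C1 * \<delta> powr (e - \<eta>) * (\<mu> / 4) powr (- p)) * (\<integral>\<^sup>+z. ennreal (mid \<mu> z powr p) \<partial>lborel)
         + ennreal (C2 * \<delta> powr (- 1 - \<epsilon>) * (\<mu> / 4) powr (- 1)) * (\<integral>\<^sup>+z. ennreal (hi \<mu> z powr 1) \<partial>lborel)"
          using \<mu> nn by (intro add_mono C1(2) C2(2) \<delta>) auto
        finally show ?thesis .
      qed
      define c1 where "c1 = \<delta> powr p * p * (4 powr p * C1 * \<delta> powr (e - \<eta>))"
      define c2 where "c2 = \<delta> powr p * p * (4 * C2 * \<delta> powr (- 1 - \<epsilon>))"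
      have c12: "0 \<le> c1" "0 \<le> c2" using p C1(1) C2(1) by (auto simp: c1_def c2_def)
      \<comment> \<open>\<open>k1\<close> and \<open>k2\<close> are the weights of the point z at
        level \<mu>: \<mu>^(p - 1) times \<mu>^(-p) gives 1/\<mu> on the middle range, and times
        1/\<mu> gives \<mu>^(p - 2) on the high range. Integrating in \<mu> first yields a logarithm
        and a power of g z.\<close>
      define k1 where "k1 = (\<lambda>\<mu> z. ennreal (1 / \<mu>) * indicator {w. 0 < fst w \<and> fst w / (2 * CS) < g (snd w) \<and> g (snd w) \<le> H * fst w} (\<mu>, z))"
      define k2 where "k2 = (\<lambda>\<mu> z. ennreal (\<mu> powr (p - 1 - 1)) * indicator {w. 0 < fst w \<and> H * fst w < g (snd w)} (\<mu>, z))"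
      have [measurable]: "case_prod k1 \<in> borel_measurable (borel \<Otimes>\<^sub>M borel)" "case_prod k2 \<in> borel_measurable (borel \<Otimes>\<^sub>M borel)"
        unfolding k1_def k2_def by measurable
      have "(\<integral>\<^sup>+x. ennpow (y x) p \<partial>lborel)
        \<le> (\<integral>\<^sup>+x. \<integral>\<^sup>+\<mu>. ennreal (\<delta> powr p * p * \<mu> powr (p - 1)) * indicator {w. 0 < snd w \<and> ennreal (snd w * \<delta>) < y (fst w)} (x, \<mu>) \<partial>lborel \<partial>lborel)"
        by (intro nn_integral_mono order_trans[OF layer_cake[OF _ \<delta>(1) yfin]]) (use p in \<open>auto intro!: nn_integral_mono split: split_indicator\<close>)
      also have "\<dots> = (\<integral>\<^sup>+\<mu>. \<integral>\<^sup>+x. ennreal (\<delta> powr p * p * \<mu> powr (p - 1)) * indicator {w. 0 < snd w \<and> ennreal (snd w * \<delta>) < y (fst w)} (x, \<mu>) \<partial>lborel \<partial>lborel)"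
        by (rule lborel_pair.Fubini') measurable
      also have "\<dots> \<le> (\<integral>\<^sup>+\<mu>. (\<integral>\<^sup>+z. ennreal c1 * (k1 \<mu> z * ennreal (g z powr p)) \<partial>lborel) + (\<integral>\<^sup>+z. ennreal c2 * (k2 \<mu> z * ennreal (g z)) \<partial>lborel) \<partial>lborel)"
      proof (rule nn_integral_mono)
        fix \<mu> :: real
        show "(\<integral>\<^sup>+x. ennreal (\<delta> powr p * p * \<mu> powr (p - 1)) * indicator {w. 0 < snd w \<and> ennreal (snd w * \<delta>) < y (fst w)} (x, \<mu>) \<partial>lborel)
          \<le> (\<integral>\<^sup>+z. ennreal c1 * (k1 \<mu> z * ennreal (g z powr p)) \<partial>lborel) + (\<integral>\<^sup>+z. ennreal c2 * (k2 \<mu> z * ennreal (g z)) \<partial>lborel)"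
        proof (cases "0 < \<mu>")
          case False
          then show ?thesis by simp
        next
          case \<mu>: True
          let ?w = "\<delta> powr p * p * \<mu> powr (p - 1)"
          have w0: "0 \<le> ?w" using p by simp
          have "(\<integral>\<^sup>+x. ennreal ?w * indicator {w. 0 < snd w \<and> ennreal (snd w * \<delta>) < y (fst w)} (x, \<mu>) \<partial>lborel)
            = (\<integral>\<^sup>+x. ennreal ?w * indicator {x. ennreal (\<mu> * \<delta>) < y x} x \<partial>lborel)"
            using \<mu> by (intro nn_integral_cong) (auto split: split_indicator)
          also have "\<dots> = ennreal ?w * emeasure lborel {x. ennreal (\<mu> * \<delta>) < y x}"
            by (rule nn_integral_cmult_indicator) measurable
          also have "\<dots> \<le> ennreal ?w * (ennreal (C1 * \<delta> powr (e - \<eta>) * (\<mu> / 4) powr (- p)) * (\<integral>\<^sup>+z. ennreal (mid \<mu> z powr p) \<partial>lborel)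
              + ennreal (C2 * \<delta> powr (- 1 - \<epsilon>) * (\<mu> / 4) powr (- 1)) * (\<integral>\<^sup>+z. ennreal (hi \<mu> z powr 1) \<partial>lborel))"
            by (intro mult_left_mono level[OF \<mu>]) simp
          also have "\<dots> = ennreal (c1 * (1 / \<mu>)) * (\<integral>\<^sup>+z. ennreal (mid \<mu> z powr p) \<partial>lborel)
              + ennreal (c2 * \<mu> powr (p - 1 - 1)) * (\<integral>\<^sup>+z. ennreal (hi \<mu> z powr 1) \<partial>lborel)"
          proof -
            have pw: "\<mu> powr (p - 1) * \<mu> powr (- p) = \<mu> powr (- 1)" "\<mu> powr (p - 1) * \<mu> powr (- 1) = \<mu> powr (p - 1 - 1)"
              unfolding powr_add[symmetric] by simp_all
            have q4: "(\<mu> / 4) powr (- p) = 4 powr p * \<mu> powr (- p)" "(\<mu> / 4) powr (- 1) = 4 * \<mu> powr (- 1)"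
              using \<mu> by (simp_all add: powr_divide powr_minus_divide)
            have "?w * (C1 * \<delta> powr (e - \<eta>) * (\<mu> / 4) powr (- p)) = c1 * \<mu> powr (- 1)"
              unfolding c1_def pw(1)[symmetric] q4 by (simp only: mult_ac)
            moreover have "?w * (C2 * \<delta> powr (- 1 - \<epsilon>) * (\<mu> / 4) powr (- 1)) = c2 * \<mu> powr (p - 1 - 1)"
              unfolding c2_def pw(2)[symmetric] q4 by (simp only: mult_ac)
            ultimately have *: "?w * (C1 * \<delta> powr (e - \<eta>) * (\<mu> / 4) powr (- p)) = c1 * (1 / \<mu>)"
              "?w * (C2 * \<delta> powr (- 1 - \<epsilon>) * (\<mu> / 4) powr (- 1)) = c2 * \<mu> powr (p - 1 - 1)"
              using \<mu> by (simp_all only: powr_minus_divide powr_one_gt_zero_iff) simp_all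
            have "ennreal ?w * ennreal (C1 * \<delta> powr (e - \<eta>) * (\<mu> / 4) powr (- p)) = ennreal (c1 * (1 / \<mu>))"
              unfolding *[symmetric] using w0 C1(1) by (intro ennreal_mult[symmetric]) auto
            moreover have "ennreal ?w * ennreal (C2 * \<delta> powr (- 1 - \<epsilon>) * (\<mu> / 4) powr (- 1)) = ennreal (c2 * \<mu> powr (p - 1 - 1))"
              unfolding *[symmetric] using w0 C2(1) by (intro ennreal_mult[symmetric]) auto
            ultimately show ?thesis by (simp only: distrib_left mult.assoc[symmetric])
          qed
          also have "ennreal (c1 * (1 / \<mu>)) * (\<integral>\<^sup>+z. ennreal (mid \<mu> z powr p) \<partial>lborel) = (\<integral>\<^sup>+z. ennreal c1 * (k1 \<mu> z * ennreal (g z powr p)) \<partial>lborel)"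
          proof -
            have "ennreal (c1 * (1 / \<mu>)) = ennreal c1 * ennreal (1 / \<mu>)" using c12 \<mu> by (intro ennreal_mult) auto
            then have "ennreal (c1 * (1 / \<mu>)) * (\<integral>\<^sup>+z. ennreal (mid \<mu> z powr p) \<partial>lborel) = (\<integral>\<^sup>+z. ennreal c1 * ennreal (1 / \<mu>) * ennreal (mid \<mu> z powr p) \<partial>lborel)"
              by (subst nn_integral_cmult) auto
            also have "\<dots> = (\<integral>\<^sup>+z. ennreal c1 * (k1 \<mu> z * ennreal (g z powr p)) \<partial>lborel)"
              using \<mu> by (intro nn_integral_cong) (auto simp: mid_def k1_def mult.assoc split: split_indicator)
            finally show ?thesis .
          qed
          also have "ennreal (c2 * \<mu> powr (p - 1 - 1)) * (\<integral>\<^sup>+z. ennreal (hi \<mu> z powr 1) \<partial>lborel) = (\<integral>\<^sup>+z. ennreal c2 * (k2 \<mu> z * ennreal (g z)) \<partial>lborel)"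
          proof -
            have "ennreal (c2 * \<mu> powr (p - 1 - 1)) = ennreal c2 * ennreal (\<mu> powr (p - 1 - 1))" using c12 by (intro ennreal_mult) auto
            then have "ennreal (c2 * \<mu> powr (p - 1 - 1)) * (\<integral>\<^sup>+z. ennreal (hi \<mu> z powr 1) \<partial>lborel) = (\<integral>\<^sup>+z. ennreal c2 * ennreal (\<mu> powr (p - 1 - 1)) * ennreal (hi \<mu> z powr 1) \<partial>lborel)"
              by (subst nn_integral_cmult) auto
            also have "\<dots> = (\<integral>\<^sup>+z. ennreal c2 * (k2 \<mu> z * ennreal (g z)) \<partial>lborel)"
              using \<mu> g0 by (intro nn_integral_cong) (auto simp: hi_def k2_def mult.assoc split: split_indicator)
            finally show ?thesis .
          qed
          finally show ?thesis .
        qed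
      qed
      also have "\<dots> = (\<integral>\<^sup>+\<mu>. \<integral>\<^sup>+z. ennreal c1 * (k1 \<mu> z * ennreal (g z powr p)) \<partial>lborel \<partial>lborel) + (\<integral>\<^sup>+\<mu>. \<integral>\<^sup>+z. ennreal c2 * (k2 \<mu> z * ennreal (g z)) \<partial>lborel \<partial>lborel)"
        by (rule nn_integral_add) measurable
      also have "(\<integral>\<^sup>+\<mu>. \<integral>\<^sup>+z. ennreal c1 * (k1 \<mu> z * ennreal (g z powr p)) \<partial>lborel \<partial>lborel) \<le> ennreal (c1 * (CL * \<delta> powr (- \<eta>))) * G"
      proof -
        have "(\<integral>\<^sup>+\<mu>. \<integral>\<^sup>+z. ennreal c1 * (k1 \<mu> z * ennreal (g z powr p)) \<partial>lborel \<partial>lborel) = (\<integral>\<^sup>+z. \<integral>\<^sup>+\<mu>. ennreal c1 * (k1 \<mu> z * ennreal (g z powr p)) \<partial>lborel \<partial>lborel)"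
          by (rule lborel_pair.Fubini') measurable
        also have "\<dots> \<le> (\<integral>\<^sup>+z. ennreal (c1 * (CL * \<delta> powr (- \<eta>))) * ennreal (g z powr p) \<partial>lborel)"
        proof (rule nn_integral_mono)
          fix z
          show "(\<integral>\<^sup>+\<mu>. ennreal c1 * (k1 \<mu> z * ennreal (g z powr p)) \<partial>lborel) \<le> ennreal (c1 * (CL * \<delta> powr (- \<eta>))) * ennreal (g z powr p)"
          proof (cases "g z = 0")
            case True
            then show ?thesis by simp
          next
            case False
            then have gz: "0 < g z" using g0 by (simp add: less_le)
            have HH: "g z / H \<le> 2 * CS * g z"
            proof -
              have "g z / H \<le> g z / 1" using H gz by (intro divide_left_mono) auto
              also have "\<dots> \<le> 2 * CS * g z" using CS(1) gz by simp
              finally show ?thesis .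
            qed
            have "(\<integral>\<^sup>+\<mu>. ennreal c1 * (k1 \<mu> z * ennreal (g z powr p)) \<partial>lborel) = ennreal c1 * ((\<integral>\<^sup>+\<mu>. k1 \<mu> z \<partial>lborel) * ennreal (g z powr p))"
              by (subst nn_integral_cmult, measurable, subst nn_integral_multc) measurable
            also have "(\<integral>\<^sup>+\<mu>. k1 \<mu> z \<partial>lborel) \<le> (\<integral>\<^sup>+\<mu>. ennreal (1 / \<mu>) * indicator {g z / H..2 * CS * g z} \<mu> \<partial>lborel)"
              unfolding k1_def using H CS(1)
              by (intro nn_integral_mono mult_left_mono) (auto simp: field_simps split: split_indicator)
            also have "\<dots> = ennreal (ln (2 * CS * g z / (g z / H)))"
              using gz H HH by (intro nn_integral_inverse_Icc) auto
            also have "2 * CS * g z / (g z / H) = 2 * CS * \<delta> powr (- B)" using gz H by (simp add: H_def)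
            also have "ennreal (ln (2 * CS * \<delta> powr (- B))) \<le> ennreal (CL * \<delta> powr (- \<eta>))"
              using \<delta> by (intro ennreal_leI CL(2)) auto
            finally have "(\<integral>\<^sup>+\<mu>. ennreal c1 * (k1 \<mu> z * ennreal (g z powr p)) \<partial>lborel) \<le> ennreal c1 * (ennreal (CL * \<delta> powr (- \<eta>)) * ennreal (g z powr p))"
              by (simp add: mult_left_mono mult_right_mono)
            also have "\<dots> = ennreal (c1 * (CL * \<delta> powr (- \<eta>))) * ennreal (g z powr p)"
              using c12 CL(1) by (subst ennreal_mult[of c1]) (auto simp: mult.assoc)
            finally show ?thesis .
          qed
        qed
        also have "\<dots> = ennreal (c1 * (CL * \<delta> powr (- \<eta>))) * G" unfolding G_def by (rule nn_integral_cmult) measurable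
        finally show ?thesis .
      qed
      also have "(\<integral>\<^sup>+\<mu>. \<integral>\<^sup>+z. ennreal c2 * (k2 \<mu> z * ennreal (g z)) \<partial>lborel \<partial>lborel) \<le> ennreal (c2 * (\<delta>\<^sup>2 / (p - 1))) * G"
      proof -
        have "(\<integral>\<^sup>+\<mu>. \<integral>\<^sup>+z. ennreal c2 * (k2 \<mu> z * ennreal (g z)) \<partial>lborel \<partial>lborel) = (\<integral>\<^sup>+z. \<integral>\<^sup>+\<mu>. ennreal c2 * (k2 \<mu> z * ennreal (g z)) \<partial>lborel \<partial>lborel)"
          by (rule lborel_pair.Fubini') measurable
        also have "\<dots> \<le> (\<integral>\<^sup>+z. ennreal (c2 * (\<delta>\<^sup>2 / (p - 1))) * ennreal (g z powr p) \<partial>lborel)"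
        proof (rule nn_integral_mono)
          fix z
          have gz: "0 \<le> g z" using g0 by simp
          have "(\<integral>\<^sup>+\<mu>. ennreal c2 * (k2 \<mu> z * ennreal (g z)) \<partial>lborel) = ennreal c2 * ((\<integral>\<^sup>+\<mu>. k2 \<mu> z \<partial>lborel) * ennreal (g z))"
            by (subst nn_integral_cmult, measurable, subst nn_integral_multc) measurable
          also have "(\<integral>\<^sup>+\<mu>. k2 \<mu> z \<partial>lborel) \<le> (\<integral>\<^sup>+\<mu>. ennreal (\<mu> powr (p - 1 - 1)) * indicator {0..g z / H} \<mu> \<partial>lborel)"
            unfolding k2_def using H
            by (intro nn_integral_mono mult_left_mono) (auto simp: field_simps split: split_indicator)
          also have "\<dots> = ennreal ((g z / H) powr (p - 1) / (p - 1))"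
            using gz H p by (intro nn_integral_powr_0) auto
          finally have "(\<integral>\<^sup>+\<mu>. ennreal c2 * (k2 \<mu> z * ennreal (g z)) \<partial>lborel) \<le> ennreal c2 * (ennreal ((g z / H) powr (p - 1) / (p - 1)) * ennreal (g z))"
            by (simp add: mult_left_mono mult_right_mono)
          also have "\<dots> = ennreal (c2 * ((g z / H) powr (p - 1) / (p - 1) * g z))"
          proof -
            define X where "X = (g z / H) powr (p - 1) / (p - 1)"
            have X: "0 \<le> X" using p by (simp add: X_def)
            have "ennreal (X * g z) = ennreal X * ennreal (g z)" "ennreal (c2 * (X * g z)) = ennreal c2 * ennreal (X * g z)"
              using X gz c12 by (intro ennreal_mult; simp)+
            then show ?thesis unfolding X_def[symmetric] by (simp only:)
          qed
          also have "(g z / H) powr (p - 1) / (p - 1) * g z = \<delta>\<^sup>2 / (p - 1) * g z powr p"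
          proof -
            have "- B * (p - 1) = - 2" using p by (simp add: B_def field_simps)
            then have "H powr (p - 1) = \<delta> powr (- 2)" by (simp only: H_def powr_powr)
            then have 1: "(g z / H) powr (p - 1) = g z powr (p - 1) * \<delta>\<^sup>2"
              using gz H \<delta> by (simp add: powr_divide powr_minus_divide)
            have 2: "g z powr (p - 1) * g z = g z powr p"
            proof (cases "g z = 0")
              case False
              then have "g z powr (p - 1) * g z powr 1 = g z powr p" by (simp only: powr_add[symmetric]) simp
              then show ?thesis using gz by simp
            qed simp
            show ?thesis unfolding 1 2[symmetric] by simp
          qed
          also have "ennreal (c2 * (\<delta>\<^sup>2 / (p - 1) * g z powr p)) = ennreal (c2 * (\<delta>\<^sup>2 / (p - 1))) * ennreal (g z powr p)"
            unfolding mult.assoc[symmetric] using c12 p by (intro ennreal_mult) auto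
          finally show "(\<integral>\<^sup>+\<mu>. ennreal c2 * (k2 \<mu> z * ennreal (g z)) \<partial>lborel) \<le> ennreal (c2 * (\<delta>\<^sup>2 / (p - 1))) * ennreal (g z powr p)" .
        qed
        also have "\<dots> = ennreal (c2 * (\<delta>\<^sup>2 / (p - 1))) * G" unfolding G_def by (rule nn_integral_cmult) measurable
        finally show ?thesis .
      qed
      finally have "(\<integral>\<^sup>+x. ennpow (y x) p \<partial>lborel) \<le> ennreal (c1 * (CL * \<delta> powr (- \<eta>))) * G + ennreal (c2 * (\<delta>\<^sup>2 / (p - 1))) * G"
        by (simp add: add_mono)
      also have "\<dots> = ennreal (c1 * (CL * \<delta> powr (- \<eta>)) + c2 * (\<delta>\<^sup>2 / (p - 1))) * G"
        using c12 CL(1) p by (subst ennreal_plus) (auto simp: distrib_right)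
      also have "\<dots> \<le> ennreal (C * \<delta> powr (p + e - \<epsilon>)) * G"
      proof (intro mult_right_mono ennreal_leI)
        have pe: "p + (e - \<eta> + - \<eta>) = p + e - \<epsilon>" by (simp add: \<eta>_def)
        have 1: "c1 * (CL * \<delta> powr (- \<eta>)) = (p * 4 powr p * C1 * CL) * \<delta> powr (p + e - \<epsilon>)"
          unfolding c1_def pe[symmetric] powr_add by (simp only: mult_ac)
        have "\<delta> powr p * \<delta> powr (- 1 - \<epsilon>) * \<delta>\<^sup>2 = \<delta> powr p * \<delta> powr (- 1 - \<epsilon>) * \<delta> powr 2" using \<delta> by simp
        also have "\<dots> = \<delta> powr (p + 1 - \<epsilon>)" by (simp add: powr_add[symmetric] algebra_simps del: powr_numeral)
        also have "\<dots> \<le> \<delta> powr (p + e - \<epsilon>)" using \<delta> e by (intro powr_mono') auto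
        finally have "(4 * p * C2 / (p - 1)) * (\<delta> powr p * \<delta> powr (- 1 - \<epsilon>) * \<delta>\<^sup>2) \<le> (4 * p * C2 / (p - 1)) * \<delta> powr (p + e - \<epsilon>)"
          using p C2(1) by (intro mult_left_mono) auto
        moreover have "c2 * (\<delta>\<^sup>2 / (p - 1)) = (4 * p * C2 / (p - 1)) * (\<delta> powr p * \<delta> powr (- 1 - \<epsilon>) * \<delta>\<^sup>2)"
          by (simp add: c2_def)
        ultimately show "c1 * (CL * \<delta> powr (- \<eta>)) + c2 * (\<delta>\<^sup>2 / (p - 1)) \<le> C * \<delta> powr (p + e - \<epsilon>)"
          unfolding C_def 1 distrib_right by (simp only: add_left_mono)
      qed simp
      finally show ?thesis by (simp add: y_def G_def)
    qed
  qed
  ultimately show ?thesis by blast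
qed

section \<open>The upper bounds\<close>

lemma ennpow_mono:
  assumes "a \<le> b" "0 \<le> r" shows "ennpow a r \<le> ennpow b r"
proof (cases "b = \<infinity>")
  case False
  then have "b < \<infinity>" "a < \<infinity>" using assms(1) by (auto simp: less_top[symmetric] top_unique)
  then show ?thesis using assms
    by (auto simp: ennpow_def intro!: ennreal_leI powr_mono2 enn2real_mono)
qed (simp add: ennpow_def)

lemma ennpow_mult:
  assumes "0 < k" "0 < r" shows "ennpow (y * ennreal k) r = ennpow y r * ennreal (k powr r)"
proof (cases y)
  case (real a)
  then have "ennpow (y * ennreal k) r = ennpow (ennreal (a * k)) r"
    using assms by (simp only: real ennreal_mult less_imp_le)
  also have "\<dots> = ennreal (a powr r) * ennreal (k powr r)"
    using real assms by (simp add: ennpow_def powr_mult flip: ennreal_mult)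
  finally show ?thesis using real by (simp add: ennpow_def)
next
  case top
  then show ?thesis using assms by (simp add: ennpow_def ennreal_top_mult)
qed

lemma ennpow_ennreal: "0 \<le> a \<Longrightarrow> ennpow (ennreal a) r = ennreal (a powr r)"
  by (simp add: ennpow_def)

lemma ennpow_le_one:
  assumes "ennpow a r \<le> 1" "0 < r" shows "a \<le> 1"
proof (cases a)
  case (real x)
  then have x: "x powr r \<le> 1" using assms by (simp add: ennpow_def)
  have "x \<le> 1"
  proof (rule ccontr)
    assume "\<not> x \<le> 1"
    then have "1 powr r < x powr r" using assms by (intro powr_less_mono2) auto
    then show False using x by simp
  qed
  then show ?thesis using real by simp
qed (use assms in \<open>simp add: ennpow_def top_unique\<close>)

lemma measurable_ennpow [measurable]:
  assumes [measurable]: "f \<in> borel_measurable M"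
  shows "(\<lambda>x. ennpow (f x) r) \<in> borel_measurable M"
  unfolding ennpow_def by measurable

lemma AE_lborel_translate:
  fixes c :: "'a::euclidean_space"
  assumes "AE z in lborel. P z" shows "AE z in lborel. P (c + z)"
proof -
  have "AE z in distr lborel borel ((+) c). P z" using assms by (simp only: lborel_distr_plus)
  then show ?thesis by (rule AE_distrD[rotated]) auto
qed

lemma nn_integral_lborel_translate:
  fixes c :: "'a::euclidean_space"
  assumes [measurable]: "f \<in> borel_measurable borel"
  shows "(\<integral>\<^sup>+z. f (c + z) \<partial>lborel) = (\<integral>\<^sup>+z. f z \<partial>lborel)"
proof -
  have "(\<integral>\<^sup>+z. f z \<partial>lborel) = (\<integral>\<^sup>+z. f z \<partial>distr lborel borel ((+) c))" by (simp only: lborel_distr_plus)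
  also have "\<dots> = (\<integral>\<^sup>+z. f (c + z) \<partial>lborel)" by (subst nn_integral_distr) auto
  finally show ?thesis by simp
qed

lemma borel_representative:
  fixes f :: "'a::euclidean_space \<Rightarrow> real"
  assumes "f \<in> borel_measurable lebesgue"
  obtains g where "g \<in> borel_measurable borel" "AE z in lborel. f z = g z"
  using completion_ex_borel_measurable_real[OF assms] by auto

text \<open>The Bochner integral of a non-integrable function is 0 by convention, so the bound holds
  in that case too.\<close>

lemma ennreal_abs_integral_le:
  "ennreal \<bar>integral\<^sup>L M f\<bar> \<le> (\<integral>\<^sup>+x. ennreal \<bar>f x\<bar> \<partial>M)"
proof (cases "integrable M f")
  case True
  then show ?thesis using integral_norm_bound_ennreal[OF True] by simp
qed (simp add: not_integrable_integral_eq)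

text \<open>Translates of null sets are null, so replacing |f| by a Borel representative is
  legitimate for every centre \<open>c\<close>, and hence under the supremum over all
  directions.\<close>

lemma set_integral_le_cap_avg:
  fixes f g :: "'a::euclidean_space \<Rightarrow> real"
  assumes \<delta>: "0 < \<delta>" "\<delta> < 1/2" and g [measurable]: "g \<in> borel_measurable borel" and fg: "AE z in lborel. \<bar>f z\<bar> = g z"
  shows "ennreal \<bar>set_lebesgue_integral lebesgue (sphere_nbhd \<delta>) (\<lambda>y. f (c + y))\<bar> \<le> cap_avg (shell \<delta> 0) g c"
proof -
  have S: "sphere_nbhd \<delta> = (shell \<delta> 0 :: 'a set)" using \<delta> by (intro sphere_nbhd_eq_shell) auto
  have "ennreal \<bar>set_lebesgue_integral lebesgue (sphere_nbhd \<delta>) (\<lambda>y. f (c + y))\<bar>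
     \<le> (\<integral>\<^sup>+y. ennreal \<bar>indicator (shell \<delta> 0) y *\<^sub>R f (c + y)\<bar> \<partial>lebesgue)"
    unfolding set_lebesgue_integral_def S by (rule ennreal_abs_integral_le)
  also have "\<dots> = (\<integral>\<^sup>+y. indicator (shell \<delta> 0) y * ennreal (g (c + y)) \<partial>lebesgue)"
    using AE_completion[OF AE_lborel_translate[OF fg, of c]]
    by (intro nn_integral_cong_AE, eventually_elim) (auto split: split_indicator)
  also have "\<dots> = (\<integral>\<^sup>+y. indicator {z. z - c \<in> shell \<delta> 0} (c + y) * ennreal (g (c + y)) \<partial>lborel)"
    by (subst nn_integral_completion) (auto intro!: nn_integral_cong split: split_indicator)
  also have "\<dots> = cap_avg (shell \<delta> 0) g c"
    unfolding cap_avg_def by (rule nn_integral_lborel_translate) measurable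
  finally show ?thesis .
qed

lemma N_op_le_cap_max:
  fixes f g :: "'a::euclidean_space \<Rightarrow> real"
  assumes \<delta>: "0 < \<delta>" "\<delta> < 1/2" and g: "g \<in> borel_measurable borel" and fg: "AE z in lborel. \<bar>f z\<bar> = g z"
    and k: "0 < k" "k \<le> measure lebesgue (sphere_nbhd \<delta> :: 'a set)"
  shows "N_op \<delta> f x \<le> cap_max (shell \<delta> 0) g x * ennreal (1 / k)"
  unfolding N_op_def
proof (rule SUP_least)
  fix u :: 'a assume u: "u \<in> sphere 0 1"
  let ?I = "\<bar>set_lebesgue_integral lebesgue (sphere_nbhd \<delta> :: 'a set) (\<lambda>y. f (x + u + y))\<bar>"
  have "?I / measure lebesgue (sphere_nbhd \<delta> :: 'a set) \<le> ?I / k"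
    using k by (intro divide_left_mono) auto
  then have "ennreal (?I / measure lebesgue (sphere_nbhd \<delta> :: 'a set)) \<le> ennreal (?I * (1 / k))"
    by (intro ennreal_leI) simp
  also have "\<dots> = ennreal ?I * ennreal (1 / k)" using k by (intro ennreal_mult) auto
  also have "\<dots> \<le> cap_avg (shell \<delta> 0) g (x + u) * ennreal (1 / k)"
    by (intro mult_right_mono set_integral_le_cap_avg \<delta> g fg) simp
  also have "\<dots> \<le> cap_max (shell \<delta> 0) g x * ennreal (1 / k)"
    unfolding cap_max_def using u by (intro mult_right_mono SUP_upper) auto
  finally show "ennreal (?I / measure lebesgue (sphere_nbhd \<delta> :: 'a set)) \<le> cap_max (shell \<delta> 0) g x * ennreal (1 / k)" .
qed

lemma ereal_le_simps:
  "ereal r \<le> 2 \<longleftrightarrow> r \<le> 2" "ereal r \<le> 3/2 \<longleftrightarrow> r \<le> 3/2" "ereal r \<le> 4/3 \<longleftrightarrow> r \<le> 4/3"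
proof -
  have "(2::ereal) = ereal 2" "(3/2::ereal) = ereal (3/2)" "(4/3::ereal) = ereal (4/3)"
    by (simp_all add: ereal_divide)
  then show "ereal r \<le> 2 \<longleftrightarrow> r \<le> 2" "ereal r \<le> 3/2 \<longleftrightarrow> r \<le> 3/2" "ereal r \<le> 4/3 \<longleftrightarrow> r \<le> 4/3" by auto
qed

lemma gamma_exp_nonpos:
  assumes "1 \<le> p" shows "gamma_exp n p \<le> 0"
proof (cases p)
  case (real r)
  then have "1 \<le> r" using assms by simp
  then show ?thesis unfolding real gamma_exp_def Let_def ereal_le_simps real_of_ereal.simps
    by (auto simp: field_simps)
qed (use assms in \<open>auto simp: gamma_exp_def\<close>)

text \<open>r times \<gamma>(n, r) is affine in r on each branch, with breakpoints at the endpoint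
  exponents: -1 at r = 1, -1/4 at 3/2 in dimension 3, -1/3 at 4/3 from dimension 4 on, 0 at 2. Each
  branch is therefore one interpolation segment, and r > 2 uses the bound at infinity.\<close>

lemma weak_type_gamma:
  assumes dim: "2 \<le> DIM('a::euclidean_space)" and r: "1 \<le> r"
  shows "weak_type r (r * gamma_exp (DIM('a)) (ereal r)) TYPE('a)"
proof -
  have w1: "weak_type 1 (- 1) TYPE('a)" by (rule weak_type_one)
  have w2: "weak_type 2 0 TYPE('a)"
  proof -
    have "weak_type 2 (2 * (2 - 1) - 2) TYPE('a)"
      by (rule weak_type_endpoint[of 2]) (use dim in simp_all)
    then show ?thesis by simp
  qed
  have seg: "weak_type r (a * r - b) TYPE('a)"
    if "weak_type p0 e0 TYPE('a)" "weak_type p1 e1 TYPE('a)" "p0 \<le> r" "r \<le> p1" "0 < p0" "e0 = a * p0 - b" "e1 = a * p1 - b" for p0 p1 e0 e1 a b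
    by (rule weak_type_interpolate[OF that(1)[unfolded that(6)] that(2)[unfolded that(7)] that(3,4,5)])
  show ?thesis
  proof (cases "2 < r")
    case True
    then have "gamma_exp (DIM('a)) (ereal r) = 0" by (simp add: gamma_exp_def Let_def ereal_le_simps)
    then show ?thesis using weak_type_mono[OF w2, of r] True by simp
  next
    case False
    then have r2: "r \<le> 2" by simp
    consider "DIM('a) = 2" | "DIM('a) = 3" | "4 \<le> DIM('a)" using dim by linarith
    then show ?thesis
    proof cases
      case 1
      have eq: "r * gamma_exp (DIM('a)) (ereal r) = 1 * r - 2"
        using 1 r r2 by (simp add: gamma_exp_def Let_def ereal_le_simps field_simps)
      show ?thesis unfolding eq by (rule seg[OF w1 w2 r r2]) simp_all
    next
      case 2
      have w: "weak_type (3/2) (- 1/4) TYPE('a)"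
      proof -
        have "weak_type (3/2) (5/2 * (3/2 - 1) - 3/2) TYPE('a)"
          by (rule weak_type_endpoint[of 3]) (use 2 in simp_all)
        then show ?thesis by simp
      qed
      show ?thesis
      proof (cases "r \<le> 3/2")
        case True
        have eq: "r * gamma_exp (DIM('a)) (ereal r) = 3/2 * r - 5/2"
          using 2 r True by (simp add: gamma_exp_def Let_def ereal_le_simps field_simps)
        show ?thesis unfolding eq by (rule seg[OF w1 w r True]) simp_all
      next
        case False
        have eq: "r * gamma_exp (DIM('a)) (ereal r) = 1/2 * r - 1"
          using 2 r False r2 by (simp add: gamma_exp_def Let_def ereal_le_simps field_simps)
        show ?thesis unfolding eq by (rule seg[OF w w2 _ r2]) (use False in simp_all)
      qed
    next
      case 3
      have w: "weak_type (4/3) (- 1/3) TYPE('a)"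
      proof -
        have "weak_type (4/3) (3 * (4/3 - 1) - 4/3) TYPE('a)"
          by (rule weak_type_endpoint[of 4]) (use 3 in simp_all)
        then show ?thesis by simp
      qed
      show ?thesis
      proof (cases "r \<le> 4/3")
        case True
        have eq: "r * gamma_exp (DIM('a)) (ereal r) = 2 * r - 3"
          using 3 r True by (simp add: gamma_exp_def Let_def ereal_le_simps field_simps)
        show ?thesis unfolding eq by (rule seg[OF w1 w r True]) simp_all
      next
        case False
        have eq: "r * gamma_exp (DIM('a)) (ereal r) = 1/2 * r - 1"
          using 3 r False r2 by (simp add: gamma_exp_def Let_def ereal_le_simps field_simps)
        show ?thesis unfolding eq by (rule seg[OF w w2 _ r2]) (use False in simp_all)
      qed
    qed
  qed
qed

text \<open>The passage from weak to strong type divides by p - 1, so r = 1 is taken from the L^1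
  bound directly. The summand r in the exponent is the missing normalisation by the shell
  volume.\<close>

lemma strong_type_gamma:
  assumes dim: "2 \<le> DIM('a::euclidean_space)" and r: "1 \<le> r" and \<epsilon>: "0 < \<epsilon>"
  shows "\<exists>C>0. \<forall>\<delta> (g::'a \<Rightarrow> real). 0 < \<delta> \<longrightarrow> \<delta> < 1/2 \<longrightarrow> g \<in> borel_measurable borel \<longrightarrow> (\<forall>z. 0 \<le> g z) \<longrightarrow>
     (\<integral>\<^sup>+x. ennpow (cap_max (shell \<delta> 0) g x) r \<partial>lborel)
       \<le> ennreal (C * \<delta> powr (r + r * gamma_exp (DIM('a)) (ereal r) - \<epsilon>)) * (\<integral>\<^sup>+z. ennreal (g z powr r) \<partial>lborel)"
proof (cases "r = 1")
  case False
  have "r * gamma_exp (DIM('a)) (ereal r) \<le> 0"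
    using r gamma_exp_nonpos[of "ereal r"] by (intro mult_nonneg_nonpos) auto
  then show ?thesis using False r by (intro strong_type[OF weak_type_gamma[OF dim r] _ _ \<epsilon>]) auto
next
  case True
  have \<gamma>: "r + r * gamma_exp (DIM('a)) (ereal r) - \<epsilon> = - \<epsilon>"
    unfolding True gamma_exp_def Let_def ereal_le_simps by simp
  obtain C where C: "0 < C" "\<And>\<delta> (g::'a \<Rightarrow> real). \<delta> < 1/2 \<Longrightarrow> g \<in> borel_measurable borel \<Longrightarrow>
     (\<integral>\<^sup>+x. cap_max (shell \<delta> 0) g x \<partial>lborel) \<le> ennreal C * (\<integral>\<^sup>+z. ennreal (g z) \<partial>lborel)"
    using nn_integral_cap_max_le by blast
  have "(\<integral>\<^sup>+x. ennpow (cap_max (shell \<delta> 0) g x) r \<partial>lborel) \<le> ennreal (C * \<delta> powr (- \<epsilon>)) * (\<integral>\<^sup>+z. ennreal (g z powr r) \<partial>lborel)"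
    if h: "0 < \<delta>" "\<delta> < 1/2" "g \<in> borel_measurable borel" "\<forall>z. 0 \<le> g z" for \<delta> and g :: "'a \<Rightarrow> real"
  proof -
    have "ennpow y r = y" for y using True by (cases y) (auto simp: ennpow_def)
    then have "(\<integral>\<^sup>+x. ennpow (cap_max (shell \<delta> 0) g x) r \<partial>lborel) \<le> ennreal C * (\<integral>\<^sup>+z. ennreal (g z powr r) \<partial>lborel)"
      using C(2)[OF h(2,3)] h(4) True by simp
    also have "\<dots> \<le> ennreal (C * \<delta> powr (- \<epsilon>)) * (\<integral>\<^sup>+z. ennreal (g z powr r) \<partial>lborel)"
    proof (intro mult_right_mono ennreal_leI)
      have "\<delta> powr 0 \<le> \<delta> powr (- \<epsilon>)" using h \<epsilon> by (intro powr_mono') auto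
      then have "C * 1 \<le> C * \<delta> powr (- \<epsilon>)" using C(1) h by (intro mult_left_mono) auto
      then show "C \<le> C * \<delta> powr (- \<epsilon>)" by simp
    qed simp
    finally show ?thesis .
  qed
  then show ?thesis unfolding \<gamma> using C(1) by (intro exI[of _ C]) blast
qed

lemma N_opnorm_upper_finite:
  assumes dim: "2 \<le> DIM('a::euclidean_space)" and r: "1 \<le> r" and \<epsilon>: "0 < \<epsilon>"
  shows "\<exists>C::real. \<forall>\<delta>\<in>{0<..<1/2}. N_opnorm (ereal r) \<delta> TYPE('a) \<le> ennreal (C * \<delta> powr (-\<epsilon>) * \<delta> powr gamma_exp (DIM('a)) (ereal r))"
proof -
  define \<gamma> where "\<gamma> = gamma_exp (DIM('a)) (ereal r)"
  \<comment> \<open>The loss is taken as r \<epsilon>, because the final r-th root divides exponents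
    by r.\<close>
  obtain C where C: "0 < C" "\<And>\<delta> (g::'a \<Rightarrow> real). 0 < \<delta> \<Longrightarrow> \<delta> < 1/2 \<Longrightarrow> g \<in> borel_measurable borel \<Longrightarrow> \<forall>z. 0 \<le> g z \<Longrightarrow>
     (\<integral>\<^sup>+x. ennpow (cap_max (shell \<delta> 0) g x) r \<partial>lborel) \<le> ennreal (C * \<delta> powr (r + r * \<gamma> - r * \<epsilon>)) * (\<integral>\<^sup>+z. ennreal (g z powr r) \<partial>lborel)"
    using strong_type_gamma[OF dim r, of "r * \<epsilon>"] r \<epsilon> unfolding \<gamma>_def by auto
  obtain c where c: "0 < c" "\<And>\<delta>. \<delta> \<in> {0<..<1/2} \<Longrightarrow> c * \<delta> \<le> measure lebesgue (sphere_nbhd \<delta> :: 'a set)"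
    using measure_sphere_nbhd_ge by blast
  define C' where "C' = (C * (1 / c) powr r) powr (1 / r)"
  have "N_opnorm (ereal r) \<delta> TYPE('a) \<le> ennreal (C' * \<delta> powr (-\<epsilon>) * \<delta> powr \<gamma>)" if \<delta>': "\<delta> \<in> {0<..<1/2}" for \<delta>
    unfolding N_opnorm_def
  proof (rule SUP_least)
    have \<delta>: "0 < \<delta>" "\<delta> < 1/2" using \<delta>' by auto
    fix f :: "'a \<Rightarrow> real" assume "f \<in> {f. f \<in> borel_measurable lebesgue \<and> Lpnorm (ereal r) (\<lambda>x. ennreal \<bar>f x\<bar>) \<le> 1}"
    then have f: "f \<in> borel_measurable lebesgue" and fL: "Lpnorm (ereal r) (\<lambda>x. ennreal \<bar>f x\<bar>) \<le> 1" by auto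
    obtain g0 where g0 [measurable]: "g0 \<in> borel_measurable borel" and fg0: "AE z in lborel. f z = g0 z"
      using borel_representative[OF f] by blast
    define g where "g = (\<lambda>z. \<bar>g0 z\<bar>)"
    have g [measurable]: "g \<in> borel_measurable borel" unfolding g_def by measurable
    have fg: "AE z in lborel. \<bar>f z\<bar> = g z" using fg0 by eventually_elim (simp add: g_def)
    have fI: "(\<integral>\<^sup>+z. ennpow (ennreal \<bar>f z\<bar>) r \<partial>lebesgue) \<le> 1"
    proof (rule ennpow_le_one)
      show "ennpow (\<integral>\<^sup>+z. ennpow (ennreal \<bar>f z\<bar>) r \<partial>lebesgue) (1 / r) \<le> 1"
        using fL by (simp add: Lpnorm_def)
    qed (use r in simp)
    have "(\<integral>\<^sup>+z. ennreal (g z powr r) \<partial>lborel) = (\<integral>\<^sup>+z. ennpow (ennreal \<bar>g0 z\<bar>) r \<partial>lborel)"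
      by (intro nn_integral_cong) (simp add: ennpow_ennreal g_def)
    moreover have "(\<integral>\<^sup>+z. ennpow (ennreal \<bar>f z\<bar>) r \<partial>lebesgue) = (\<integral>\<^sup>+z. ennpow (ennreal \<bar>g0 z\<bar>) r \<partial>lborel)"
      unfolding nn_integral_completion
    proof (rule nn_integral_cong_AE)
      show "AE z in lborel. ennpow (ennreal \<bar>f z\<bar>) r = ennpow (ennreal \<bar>g0 z\<bar>) r"
        using fg0 by eventually_elim simp
    qed
    ultimately have G: "(\<integral>\<^sup>+z. ennreal (g z powr r) \<partial>lborel) \<le> 1" using fI by (simp only:)
    let ?k = "1 / (c * \<delta>)"
    have k: "0 < ?k" using c \<delta> by simp
    have [measurable]: "cap_max (shell \<delta> 0) g \<in> borel_measurable borel" by (rule cap_max_measurable[OF open_shell g])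
    \<comment> \<open>Monotonicity of \<open>nn_integral\<close> holds for arbitrary functions; the
      majorant on the right is Borel.\<close>
    have "(\<integral>\<^sup>+x. ennpow (N_op \<delta> f x) r \<partial>lebesgue) \<le> (\<integral>\<^sup>+x. ennpow (cap_max (shell \<delta> 0) g x * ennreal ?k) r \<partial>lebesgue)"
    proof (rule nn_integral_mono)
      fix x
      have "N_op \<delta> f x \<le> cap_max (shell \<delta> 0) g x * ennreal ?k"
        by (rule N_op_le_cap_max[OF \<delta> g fg]) (use c(1) c(2)[OF \<delta>'] \<delta> in auto)
      then show "ennpow (N_op \<delta> f x) r \<le> ennpow (cap_max (shell \<delta> 0) g x * ennreal ?k) r"
        using r by (intro ennpow_mono) auto
    qed
    also have "\<dots> = (\<integral>\<^sup>+x. ennpow (cap_max (shell \<delta> 0) g x) r * ennreal (?k powr r) \<partial>lborel)"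
      unfolding nn_integral_completion using r by (intro nn_integral_cong ennpow_mult[OF k]) auto
    also have "\<dots> = (\<integral>\<^sup>+x. ennpow (cap_max (shell \<delta> 0) g x) r \<partial>lborel) * ennreal (?k powr r)"
      by (rule nn_integral_multc) measurable
    also have "\<dots> \<le> (ennreal (C * \<delta> powr (r + r * \<gamma> - r * \<epsilon>)) * 1) * ennreal (?k powr r)"
    proof (rule mult_right_mono)
      have "(\<integral>\<^sup>+x. ennpow (cap_max (shell \<delta> 0) g x) r \<partial>lborel) \<le> ennreal (C * \<delta> powr (r + r * \<gamma> - r * \<epsilon>)) * (\<integral>\<^sup>+z. ennreal (g z powr r) \<partial>lborel)"
        by (rule C(2)[OF \<delta> g]) (simp add: g_def)
      also have "\<dots> \<le> ennreal (C * \<delta> powr (r + r * \<gamma> - r * \<epsilon>)) * 1" by (intro mult_left_mono G) simp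
      finally show "(\<integral>\<^sup>+x. ennpow (cap_max (shell \<delta> 0) g x) r \<partial>lborel) \<le> ennreal (C * \<delta> powr (r + r * \<gamma> - r * \<epsilon>)) * 1" .
    qed simp
    also have "\<dots> = ennreal (C * \<delta> powr (r + r * \<gamma> - r * \<epsilon>) * ?k powr r)"
      unfolding mult_1_right using C(1) by (intro ennreal_mult[symmetric]) auto
    also have "C * \<delta> powr (r + r * \<gamma> - r * \<epsilon>) * ?k powr r = (C * (1 / c) powr r) * \<delta> powr (r * (\<gamma> - \<epsilon>))"
    proof -
      have "?k = 1 / c * (1 / \<delta>)" by simp
      then have kr: "?k powr r = (1 / c) powr r * \<delta> powr (- r)"
        using c \<delta> by (simp add: powr_mult powr_divide powr_minus_divide)
      have dr: "\<delta> powr (r + r * \<gamma> - r * \<epsilon>) * \<delta> powr (- r) = \<delta> powr (r * (\<gamma> - \<epsilon>))"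
        by (simp add: powr_add[symmetric] algebra_simps)
      show ?thesis unfolding kr dr[symmetric] by (simp only: mult_ac)
    qed
    finally have int: "(\<integral>\<^sup>+x. ennpow (N_op \<delta> f x) r \<partial>lebesgue) \<le> ennreal ((C * (1 / c) powr r) * \<delta> powr (r * (\<gamma> - \<epsilon>)))" .
    have "Lpnorm (ereal r) (N_op \<delta> f) = ennpow (\<integral>\<^sup>+x. ennpow (N_op \<delta> f x) r \<partial>lebesgue) (1 / r)"
      by (simp add: Lpnorm_def)
    also have "\<dots> \<le> ennpow (ennreal ((C * (1 / c) powr r) * \<delta> powr (r * (\<gamma> - \<epsilon>)))) (1 / r)"
      by (rule ennpow_mono[OF int]) (use r in simp)
    also have "\<dots> = ennreal (((C * (1 / c) powr r) * \<delta> powr (r * (\<gamma> - \<epsilon>))) powr (1 / r))"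
      using C(1) by (intro ennpow_ennreal) auto
    also have "((C * (1 / c) powr r) * \<delta> powr (r * (\<gamma> - \<epsilon>))) powr (1 / r) = C' * \<delta> powr (\<gamma> - \<epsilon>)"
      using C(1) c(1) \<delta> r by (simp add: powr_mult powr_powr C'_def)
    also have "\<dots> = C' * \<delta> powr (-\<epsilon>) * \<delta> powr \<gamma>" by (simp add: powr_add[symmetric])
    finally show "Lpnorm (ereal r) (N_op \<delta> f) \<le> ennreal (C' * \<delta> powr (-\<epsilon>) * \<delta> powr \<gamma>)" .
  qed
  then show ?thesis unfolding \<gamma>_def by blast
qed

section \<open>The endpoint at infinity and test sets\<close>

lemma lebesgue_measurable_translate:
  fixes c :: "'a::euclidean_space"
  shows "(\<lambda>x. c + x) \<in> lebesgue \<rightarrow>\<^sub>M lebesgue"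
proof -
  have "(\<lambda>x. c + (\<Sum>j\<in>Basis. (1 * (x \<bullet> j)) *\<^sub>R j)) \<in> lebesgue \<rightarrow>\<^sub>M lebesgue"
    by (rule lebesgue_affine_measurable) simp
  then show ?thesis by (simp add: euclidean_representation)
qed

lemma cap_avg_translate:
  fixes c :: "'a::euclidean_space"
  assumes [measurable]: "W \<in> sets borel" "g \<in> borel_measurable borel"
  shows "cap_avg W g c = (\<integral>\<^sup>+y. indicator W y * ennreal (g (c + y)) \<partial>lborel)"
proof -
  have "(\<integral>\<^sup>+y. indicator {z. z - c \<in> W} (c + y) * ennreal (g (c + y)) \<partial>lborel) = cap_avg W g c"
    unfolding cap_avg_def by (rule nn_integral_lborel_translate) measurable
  then show ?thesis by (simp add: indicator_def)
qed

lemma measure_sphere_nbhd_shell: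
  assumes "0 < \<delta>" "\<delta> < 1/2"
  shows "measure lebesgue (sphere_nbhd \<delta> :: 'a::euclidean_space set) = measure lborel (shell \<delta> 0 :: 'a set)"
    "0 < measure lebesgue (sphere_nbhd \<delta> :: 'a set)"
    "emeasure lborel (shell \<delta> 0 :: 'a set) = ennreal (measure lebesgue (sphere_nbhd \<delta> :: 'a set))"
proof -
  show 1: "measure lebesgue (sphere_nbhd \<delta> :: 'a set) = measure lborel (shell \<delta> 0 :: 'a set)"
    using assms by (simp add: sphere_nbhd_eq_shell)
  obtain c where c: "0 < c" "\<And>\<delta>. \<delta> \<in> {0<..<1/2} \<Longrightarrow> c * \<delta> \<le> measure lebesgue (sphere_nbhd \<delta> :: 'a set)"
    using measure_sphere_nbhd_ge by blast
  have "0 < c * \<delta>" using c(1) assms by simp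
  also have "\<dots> \<le> measure lebesgue (sphere_nbhd \<delta> :: 'a set)" using assms by (intro c(2)) auto
  finally show "0 < measure lebesgue (sphere_nbhd \<delta> :: 'a set)" .
  obtain C where "emeasure lborel (shell \<delta> 0 :: 'a set) \<le> ennreal (C * \<delta>)"
    using emeasure_shell_le[where 'a='a] assms by blast
  then have "emeasure lborel (shell \<delta> 0 :: 'a set) \<noteq> \<infinity>" by (auto simp: top_unique)
  then show "emeasure lborel (shell \<delta> 0 :: 'a set) = ennreal (measure lebesgue (sphere_nbhd \<delta> :: 'a set))"
    unfolding 1 by (intro emeasure_eq_ennreal_measure) auto
qed

text \<open>\<open>esssup_I\<close> asks for measurability of the maximal function itself, with the
  absolute value outside the integral. Since |g| \<le> 1, the functions 1 + g and 1 - g are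
  nonnegative with averages m + J and m - J, so the condition |J| > a m becomes a union of two
  superlevel sets of \<open>cap_avg\<close>, which are open in the centre.\<close>

lemma N_op_bounded:
  fixes f :: "'a::euclidean_space \<Rightarrow> real"
  assumes \<delta>: "0 < \<delta>" "\<delta> < 1/2" and f: "f \<in> borel_measurable lebesgue" and f1: "AE z in lborel. \<bar>f z\<bar> \<le> 1"
  shows "N_op \<delta> f \<in> borel_measurable borel" "N_op \<delta> f x \<le> 1"
proof -
  obtain g0 where g0 [measurable]: "g0 \<in> borel_measurable borel" and fg0: "AE z in lborel. f z = g0 z"
    using borel_representative[OF f] by blast
  \<comment> \<open>Clipping to [-1, 1] changes g0 on a null set only and makes the bound hold
    everywhere.\<close>
  define g where "g = (\<lambda>z. max (-1) (min 1 (g0 z)))"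
  have g [measurable]: "g \<in> borel_measurable borel" unfolding g_def by measurable
  have g1: "\<bar>g z\<bar> \<le> 1" for z by (auto simp: g_def)
  have fg: "AE z in lborel. f z = g z" using fg0 f1 by eventually_elim (auto simp: g_def)
  define m where "m = measure lebesgue (sphere_nbhd \<delta> :: 'a set)"
  note ms = measure_sphere_nbhd_shell[OF \<delta>, where 'a='a, folded m_def]
  define J where "J = (\<lambda>c. integral\<^sup>L lborel (\<lambda>y. indicator (shell \<delta> 0) y * g (c + y)))"
  have J: "set_lebesgue_integral lebesgue (sphere_nbhd \<delta>) (\<lambda>y. f (c + y)) = J c" for c
  proof -
    have S: "sphere_nbhd \<delta> = (shell \<delta> 0 :: 'a set)" using \<delta> by (intro sphere_nbhd_eq_shell) auto
    have "set_lebesgue_integral lebesgue (sphere_nbhd \<delta>) (\<lambda>y. f (c + y)) = integral\<^sup>L lebesgue (\<lambda>y. indicator (shell \<delta> 0) y * g (c + y))"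
      unfolding set_lebesgue_integral_def S real_scaleR_def
    proof (rule integral_cong_AE)
      have fm: "(\<lambda>y. f (c + y)) \<in> borel_measurable lebesgue"
        using measurable_compose[OF lebesgue_measurable_translate f] .
      show "(\<lambda>y. indicator (shell \<delta> 0) y * f (c + y)) \<in> borel_measurable lebesgue"
        using fm by (intro borel_measurable_times borel_measurable_indicator) auto
      show "(\<lambda>y. indicator (shell \<delta> 0) y * g (c + y)) \<in> borel_measurable lebesgue"
        by (intro measurable_completion) measurable
      show "AE y in lebesgue. indicator (shell \<delta> 0) y * f (c + y) = indicator (shell \<delta> 0) y * g (c + y)"
        using AE_completion[OF AE_lborel_translate[OF fg, of c]] by eventually_elim simp
    qed
    also have "\<dots> = J c" unfolding J_def by (rule integral_completion) measurable
    finally show ?thesis .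
  qed
  have int1: "integrable lborel (indicator (shell \<delta> 0) :: 'a \<Rightarrow> real)"
    using ms(3) by (intro integrable_real_indicator) auto
  have intg: "integrable lborel (\<lambda>y. indicator (shell \<delta> 0) y * g (c + y))" for c
    by (rule Bochner_Integration.integrable_bound[OF int1])
      (use g1 in \<open>auto simp: abs_mult split: split_indicator intro!: AE_I2\<close>)
  have int_one: "integral\<^sup>L lborel (indicator (shell \<delta> 0) :: 'a \<Rightarrow> real) = m" using ms(1) by simp
  have avg: "cap_avg (shell \<delta> 0) (\<lambda>z. 1 + s * g z) c = ennreal (m + s * J c)" if s: "\<bar>s\<bar> \<le> 1" for s c
  proof -
    have nn: "0 \<le> 1 + s * g z" for z
    proof -
      have "\<bar>s * g z\<bar> \<le> 1 * 1" unfolding abs_mult using s g1 by (intro mult_mono) auto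
      then show ?thesis by (simp add: abs_le_iff)
    qed
    have "cap_avg (shell \<delta> 0) (\<lambda>z. 1 + s * g z) c = (\<integral>\<^sup>+y. ennreal (indicator (shell \<delta> 0) y + s * (indicator (shell \<delta> 0) y * g (c + y))) \<partial>lborel)"
      by (subst cap_avg_translate) (auto intro!: nn_integral_cong split: split_indicator)
    also have "\<dots> = ennreal (integral\<^sup>L lborel (\<lambda>y. indicator (shell \<delta> 0) y + s * (indicator (shell \<delta> 0) y * g (c + y))))"
      using int1 intg nn by (intro nn_integral_eq_integral) (auto split: split_indicator)
    also have "integral\<^sup>L lborel (\<lambda>y. indicator (shell \<delta> 0) y + s * (indicator (shell \<delta> 0) y * g (c + y))) = m + s * J c"
      using int1 intg int_one by (simp add: J_def)
    finally show ?thesis .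
  qed
  have Jm: "\<bar>J c\<bar> \<le> m" for c
  proof -
    have "\<bar>J c\<bar> \<le> integral\<^sup>L lborel (\<lambda>y. \<bar>indicator (shell \<delta> 0) y * g (c + y)\<bar>)"
      unfolding J_def by (rule integral_abs_bound)
    also have "\<dots> \<le> integral\<^sup>L lborel (indicator (shell \<delta> 0) :: 'a \<Rightarrow> real)"
    proof (rule integral_mono[OF integrable_abs[OF intg] int1])
      show "\<bar>indicator (shell \<delta> 0) y * g (c + y)\<bar> \<le> indicator (shell \<delta> 0) y" for y
        using g1 by (auto simp: abs_mult split: split_indicator)
    qed
    finally show ?thesis unfolding int_one .
  qed
  have N: "N_op \<delta> f x = (SUP u\<in>sphere 0 1. ennreal (\<bar>J (x + u)\<bar> / m))" for x
    unfolding N_op_def J m_def ..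
  show "N_op \<delta> f x \<le> 1"
    unfolding N using Jm ms(2) by (intro SUP_least) (simp add: ennreal_le_1)
  show "N_op \<delta> f \<in> borel_measurable borel"
  proof (rule borel_measurableI_greater)
    fix y :: ennreal
    have "open {x. y < N_op \<delta> f x}"
    proof (cases y)
      case top
      then show ?thesis by simp
    next
      case (real a)
      have lev: "y < ennreal (\<bar>J c\<bar> / m) \<longleftrightarrow>
         ennreal (m + a * m) < cap_avg (shell \<delta> 0) (\<lambda>z. 1 + 1 * g z) c \<or> ennreal (m + a * m) < cap_avg (shell \<delta> 0) (\<lambda>z. 1 + (-1) * g z) c" for c
      proof -
        have "y < ennreal (\<bar>J c\<bar> / m) \<longleftrightarrow> a * m < \<bar>J c\<bar>"
          using real ms(2) by (simp add: ennreal_less_iff pos_less_divide_eq)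
        also have "\<dots> \<longleftrightarrow> m + a * m < m + 1 * J c \<or> m + a * m < m + (-1) * J c" by (auto simp: abs_if)
        also have "\<dots> \<longleftrightarrow> ennreal (m + a * m) < ennreal (m + 1 * J c) \<or> ennreal (m + a * m) < ennreal (m + (-1) * J c)"
          using real ms(2) by (subst (1 2) ennreal_less_iff) auto
        finally show ?thesis by (simp only: avg abs_one abs_minus_cancel order_refl)
      qed
      have "{x. y < N_op \<delta> f x} = (\<Union>u\<in>sphere 0 1. {x. ennreal (m + a * m) < cap_avg (shell \<delta> 0) (\<lambda>z. 1 + 1 * g z) (x + u)}
          \<union> {x. ennreal (m + a * m) < cap_avg (shell \<delta> 0) (\<lambda>z. 1 + (-1) * g z) (x + u)})"
        unfolding N less_SUP_iff lev by blast
      moreover have "open {x. ennreal (m + a * m) < cap_avg (shell \<delta> 0) (\<lambda>z. 1 + s * g z) (x + u)}" for s u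
        by (rule open_cap_avg_shift(1)[OF open_shell]) measurable
      ultimately show ?thesis by (auto simp only: intro!: open_UN open_Un)
    qed
    then show "{x \<in> space borel. y < N_op \<delta> f x} \<in> sets borel" by simp
  qed
qed

lemma N_opnorm_infinity_le:
  assumes \<delta>: "0 < \<delta>" "\<delta> < 1/2"
  shows "N_opnorm \<infinity> \<delta> TYPE('a::euclidean_space) \<le> 1"
  unfolding N_opnorm_def
proof (rule SUP_least)
  fix f :: "'a \<Rightarrow> real" assume "f \<in> {f. f \<in> borel_measurable lebesgue \<and> Lpnorm \<infinity> (\<lambda>x. ennreal \<bar>f x\<bar>) \<le> 1}"
  then have f: "f \<in> borel_measurable lebesgue" and fL: "esssup lebesgue (\<lambda>x. ennreal \<bar>f x\<bar>) \<le> 1" by (auto simp: Lpnorm_def)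
  have "AE x in lebesgue. \<bar>f x\<bar> \<le> 1"
    using esssup_AE[of "\<lambda>x. ennreal \<bar>f x\<bar>" lebesgue]
  proof eventually_elim
    case (elim x)
    then have "ennreal \<bar>f x\<bar> \<le> 1" using fL by (rule order_trans)
    then show ?case by simp
  qed
  then have "AE x in lborel. \<bar>f x\<bar> \<le> 1" by (simp only: AE_completion_iff)
  note * = N_op_bounded[OF \<delta> f this]
  show "Lpnorm \<infinity> (N_op \<delta> f) \<le> 1"
    unfolding Lpnorm_def using * by (auto intro!: esssup_I measurable_completion)
qed

lemma N_opnorm_infinity_ge:
  assumes \<delta>: "0 < \<delta>" "\<delta> < 1/2"
  shows "1 \<le> N_opnorm \<infinity> \<delta> TYPE('a::euclidean_space)"
proof -
  let ?f = "\<lambda>_::'a. 1::real"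
  have S: "sphere_nbhd \<delta> = (shell \<delta> 0 :: 'a set)" using \<delta> by (intro sphere_nbhd_eq_shell) auto
  have "set_lebesgue_integral lebesgue (sphere_nbhd \<delta> :: 'a set) (\<lambda>y. 1::real) = measure lebesgue (sphere_nbhd \<delta> :: 'a set)"
    unfolding set_lebesgue_integral_def S by simp
  then have "N_op \<delta> ?f x = (SUP u\<in>sphere (0::'a) 1. 1)" for x
    unfolding N_op_def using measure_sphere_nbhd_shell(2)[OF \<delta>, where 'a='a] by simp
  moreover have "sphere (0::'a) 1 \<noteq> {}" by simp
  ultimately have N: "N_op \<delta> ?f = (\<lambda>_. 1)" by (auto simp: fun_eq_iff)
  have "1 \<le> esssup lebesgue (\<lambda>_::'a. 1::ennreal)"
  proof -
    have "AE x::'a in lebesgue. 1 \<le> esssup lebesgue (\<lambda>_::'a. 1::ennreal)"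
      using esssup_AE[of "\<lambda>_::'a. 1::ennreal" lebesgue] by simp
    moreover have "ae_filter (lebesgue :: 'a measure) \<noteq> bot"
      by (simp add: ae_filter_eq_bot_iff)
    ultimately show ?thesis by (simp add: eventually_const)
  qed
  then have "1 \<le> Lpnorm \<infinity> (N_op \<delta> ?f)" by (simp add: Lpnorm_def N)
  moreover have "Lpnorm \<infinity> (\<lambda>x. ennreal \<bar>?f x\<bar>) \<le> 1"
    unfolding Lpnorm_def by (auto intro!: esssup_I)
  ultimately show ?thesis
    unfolding N_opnorm_def by (intro SUP_upper2[of ?f]) auto
qed

text \<open>Test on the indicator of \<open>E\<close> divided by its L^r norm |E|^(1/r). For every x
  in \<open>B\<close> some admissible shell meets \<open>E\<close> in measure at least m, so the
  maximal function is at least m |E|^(-1/r) over the shell volume on a set of measure w.\<close>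

lemma N_opnorm_test_set:
  fixes E B :: "'a::euclidean_space set"
  assumes \<delta>: "0 < \<delta>" "\<delta> < 1/2" and r: "1 \<le> r"
    and E [measurable]: "E \<in> sets borel" and B [measurable]: "B \<in> sets borel"
    and v: "0 < v" "emeasure lborel E = ennreal v" and w: "0 \<le> w" "emeasure lborel B = ennreal w"
    and m: "0 \<le> m" "\<And>x. x \<in> B \<Longrightarrow> \<exists>u\<in>sphere 0 1. ennreal m \<le> emeasure lborel (shell \<delta> (x + u) \<inter> E)"
  shows "ennreal (m / measure lebesgue (sphere_nbhd \<delta> :: 'a set) * (w / v) powr (1 / r)) \<le> N_opnorm (ereal r) \<delta> TYPE('a)"
proof -
  define \<mu> where "\<mu> = measure lebesgue (sphere_nbhd \<delta> :: 'a set)"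
  note ms = measure_sphere_nbhd_shell[OF \<delta>, where 'a='a, folded \<mu>_def]
  have S: "sphere_nbhd \<delta> = (shell \<delta> 0 :: 'a set)" using \<delta> by (intro sphere_nbhd_eq_shell) auto
  define k where "k = v powr (- (1 / r))"
  have k: "0 < k" using v by (simp add: k_def)
  have kr: "k powr r = 1 / v"
  proof -
    have "- (1 / r) * r = - 1" using r by simp
    then have "k powr r = v powr (- 1)" by (simp only: k_def powr_powr)
    then show ?thesis using v by (simp add: powr_minus_divide)
  qed
  define f where "f = (\<lambda>z::'a. k * indicator E z)"
  have [measurable]: "f \<in> borel_measurable borel" unfolding f_def by measurable
  have fm: "f \<in> borel_measurable lebesgue" by (intro measurable_completion) measurable
  have "(\<integral>\<^sup>+x. ennpow (ennreal \<bar>f x\<bar>) r \<partial>lebesgue) = (\<integral>\<^sup>+x. ennreal (k powr r) * indicator E x \<partial>lborel)"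
    unfolding nn_integral_completion using k r
    by (intro nn_integral_cong) (auto simp: f_def ennpow_def split: split_indicator)
  also have "\<dots> = ennreal (1 / v) * ennreal v" unfolding kr using v(2) by (subst nn_integral_cmult_indicator) auto
  also have "\<dots> = 1" using v by (simp add: ennreal_mult''[symmetric])
  finally have "Lpnorm (ereal r) (\<lambda>x. ennreal \<bar>f x\<bar>) = 1" by (simp add: Lpnorm_def ennpow_def)
  moreover have "ennreal (m / \<mu> * (w / v) powr (1 / r)) \<le> Lpnorm (ereal r) (N_op \<delta> f)"
  proof -
    have N: "ennreal (k * m / \<mu>) \<le> N_op \<delta> f x" if x: "x \<in> B" for x
    proof -
      obtain u where u: "u \<in> sphere 0 1" "ennreal m \<le> emeasure lborel (shell \<delta> (x + u) \<inter> E)"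
        using m(2)[OF x] by blast
      define c where "c = x + u"
      define T where "T = {y. y \<in> shell \<delta> 0 \<and> c + y \<in> E}"
      have T [measurable]: "T \<in> sets borel" unfolding T_def by measurable
      have "emeasure lborel (shell \<delta> c \<inter> E) = (\<integral>\<^sup>+z. indicator (shell \<delta> c \<inter> E) z \<partial>lborel)" by simp
      also have "\<dots> = (\<integral>\<^sup>+z. indicator (shell \<delta> c \<inter> E) (c + z) \<partial>lborel)"
        by (rule nn_integral_lborel_translate[symmetric]) measurable
      also have "\<dots> = (\<integral>\<^sup>+z. indicator T z \<partial>lborel)"
        by (intro nn_integral_cong) (auto simp: T_def mem_shell split: split_indicator)
      also have "\<dots> = emeasure lborel T" by simp
      finally have eT: "emeasure lborel (shell \<delta> c \<inter> E) = emeasure lborel T" .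
      have "emeasure lborel T \<le> emeasure lborel (shell \<delta> 0 :: 'a set)" by (intro emeasure_mono) (auto simp: T_def)
      then have Tfin: "emeasure lborel T \<noteq> \<infinity>" unfolding ms(3) by (auto simp: top_unique)
      then have "ennreal m \<le> ennreal (measure lborel T)"
        using u(2) eT by (simp add: c_def emeasure_eq_ennreal_measure)
      then have mT: "m \<le> measure lborel T" by simp
      have "set_lebesgue_integral lebesgue (sphere_nbhd \<delta>) (\<lambda>y. f (c + y)) = integral\<^sup>L lebesgue (\<lambda>y. k * indicator T y)"
        unfolding set_lebesgue_integral_def S f_def T_def
        by (intro Bochner_Integration.integral_cong) (auto split: split_indicator)
      also have "\<dots> = integral\<^sup>L lborel (\<lambda>y. k * indicator T y)" by (rule integral_completion) measurable
      also have "\<dots> = k * measure lborel T" by simp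
      finally have I: "set_lebesgue_integral lebesgue (sphere_nbhd \<delta>) (\<lambda>y. f (c + y)) = k * measure lborel T" .
      have "k * m / \<mu> \<le> \<bar>set_lebesgue_integral lebesgue (sphere_nbhd \<delta>) (\<lambda>y. f (x + u + y))\<bar> / \<mu>"
        unfolding I[unfolded c_def] using mT k ms(2) by (intro divide_right_mono) (auto simp: abs_mult)
      then have "ennreal (k * m / \<mu>) \<le> ennreal (\<bar>set_lebesgue_integral lebesgue (sphere_nbhd \<delta>) (\<lambda>y. f (x + u + y))\<bar> / \<mu>)"
        by (rule ennreal_leI)
      also have "\<dots> \<le> N_op \<delta> f x" unfolding N_op_def \<mu>_def using u(1) by (rule SUP_upper)
      finally show ?thesis .
    qed
    define K where "K = k * m / \<mu>"
    have K: "0 \<le> K" using k m ms(2) by (simp add: K_def)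
    have "ennreal (K powr r * w) = ennreal (K powr r) * emeasure lborel B" using w by (simp add: ennreal_mult)
    also have "\<dots> = (\<integral>\<^sup>+x. ennreal (K powr r) * indicator B x \<partial>lborel)" by (subst nn_integral_cmult_indicator) auto
    also have "\<dots> \<le> (\<integral>\<^sup>+x. ennpow (N_op \<delta> f x) r \<partial>lborel)"
    proof (rule nn_integral_mono)
      fix x
      show "ennreal (K powr r) * indicator B x \<le> ennpow (N_op \<delta> f x) r"
      proof (cases "x \<in> B")
        case True
        have "ennreal (K powr r) = ennpow (ennreal K) r" using K by (simp add: ennpow_ennreal)
        also have "\<dots> \<le> ennpow (N_op \<delta> f x) r" unfolding K_def using N[OF True] r by (intro ennpow_mono) auto
        finally show ?thesis using True by simp
      qed simp
    qed
    finally have "ennpow (ennreal (K powr r * w)) (1 / r) \<le> ennpow (\<integral>\<^sup>+x. ennpow (N_op \<delta> f x) r \<partial>lborel) (1 / r)"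
      using r by (intro ennpow_mono) auto
    then have "ennreal ((K powr r * w) powr (1 / r)) \<le> Lpnorm (ereal r) (N_op \<delta> f)"
      using w by (simp add: Lpnorm_def nn_integral_completion ennpow_ennreal)
    also have "(K powr r * w) powr (1 / r) = m / \<mu> * (w / v) powr (1 / r)"
    proof -
      have "(K powr r * w) powr (1 / r) = K * w powr (1 / r)"
        using K w r by (simp add: powr_mult powr_powr)
      also have "\<dots> = m / \<mu> * (w powr (1 / r) * k)" by (simp add: K_def)
      also have "w powr (1 / r) * k = (w / v) powr (1 / r)"
        using w v by (simp add: k_def powr_divide powr_minus_divide)
      finally show ?thesis .
    qed
    finally show ?thesis .
  qed
  ultimately show ?thesis
    unfolding N_opnorm_def \<mu>_def using fm by (intro SUP_upper2[of f]) auto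
qed

section \<open>The lower bounds\<close>

text \<open>|s - 1| is at most |s - 1| (s + 1) = |s^2 - 1| for s \<ge> 0, so squared norms, which
  are polynomial in the coordinates, can be used.\<close>

lemma mem_shellI:
  assumes "\<bar>(norm (z - c))\<^sup>2 - 1\<bar> < \<delta>" shows "z \<in> shell \<delta> c"
proof -
  have "\<bar>norm (z - c) - 1\<bar> * 1 \<le> \<bar>norm (z - c) - 1\<bar> * (norm (z - c) + 1)" by (intro mult_left_mono) auto
  also have "\<dots> = \<bar>(norm (z - c) - 1) * (norm (z - c) + 1)\<bar>" by (simp add: abs_mult)
  also have "(norm (z - c) - 1) * (norm (z - c) + 1) = (norm (z - c))\<^sup>2 - 1" by (simp add: algebra_simps power2_eq_square)
  finally show ?thesis using assms by (simp add: mem_shell)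
qed

lemma norm_sq_coordinates:
  fixes z :: "'a::euclidean_space"
  assumes "J \<subseteq> Basis"
  shows "(norm z)\<^sup>2 = (\<Sum>j\<in>J. (z \<bullet> j)\<^sup>2) + (\<Sum>j\<in>Basis - J. (z \<bullet> j)\<^sup>2)"
  unfolding norm_sq_Basis using sum.subset_diff[OF assms finite_Basis] by (simp add: add.commute)

lemma measure_sphere_nbhd_le:
  "\<exists>C>0. \<forall>\<delta>\<in>{0<..<1/2}. measure lebesgue (sphere_nbhd \<delta> :: 'a::euclidean_space set) \<le> C * \<delta>"
proof -
  obtain C where C: "C > 0" "\<And>\<delta> c. 0 < \<delta> \<Longrightarrow> \<delta> < 1/2 \<Longrightarrow> emeasure lborel (shell \<delta> c :: 'a set) \<le> ennreal (C * \<delta>)"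
    using emeasure_shell_le by blast
  have "measure lebesgue (sphere_nbhd \<delta> :: 'a set) \<le> C * \<delta>" if "\<delta> \<in> {0<..<1/2}" for \<delta>
    using C(2)[of \<delta> 0] measure_sphere_nbhd_shell(3)[of \<delta>, where 'a='a] that C(1) by simp
  then show ?thesis using C(1) by blast
qed

lemma emeasure_ball_pos:
  fixes x :: "'a::euclidean_space"
  assumes "0 < \<rho>" obtains w where "0 < w" "emeasure lborel (ball x \<rho>) = ennreal w"
proof (rule that)
  show "0 < measure lborel (ball x \<rho>)" by (rule content_ball_pos[OF assms])
  show "emeasure lborel (ball x \<rho>) = ennreal (measure lborel (ball x \<rho>))"
    using emeasure_lborel_ball_finite[of x \<rho>] by (simp add: emeasure_eq_ennreal_measure)
qed

text \<open>Test on the ball of radius 5: for x in the unit ball every admissible shell lies in it,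
  since 1 + 1 + 3/2 < 5, and the average is full.\<close>

lemma N_opnorm_lower_const:
  assumes r: "1 \<le> r"
  shows "\<exists>c>0. \<forall>\<delta>\<in>{0<..<1/2}. ennreal c \<le> N_opnorm (ereal r) \<delta> TYPE('a::euclidean_space)"
proof -
  obtain v where v: "0 < v" "emeasure lborel (ball (0::'a) 5) = ennreal v" using emeasure_ball_pos[of 5 "0::'a"] by auto
  obtain w where w: "0 < w" "emeasure lborel (ball (0::'a) 1) = ennreal w" using emeasure_ball_pos[of 1 "0::'a"] by auto
  have "ennreal ((w / v) powr (1 / r)) \<le> N_opnorm (ereal r) \<delta> TYPE('a)" if d: "\<delta> \<in> {0<..<1/2}" for \<delta>
  proof -
    have \<delta>: "0 < \<delta>" "\<delta> < 1/2" using d by auto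
    define \<mu> where "\<mu> = measure lebesgue (sphere_nbhd \<delta> :: 'a set)"
    note ms = measure_sphere_nbhd_shell[OF \<delta>, where 'a='a, folded \<mu>_def]
    have "ennreal (\<mu> / \<mu> * (w / v) powr (1 / r)) \<le> N_opnorm (ereal r) \<delta> TYPE('a)"
      unfolding \<mu>_def
    proof (rule N_opnorm_test_set[OF \<delta> r _ _ v])
      show "emeasure lborel (ball (0::'a) 1) = ennreal w" by (rule w(2))
      fix x :: 'a assume x: "x \<in> ball 0 1"
      obtain u :: 'a where u: "norm u = 1" using vector_choose_size[of 1] by auto
      have "shell \<delta> (x + u) \<subseteq> ball 0 5"
      proof
        fix z assume "z \<in> shell \<delta> (x + u)"
        moreover have "norm z \<le> norm (z - (x + u)) + norm (x + u)" using norm_triangle_ineq[of "z - (x + u)" "x + u"] by simp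
        moreover have "norm (x + u) \<le> norm x + norm u" by (rule norm_triangle_ineq)
        ultimately show "z \<in> ball 0 5" using x u \<delta> by (auto simp: mem_shell)
      qed
      then have eq: "shell \<delta> (x + u) \<inter> ball 0 5 = shell \<delta> (x + u)" by blast
      have "emeasure lborel (shell \<delta> (x + u)) = (\<integral>\<^sup>+z. indicator (shell \<delta> (x + u)) z \<partial>lborel)" by simp
      also have "\<dots> = (\<integral>\<^sup>+z. indicator (shell \<delta> (x + u)) (x + u + z) \<partial>lborel)"
        by (rule nn_integral_lborel_translate[symmetric]) measurable
      also have "\<dots> = (\<integral>\<^sup>+z. indicator (shell \<delta> (0::'a)) z \<partial>lborel)"
        by (intro nn_integral_cong) (auto simp: mem_shell split: split_indicator)
      also have "\<dots> = ennreal (measure lebesgue (sphere_nbhd \<delta> :: 'a set))" using ms(3) by (simp add: \<mu>_def)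
      finally show "\<exists>u\<in>sphere 0 1. ennreal (measure lebesgue (sphere_nbhd \<delta> :: 'a set)) \<le> emeasure lborel (shell \<delta> (x + u) \<inter> ball 0 5)"
        using u eq by (intro bexI[of _ u]) auto
    qed (use w in auto)
    then show ?thesis using ms(2) by simp
  qed
  moreover have "0 < (w / v) powr (1 / r)" using v w by simp
  ultimately show ?thesis by blast
qed

lemma centre_exists:
  fixes i j x :: "'a::euclidean_space"
  assumes ij: "i \<in> Basis" "j \<in> Basis" "i \<noteq> j" and \<rho>: "7/10 \<le> \<rho>" "\<rho> \<le> 1" and x: "x \<in> ball (\<rho> *\<^sub>R i) (1/8)"
  obtains \<alpha> \<beta> where "\<alpha>\<^sup>2 + \<beta>\<^sup>2 = \<rho>\<^sup>2" "norm (\<alpha> *\<^sub>R i + \<beta> *\<^sub>R j - x) = 1"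
proof -
  define c where "c = (\<lambda>\<theta>::real. (\<rho> * cos \<theta>) *\<^sub>R i + (\<rho> * sin \<theta>) *\<^sub>R j)"
  have "\<exists>\<theta>\<ge>0. \<theta> \<le> pi \<and> norm (c \<theta> - x) = 1"
  proof (rule IVT')
    show "continuous_on {0..pi} (\<lambda>\<theta>. norm (c \<theta> - x))" unfolding c_def by (intro continuous_intros)
    have d: "norm (\<rho> *\<^sub>R i - x) < 1/8" using x by (simp add: dist_norm)
    then show "norm (c 0 - x) \<le> 1" by (simp add: c_def)
    have "norm (2 * \<rho>) *\<^sub>R norm i \<le> norm (\<rho> *\<^sub>R i - x) + norm (c pi - x)"
      using norm_triangle_ineq4[of "\<rho> *\<^sub>R i - x" "c pi - x"] ij \<rho> by (simp add: c_def flip: scaleR_add_left)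
    then show "1 \<le> norm (c pi - x)" using d \<rho> ij by simp
  qed simp
  then obtain \<theta> where "norm (c \<theta> - x) = 1" by blast
  moreover have "(\<rho> * cos \<theta>)\<^sup>2 + (\<rho> * sin \<theta>)\<^sup>2 = \<rho>\<^sup>2" by (simp add: power_mult_distrib flip: distrib_left)
  ultimately show ?thesis using that unfolding c_def by blast
qed

text \<open>A thin neighbourhood of an \<open>(n-3)\<close>-sphere (a point if \<open>\<rho> = 1\<close>): a circle of unit spheres contains it, and
  those spheres pass through every point of an open set.\<close>
definition core_set :: "real \<Rightarrow> real \<Rightarrow> 'a \<Rightarrow> 'a \<Rightarrow> ('a::euclidean_space) set" where
  "core_set \<delta> \<rho> i j = {z. \<bar>z \<bullet> i\<bar> \<le> \<delta> / 16 \<and> \<bar>z \<bullet> j\<bar> \<le> \<delta> / 16 \<and> \<bar>(norm z)\<^sup>2 - (z \<bullet> i)\<^sup>2 - (z \<bullet> j)\<^sup>2 - (1 - \<rho>\<^sup>2)\<bar> \<le> \<delta> / 4}"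

lemma core_set_borel [measurable]: "core_set \<delta> \<rho> i j \<in> sets borel"
  unfolding core_set_def by measurable

text \<open>For a centre on the circle of radius \<rho>, |z - c|^2 - 1 is the defect in the last
  condition plus the squares of the i- and j-coordinates minus twice their inner product with
  (\<alpha>, \<beta>). The thresholds give at most \<delta>/4 + 2 \<delta>/16 + 4 \<delta>/16 <
  \<delta>.\<close>

lemma core_set_subset_shell:
  fixes i j :: "'a::euclidean_space"
  assumes ij: "i \<in> Basis" "j \<in> Basis" "i \<noteq> j" and \<delta>: "0 < \<delta>" "\<delta> < 1/2" and \<rho>: "\<rho> \<le> 1" "0 \<le> \<rho>" and \<alpha>\<beta>: "\<alpha>\<^sup>2 + \<beta>\<^sup>2 = \<rho>\<^sup>2"
  shows "core_set \<delta> \<rho> i j \<subseteq> shell \<delta> (\<alpha> *\<^sub>R i + \<beta> *\<^sub>R j)"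
proof
  fix z assume z: "z \<in> core_set \<delta> \<rho> i j"
  let ?a = "z \<bullet> i" and ?b = "z \<bullet> j"
  have ab: "\<bar>?a\<bar> \<le> \<delta> / 16" "\<bar>?b\<bar> \<le> \<delta> / 16" using z by (auto simp: core_set_def)
  have "(norm (z - (\<alpha> *\<^sub>R i + \<beta> *\<^sub>R j)))\<^sup>2 = (norm z)\<^sup>2 - 2 * (\<alpha> * ?a + \<beta> * ?b) + (\<alpha>\<^sup>2 + \<beta>\<^sup>2)"
    using ij unfolding power2_norm_eq_inner
    by (simp add: inner_simps inner_Basis inner_commute power2_eq_square algebra_simps)
  then have eq: "(norm (z - (\<alpha> *\<^sub>R i + \<beta> *\<^sub>R j)))\<^sup>2 - 1 = ((norm z)\<^sup>2 - ?a\<^sup>2 - ?b\<^sup>2 - (1 - \<rho>\<^sup>2)) + (?a\<^sup>2 + ?b\<^sup>2) - 2 * (\<alpha> * ?a + \<beta> * ?b)"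
    unfolding \<alpha>\<beta> by simp
  have "\<rho>\<^sup>2 \<le> 1" using \<rho> by (simp add: power_le_one)
  then have "\<alpha>\<^sup>2 \<le> 1" "\<beta>\<^sup>2 \<le> 1" using \<alpha>\<beta> zero_le_power2[of \<alpha>] zero_le_power2[of \<beta>] by linarith+
  then have "\<bar>\<alpha>\<bar> \<le> 1" "\<bar>\<beta>\<bar> \<le> 1" by (auto simp: abs_square_le_1)
  then have 1: "\<bar>\<alpha> * ?a\<bar> \<le> \<delta> / 16" "\<bar>\<beta> * ?b\<bar> \<le> \<delta> / 16"
    using mult_mono[of "\<bar>\<alpha>\<bar>" 1 "\<bar>?a\<bar>" "\<delta> / 16"] mult_mono[of "\<bar>\<beta>\<bar>" 1 "\<bar>?b\<bar>" "\<delta> / 16"] ab by (auto simp: abs_mult)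
  have sq: "t\<^sup>2 \<le> \<delta> / 16" if "\<bar>t\<bar> \<le> \<delta> / 16" for t :: real
  proof -
    have "\<bar>t\<bar> * \<bar>t\<bar> \<le> \<delta> / 16 * 1" using that \<delta> by (intro mult_mono) auto
    then show ?thesis by (simp add: power2_eq_square flip: abs_mult)
  qed
  have 2: "0 \<le> ?a\<^sup>2" "0 \<le> ?b\<^sup>2" "?a\<^sup>2 \<le> \<delta> / 16" "?b\<^sup>2 \<le> \<delta> / 16" using sq ab by auto
  have 3: "\<bar>(norm z)\<^sup>2 - ?a\<^sup>2 - ?b\<^sup>2 - (1 - \<rho>\<^sup>2)\<bar> \<le> \<delta> / 4" using z by (simp add: core_set_def)
  have "\<bar>(norm (z - (\<alpha> *\<^sub>R i + \<beta> *\<^sub>R j)))\<^sup>2 - 1\<bar> < \<delta>"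
  proof -
    have *: "\<bar>A + (p + q) - 2 * (s + t)\<bar> < \<delta>"
      if "\<bar>s\<bar> \<le> \<delta> / 16" "\<bar>t\<bar> \<le> \<delta> / 16" "0 \<le> p" "0 \<le> q" "p \<le> \<delta> / 16" "q \<le> \<delta> / 16" "\<bar>A\<bar> \<le> \<delta> / 4" for A p q s t
    proof -
      have "s \<le> \<delta> / 16" "- s \<le> \<delta> / 16" "t \<le> \<delta> / 16" "- t \<le> \<delta> / 16" "A \<le> \<delta> / 4" "- A \<le> \<delta> / 4"
        using that(1,2,7) by (auto simp only: abs_le_iff)
      then have "A + (p + q) - 2 * (s + t) < \<delta>" "- (A + (p + q) - 2 * (s + t)) < \<delta>" using that(3-6) \<delta>(1) by argo+
      then show ?thesis by (simp only: abs_less_iff)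
    qed
    show ?thesis unfolding eq by (rule *[OF 1 2 3])
  qed
  then show "z \<in> shell \<delta> (\<alpha> *\<^sub>R i + \<beta> *\<^sub>R j)" by (rule mem_shellI)
qed

text \<open>The test set lies in a whole shell for each x, so m is its volume v and the bound is of
  order v^(1 - 1/r)/\<delta>. As r \<ge> 1 this increases with v, and a lower bound of order
  \<delta>^a suffices. The values a = 2, 5/2, 3 reproduce the branches of \<open>gamma_exp\<close>
  for small p.\<close>

lemma N_opnorm_lower_core:
  assumes r: "1 \<le> r" and a: "0 < c0"
    and ij: "i \<in> Basis" "j \<in> Basis" "i \<noteq> (j::'a::euclidean_space)" and \<rho>: "7/10 \<le> \<rho>" "\<rho> \<le> 1"
    and vol: "\<And>\<delta>. 0 < \<delta> \<Longrightarrow> \<delta> < 1/2 \<Longrightarrow> ennreal (c0 * \<delta> powr a) \<le> emeasure lborel (core_set \<delta> \<rho> i j)"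
  shows "\<exists>c>0. \<forall>\<delta>\<in>{0<..<1/2}. ennreal (c * \<delta> powr (a * (1 - 1 / r) - 1)) \<le> N_opnorm (ereal r) \<delta> TYPE('a)"
proof -
  obtain w where w: "0 < w" "emeasure lborel (ball (\<rho> *\<^sub>R i) (1/8)) = ennreal w" using emeasure_ball_pos[of "1/8" "\<rho> *\<^sub>R i"] by auto
  obtain C where C: "0 < C" "\<And>\<delta>. \<delta> \<in> {0<..<1/2} \<Longrightarrow> measure lebesgue (sphere_nbhd \<delta> :: 'a set) \<le> C * \<delta>"
    using measure_sphere_nbhd_le by blast
  define c where "c = c0 powr (1 - 1 / r) * w powr (1 / r) / C"
  have "ennreal (c * \<delta> powr (a * (1 - 1 / r) - 1)) \<le> N_opnorm (ereal r) \<delta> TYPE('a)" if d: "\<delta> \<in> {0<..<1/2}" for \<delta>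
  proof -
    have \<delta>: "0 < \<delta>" "\<delta> < 1/2" using d by auto
    let ?E = "core_set \<delta> \<rho> i j"
    define \<mu> where "\<mu> = measure lebesgue (sphere_nbhd \<delta> :: 'a set)"
    have \<mu>: "0 < \<mu>" "\<mu> \<le> C * \<delta>" unfolding \<mu>_def using measure_sphere_nbhd_shell(2)[OF \<delta>] C(2)[OF d] by auto
    have sub: "?E \<subseteq> shell \<delta> (\<alpha> *\<^sub>R i + \<beta> *\<^sub>R j)" if "\<alpha>\<^sup>2 + \<beta>\<^sup>2 = \<rho>\<^sup>2" for \<alpha> \<beta>
      using \<rho> by (intro core_set_subset_shell ij \<delta> that) auto
    have "emeasure lborel ?E \<le> emeasure lborel (shell \<delta> (\<rho> *\<^sub>R i + 0 *\<^sub>R j))" by (intro emeasure_mono sub) auto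
    also have "\<dots> < \<infinity>"
    proof -
      obtain C' where "emeasure lborel (shell \<delta> (\<rho> *\<^sub>R i + 0 *\<^sub>R j)) \<le> ennreal C'"
        using emeasure_shell_le[where 'a='a] \<delta> by blast
      then show ?thesis by (auto intro: le_less_trans)
    qed
    finally obtain v where v: "emeasure lborel ?E = ennreal v" "0 \<le> v" by (cases "emeasure lborel ?E") auto
    have vge: "c0 * \<delta> powr a \<le> v" using vol[OF \<delta>] v by simp
    have vp: "0 < v" using vge a \<delta> by (smt (verit) mult_pos_pos powr_gt_zero)
    have "ennreal (v / \<mu> * (w / v) powr (1 / r)) \<le> N_opnorm (ereal r) \<delta> TYPE('a)"
      unfolding \<mu>_def
    proof (rule N_opnorm_test_set[OF \<delta> r _ _ vp v(1) _ w(2)])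
      fix x assume "x \<in> ball (\<rho> *\<^sub>R i) (1/8)"
      then obtain \<alpha> \<beta> where \<alpha>\<beta>: "\<alpha>\<^sup>2 + \<beta>\<^sup>2 = \<rho>\<^sup>2" "norm (\<alpha> *\<^sub>R i + \<beta> *\<^sub>R j - x) = 1"
        using centre_exists[OF ij \<rho>] by blast
      have "shell \<delta> (x + (\<alpha> *\<^sub>R i + \<beta> *\<^sub>R j - x)) \<inter> ?E = ?E" using sub[OF \<alpha>\<beta>(1)] by auto
      then show "\<exists>u\<in>sphere 0 1. ennreal v \<le> emeasure lborel (shell \<delta> (x + u) \<inter> ?E)"
        using \<alpha>\<beta>(2) v by (intro bexI[of _ "\<alpha> *\<^sub>R i + \<beta> *\<^sub>R j - x"]) auto
    qed (use w vp in auto)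
    moreover have "c * \<delta> powr (a * (1 - 1 / r) - 1) \<le> v / \<mu> * (w / v) powr (1 / r)"
    proof -
      have r1: "0 \<le> 1 - 1 / r" using r by simp
      have "(c0 * \<delta> powr a) powr (1 - 1 / r) \<le> v powr (1 - 1 / r)" using vge a r1 by (intro powr_mono2) auto
      moreover have "(c0 * \<delta> powr a) powr (1 - 1 / r) = c0 powr (1 - 1 / r) * \<delta> powr (a * (1 - 1 / r))"
        using a \<delta> by (simp add: powr_mult powr_powr)
      ultimately have "c0 powr (1 - 1 / r) * \<delta> powr (a * (1 - 1 / r)) * w powr (1 / r) / (C * \<delta>) \<le> v powr (1 - 1 / r) * w powr (1 / r) / \<mu>"
        using \<mu> by (intro frac_le mult_right_mono) auto
      moreover have "c * \<delta> powr (a * (1 - 1 / r) - 1) = c0 powr (1 - 1 / r) * \<delta> powr (a * (1 - 1 / r)) * w powr (1 / r) / (C * \<delta>)"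
      proof -
        have *: "A * B / C * (D / \<delta>) = A * D * B / (C * \<delta>)" for A B D :: real by simp
        have "\<delta> powr (a * (1 - 1 / r) - 1) = \<delta> powr (a * (1 - 1 / r)) / \<delta>" using \<delta> by (simp add: powr_diff)
        then show ?thesis unfolding c_def by (simp only: *)
      qed
      moreover have "v powr (1 - 1 / r) * w powr (1 / r) / \<mu> = v / \<mu> * (w / v) powr (1 / r)"
        using vp w by (simp add: powr_diff powr_divide)
      ultimately show ?thesis by simp
    qed
    ultimately show ?thesis by (meson ennreal_leI order_trans)
  qed
  moreover have "0 < c" using a w C by (simp add: c_def)
  ultimately show ?thesis by blast
qed

text \<open>Lower counterpart of \<open>emeasure_square_interval\<close>: on [0, 4] the square root
  has slope at least 1/4, and the nonnegative branch alone is kept.\<close>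

lemma Icc_subset_sqrt:
  fixes A \<eta> :: real
  assumes "0 \<le> A" "0 \<le> \<eta>" "A + \<eta> \<le> 4"
  shows "ennreal (\<eta> / 4) \<le> emeasure lborel {y::real. 0 \<le> y \<and> A \<le> y\<^sup>2 \<and> y\<^sup>2 \<le> A + \<eta>}"
proof -
  have le: "sqrt A \<le> sqrt (A + \<eta>)" using assms by simp
  have s2: "sqrt A \<le> 2" "sqrt (A + \<eta>) \<le> 2" using assms real_sqrt_le_mono[of A 4] real_sqrt_le_mono[of "A + \<eta>" 4] by auto
  have "\<eta> = (sqrt (A + \<eta>) - sqrt A) * (sqrt (A + \<eta>) + sqrt A)"
    using assms by (simp add: algebra_simps)
  also have "\<dots> \<le> (sqrt (A + \<eta>) - sqrt A) * 4" using le s2 by (intro mult_left_mono) auto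
  finally have "\<eta> / 4 \<le> sqrt (A + \<eta>) - sqrt A" by simp
  then have "ennreal (\<eta> / 4) \<le> emeasure lborel {sqrt A..sqrt (A + \<eta>)}" using le by (simp add: ennreal_leI)
  also have "\<dots> \<le> emeasure lborel {y::real. 0 \<le> y \<and> A \<le> y\<^sup>2 \<and> y\<^sup>2 \<le> A + \<eta>}"
  proof (rule emeasure_mono)
    show "{sqrt A..sqrt (A + \<eta>)} \<subseteq> {y. 0 \<le> y \<and> A \<le> y\<^sup>2 \<and> y\<^sup>2 \<le> A + \<eta>}"
    proof safe
      fix y assume y: "y \<in> {sqrt A..sqrt (A + \<eta>)}"
      then show y0: "0 \<le> y" using assms by (meson atLeastAtMost_iff order_trans real_sqrt_ge_zero)
      show "A \<le> y\<^sup>2" using y by (simp add: sqrt_le_D)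
      have "y\<^sup>2 \<le> (sqrt (A + \<eta>))\<^sup>2" using y y0 by (intro power_mono) auto
      then show "y\<^sup>2 \<le> A + \<eta>" using assms by simp
    qed
  qed measurable
  finally show ?thesis .
qed

text \<open>For \<rho> = 1 in the plane no coordinate is left, the last condition reads 0 \<le>
  \<delta>/4, and the set is a square of side \<delta>/8.\<close>

lemma core_set_volume_2:
  fixes i j :: "'a::euclidean_space"
  assumes dim: "DIM('a) = 2" and ij: "i \<in> Basis" "j \<in> Basis" "i \<noteq> j" and \<delta>: "0 < \<delta>" "\<delta> < 1/2"
  shows "ennreal (1/64 * \<delta> powr 2) \<le> emeasure lborel (core_set \<delta> 1 i j)"
proof -
  have "card {i, j} = card (Basis :: 'a set)" using dim ij by simp
  then have B: "Basis = {i, j}" using ij card_subset_eq[of "Basis :: 'a set" "{i, j}"] by auto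
  have Bi: "Basis - {i} = {j}" using B ij by auto
  have "ennreal (\<Prod>x\<in>Basis - {i}. \<delta> / 16 - - (\<delta> / 16)) * ennreal (\<delta> / 8) \<le> emeasure lborel (core_set \<delta> 1 i j)"
  proof (rule emeasure_slab_ge)
    fix w assume w: "w \<bullet> i = 0" "\<And>x. x \<in> Basis - {i} \<Longrightarrow> - (\<delta> / 16) \<le> w \<bullet> x \<and> w \<bullet> x \<le> \<delta> / 16"
    have "ennreal (\<delta> / 8) = emeasure lborel {- (\<delta> / 16)..\<delta> / 16}" using \<delta> by simp
    also have "\<dots> \<le> emeasure lborel {y. w + y *\<^sub>R i \<in> core_set \<delta> 1 i j}"
    proof (rule emeasure_mono)
      show "{- (\<delta> / 16)..\<delta> / 16} \<subseteq> {y. w + y *\<^sub>R i \<in> core_set \<delta> 1 i j}"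
      proof
        fix y assume y: "y \<in> {- (\<delta> / 16)..\<delta> / 16}"
        let ?z = "w + y *\<^sub>R i"
        have zi: "?z \<bullet> i = y" "?z \<bullet> j = w \<bullet> j" using ij w by (auto simp: inner_simps inner_Basis)
        have "(norm ?z)\<^sup>2 = (?z \<bullet> i)\<^sup>2 + (?z \<bullet> j)\<^sup>2" unfolding norm_sq_Basis B using ij by simp
        then show "y \<in> {y. w + y *\<^sub>R i \<in> core_set \<delta> 1 i j}"
          using zi y w(2)[of j] ij \<delta> by (auto simp: core_set_def abs_le_iff)
      qed
    qed measurable
    finally show "ennreal (\<delta> / 8) \<le> emeasure lborel {y. w + y *\<^sub>R i \<in> core_set \<delta> 1 i j}" .
  qed (use ij \<delta> in auto)
  then show ?thesis using \<delta> by (simp add: Bi ennreal_mult''[symmetric] power2_eq_square)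
qed

text \<open>For \<rho> = 1 the one remaining coordinate y satisfies y^2 \<le> \<delta>/4: contact of
  second order between the sphere and its tangent line yields the factor sqrt \<delta>.\<close>

lemma core_set_volume_3:
  fixes i j :: "'a::euclidean_space"
  assumes dim: "DIM('a) = 3" and ij: "i \<in> Basis" "j \<in> Basis" "i \<noteq> j" and \<delta>: "0 < \<delta>" "\<delta> < 1/2"
  shows "ennreal (1/64 * \<delta> powr (5/2)) \<le> emeasure lborel (core_set \<delta> 1 i j)"
proof -
  have "card (Basis - {i, j} :: 'a set) = 1" using ij dim by (subst card_Diff_subset) auto
  then obtain k where k: "Basis - {i, j} = {k}" by (auto simp: card_1_singleton_iff)
  have kB: "k \<in> Basis" "k \<noteq> i" "k \<noteq> j" using k by blast+
  have Bk: "Basis - {k} = {i, j}" using k kB ij by blast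
  have B: "(Basis::'a set) = {i, j, k}" using k ij by blast
  have "ennreal (\<Prod>x\<in>Basis - {k}. \<delta> / 16 - - (\<delta> / 16)) * ennreal (sqrt \<delta>) \<le> emeasure lborel (core_set \<delta> 1 i j)"
  proof (rule emeasure_slab_ge)
    fix w assume w: "w \<bullet> k = 0" "\<And>x. x \<in> Basis - {k} \<Longrightarrow> - (\<delta> / 16) \<le> w \<bullet> x \<and> w \<bullet> x \<le> \<delta> / 16"
    have "ennreal (sqrt \<delta>) = emeasure lborel {- (sqrt \<delta> / 2)..sqrt \<delta> / 2}" using \<delta> by simp
    also have "\<dots> \<le> emeasure lborel {y. w + y *\<^sub>R k \<in> core_set \<delta> 1 i j}"
    proof (rule emeasure_mono)
      show "{- (sqrt \<delta> / 2)..sqrt \<delta> / 2} \<subseteq> {y. w + y *\<^sub>R k \<in> core_set \<delta> 1 i j}"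
      proof
        fix y assume y: "y \<in> {- (sqrt \<delta> / 2)..sqrt \<delta> / 2}"
        let ?z = "w + y *\<^sub>R k"
        have zi: "?z \<bullet> i = w \<bullet> i" "?z \<bullet> j = w \<bullet> j" "?z \<bullet> k = y" using ij kB w by (auto simp: inner_simps inner_Basis)
        have "(norm ?z)\<^sup>2 = (?z \<bullet> i)\<^sup>2 + (?z \<bullet> j)\<^sup>2 + (?z \<bullet> k)\<^sup>2" unfolding norm_sq_Basis B using ij kB by simp
        moreover have "y\<^sup>2 \<le> \<delta> / 4"
        proof -
          have "\<bar>y\<bar>\<^sup>2 \<le> (sqrt \<delta> / 2)\<^sup>2" using y by (intro power_mono) (auto simp: abs_le_iff)
          then show ?thesis using \<delta> by (simp add: power_divide)
        qed
        ultimately show "y \<in> {y. w + y *\<^sub>R k \<in> core_set \<delta> 1 i j}"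
          using zi w(2)[of i] w(2)[of j] ij kB by (auto simp: core_set_def abs_le_iff)
      qed
    qed measurable
    finally show "ennreal (sqrt \<delta>) \<le> emeasure lborel {y. w + y *\<^sub>R k \<in> core_set \<delta> 1 i j}" .
  qed (use kB \<delta> in auto)
  moreover have "\<delta> powr (5/2) = \<delta> * \<delta> * sqrt \<delta>"
  proof -
    have "\<delta> powr (5/2) = \<delta> powr (2 + 1/2)" by simp
    also have "\<dots> = \<delta> * \<delta> * sqrt \<delta>" using \<delta> by (simp only: powr_add powr_half_sqrt) (simp add: power2_eq_square)
    finally show ?thesis .
  qed
  ultimately show ?thesis using \<delta> ij by (simp add: Bk ennreal_mult''[symmetric])
qed

text \<open>With \<rho>^2 = 1/2 the remaining coordinates, at least two, are near a sphere of radius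
  sqrt(1/2), a set of codimension 1 and not a point; hence thickness \<delta> in three directions.
  All but \<open>i\<close>, \<open>j\<close>, \<open>k\<close> range over a box of side 1/n, where
  their square sum s is at most 1/4, and slicing is along \<open>k\<close> with y^2 near 1/2 -
  s.\<close>

lemma core_set_volume_4:
  fixes i j :: "'a::euclidean_space"
  assumes dim: "4 \<le> DIM('a)" and ij: "i \<in> Basis" "j \<in> Basis" "i \<noteq> j"
  shows "\<exists>c>0. \<forall>\<delta>. 0 < \<delta> \<longrightarrow> \<delta> < 1/2 \<longrightarrow> ennreal (c * \<delta> powr 3) \<le> emeasure lborel (core_set \<delta> (sqrt (1/2)) i j)"
proof -
  define n where "n = real DIM('a)"
  have n: "4 \<le> n" using dim by (simp add: n_def)
  have "card {i, j} < card (Basis :: 'a set)" using dim ij by simp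
  then have "\<not> Basis \<subseteq> {i, j}" by (meson card_mono finite.emptyI finite.insertI linorder_not_less)
  then obtain k where k: "k \<in> Basis" "k \<noteq> i" "k \<noteq> j" by blast
  let ?R = "Basis - {k} - {i} - {j}"
  define P where "P = (\<Prod>x\<in>?R. 1 / (2 * n) - - (1 / (2 * n)))"
  have P: "0 < P" unfolding P_def using n by (intro prod_pos) auto
  have "ennreal (P / 1024 * \<delta> powr 3) \<le> emeasure lborel (core_set \<delta> (sqrt (1/2)) i j)" if \<delta>: "0 < \<delta>" "\<delta> < 1/2" for \<delta>
  proof -
    define h where "h = (\<lambda>x. if x = i \<or> x = j then \<delta> / 16 else 1 / (2 * n))"
    let ?E = "core_set \<delta> (sqrt (1/2)) i j"
    have "ennreal (\<Prod>x\<in>Basis - {k}. h x - - h x) * ennreal (\<delta> / 4 / 4) \<le> emeasure lborel ?E"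
    proof (rule emeasure_slab_ge)
      fix w assume w: "w \<bullet> k = 0" "\<And>x. x \<in> Basis - {k} \<Longrightarrow> - h x \<le> w \<bullet> x \<and> w \<bullet> x \<le> h x"
      define s where "s = (\<Sum>x\<in>?R. (w \<bullet> x)\<^sup>2)"
      have s: "0 \<le> s" "s \<le> 1/4"
      proof -
        show "0 \<le> s" unfolding s_def by (intro sum_nonneg) auto
        have "s \<le> (\<Sum>x\<in>?R. (1 / (2 * n))\<^sup>2)" unfolding s_def
        proof (rule sum_mono)
          fix x assume "x \<in> ?R"
          then have "\<bar>w \<bullet> x\<bar> \<le> 1 / (2 * n)" using w(2)[of x] by (auto simp: h_def abs_le_iff)
          then have "\<bar>w \<bullet> x\<bar>\<^sup>2 \<le> (1 / (2 * n))\<^sup>2" by (intro power_mono) auto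
          then show "(w \<bullet> x)\<^sup>2 \<le> (1 / (2 * n))\<^sup>2" by simp
        qed
        also have "\<dots> \<le> n * (1 / (2 * n))\<^sup>2"
        proof -
          have "card ?R \<le> DIM('a)" by (intro card_mono) auto
          then show ?thesis unfolding sum_constant n_def by (intro mult_right_mono) auto
        qed
        also have "\<dots> \<le> 1/4" using n by (simp add: power2_eq_square field_simps)
        finally show "s \<le> 1/4" .
      qed
      have "ennreal (\<delta> / 4 / 4) \<le> emeasure lborel {y::real. 0 \<le> y \<and> 1/2 - s \<le> y\<^sup>2 \<and> y\<^sup>2 \<le> 1/2 - s + \<delta> / 4}"
        using s \<delta> by (intro Icc_subset_sqrt) auto
      also have "\<dots> \<le> emeasure lborel {y. w + y *\<^sub>R k \<in> ?E}"
      proof (rule emeasure_mono)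
        show "{y. 0 \<le> y \<and> 1/2 - s \<le> y\<^sup>2 \<and> y\<^sup>2 \<le> 1/2 - s + \<delta> / 4} \<subseteq> {y. w + y *\<^sub>R k \<in> ?E}"
        proof
          fix y assume y: "y \<in> {y. 0 \<le> y \<and> 1/2 - s \<le> y\<^sup>2 \<and> y\<^sup>2 \<le> 1/2 - s + \<delta> / 4}"
          let ?z = "w + y *\<^sub>R k"
          have zk: "?z \<bullet> k = y" using k w by (simp add: inner_simps)
          have zx: "?z \<bullet> x = w \<bullet> x" if "x \<in> Basis" "x \<noteq> k" for x using that k by (simp add: inner_simps inner_not_same_Basis)
          have "(norm ?z)\<^sup>2 = (\<Sum>x\<in>{k, i, j}. (?z \<bullet> x)\<^sup>2) + (\<Sum>x\<in>Basis - {k, i, j}. (?z \<bullet> x)\<^sup>2)"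
            using k ij by (intro norm_sq_coordinates) auto
          also have "(\<Sum>x\<in>Basis - {k, i, j}. (?z \<bullet> x)\<^sup>2) = s"
          proof -
            have "Basis - {k, i, j} = ?R" by blast
            then show ?thesis unfolding s_def by (intro sum.cong) (auto simp: zx)
          qed
          also have "(\<Sum>x\<in>{k, i, j}. (?z \<bullet> x)\<^sup>2) = y\<^sup>2 + (?z \<bullet> i)\<^sup>2 + (?z \<bullet> j)\<^sup>2" using k ij zk by simp
          finally have n2: "(norm ?z)\<^sup>2 - (?z \<bullet> i)\<^sup>2 - (?z \<bullet> j)\<^sup>2 = y\<^sup>2 + s" by simp
          have "\<bar>(norm ?z)\<^sup>2 - (?z \<bullet> i)\<^sup>2 - (?z \<bullet> j)\<^sup>2 - (1 - (sqrt (1/2))\<^sup>2)\<bar> \<le> \<delta> / 4"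
            unfolding n2 using y \<delta> by (simp add: abs_le_iff)
          moreover have "\<bar>?z \<bullet> i\<bar> \<le> \<delta> / 16" "\<bar>?z \<bullet> j\<bar> \<le> \<delta> / 16"
            using w(2)[of i] w(2)[of j] ij k by (auto simp: zx h_def abs_le_iff)
          ultimately show "y \<in> {y. w + y *\<^sub>R k \<in> ?E}" by (simp add: core_set_def)
        qed
      qed measurable
      finally show "ennreal (\<delta> / 4 / 4) \<le> emeasure lborel {y. w + y *\<^sub>R k \<in> ?E}" .
    qed (use k \<delta> n in \<open>auto simp: h_def\<close>)
    also have "(\<Prod>x\<in>Basis - {k}. h x - - h x) = (h i - - h i) * (\<Prod>x\<in>Basis - {k} - {i}. h x - - h x)"
      using ij k by (intro prod.remove) auto
    also have "(\<Prod>x\<in>Basis - {k} - {i}. h x - - h x) = (h j - - h j) * (\<Prod>x\<in>?R. h x - - h x)"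
      using ij k by (intro prod.remove) auto
    also have "(\<Prod>x\<in>?R. h x - - h x) = P" unfolding P_def by (intro prod.cong) (auto simp: h_def)
    also have "h i - - h i = \<delta> / 8" by (simp add: h_def)
    also have "h j - - h j = \<delta> / 8" by (simp add: h_def)
    also have "ennreal (\<delta> / 8 * (\<delta> / 8 * P)) * ennreal (\<delta> / 4 / 4) = ennreal (\<delta> / 8 * (\<delta> / 8 * P) * (\<delta> / 4 / 4))"
      using \<delta> by (intro ennreal_mult''[symmetric]) auto
    also have "\<delta> / 8 * (\<delta> / 8 * P) * (\<delta> / 4 / 4) = P / 1024 * \<delta> powr 3" using \<delta> by (simp add: power3_eq_cube)
    finally show ?thesis .
  qed
  then show ?thesis using P by (intro exI[of _ "P / 1024"]) auto
qed

text \<open>A piece of a thin neighbourhood of a unit cylinder: every unit sphere centred on the axis \<open>h\<close> is tangent to it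
  along an equator, to the order \<open>sqrt \<delta>\<close>.\<close>
definition cylinder_piece :: "real \<Rightarrow> 'a \<Rightarrow> 'a \<Rightarrow> ('a::euclidean_space) set" where
  "cylinder_piece \<delta> h k = {z. \<bar>z \<bullet> h\<bar> \<le> 3 \<and> (\<forall>x\<in>Basis - {h, k}. \<bar>z \<bullet> x\<bar> \<le> 1 / (4 * DIM('a))) \<and> 0 \<le> z \<bullet> k
     \<and> \<bar>(norm z)\<^sup>2 - (z \<bullet> h)\<^sup>2 - 1\<bar> \<le> \<delta> / 4}"

lemma cylinder_piece_borel [measurable]: "cylinder_piece \<delta> h k \<in> sets borel"
proof -
  have "cylinder_piece \<delta> h k = {z. \<bar>z \<bullet> h\<bar> \<le> 3} \<inter> (\<Inter>x\<in>Basis - {h, k}. {z. \<bar>z \<bullet> x\<bar> \<le> 1 / (4 * DIM('a))}) \<inter> {z::'a. 0 \<le> z \<bullet> k}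
     \<inter> {z. \<bar>(norm z)\<^sup>2 - (z \<bullet> h)\<^sup>2 - 1\<bar> \<le> \<delta> / 4}"
    by (auto simp: cylinder_piece_def)
  also have "closed \<dots>"
    by (intro closed_Int closed_INT ballI closed_Collect_le continuous_intros)
  finally show ?thesis by (rule borel_closed)
qed

text \<open>The coordinates other than \<open>h\<close> and \<open>k\<close> enter the cylinder
  equation only through their square sum s, at most n/(4 n)^2 \<le> 1/16, so the cylinder is a graph
  over the hyperplane orthogonal to \<open>k\<close>.\<close>

lemma cylinder_coordinates:
  fixes w h k :: "'a::euclidean_space"
  assumes hk: "h \<in> Basis" "k \<in> Basis" "h \<noteq> k" and w: "w \<bullet> k = 0"
    and small: "\<And>x. x \<in> Basis - {h, k} \<Longrightarrow> \<bar>w \<bullet> x\<bar> \<le> 1 / (4 * DIM('a))"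
  obtains s where "0 \<le> s" "s \<le> 1/16" "\<And>y. (norm (w + y *\<^sub>R k))\<^sup>2 - ((w + y *\<^sub>R k) \<bullet> h)\<^sup>2 = y\<^sup>2 + s"
    "\<And>y. (w + y *\<^sub>R k) \<bullet> k = y" "\<And>y x. x \<in> Basis - {k} \<Longrightarrow> (w + y *\<^sub>R k) \<bullet> x = w \<bullet> x"
proof -
  define n where "n = real DIM('a)"
  have n: "1 \<le> n" unfolding n_def using DIM_positive[where 'a='a] by linarith
  define s where "s = (\<Sum>x\<in>Basis - {h, k}. (w \<bullet> x)\<^sup>2)"
  have zk: "(w + y *\<^sub>R k) \<bullet> k = y" for y using hk w by (simp add: inner_simps)
  have zx: "(w + y *\<^sub>R k) \<bullet> x = w \<bullet> x" if "x \<in> Basis - {k}" for x y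
    using that inner_not_same_Basis[OF hk(2), of x] by (auto simp: inner_add_left)
  have "(norm (w + y *\<^sub>R k))\<^sup>2 - ((w + y *\<^sub>R k) \<bullet> h)\<^sup>2 = y\<^sup>2 + s" for y
  proof -
    have "(norm (w + y *\<^sub>R k))\<^sup>2 = (\<Sum>x\<in>{h, k}. ((w + y *\<^sub>R k) \<bullet> x)\<^sup>2) + (\<Sum>x\<in>Basis - {h, k}. ((w + y *\<^sub>R k) \<bullet> x)\<^sup>2)"
      using hk by (intro norm_sq_coordinates) auto
    also have "(\<Sum>x\<in>Basis - {h, k}. ((w + y *\<^sub>R k) \<bullet> x)\<^sup>2) = s" unfolding s_def by (intro sum.cong refl) (simp add: zx)
    also have "(\<Sum>x\<in>{h, k}. ((w + y *\<^sub>R k) \<bullet> x)\<^sup>2) = ((w + y *\<^sub>R k) \<bullet> h)\<^sup>2 + y\<^sup>2" using hk zk by simp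
    finally show ?thesis by simp
  qed
  moreover have "0 \<le> s" unfolding s_def by (intro sum_nonneg) auto
  moreover have "s \<le> 1/16"
  proof -
    have "s \<le> (\<Sum>x\<in>Basis - {h, k}. (1 / (4 * n))\<^sup>2)" unfolding s_def
    proof (rule sum_mono)
      fix x assume "x \<in> Basis - {h, k}"
      then have "\<bar>w \<bullet> x\<bar>\<^sup>2 \<le> (1 / (4 * n))\<^sup>2" using small[of x] by (intro power_mono) (auto simp: n_def)
      then show "(w \<bullet> x)\<^sup>2 \<le> (1 / (4 * n))\<^sup>2" by simp
    qed
    also have "\<dots> \<le> n * (1 / (4 * n))\<^sup>2"
    proof -
      have "card (Basis - {h, k} :: 'a set) \<le> DIM('a)" by (intro card_mono) auto
      then show ?thesis unfolding sum_constant n_def by (intro mult_right_mono) auto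
    qed
    also have "\<dots> \<le> 1/16" using n by (simp add: power2_eq_square field_simps)
    finally show ?thesis .
  qed
  ultimately show ?thesis using that zk zx by blast
qed

text \<open>On a slice y^2 ranges over an interval of length \<delta>/2 starting at 1 - s -
  \<delta>/4, which exceeds 1/4. Hence |y| \<ge> 1/2 and the slice has length at most
  \<delta>.\<close>

lemma cylinder_piece_upper:
  fixes h k :: "'a::euclidean_space"
  assumes hk: "h \<in> Basis" "k \<in> Basis" "h \<noteq> k"
  shows "\<exists>C>0. \<forall>\<delta>. 0 < \<delta> \<longrightarrow> \<delta> < 1/2 \<longrightarrow> emeasure lborel (cylinder_piece \<delta> h k) \<le> ennreal (C * \<delta>)"
proof -
  define b where "b = 1 / (4 * real DIM('a))"
  have b: "0 < b" using DIM_positive[where 'a='a] by (simp add: b_def)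
  define H where "H = (\<lambda>x. if x = h then 3 else b)"
  define P where "P = (\<Prod>x\<in>Basis - {k}. H x - - H x)"
  have P: "0 < P" unfolding P_def using b by (intro prod_pos) (auto simp: H_def)
  have "emeasure lborel (cylinder_piece \<delta> h k) \<le> ennreal (P * \<delta>)" if \<delta>: "0 < \<delta>" "\<delta> < 1/2" for \<delta>
  proof -
    have "emeasure lborel (cylinder_piece \<delta> h k) \<le> ennreal P * ennreal \<delta>"
      unfolding P_def
    proof (rule emeasure_slab1_le)
      show "- H x \<le> H x" if "x \<in> Basis - {k}" for x using b by (simp add: H_def)
      show "- H x \<le> z \<bullet> x \<and> z \<bullet> x \<le> H x" if "z \<in> cylinder_piece \<delta> h k" "x \<in> Basis - {k}" for z x
      proof -
        have "\<bar>z \<bullet> x\<bar> \<le> H x"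
        proof (cases "x = h")
          case False
          then have "x \<in> Basis - {h, k}" using that(2) by simp
          then have "\<bar>z \<bullet> x\<bar> \<le> b" using that(1) by (simp add: cylinder_piece_def b_def)
          then show ?thesis using False by (simp add: H_def)
        qed (use that(1) in \<open>simp add: cylinder_piece_def H_def\<close>)
        then show ?thesis by linarith
      qed
      fix w :: 'a assume w: "w \<bullet> k = 0"
      show "emeasure lborel {y. w + y *\<^sub>R k \<in> cylinder_piece \<delta> h k} \<le> ennreal \<delta>"
      proof (cases "\<forall>x\<in>Basis - {h, k}. \<bar>w \<bullet> x\<bar> \<le> 1 / (4 * DIM('a))")
        case True
        then obtain s where s: "0 \<le> s" "s \<le> 1/16" "\<And>y. (norm (w + y *\<^sub>R k))\<^sup>2 - ((w + y *\<^sub>R k) \<bullet> h)\<^sup>2 = y\<^sup>2 + s"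
          "\<And>y. (w + y *\<^sub>R k) \<bullet> k = y" "\<And>y x. x \<in> Basis - {k} \<Longrightarrow> (w + y *\<^sub>R k) \<bullet> x = w \<bullet> x"
          using cylinder_coordinates[OF hk w] by blast
        have "emeasure lborel {y. w + y *\<^sub>R k \<in> cylinder_piece \<delta> h k}
          \<le> emeasure lborel {y::real. 1 - s - \<delta> / 4 \<le> y\<^sup>2 \<and> y\<^sup>2 \<le> 1 - s - \<delta> / 4 + \<delta> / 2 \<and> 1/2 \<le> \<bar>y\<bar>}"
        proof (rule emeasure_mono)
          show "{y. w + y *\<^sub>R k \<in> cylinder_piece \<delta> h k} \<subseteq> {y. 1 - s - \<delta> / 4 \<le> y\<^sup>2 \<and> y\<^sup>2 \<le> 1 - s - \<delta> / 4 + \<delta> / 2 \<and> 1/2 \<le> \<bar>y\<bar>}"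
          proof
            fix y assume "y \<in> {y. w + y *\<^sub>R k \<in> cylinder_piece \<delta> h k}"
            then have y: "\<bar>y\<^sup>2 + s - 1\<bar> \<le> \<delta> / 4" using s(3)[of y] by (simp add: cylinder_piece_def)
            then have yy: "1 - s - \<delta> / 4 \<le> y\<^sup>2" "y\<^sup>2 \<le> 1 - s - \<delta> / 4 + \<delta> / 2" unfolding abs_le_iff by auto
            then have "(1/2)\<^sup>2 \<le> \<bar>y\<bar>\<^sup>2" using s \<delta> by (simp add: power2_eq_square[of "1/2::real"])
            then have "1/2 \<le> \<bar>y\<bar>" by (rule power2_le_imp_le) simp
            then show "y \<in> {y. 1 - s - \<delta> / 4 \<le> y\<^sup>2 \<and> y\<^sup>2 \<le> 1 - s - \<delta> / 4 + \<delta> / 2 \<and> 1/2 \<le> \<bar>y\<bar>}" using yy by simp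
          qed
        qed measurable
        also have "\<dots> \<le> ennreal (\<delta> / 2 / (1/2))" using \<delta> by (intro emeasure_square_interval) auto
        finally show ?thesis by simp
      next
        case False
        then obtain x where x: "x \<in> Basis - {h, k}" "\<not> \<bar>w \<bullet> x\<bar> \<le> 1 / (4 * DIM('a))" by blast
        then have wx: "(w + y *\<^sub>R k) \<bullet> x = w \<bullet> x" for y using inner_not_same_Basis[OF hk(2), of x] by (auto simp: inner_add_left)
        have "w + y *\<^sub>R k \<notin> cylinder_piece \<delta> h k" for y
        proof
          assume "w + y *\<^sub>R k \<in> cylinder_piece \<delta> h k"
          then have "\<forall>x\<in>Basis - {h, k}. \<bar>(w + y *\<^sub>R k) \<bullet> x\<bar> \<le> 1 / (4 * DIM('a))" by (simp add: cylinder_piece_def)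
          from bspec[OF this x(1)] show False using x(2) unfolding wx by blast
        qed
        then have "{y. w + y *\<^sub>R k \<in> cylinder_piece \<delta> h k} = {}" by simp
        then show ?thesis by (simp only: emeasure_empty zero_le)
      qed
    qed (use hk in auto)
    also have "\<dots> = ennreal (P * \<delta>)" using P \<delta> by (intro ennreal_mult[symmetric]) auto
    finally show ?thesis .
  qed
  then show ?thesis using P by blast
qed

text \<open>For a centre t h, |z - t h|^2 is the squared distance from the axis plus (z . h - t)^2.
  In the band |z . h - t| \<le> sqrt \<delta>/2 the second term is at most \<delta>/4, so a piece of
  size sqrt \<delta> times \<delta> lies in both sets. The length bound 3 of the piece leaves room
  for |t| \<le> 2.\<close>

lemma cylinder_piece_shell:
  fixes h k :: "'a::euclidean_space"
  assumes hk: "h \<in> Basis" "k \<in> Basis" "h \<noteq> k"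
  shows "\<exists>c>0. \<forall>\<delta> t. 0 < \<delta> \<longrightarrow> \<delta> < 1/2 \<longrightarrow> \<bar>t\<bar> \<le> 2 \<longrightarrow>
     ennreal (c * \<delta> powr (3/2)) \<le> emeasure lborel (shell \<delta> (t *\<^sub>R h) \<inter> cylinder_piece \<delta> h k)"
proof -
  define b where "b = 1 / (4 * real DIM('a))"
  have b: "0 < b" using DIM_positive[where 'a='a] by (simp add: b_def)
  define P where "P = (\<Prod>x\<in>Basis - {k} - {h}. b - - b)"
  have P: "0 < P" unfolding P_def using b by (intro prod_pos) auto
  have "ennreal (P / 8 * \<delta> powr (3/2)) \<le> emeasure lborel (shell \<delta> (t *\<^sub>R h) \<inter> cylinder_piece \<delta> h k)"
    if \<delta>: "0 < \<delta>" "\<delta> < 1/2" and t: "\<bar>t\<bar> \<le> 2" for \<delta> t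
  proof -
    let ?Z = "shell \<delta> (t *\<^sub>R h) \<inter> cylinder_piece \<delta> h k"
    define l where "l = (\<lambda>x. if x = h then t - sqrt \<delta> / 2 else - b)"
    define u where "u = (\<lambda>x. if x = h then t + sqrt \<delta> / 2 else b)"
    have sq1: "sqrt \<delta> \<le> 1" using \<delta> by simp
    have "ennreal (\<Prod>x\<in>Basis - {k}. u x - l x) * ennreal (\<delta> / 2 / 4) \<le> emeasure lborel ?Z"
    proof (rule emeasure_slab_ge)
      show "l x \<le> u x" if "x \<in> Basis - {k}" for x using b \<delta> by (simp add: l_def u_def)
      fix w :: 'a assume w: "w \<bullet> k = 0" "\<And>x. x \<in> Basis - {k} \<Longrightarrow> l x \<le> w \<bullet> x \<and> w \<bullet> x \<le> u x"
      have small: "\<bar>w \<bullet> x\<bar> \<le> 1 / (4 * DIM('a))" if "x \<in> Basis - {h, k}" for x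
        using w(2)[of x] that by (auto simp: l_def u_def b_def abs_le_iff)
      have wh: "\<bar>w \<bullet> h - t\<bar> \<le> sqrt \<delta> / 2" 
      proof -
        have "l h \<le> w \<bullet> h" "w \<bullet> h \<le> u h" using w(2)[of h] hk by auto
        then have "t - sqrt \<delta> / 2 \<le> w \<bullet> h" "w \<bullet> h \<le> t + sqrt \<delta> / 2" by (simp_all only: l_def u_def if_True refl)
        then show ?thesis by linarith
      qed
      obtain s where s: "0 \<le> s" "s \<le> 1/16" "\<And>y. (norm (w + y *\<^sub>R k))\<^sup>2 - ((w + y *\<^sub>R k) \<bullet> h)\<^sup>2 = y\<^sup>2 + s"
          "\<And>y. (w + y *\<^sub>R k) \<bullet> k = y" "\<And>y x. x \<in> Basis - {k} \<Longrightarrow> (w + y *\<^sub>R k) \<bullet> x = w \<bullet> x"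
        using cylinder_coordinates[OF hk w(1) small] by blast
      have "ennreal (\<delta> / 2 / 4) \<le> emeasure lborel {y::real. 0 \<le> y \<and> 1 - s - \<delta> / 4 \<le> y\<^sup>2 \<and> y\<^sup>2 \<le> 1 - s - \<delta> / 4 + \<delta> / 2}"
        using s \<delta> by (intro Icc_subset_sqrt) auto
      also have "\<dots> \<le> emeasure lborel {y. w + y *\<^sub>R k \<in> ?Z}"
      proof (rule emeasure_mono)
        show "{y. 0 \<le> y \<and> 1 - s - \<delta> / 4 \<le> y\<^sup>2 \<and> y\<^sup>2 \<le> 1 - s - \<delta> / 4 + \<delta> / 2} \<subseteq> {y. w + y *\<^sub>R k \<in> ?Z}"
        proof
          fix y assume y: "y \<in> {y. 0 \<le> y \<and> 1 - s - \<delta> / 4 \<le> y\<^sup>2 \<and> y\<^sup>2 \<le> 1 - s - \<delta> / 4 + \<delta> / 2}"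
          let ?z = "w + y *\<^sub>R k"
          have zh: "?z \<bullet> h = w \<bullet> h" using hk by (intro s(5)) auto
          have rad: "\<bar>(norm ?z)\<^sup>2 - (?z \<bullet> h)\<^sup>2 - 1\<bar> \<le> \<delta> / 4" unfolding s(3) abs_le_iff using y by auto
          have "\<bar>?z \<bullet> h\<bar> \<le> 3" unfolding zh using wh t sq1 by linarith
          moreover have "\<bar>?z \<bullet> x\<bar> \<le> 1 / (4 * DIM('a))" if "x \<in> Basis - {h, k}" for x
            using small[OF that] s(5)[of x y] that by simp
          ultimately have 1: "?z \<in> cylinder_piece \<delta> h k" using rad y s(4)[of y] by (simp add: cylinder_piece_def)
          have "(norm (?z - t *\<^sub>R h))\<^sup>2 = ((norm ?z)\<^sup>2 - (?z \<bullet> h)\<^sup>2) + (?z \<bullet> h - t)\<^sup>2"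
            using hk unfolding power2_norm_eq_inner
            by (simp add: inner_diff_left inner_diff_right inner_commute power2_eq_square algebra_simps)
          moreover have "(?z \<bullet> h - t)\<^sup>2 \<le> \<delta> / 4"
          proof -
            have "\<bar>?z \<bullet> h - t\<bar>\<^sup>2 \<le> (sqrt \<delta> / 2)\<^sup>2" unfolding zh using wh by (intro power_mono) auto
            then show ?thesis using \<delta> by (simp add: power_divide)
          qed
          moreover have "0 \<le> (?z \<bullet> h - t)\<^sup>2" by simp
          ultimately have "\<bar>(norm (?z - t *\<^sub>R h))\<^sup>2 - 1\<bar> < \<delta>" using rad \<delta>(1) unfolding abs_le_iff abs_less_iff by linarith
          then have "?z \<in> shell \<delta> (t *\<^sub>R h)" by (rule mem_shellI)
          then show "y \<in> {y. w + y *\<^sub>R k \<in> ?Z}" using 1 by simp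
        qed
      qed measurable
      finally show "ennreal (\<delta> / 2 / 4) \<le> emeasure lborel {y. w + y *\<^sub>R k \<in> ?Z}" .
    qed (use hk in auto)
    also have "(\<Prod>x\<in>Basis - {k}. u x - l x) = (u h - l h) * (\<Prod>x\<in>Basis - {k} - {h}. u x - l x)"
      using hk by (intro prod.remove) auto
    also have "(\<Prod>x\<in>Basis - {k} - {h}. u x - l x) = P" unfolding P_def by (intro prod.cong) (auto simp: u_def l_def)
    also have "u h - l h = sqrt \<delta>" by (simp add: u_def l_def)
    also have "ennreal (sqrt \<delta> * P) * ennreal (\<delta> / 2 / 4) = ennreal (sqrt \<delta> * P * (\<delta> / 2 / 4))"
      using \<delta> by (intro ennreal_mult''[symmetric]) auto
    also have "sqrt \<delta> * P * (\<delta> / 2 / 4) = P / 8 * \<delta> powr (3/2)"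
    proof -
      have "\<delta> powr (3/2) = \<delta> powr (1 + 1/2)" by simp
      also have "\<dots> = \<delta> * sqrt \<delta>" using \<delta> by (simp only: powr_add powr_half_sqrt) simp
      finally show ?thesis by simp
    qed
    finally show ?thesis .
  qed
  then show ?thesis using P by (intro exI[of _ "P / 8"]) auto
qed

text \<open>Every x near the origin is at distance 1 from some point of the axis, whose shell meets
  the test set in measure of order \<delta>^(3/2), while the test set has measure O(\<delta>). The
  quotient is \<delta>^(3/2)/\<delta> times \<delta>^(-1/r).\<close>

lemma N_opnorm_lower_cylinder:
  assumes r: "1 \<le> r" and dim: "2 \<le> DIM('a::euclidean_space)"
  shows "\<exists>c>0. \<forall>\<delta>\<in>{0<..<1/2}. ennreal (c * \<delta> powr (1/2 - 1 / r)) \<le> N_opnorm (ereal r) \<delta> TYPE('a)"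
proof -
  obtain B :: "'a set" where "B \<subseteq> Basis" "card B = 2" using dim by (metis obtain_subset_with_card_n)
  then obtain h k :: 'a where hk: "h \<in> Basis" "k \<in> Basis" "h \<noteq> k" by (auto simp: card_2_iff)
  obtain C1 where C1: "0 < C1" "\<And>\<delta>. 0 < \<delta> \<Longrightarrow> \<delta> < 1/2 \<Longrightarrow> emeasure lborel (cylinder_piece \<delta> h k) \<le> ennreal (C1 * \<delta>)"
    using cylinder_piece_upper[OF hk] by blast
  obtain c2 where c2: "0 < c2" "\<And>\<delta> t. 0 < \<delta> \<Longrightarrow> \<delta> < 1/2 \<Longrightarrow> \<bar>t\<bar> \<le> 2 \<Longrightarrow>
     ennreal (c2 * \<delta> powr (3/2)) \<le> emeasure lborel (shell \<delta> (t *\<^sub>R h) \<inter> cylinder_piece \<delta> h k)"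
    using cylinder_piece_shell[OF hk] by blast
  obtain w where w: "0 < w" "emeasure lborel (ball (0::'a) (1/2)) = ennreal w" using emeasure_ball_pos[of "1/2" "0::'a"] by auto
  obtain C where C: "0 < C" "\<And>\<delta>. \<delta> \<in> {0<..<1/2} \<Longrightarrow> measure lebesgue (sphere_nbhd \<delta> :: 'a set) \<le> C * \<delta>"
    using measure_sphere_nbhd_le by blast
  define c where "c = c2 / C * (w / C1) powr (1 / r)"
  have "ennreal (c * \<delta> powr (1/2 - 1 / r)) \<le> N_opnorm (ereal r) \<delta> TYPE('a)" if d: "\<delta> \<in> {0<..<1/2}" for \<delta>
  proof -
    have \<delta>: "0 < \<delta>" "\<delta> < 1/2" using d by auto
    let ?E = "cylinder_piece \<delta> h k"
    define \<mu> where "\<mu> = measure lebesgue (sphere_nbhd \<delta> :: 'a set)"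
    have \<mu>: "0 < \<mu>" "\<mu> \<le> C * \<delta>" unfolding \<mu>_def using measure_sphere_nbhd_shell(2)[OF \<delta>] C(2)[OF d] by auto
    define m where "m = c2 * \<delta> powr (3/2)"
    have m: "0 < m" using c2 \<delta> by (simp add: m_def)
    obtain v where v: "emeasure lborel ?E = ennreal v" "0 \<le> v"
      using C1(2)[OF \<delta>] by (cases "emeasure lborel ?E") (auto simp: top_unique)
    have vle: "v \<le> C1 * \<delta>" using C1(2)[OF \<delta>] v C1(1) \<delta> by simp
    have "ennreal m \<le> emeasure lborel (shell \<delta> (0 *\<^sub>R h) \<inter> ?E)" unfolding m_def using \<delta> by (intro c2(2)) auto
    also have "\<dots> \<le> ennreal v" unfolding v(1)[symmetric] by (intro emeasure_mono) auto
    finally have vp: "0 < v" using m v(2) by simp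
    have "ennreal (m / \<mu> * (w / v) powr (1 / r)) \<le> N_opnorm (ereal r) \<delta> TYPE('a)"
      unfolding \<mu>_def
    proof (rule N_opnorm_test_set[OF \<delta> r _ _ vp v(1) _ w(2)])
      fix x :: 'a assume x: "x \<in> ball 0 (1/2)"
      have xn: "norm x < 1/2" using x by simp
      define q where "q = (norm x)\<^sup>2 - (x \<bullet> h)\<^sup>2"
      have "(norm x)\<^sup>2 \<le> (1/2)\<^sup>2" using xn by (intro power_mono) auto
      moreover have "(1/2)\<^sup>2 = (1/4::real)" by (simp add: power2_eq_square)
      ultimately have q: "q \<le> 1/4" unfolding q_def using zero_le_power2[of "x \<bullet> h"] by linarith
      have "\<bar>x \<bullet> h\<bar>\<^sup>2 \<le> (norm x)\<^sup>2" using Basis_le_norm[OF hk(1), of x] by (intro power_mono) auto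
      then have q0: "0 \<le> q" by (simp add: q_def)
      \<comment> \<open>q is the squared distance of x from the axis, at most 1/4; moving by sqrt(1
        - q) along the axis from the foot of the perpendicular gives distance exactly 1.\<close>
      define t where "t = x \<bullet> h - sqrt (1 - q)"
      have "sqrt (1 - q) \<le> 1" "0 \<le> sqrt (1 - q)" using q q0 by auto
      moreover have "\<bar>x \<bullet> h\<bar> \<le> 1/2" using Basis_le_norm[OF hk(1), of x] xn by linarith
      ultimately have t: "\<bar>t\<bar> \<le> 2" unfolding t_def by linarith
      have "(norm (t *\<^sub>R h - x))\<^sup>2 = q + (t - x \<bullet> h)\<^sup>2"
        using hk(1) unfolding power2_norm_eq_inner q_def
        by (simp add: inner_diff_left inner_diff_right inner_commute power2_eq_square algebra_simps)
      also have "\<dots> = 1" using q by (simp add: t_def)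
      finally have "norm (t *\<^sub>R h - x) = 1" using norm_ge_zero[of "t *\<^sub>R h - x"] by (auto simp: power2_eq_1_iff simp del: norm_ge_zero)
      moreover have "ennreal m \<le> emeasure lborel (shell \<delta> (x + (t *\<^sub>R h - x)) \<inter> ?E)"
        unfolding m_def using c2(2)[OF \<delta> t] by simp
      ultimately show "\<exists>u\<in>sphere 0 1. ennreal m \<le> emeasure lborel (shell \<delta> (x + u) \<inter> ?E)"
        by (intro bexI[of _ "t *\<^sub>R h - x"]) auto
    qed (use w m in auto)
    moreover have "c * \<delta> powr (1/2 - 1 / r) \<le> m / \<mu> * (w / v) powr (1 / r)"
    proof -
      have "m / (C * \<delta>) \<le> m / \<mu>" using \<mu> m by (intro divide_left_mono) auto
      moreover have "(w / (C1 * \<delta>)) powr (1 / r) \<le> (w / v) powr (1 / r)"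
        using vle vp w C1(1) \<delta> r by (intro powr_mono2 divide_left_mono) auto
      ultimately have "m / (C * \<delta>) * (w / (C1 * \<delta>)) powr (1 / r) \<le> m / \<mu> * (w / v) powr (1 / r)"
        using m \<mu> by (intro mult_mono) auto
      moreover have "m / (C * \<delta>) * (w / (C1 * \<delta>)) powr (1 / r) = c * \<delta> powr (1/2 - 1 / r)"
      proof -
        have "w / (C1 * \<delta>) = w / C1 * (1 / \<delta>)" by simp
        then have 1: "(w / (C1 * \<delta>)) powr (1 / r) = (w / C1) powr (1 / r) * \<delta> powr (- (1 / r))"
          using w C1(1) \<delta> by (simp add: powr_mult powr_divide powr_minus_divide)
        have "m / (C * \<delta>) = c2 / C * (\<delta> powr (3/2) / \<delta>)" by (simp add: m_def)
        also have "\<delta> powr (3/2) / \<delta> = \<delta> powr (1/2)"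
          using \<delta> powr_diff[of \<delta> "3/2" 1] by simp
        finally have 2: "m / (C * \<delta>) = c2 / C * \<delta> powr (1/2)" .
        have 3: "\<delta> powr (1/2) * \<delta> powr (- (1 / r)) = \<delta> powr (1/2 - 1 / r)" by (simp only: powr_add[symmetric]) simp
        show ?thesis unfolding 1 2 3[symmetric] c_def by (simp only: mult_ac)
      qed
      ultimately show ?thesis by simp
    qed
    ultimately show ?thesis by (meson ennreal_leI order_trans)
  qed
  moreover have "0 < c" using c2 C w C1 by (simp add: c_def)
  ultimately show ?thesis by blast
qed

text \<open>The exponents of the core and cylinder examples cross at r = 3/2 in dimension 3 and at r
  = 4/3 from dimension 4 on. In dimension 2 they cross at r = 2, so the core example serves up to
  there.\<close>

lemma N_opnorm_lower_finite:
  assumes r: "1 \<le> r" and dim: "2 \<le> DIM('a::euclidean_space)"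
  shows "\<exists>c>0. \<forall>\<delta>\<in>{0<..<1/2}. ennreal (c * \<delta> powr gamma_exp (DIM('a)) (ereal r)) \<le> N_opnorm (ereal r) \<delta> TYPE('a)"
proof (cases "2 < r")
  case True
  then have "gamma_exp (DIM('a)) (ereal r) = 0" by (simp add: gamma_exp_def Let_def ereal_le_simps)
  moreover have "\<delta> powr 0 = 1" if "\<delta> \<in> {0<..<1/2}" for \<delta> :: real using that by simp
  ultimately show ?thesis using N_opnorm_lower_const[OF r, where 'a='a] by simp
next
  case False
  then have r2: "r \<le> 2" by simp
  obtain B :: "'a set" where "B \<subseteq> Basis" "card B = 2" using dim by (metis obtain_subset_with_card_n)
  then obtain i j :: 'a where ij: "i \<in> Basis" "j \<in> Basis" "i \<noteq> j" by (auto simp: card_2_iff)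
  consider "DIM('a) = 2" | "DIM('a) = 3" "r \<le> 3/2" | "4 \<le> DIM('a)" "r \<le> 4/3"
    | "DIM('a) = 3" "3/2 < r" | "4 \<le> DIM('a)" "4/3 < r" using dim by linarith
  then show ?thesis
  proof cases
    case 1
    have "gamma_exp (DIM('a)) (ereal r) = 2 * (1 - 1 / r) - 1"
      using 1 r2 by (simp add: gamma_exp_def Let_def ereal_le_simps)
    then show ?thesis
      using N_opnorm_lower_core[OF r _ ij _ _ core_set_volume_2[OF 1 ij]] by simp
  next
    case 2
    have "gamma_exp (DIM('a)) (ereal r) = 5/2 * (1 - 1 / r) - 1"
      using 2 by (simp add: gamma_exp_def Let_def ereal_le_simps field_simps)
    then show ?thesis
      using N_opnorm_lower_core[OF r _ ij _ _ core_set_volume_3[OF 2(1) ij]] by simp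
  next
    case 3
    have \<gamma>: "gamma_exp (DIM('a)) (ereal r) = 3 * (1 - 1 / r) - 1"
      using 3 by (simp add: gamma_exp_def Let_def ereal_le_simps)
    obtain c0 where c0: "0 < c0" "\<And>\<delta>. 0 < \<delta> \<Longrightarrow> \<delta> < 1/2 \<Longrightarrow> ennreal (c0 * \<delta> powr 3) \<le> emeasure lborel (core_set \<delta> (sqrt (1/2)) i j)"
      using core_set_volume_4[OF 3(1) ij] by blast
    have "7/10 \<le> sqrt (1/2)" by (rule real_le_rsqrt) (simp add: power2_eq_square)
    moreover have "sqrt (1/2) \<le> 1" by simp
    ultimately show ?thesis unfolding \<gamma> by (rule N_opnorm_lower_core[OF r c0(1) ij _ _ c0(2)])
  next
    case 4
    have "gamma_exp (DIM('a)) (ereal r) = 1/2 - 1 / r"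
      using 4 r2 by (simp add: gamma_exp_def Let_def ereal_le_simps)
    then show ?thesis using N_opnorm_lower_cylinder[OF r dim] by simp
  next
    case 5
    have "gamma_exp (DIM('a)) (ereal r) = 1/2 - 1 / r"
      using 5 r2 by (simp add: gamma_exp_def Let_def ereal_le_simps)
    then show ?thesis using N_opnorm_lower_cylinder[OF r dim] by simp
  qed
qed

theorem theorem1p3:
  fixes p :: ereal
  assumes "CARD('n::finite) \<ge> 2" and "1 \<le> p"
  shows "(\<forall>\<epsilon>>0. \<exists>C::real. \<forall>\<delta>\<in>{0<..<1/2}.
            N_opnorm p \<delta> TYPE(real^'n) \<le> ennreal (C * \<delta> powr (-\<epsilon>) * \<delta> powr gamma_exp CARD('n) p))
       \<and> (\<exists>c::real>0. \<forall>\<delta>\<in>{0<..<1/2}.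
            N_opnorm p \<delta> TYPE(real^'n) \<ge> ennreal (c * \<delta> powr gamma_exp CARD('n) p))"
proof -
  have dim: "2 \<le> DIM(real^'n)" "DIM(real^'n) = CARD('n)" using assms(1) by simp_all
  show ?thesis
  proof (cases p)
    case (real r)
    then have r: "1 \<le> r" using assms(2) by simp
    show ?thesis
      unfolding real using N_opnorm_upper_finite[OF dim(1) r] N_opnorm_lower_finite[OF r dim(1)] dim(2) by simp
  next
    \<comment> \<open>The exponent is 0 and both constants are 1: averages of a function bounded by
      1 are at most 1, with equality for the constant function.\<close>
    case PInf
    have \<gamma>: "gamma_exp CARD('n) \<infinity> = 0" by (simp add: gamma_exp_def)
    have up: "N_opnorm \<infinity> \<delta> TYPE(real^'n) \<le> ennreal (1 * \<delta> powr (-\<epsilon>) * \<delta> powr 0)" if "0 < \<epsilon>" "\<delta> \<in> {0<..<1/2}" for \<epsilon> \<delta>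
    proof -
      have "\<delta> powr 0 \<le> \<delta> powr (-\<epsilon>)" using that by (intro powr_mono') auto
      then have "1 \<le> ennreal (1 * \<delta> powr (-\<epsilon>) * \<delta> powr 0)" using that by simp
      then show ?thesis by (rule order_trans[OF N_opnorm_infinity_le, rotated 2]) (use that in auto)
    qed
    have low: "ennreal (1 * \<delta> powr 0) \<le> N_opnorm \<infinity> \<delta> TYPE(real^'n)" if "\<delta> \<in> {0<..<1/2}" for \<delta>
      using N_opnorm_infinity_ge[of \<delta>, where 'a="real^'n"] that by simp
    show ?thesis
      unfolding PInf \<gamma> using up low zero_less_one by blast
  qed (use assms(2) in simp)
qed

end
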